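(* Let $\mathbb{G}$ be a Carnot group with stratified Lie algebra $\mathfrak{g}=\mathfrak{g}_1\oplus\dots\oplus\mathfrak{g}_s$, and let $X\in\mathfrak{g}_1$. With the notation $E$, $E_X$, $\Gamma^{(p)}$ of the context, consider the following conditions on $X$: (P) (pliability) the map $E$ is open at $X$ (equivalently by definition, $E_X$ is open at $0$); (SP) (strong pliability) for all $\eta>0$ there exists $Y\in L^\infty([0,1],\mathfrak{g}_1)$ such that $\|Y\|_\infty<\eta$, $E_X(Y)=E_X(0)$, and $E_X$ is a submersion at $Y$; (FH) ($p$-free (H)-condition) for all $\eta>0$ there exist an integer $p\ge 2$ and $W_1,\dots,W_p\in\mathfrak{g}_1$ such that $\|W_i-X\|<\eta$ for $i=1,\dots,p$, $\Gamma^{(p)}(W_1,\dots,W_p)=\Gamma^{(p)}(X,\dots,X)$, and $\Gamma^{(p)}$ is a submersion at $(W_1,\dots,W_p)$; (H) there exists $p\in\mathbb{N}$, $p\geq 1$, such that $\Gamma^{(p)}$ is open at $(X,\dots,X)\in(\mathfrak{g}_1)^p$; (SbH) (submersive (H)-condition) there exists $p\in\mathbb{N}$, $p\geq 1$, such that $\Gamma^{(p)}$ is a submersion at $(X,\dots,X)\in(\mathfrak{g}_1)^p$; (Reg) (regularity) the map $E$ is a submersion at $X$ (equivalently by definition, $E_X$ is a submersion at $0$). Then the following hold: 1. Conditions (P), (SP) and (FH) are equivalent. 2. Conditions (Reg) and (SbH) are equivalent, they imply (H), and (H) in turn implies the three equivalent conditions (P), (SP), (FH).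
   Context: A Carnot group is a nilpotent, connected, simply connected (real, finite-dimensional) Lie group $\mathbb{G}$ whose Lie algebra $\mathfrak{g}$ admits a stratification, i.e. a direct sum decomposition $\mathfrak{g}=\mathfrak{g}_1\oplus\dots\oplus\mathfrak{g}_s$ with $[\mathfrak{g}_1,\mathfrak{g}_k]=\mathfrak{g}_{k+1}$ for $k=1,\dots,s-1$ and $[\mathfrak{g}_1,\mathfrak{g}_s]=0$. A norm $\|\cdot\|$ on the finite-dimensional space $\mathfrak{g}_1$ is fixed, and $L^\infty([0,1],\mathfrak{g}_1)$ carries the corresponding norm $\|\cdot\|_\infty$. $L_g:\mathbb{G}\to\mathbb{G}$, $L_g(x)=gx$, denotes left translation. The endpoint map $E:L^\infty([0,1],\mathfrak{g}_1)\to\mathbb{G}$ is $E(Y):=\gamma(1)$, where $\gamma:[0,1]\to\mathbb{G}$ is the unique absolutely continuous solution of $(L_{\gamma(t)}^{-1})_*\dot\gamma(t)=Y(t)$ for a.e. $t\in[0,1]$, $\gamma(0)=1_{\mathbb{G}}$. For $X\in\mathfrak{g}_1$ (identified with the corresponding constant function), the endpoint map based at $X$ is $E_X:L^\infty([0,1],\mathfrak{g}_1)\to\mathbb{G}$, $E_X(Y):=E(X+Y)$. For an integer $p\ge1$, the multiexponential map is $\Gamma^{(p)}:(\mathfrak{g}_1)^p\to\mathbb{G}$, $\Gamma^{(p)}(Y_1,\dots,Y_p):=\exp(Y_1)\cdots\exp(Y_p)$, where $\exp$ is the Lie group exponential (so $\exp(Y)=E(Y)$ for constant $Y\in\mathfrak{g}_1$).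 A map $F$ is open at a point $x$ if $F$ maps every neighborhood of $x$ to a neighborhood of $F(x)$. A ($C^1$) map is a submersion at a point if its differential at that point is surjective. *)

theory Defs
  imports
    "HOL-Analysis.Analysis"
    "HOL-Algebra.Generated_Groups"
    "HOL-Probability.Essential_Supremum"
begin

section \<open>Smooth manifolds and Lie groups\<close>

fun times_diff_on :: "nat \<Rightarrow> 'a::real_normed_vector set \<Rightarrow> ('a \<Rightarrow> 'b::real_normed_vector) \<Rightarrow> bool" where
  "times_diff_on 0 S f \<longleftrightarrow> continuous_on S f"
| "times_diff_on (Suc n) S f \<longleftrightarrow>
     (\<forall>x\<in>S. f differentiable (at x)) \<and>
     (\<forall>v. times_diff_on n S (\<lambda>x. frechet_derivative f (at x) v))"

text \<open>Only meant for open \<open>S\<close> in a finite-dimensional space; there \<open>times_diff_on n\<close> is \<open>C\<^sup>n\<close>.\<close>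

definition smooth_on :: "'a::real_normed_vector set \<Rightarrow> ('a \<Rightarrow> 'b::real_normed_vector) \<Rightarrow> bool" where
  "smooth_on S f \<longleftrightarrow> (\<forall>n. times_diff_on n S f)"

text \<open>A chart is a pair of its domain and its coordinate map; the values of the coordinate map
  outside the domain are irrelevant. The manifold is the whole type \<open>'g\<close>.\<close>

type_synonym ('g, 'e) chart = "'g set \<times> ('g \<Rightarrow> 'e)"

definition param :: "('g, 'e) chart \<Rightarrow> 'e \<Rightarrow> 'g" where
  "param c = inv_into (fst c) (snd c)"

definition is_chart :: "('g::topological_space, 'e::euclidean_space) chart \<Rightarrow> bool" where
  "is_chart c \<longleftrightarrow> open (fst c) \<and> open (snd c ` fst c) \<and>
     homeomorphism (fst c) (snd c ` fst c) (snd c) (param c)"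

definition smooth_atlas :: "('g::topological_space, 'e::euclidean_space) chart set \<Rightarrow> bool" where
  "smooth_atlas A \<longleftrightarrow> (\<forall>c\<in>A. is_chart c) \<and> (\<Union>c\<in>A. fst c) = UNIV \<and>
     (\<forall>c\<in>A. \<forall>d\<in>A. smooth_on (snd c ` (fst c \<inter> fst d)) (snd d \<circ> param c))"

definition prod_atlas ::
  "('g, 'e) chart set \<Rightarrow> ('h, 'f) chart set \<Rightarrow> ('g \<times> 'h, 'e \<times> 'f) chart set" where
  "prod_atlas A B = {(fst c \<times> fst d, map_prod (snd c) (snd d)) | c d. c \<in> A \<and> d \<in> B}"

definition smooth_map ::
  "('g::topological_space, 'e::euclidean_space) chart set \<Rightarrow>
   ('h::topological_space, 'f::euclidean_space) chart set \<Rightarrow> ('g \<Rightarrow> 'h) \<Rightarrow> bool" where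
  "smooth_map A B F \<longleftrightarrow> continuous_on UNIV F \<and>
     (\<forall>c\<in>A. \<forall>d\<in>B. smooth_on (snd c ` (fst c \<inter> F -` fst d)) (snd d \<circ> F \<circ> param c))"

definition lie_group ::
  "'g::{t2_space,second_countable_topology} monoid \<Rightarrow> ('g, 'e::euclidean_space) chart set \<Rightarrow> bool" where
  "lie_group G A \<longleftrightarrow> group G \<and> carrier G = UNIV \<and> smooth_atlas A \<and>
     smooth_map (prod_atlas A A) A (\<lambda>(x, y). x \<otimes>\<^bsub>G\<^esub> y) \<and>
     smooth_map A A (\<lambda>x. inv\<^bsub>G\<^esub> x)"

fun lower_central :: "'g monoid \<Rightarrow> nat \<Rightarrow> 'g set" where
  "lower_central G 0 = carrier G"
| "lower_central G (Suc n) = generate G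
     {x \<otimes>\<^bsub>G\<^esub> y \<otimes>\<^bsub>G\<^esub> inv\<^bsub>G\<^esub> x \<otimes>\<^bsub>G\<^esub> inv\<^bsub>G\<^esub> y | x y. x \<in> carrier G \<and> y \<in> lower_central G n}"

definition nilpotent_group :: "'g monoid \<Rightarrow> bool" where
  "nilpotent_group G \<longleftrightarrow> (\<exists>n. lower_central G n = {\<one>\<^bsub>G\<^esub>})"

section \<open>The Lie algebra\<close>

text \<open>The Lie algebra is the tangent space at the identity, identified with the model space \<open>'e\<close>
  by a fixed chart \<open>c\<close> around the identity. \<open>left_field G c v\<close> is the coordinate expression in
  \<open>c\<close> of the left-invariant vector field whose value at the identity is \<open>v\<close>, and \<open>lie_bracket\<close>
  is the value at the identity of the commutator of two such fields
  (in coordinates, \<open>[V, W] = DW V - DV W\<close>).\<close>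

definition left_field ::
  "'g monoid \<Rightarrow> ('g, 'e::euclidean_space) chart \<Rightarrow> 'e \<Rightarrow> 'e \<Rightarrow> 'e" where
  "left_field G c v a =
     frechet_derivative (\<lambda>b. snd c (param c a \<otimes>\<^bsub>G\<^esub> param c b)) (at (snd c \<one>\<^bsub>G\<^esub>)) v"

definition lie_bracket ::
  "'g monoid \<Rightarrow> ('g, 'e::euclidean_space) chart \<Rightarrow> 'e \<Rightarrow> 'e \<Rightarrow> 'e" where
  "lie_bracket G c v w =
     frechet_derivative (left_field G c w) (at (snd c \<one>\<^bsub>G\<^esub>)) v -
     frechet_derivative (left_field G c v) (at (snd c \<one>\<^bsub>G\<^esub>)) w"

definition bracket_space ::
  "'g monoid \<Rightarrow> ('g, 'e::euclidean_space) chart \<Rightarrow> 'e set \<Rightarrow> 'e set \<Rightarrow> 'e set" where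
  "bracket_space G c V W = span {lie_bracket G c v w | v w. v \<in> V \<and> w \<in> W}"

definition stratification ::
  "'g monoid \<Rightarrow> ('g, 'e::euclidean_space) chart \<Rightarrow> (nat \<Rightarrow> 'e set) \<Rightarrow> nat \<Rightarrow> bool" where
  "stratification G c gs s \<longleftrightarrow> s \<ge> 1 \<and> (\<forall>k\<in>{1..s}. subspace (gs k)) \<and>
     (\<forall>x. \<exists>!f. (\<forall>k\<in>{1..s}. f k \<in> gs k) \<and> (\<forall>k. k \<notin> {1..s} \<longrightarrow> f k = 0) \<and> x = (\<Sum>k=1..s. f k)) \<and>
     (\<forall>k\<in>{1..<s}. bracket_space G c (gs 1) (gs k) = gs (Suc k)) \<and>
     bracket_space G c (gs 1) (gs s) = {0}"

definition carnot_group ::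
  "'g::{t2_space,second_countable_topology} monoid \<Rightarrow> ('g, 'e::euclidean_space) chart set \<Rightarrow>
   ('g, 'e) chart \<Rightarrow> (nat \<Rightarrow> 'e set) \<Rightarrow> nat \<Rightarrow> bool" where
  "carnot_group G A c gs s \<longleftrightarrow> lie_group G A \<and> nilpotent_group G \<and>
     connected (UNIV :: 'g set) \<and> simply_connected (UNIV :: 'g set) \<and>
     c \<in> A \<and> \<one>\<^bsub>G\<^esub> \<in> fst c \<and> stratification G c gs s"

definition norm_on :: "'e::real_vector set \<Rightarrow> ('e \<Rightarrow> real) \<Rightarrow> bool" where
  "norm_on V N \<longleftrightarrow> (\<forall>x\<in>V. 0 \<le> N x) \<and> (\<forall>x\<in>V. N x = 0 \<longleftrightarrow> x = 0) \<and>
     (\<forall>x\<in>V. \<forall>r. N (r *\<^sub>R x) = \<bar>r\<bar> * N x) \<and> (\<forall>x\<in>V. \<forall>y\<in>V. N (x + y) \<le> N x + N y)"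

section \<open>Exponential, multiexponential and endpoint maps\<close>

text \<open>\<open>exp v\<close> is the time-one value of the one-parameter subgroup with initial velocity \<open>v\<close>.\<close>

definition lie_exp ::
  "'g::topological_space monoid \<Rightarrow> ('g, 'e::euclidean_space) chart \<Rightarrow> 'e \<Rightarrow> 'g" where
  "lie_exp G c v = (THE x. \<exists>\<gamma> :: real \<Rightarrow> 'g. continuous_on UNIV \<gamma> \<and>
     (\<forall>s t. \<gamma> (s + t) = \<gamma> s \<otimes>\<^bsub>G\<^esub> \<gamma> t) \<and>
     ((\<lambda>t. snd c (\<gamma> t)) has_vector_derivative v) (at 0) \<and> x = \<gamma> 1)"

fun multiexp ::
  "'g::topological_space monoid \<Rightarrow> ('g, 'e::euclidean_space) chart \<Rightarrow> nat \<Rightarrow> (nat \<Rightarrow> 'e) \<Rightarrow> 'g" where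
  "multiexp G c 0 W = \<one>\<^bsub>G\<^esub>"
| "multiexp G c (Suc p) W = multiexp G c p W \<otimes>\<^bsub>G\<^esub> lie_exp G c (W (Suc p))"

definition abs_cont_on :: "real \<Rightarrow> real \<Rightarrow> (real \<Rightarrow> 'e::real_normed_vector) \<Rightarrow> bool" where
  "abs_cont_on a b f \<longleftrightarrow> (\<forall>\<epsilon>>0. \<exists>\<delta>>0. \<forall>n (l :: nat \<Rightarrow> real) r.
     (\<forall>i<n. a \<le> l i \<and> l i < r i \<and> r i \<le> b) \<and>
     (\<forall>i<n. \<forall>j<n. i \<noteq> j \<longrightarrow> {l i<..<r i} \<inter> {l j<..<r j} = {}) \<and>
     (\<Sum>i<n. r i - l i) < \<delta> \<longrightarrow> (\<Sum>i<n. norm (f (r i) - f (l i))) < \<epsilon>)"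

definition abs_cont_curve ::
  "('g::topological_space, 'e::euclidean_space) chart set \<Rightarrow> (real \<Rightarrow> 'g) \<Rightarrow> bool" where
  "abs_cont_curve A \<gamma> \<longleftrightarrow> continuous_on {0..1} \<gamma> \<and>
     (\<forall>d\<in>A. \<forall>a b. 0 \<le> a \<and> a \<le> b \<and> b \<le> 1 \<and> \<gamma> ` {a..b} \<subseteq> fst d \<longrightarrow> abs_cont_on a b (snd d \<circ> \<gamma>))"

text \<open>\<open>(L\<^bsub>\<gamma>(t)\<^esub>\<^sup>-\<^sup>1)\<^sub>* \<gamma>'(t)\<close> is the velocity at time \<open>t\<close> of the curve \<open>s \<mapsto> \<gamma>(t)\<^sup>-\<^sup>1 \<gamma>(s)\<close>, which passes
  through the identity at time \<open>t\<close> and can therefore be differentiated in the chart \<open>c\<close>.\<close>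

definition solves ::
  "'g::topological_space monoid \<Rightarrow> ('g, 'e::euclidean_space) chart set \<Rightarrow> ('g, 'e) chart \<Rightarrow>
   (real \<Rightarrow> 'e) \<Rightarrow> (real \<Rightarrow> 'g) \<Rightarrow> bool" where
  "solves G A c Y \<gamma> \<longleftrightarrow> abs_cont_curve A \<gamma> \<and> \<gamma> 0 = \<one>\<^bsub>G\<^esub> \<and>
     (AE t in lebesgue_on {0..1}.
        ((\<lambda>s. snd c (inv\<^bsub>G\<^esub> (\<gamma> t) \<otimes>\<^bsub>G\<^esub> \<gamma> s)) has_vector_derivative Y t) (at t within {0..1}))"

text \<open>The solution is only determined on \<open>{0..1}\<close>, hence the description is of its endpoint.\<close>

definition endpoint ::
  "'g::topological_space monoid \<Rightarrow> ('g, 'e::euclidean_space) chart set \<Rightarrow> ('g, 'e) chart \<Rightarrow>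
   (real \<Rightarrow> 'e) \<Rightarrow> 'g" where
  "endpoint G A c Y = (THE x. \<exists>\<gamma>. solves G A c Y \<gamma> \<and> x = \<gamma> 1)"

definition endpoint_at ::
  "'g::topological_space monoid \<Rightarrow> ('g, 'e::euclidean_space) chart set \<Rightarrow> ('g, 'e) chart \<Rightarrow>
   'e \<Rightarrow> (real \<Rightarrow> 'e) \<Rightarrow> 'g" where
  "endpoint_at G A c X Y = endpoint G A c (\<lambda>t. X + Y t)"

section \<open>The normed spaces of controls and of tuples\<close>

text \<open>\<open>L\<^sup>\<infinity>([0,1], V)\<close> for a normed subspace \<open>(V, N)\<close>. Elements are represented by functions rather
  than by classes modulo a.e. equality, so \<open>Linf_norm\<close> is a seminorm; functions at distance zero
  have the same endpoint.\<close>

definition Linf :: "'e::euclidean_space set \<Rightarrow> ('e \<Rightarrow> real) \<Rightarrow> (real \<Rightarrow> 'e) set" where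
  "Linf V N = {Y. Y \<in> borel_measurable (lebesgue_on {0..1}) \<and> (\<forall>t\<in>{0..1}. Y t \<in> V) \<and>
     esssup (lebesgue_on {0..1}) (\<lambda>t. ereal (N (Y t))) < \<infinity>}"

definition Linf_norm :: "('e::euclidean_space \<Rightarrow> real) \<Rightarrow> (real \<Rightarrow> 'e) \<Rightarrow> real" where
  "Linf_norm N Y = real_of_ereal (esssup (lebesgue_on {0..1}) (\<lambda>t. ereal (N (Y t))))"

text \<open>A \<open>p\<close>-tuple is a function on \<open>nat\<close> vanishing outside \<open>{1..p}\<close>.\<close>

definition tuples :: "nat \<Rightarrow> 'e::zero set \<Rightarrow> (nat \<Rightarrow> 'e) set" where
  "tuples p V = {W. (\<forall>i\<in>{1..p}. W i \<in> V) \<and> (\<forall>i. i \<notin> {1..p} \<longrightarrow> W i = 0)}"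

definition tuple_norm :: "('e \<Rightarrow> real) \<Rightarrow> nat \<Rightarrow> (nat \<Rightarrow> 'e) \<Rightarrow> real" where
  "tuple_norm N p W = Max ((\<lambda>i. N (W i)) ` {1..p})"

definition const_tuple :: "nat \<Rightarrow> 'e::zero \<Rightarrow> nat \<Rightarrow> 'e" where
  "const_tuple p X = (\<lambda>i. if i \<in> {1..p} then X else 0)"

section \<open>Openness and submersions at a point\<close>

text \<open>Both domains above are sets \<open>V\<close> of functions, closed under pointwise linear combinations,
  with a (semi)norm \<open>\<nu>\<close>.\<close>

definition open_at ::
  "('i \<Rightarrow> 'e::real_vector) set \<Rightarrow> (('i \<Rightarrow> 'e) \<Rightarrow> real) \<Rightarrow>
   (('i \<Rightarrow> 'e) \<Rightarrow> 'g::topological_space) \<Rightarrow> ('i \<Rightarrow> 'e) \<Rightarrow> bool" where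
  "open_at V \<nu> F y \<longleftrightarrow>
     (\<forall>S\<subseteq>V. (\<exists>r>0. \<forall>z\<in>V. \<nu> (\<lambda>i. z i - y i) < r \<longrightarrow> z \<in> S) \<longrightarrow> F y \<in> interior (F ` S))"

text \<open>Frechet differentiability at \<open>y\<close>, with bounded linear derivative \<open>D\<close>.\<close>

definition has_derivative_in ::
  "('i \<Rightarrow> 'e::real_vector) set \<Rightarrow> (('i \<Rightarrow> 'e) \<Rightarrow> real) \<Rightarrow>
   (('i \<Rightarrow> 'e) \<Rightarrow> 'f::real_normed_vector) \<Rightarrow> (('i \<Rightarrow> 'e) \<Rightarrow> 'f) \<Rightarrow> ('i \<Rightarrow> 'e) \<Rightarrow> bool" where
  "has_derivative_in V \<nu> F D y \<longleftrightarrow>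
     (\<forall>h\<in>V. \<forall>k\<in>V. D (\<lambda>i. h i + k i) = D h + D k) \<and>
     (\<forall>h\<in>V. \<forall>r. D (\<lambda>i. r *\<^sub>R h i) = r *\<^sub>R D h) \<and>
     (\<exists>K. \<forall>h\<in>V. norm (D h) \<le> K * \<nu> h) \<and>
     (\<forall>\<epsilon>>0. \<exists>\<delta>>0. \<forall>h\<in>V. \<nu> h < \<delta> \<longrightarrow> norm (F (\<lambda>i. y i + h i) - F y - D h) \<le> \<epsilon> * \<nu> h)"

text \<open>The differential is computed in a chart \<open>d\<close> around \<open>F y\<close>. As \<open>snd d\<close> is arbitrary off
  \<open>fst d\<close>, a neighbourhood of \<open>y\<close> is required to be mapped into \<open>fst d\<close>.\<close>

definition submersion_at ::
  "('g::topological_space, 'e::euclidean_space) chart set \<Rightarrow> ('i \<Rightarrow> 'e) set \<Rightarrow>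
   (('i \<Rightarrow> 'e) \<Rightarrow> real) \<Rightarrow> (('i \<Rightarrow> 'e) \<Rightarrow> 'g) \<Rightarrow> ('i \<Rightarrow> 'e) \<Rightarrow> bool" where
  "submersion_at A V \<nu> F y \<longleftrightarrow> (\<exists>d\<in>A. \<exists>D. F y \<in> fst d \<and>
     (\<exists>r>0. \<forall>h\<in>V. \<nu> h < r \<longrightarrow> F (\<lambda>i. y i + h i) \<in> fst d) \<and>
     has_derivative_in V \<nu> (snd d \<circ> F) D y \<and> D ` V = UNIV)"

section \<open>The six conditions\<close>

text \<open>In all of them \<open>V\<close> is the first layer and \<open>N\<close> the norm fixed on it.\<close>

definition cond_P where
  "cond_P G A c V N X \<longleftrightarrow> open_at (Linf V N) (Linf_norm N) (endpoint G A c) (\<lambda>t. X)"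

definition cond_SP where
  "cond_SP G A c V N X \<longleftrightarrow> (\<forall>\<eta>>0. \<exists>Y\<in>Linf V N. Linf_norm N Y < \<eta> \<and>
     endpoint_at G A c X Y = endpoint_at G A c X (\<lambda>t. 0) \<and>
     submersion_at A (Linf V N) (Linf_norm N) (endpoint_at G A c X) Y)"

definition cond_FH where
  "cond_FH G A c V N X \<longleftrightarrow> (\<forall>\<eta>>0. \<exists>p\<ge>2. \<exists>W\<in>tuples p V. (\<forall>i\<in>{1..p}. N (W i - X) < \<eta>) \<and>
     multiexp G c p W = multiexp G c p (const_tuple p X) \<and>
     submersion_at A (tuples p V) (tuple_norm N p) (multiexp G c p) W)"

definition cond_H where
  "cond_H G c V N X \<longleftrightarrow>
     (\<exists>p\<ge>1. open_at (tuples p V) (tuple_norm N p) (multiexp G c p) (const_tuple p X))"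

definition cond_SbH where
  "cond_SbH G A c V N X \<longleftrightarrow>
     (\<exists>p\<ge>1. submersion_at A (tuples p V) (tuple_norm N p) (multiexp G c p) (const_tuple p X))"

definition cond_Reg where
  "cond_Reg G A c V N X \<longleftrightarrow>
     submersion_at A (Linf V N) (Linf_norm N) (endpoint G A c) (\<lambda>t. X)"

end

theory Submission
imports Defs
begin

text \<open>Left translation of a curve to the identity turns it into its control. The flow of a bounded control is
  obtained by Picard iteration in a coordinate ball and continued by translation; the differential of
  \<open>u \<mapsto> flow u T\<close>, right-translated to the identity, is \<open>h \<mapsto> \<integral> Ad (flow u t) (h t) dt\<close>. On step controls the flow is
  a multiexponential, up to the change of time that the dilations provide: these integrate to group automorphisms
  because the group is simply connected (monodromy of products of exponentials along a contraction).

  Controls with surjective differential exist arbitrarily close to \<open>X\<close>: an image of maximal dimension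
  absorbs the brackets with the first layer, which generates. Surjectivity at a point gives openness there by
  Sussmann's open mapping theorem. From (P) to (SP) a short dilated piece of such a control is put in front,
  and openness at \<open>X\<close> supplies the rest. From (SP) to (FH) the control is replaced by its averages on small
  cells, which converge in \<open>L\<^sup>1\<close>; Brouwer's theorem corrects the endpoint within a finite-dimensional family.
  (Reg) and (SbH) agree since the image of the differential is already attained on step controls.\<close>

text \<open>The conditions live on intervals of different length: a \<open>p\<close>-fold
  multiexponential takes time \<open>p\<close>, the endpoint map time one. On the first layer
  \<open>dil c\<close> is multiplication by \<open>c\<close>, so a change of time is an automorphism
  \<open>D c\<close> of the group, once the dilations of the algebra are known to integrate. They
  also make (P) usable: for \<open>x = exp X\<close> and \<open>e + e' = 1\<close> one has
  \<open>x = D e x \<otimes> D e' x\<close>. A regular piece with endpoint \<open>g\<close>, run in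
  time \<open>e = 1 / (n + 1)\<close>, must therefore be completed by a control with endpoint
  \<open>D (1 / n) (inv g \<otimes> x) \<otimes> x\<close>, and this point tends to
  \<open>x\<close>.

  Estimates use the L1 norm of controls: the essential supremum dominates it, and cell averages
  converge in it although in general not uniformly. (SP) and (FH) demand equality of endpoints,
  while averaging gives only approximate equality; surjectivity of the differential pays for the
  correction. Openness needs no continuity of the differential: differentiability at one point and
  continuity of a finite-dimensional family suffice for Sussmann's theorem.\<close>

notation scaleR (infixr "*R" 75)
notation tendsto (infixr "--->" 55)
notation iff (infixr "<->" 25)

abbreviation ae :: "real set => (real => bool) => bool" where
 "ae S P == AE t in lebesgue. t : S --> P t"

section \<open>Absolutely continuous curves and strict derivatives\<close>

lemma AE_lebesgue_iff: "(AE x in lebesgue. P x) <-> negligible {x::'a::euclidean_space. ~ P x}"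
 by (simp add: completion.AE_iff_null_sets negligible_iff_null_sets)

lemma AE_lebesgue_on_iff:
 assumes "S : sets lebesgue"
 shows "(AE x in lebesgue_on S. P x) <-> (AE x::'a::euclidean_space in lebesgue. x : S --> P x)" using assms by (subst AE_restrict_space_iff) auto

definition pieces :: "real => real => nat => (nat => real) => (nat => real) => bool" where
 "pieces a b n l r <-> (ALL i<n. a <= l i & l i < r i & r i <= b) &
   (ALL i<n. ALL j<n. i ~= j --> {l i<..<r i} Int {l j<..<r j} = {})"

lemma abs_cont_on_iff: "abs_cont_on a b f <-> (ALL e>0. EX d>0. ALL n l r. pieces a b n l r -->
  (\<Sum>i<n. r i - l i) < d --> (\<Sum>i<n. norm (f (r i) - f (l i))) < e)" unfolding abs_cont_on_def pieces_def by (simp only: conj_assoc imp_conjL)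

lemma lipschitz_abs_cont_on:
 fixes f :: "real => 'e::real_normed_vector"
 assumes "!!s t. a <= s ==> s < t ==> t <= b ==> norm (f t - f s) <= K * (t - s)"
 shows "abs_cont_on a b f" unfolding abs_cont_on_iff
proof (intro allI impI)
 fix e :: real assume "e > 0"
 show "EX d>0. ALL n l r. pieces a b n l r --> (\<Sum>i<n. r i - l i) < d --> (\<Sum>i<n. norm (f (r i) - f (l i))) < e"
 proof (intro exI[of _ "e / (abs K + 1)"] conjI allI impI)
  fix n l r assume A: "pieces a b n l r" and s: "(\<Sum>i<n. r i - l i) < e / (abs K + 1)"
  have "norm (f (r i) - f (l i)) <= (abs K + 1) * (r i - l i)" if "i < n" for i
  proof -
   have i: "a <= l i" "l i < r i" "r i <= b" using A that by (auto simp: pieces_def)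
   have "K * (r i - l i) <= (abs K + 1) * (r i - l i)" using i by (intro mult_right_mono) auto
   thus ?thesis using assms[OF i] by linarith
  qed
  hence "(\<Sum>i<n. norm (f (r i) - f (l i))) <= (abs K + 1) * (\<Sum>i<n. r i - l i)" unfolding sum_distrib_left by (intro sum_mono) auto
  also have "... < e" using s by (simp add: pos_less_divide_eq mult.commute)
  finally show "(\<Sum>i<n. norm (f (r i) - f (l i))) < e" .
 qed (use \<open>e > 0\<close> in simp)
qed

text \<open>Two uses: the difference of a function and the primitive of its derivative, and a
  product of two curves in the group, read in a chart.\<close>

lemma abs_cont_on_dominated:
 fixes f :: "real => 'a::real_normed_vector" and h :: "real => 'b::real_normed_vector" and k :: "real => 'c::real_normed_vector"
 assumes f: "abs_cont_on a b f" and h: "abs_cont_on a b h" and K: "0 <= K"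
  and le: "!!s t. s : {a..b} ==> t : {a..b} ==> norm (k t - k s) <= K * (norm (f t - f s) + norm (h t - h s))"
 shows "abs_cont_on a b k" unfolding abs_cont_on_iff
proof (intro allI impI)
 fix e :: real assume "e > 0"
 define q where "q = e / (2 * (K + 1))"
 have q: "0 < q" "K * (2 * q) < e" using \<open>e > 0\<close> K by (auto simp: q_def divide_less_eq)
 obtain d1 where d1: "d1 > 0" "!!n l r. pieces a b n l r ==> (\<Sum>i<n. r i - l i) < d1 ==>
   (\<Sum>i<n. norm (f (r i) - f (l i))) < q" using f q(1) unfolding abs_cont_on_iff by blast
 obtain d2 where d2: "d2 > 0" "!!n l r. pieces a b n l r ==> (\<Sum>i<n. r i - l i) < d2 ==>
   (\<Sum>i<n. norm (h (r i) - h (l i))) < q" using h q(1) unfolding abs_cont_on_iff by blast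
 show "EX d>0. ALL n l r. pieces a b n l r --> (\<Sum>i<n. r i - l i) < d --> (\<Sum>i<n. norm (k (r i) - k (l i))) < e"
 proof (intro exI[of _ "min d1 d2"] conjI allI impI)
  fix n l r assume A: "pieces a b n l r" "(\<Sum>i<n. r i - l i) < min d1 d2"
  have "(\<Sum>i<n. norm (k (r i) - k (l i))) <= (\<Sum>i<n. K * (norm (f (r i) - f (l i)) + norm (h (r i) - h (l i))))"
   using A(1) by (intro sum_mono le) (auto simp: pieces_def intro: order_trans less_imp_le)
  also have "... = K * ((\<Sum>i<n. norm (f (r i) - f (l i))) + (\<Sum>i<n. norm (h (r i) - h (l i))))"
   by (simp add: sum_distrib_left[symmetric] sum.distrib)
  also have "... <= K * (2 * q)" using d1(2)[OF A(1)] d2(2)[OF A(1)] A(2) K by (intro mult_left_mono) auto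
  also have "... < e" by (rule q)
  finally show "(\<Sum>i<n. norm (k (r i) - k (l i))) < e" .
 qed (use d1 d2 in auto)
qed
text \<open>A fine tagged division splits the increment of \<open>f\<close>: intervals tagged in the null set lie in an
  open set of small measure, where absolute continuity applies, and the others contribute little by
  differentiability at the tag.\<close>

lemma abs_cont_zero_derivative:
 fixes f :: "real => 'e::real_normed_vector"
 assumes ac: "abs_cont_on a b f" and "a <= b"
  and der: "ae {a..b} (%t. (f has_vector_derivative 0) (at t within {a..b}))"
 shows "f b = f a"
proof -
 define N where "N = {t. ~ (t : {a..b} --> (f has_vector_derivative 0) (at t within {a..b}))}"
 have N: "negligible N" using der by (simp add: AE_lebesgue_iff N_def)
 have "norm (f b - f a) <= e * (1 + (b - a))" if "e > 0" for e
 proof -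
  obtain d where d: "d > 0" "!!n l r. pieces a b n l r ==> (\<Sum>i<n. r i - l i) < d ==>
    (\<Sum>i<n. norm (f (r i) - f (l i))) < e" using ac \<open>e > 0\<close> unfolding abs_cont_on_iff by blast
  obtain U where U: "open U" "N \<subseteq> U" "U - N : lmeasurable" "emeasure lebesgue (U - N) < d"
   using sets_lebesgue_outer_open[of N d] N d(1) by (auto dest: negligible_imp_sets)
  have UL: "U : lmeasurable" "measure lebesgue U < d"
  proof -
   have U': "U = (U - N) \<union> N" using U by auto
   have N': "N : lmeasurable" using N by (simp add: negligible_iff_measure)
   thus "U : lmeasurable" using U(3) U' by (metis fmeasurable.Un)
   have "measure lebesgue U = measure lebesgue (U - N)"
    using U' N U(3) by (metis Diff_Diff_Int fmeasurableD measure_Un_null_set negligible_iff_null_sets)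
   also have "... < d" using U(3,4) d(1) by (metis emeasure_eq_measure2 ennreal_less_iff measure_nonneg)
   finally show "measure lebesgue U < d" .
  qed
  have ex: "EX r>0. (t : N --> ball t r \<subseteq> U) &
    (t : {a..b} - N --> (ALL s:{a..b} Int ball t r. norm (f s - f t) <= e * abs (s - t)))" for t
  proof (cases "t : N")
   case True
   thus ?thesis using U by (metis DiffE openE subsetD)
  next
   case False
   show ?thesis
   proof (cases "t : {a..b}")
    case True
    hence "(f has_vector_derivative 0) (at t within {a..b})" using False by (auto simp: N_def)
    hence "(f has_derivative (%h. h *R 0)) (at t within {a..b})" by (simp add: has_vector_derivative_def)
    then obtain r where "r > 0"
     "!!s. s : {a..b} ==> norm (s - t) < r ==> norm (f s - f t - (s - t) *R 0) <= e * norm (s - t)"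
     using \<open>e > 0\<close> unfolding has_derivative_within_alt by blast
    thus ?thesis using False by (intro exI[of _ r]) (auto simp: dist_norm norm_minus_commute)
   qed (use False in "auto intro: exI[of _ 1]")
  qed
  obtain r where r: "!!t. r t > 0" "!!t. t : N ==> ball t (r t) \<subseteq> U"
   "!!t s. t : {a..b} - N ==> s:{a..b} Int ball t (r t) ==> norm (f s - f t) <= e * abs (s - t)" using ex by metis
  have "gauge (%t. ball t (r t))" using r(1) by (auto simp: gauge_def)
  then obtain p where p: "p tagged_division_of {a..b}" "(%t. ball t (r t)) fine p" using fine_division_exists_real by blast
  have fin: "finite p" using p(1) by (rule tagged_division_of_finite)
  define g where "g = (%K. f (Sup K) - f (Inf K))"
  have sumg: "(SUM (x, K):p. g K) = f b - f a" using additive_tagged_division_1[OF \<open>a <= b\<close> p(1), of f] unfolding g_def by simp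
  have box: "EX c d. K = {c..d} & c <= x & x <= d & a <= c & d <= b" if xKp: "(x, K) : p" for x K
  proof -
   obtain c d where cd: "K = cbox c d" using tagged_division_ofD(4)[OF p(1) xKp] by blast
   have "x : K" "K \<subseteq> {a..b}" using tagged_division_ofD(2,3)[OF p(1) xKp] by auto
   with cd show ?thesis by (intro exI[of _ c] exI[of _ d]) auto
  qed
  \<comment> \<open>The condition on the interior is there because \<open>pieces\<close> admits no
    degenerate intervals; those have zero increment and are counted in \<open>p2\<close>.\<close>
  define p1 where "p1 = {(x, K) : p. x : N & interior K ~= {}}"
  define p2 where "p2 = p - p1"
  have "p1 \<subseteq> p" by (auto simp: p1_def)
  have fin1: "finite p1" using fin \<open>p1 \<subseteq> p\<close> by (rule rev_finite_subset)
  have g2: "norm (g K) <= e * measure lborel K" if "(x, K) : p2" for x K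
  proof -
   have xK: "(x, K) : p" "~ (x : N & interior K ~= {})" using that by (auto simp: p2_def p1_def)
   obtain c d where cd: "K = {c..d}" "c <= x" "x <= d" "a <= c" "d <= b" using box[OF xK(1)] by blast
   show ?thesis
   proof (cases "x : N")
    case True
    hence "interior K = {}" using xK by auto
    hence "c = d" using cd by (simp add: interior_atLeastAtMost_real)
    thus ?thesis using cd by (simp add: g_def)
   next
    case False
    have sub: "K \<subseteq> ball x (r x)" using p(2) xK(1) by (auto simp: fine_def)
    have "x : {a..b} - N" using False cd by auto
    hence "norm (f s - f x) <= e * abs (s - x)" if "s : {c, d}" for s using r(3)[of x s] sub cd that by (cases "s = c") (auto simp: subset_iff)
    from this[of d] this[of c] have "norm (f d - f x) <= e * (d - x)" "norm (f c - f x) <= e * (x - c)" using cd by auto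
    hence "norm (f d - f c) <= e * (d - x) + e * (x - c)" using norm_triangle_ineq4[of "f d - f x" "f c - f x"] by simp
    thus ?thesis using cd by (simp add: g_def algebra_simps)
   qed
  qed
  obtain h n where h: "bij_betw h {..<n::nat} p1" using ex_bij_betw_nat_finite[OF fin1] by (metis atLeast0LessThan)
  have hp: "h i : p1" if "i < n" for i using h that by (auto simp: bij_betw_def)
  define l where "l i = Inf (snd (h i))" for i
  define rr where "rr i = Sup (snd (h i))" for i
  have K: "snd (h i) = {l i..rr i} & l i < rr i & a <= l i & rr i <= b & fst (h i) : N & {l i..rr i} \<subseteq> U" if "i < n" for i
  proof -
   obtain x K where xK: "h i = (x, K)" by fastforce
   hence p1': "(x, K) : p" "x : N" "interior K ~= {}" using hp[OF that] by (auto simp: p1_def)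
   obtain c d where cd: "K = {c..d}" "c <= x" "x <= d" "a <= c" "d <= b" using box[OF p1'(1)] by blast
   have "c < d" using p1'(3) cd by (auto simp: interior_atLeastAtMost_real)
   moreover have "K \<subseteq> U" using p(2) p1' r(2)[of x] by (fastforce simp: fine_def)
   ultimately show ?thesis using cd xK p1' by (simp add: l_def rr_def)
  qed
  have disj: "{l i<..<rr i} Int {l j<..<rr j} = {}" if "i < n" "j < n" "i ~= j" for i j
  proof -
   have "h i ~= h j" using h that by (auto simp: bij_betw_def inj_on_def)
   hence "interior (snd (h i)) Int interior (snd (h j)) = {}"
    using tagged_division_ofD(5)[OF p(1), of "fst (h i)" "snd (h i)" "fst (h j)" "snd (h j)"]
     hp[OF that(1)] hp[OF that(2)] \<open>p1 \<subseteq> p\<close> by auto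
   thus ?thesis using K[OF that(1)] K[OF that(2)] by (simp add: interior_atLeastAtMost_real)
  qed
  have "(\<Sum>i<n. rr i - l i) = (\<Sum>i<n. measure lebesgue {l i<..<rr i})" using K by (intro sum.cong) (simp_all add: less_imp_le)
  also have "... = measure lebesgue (\<Union>i<n. {l i<..<rr i})"
   using disj by (intro measure_negligible_finite_Union_image[symmetric]) (auto simp: pairwise_def)
  also have "... <= measure lebesgue U"
  proof (rule measure_mono_fmeasurable[OF _ _ UL(1)])
   show "(\<Union>i<n. {l i<..<rr i}) \<subseteq> U"
   proof
    fix t assume "t : (\<Union>i<n. {l i<..<rr i})"
    then obtain i where "i < n" "t : {l i..rr i}" by force
    thus "t : U" using K by blast
   qed
  qed auto
  also have "... < d" by fact
  finally have "(\<Sum>i<n. norm (f (rr i) - f (l i))) < e" using K disj by (intro d(2)) (simp_all add: pieces_def)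
  moreover have "(SUM (x, K):p1. norm (g K)) = (\<Sum>i<n. norm (f (rr i) - f (l i)))"
   unfolding g_def l_def rr_def using h by (subst sum.reindex_bij_betw[symmetric]) (auto simp: case_prod_unfold)
  ultimately have s1: "(SUM (x, K):p1. norm (g K)) <= e" by simp
  have "(SUM (x, K):p2. norm (g K)) <= (SUM (x, K):p2. e * measure lborel K)" using g2 by (intro sum_mono) auto
  also have "... <= (SUM (x, K):p. e * measure lborel K)" using fin \<open>e > 0\<close> by (intro sum_mono2) (auto simp: p2_def)
  also have "... = e * (SUM (x, K):p. measure lborel K)" by (simp add: sum_distrib_left case_prod_unfold)
  also have "... = e * (b - a)" using additive_content_tagged_division[of p a b] p(1) \<open>a <= b\<close> by simp
  finally have s2: "(SUM (x, K):p2. norm (g K)) <= e * (b - a)" .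
  have "norm (f b - f a) <= (SUM (x, K):p. norm (g K))" unfolding sumg[symmetric] by (intro order_trans[OF norm_sum] sum_mono) auto
  also have "... = (SUM (x, K):p1. norm (g K)) + (SUM (x, K):p2. norm (g K))"
   using fin \<open>p1 \<subseteq> p\<close> by (simp add: p2_def sum.subset_diff add.commute)
  finally show ?thesis using s1 s2 by (simp add: algebra_simps)
 qed
 note * = this
 have "norm (f b - f a) <= 0"
 proof (rule field_le_epsilon)
  fix e :: real assume "e > 0"
  moreover have "1 + (b - a) > 0" using \<open>a <= b\<close> by simp
  ultimately show "norm (f b - f a) <= 0 + e" using *[of "e / (1 + (b - a))"] by simp
 qed
 thus ?thesis by simp
qed

lemma integral_norm_bound_AE:
 fixes f :: "real => 'e::euclidean_space"
 assumes "a <= b" "f integrable_on {a..b}" "ae {a..b} (%t. norm (f t) <= C)" "0 <= C"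
 shows "norm (integral {a..b} f) <= C * (b - a)"
proof -
 define g where "g t = (if norm (f t) <= C then f t else 0)" for t
 have N: "negligible {t. ~ (t : {a..b} --> norm (f t) <= C)}" using assms(3) by (simp add: AE_lebesgue_iff)
 have "g integrable_on {a..b}" using assms(2) by (rule integrable_spike[OF _ N]) (auto simp: g_def)
 moreover have "integral {a..b} f = integral {a..b} g" by (rule integral_spike[OF N]) (auto simp: g_def)
 moreover have "norm (g t) <= C" for t using assms(4) by (auto simp: g_def)
 ultimately show ?thesis using has_integral_bound_real[OF assms(4), of "{}" g "integral {a..b} g" a b] assms(1) by (simp add: has_integral_integral)
qed

text \<open>\<open>integrable_ccontinuous_explicit\<close> controls difference quotients to the
  right only, so it is applied a second time to the reflected function for those to the
  left.\<close>

lemma has_vector_derivative_indefinite_integral_AE: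
 fixes f :: "real => 'e::euclidean_space"
 assumes f: "f integrable_on {a..b}"
 shows "AE t in lebesgue. t : {a..b} -->
  ((%s. integral {a..s} f) has_vector_derivative f t) (at t within {a..b})"
proof -
 define g where "g x = (if x : {a..b} then f x else 0)" for x
 have gi: "g integrable_on cbox c d" for c d
  using Henstock_Kurzweil_Integration.integrable_restrict_UNIV[of "{a..b}" f] f integrable_on_subcbox[of g UNIV c d] by (simp add: g_def[abs_def])
 have gi': "(%x. g (- x)) integrable_on cbox c d" for c d :: real
  using gi[of "-d" "-c"] by (simp add: Henstock_Kurzweil_Integration.integrable_reflect_real[of g "-c" "-d", simplified])
 obtain N1 where N1: "negligible N1" "!!x e. x \<notin> N1 ==> 0 < e ==>
   EX d>0. ALL h. 0 < h & h < d --> norm (integral (cbox x (x + h *R One)) g /\<^sub>R h ^ DIM(real) - g x) < e"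
  using integrable_ccontinuous_explicit[OF gi] by metis
 obtain N2 where N2: "negligible N2" "!!x e. x \<notin> N2 ==> 0 < e ==>
   EX d>0. ALL h. 0 < h & h < d --> norm (integral (cbox x (x + h *R One)) (%x. g (- x)) /\<^sub>R h ^ DIM(real) - g (- x)) < e"
  using integrable_ccontinuous_explicit[OF gi'] by metis
 have N2': "negligible (uminus ` N2)" by (rule negligible_differentiable_image_negligible[OF order_refl N2(1)])
   (auto simp: differentiable_on_def intro!: derivative_intros)
 have key: "((%s. integral {a..s} f) has_vector_derivative f t) (at t within {a..b})"
  if t: "t : {a..b}" "t \<notin> N1 \<union> uminus ` N2" for t unfolding has_vector_derivative_def has_derivative_within_alt
 proof (intro conjI bounded_linear_scaleR_left allI impI)
  fix e :: real assume "e > 0"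
  obtain d1 where d1: "d1 > 0" "!!h. 0 < h ==> h < d1 ==> norm (integral {t..t + h} g /\<^sub>R h - g t) < e"
   using N1(2)[of t e] t \<open>e > 0\<close> by auto
  have "- t \<notin> N2" using t by force
  then obtain d2 where d2: "d2 > 0"
   "!!h. 0 < h ==> h < d2 ==> norm (integral {- t..- t + h} (%x. g (- x)) /\<^sub>R h - g t) < e" using N2(2)[of "- t" e] \<open>e > 0\<close> by auto
  have refl: "integral {- t..- t + h} (%x. g (- x)) = integral {t - h..t} g" for h
   using Henstock_Kurzweil_Integration.integral_reflect_real[of t "t - h" g] by (simp add: algebra_simps)
  have Ig: "integral {a..s} f = integral {a..s} g" if "s : {a..b}" for s using that by (intro integral_cong) (auto simp: g_def)
  have aux: "norm (v - h *R w) <= e * h" if "norm (v /\<^sub>R h - w) < e" "h > 0" for v w :: 'e and h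
  proof -
   have "v - h *R w = h *R (v /\<^sub>R h - w)" using that(2) by (simp add: algebra_simps)
   hence "norm (v - h *R w) = h * norm (v /\<^sub>R h - w)" using that(2) by simp
   thus ?thesis using that by (simp add: mult.commute less_imp_le)
  qed
  show "EX d>0. ALL y:{a..b}. norm (y - t) < d -->
    norm (integral {a..y} f - integral {a..t} f - (y - t) *R f t) <= e * norm (y - t)"
  proof (intro exI[of _ "min d1 d2"] conjI ballI impI)
   show "min d1 d2 > 0" using d1 d2 by simp
   fix y assume y: "y : {a..b}" "norm (y - t) < min d1 d2"
   have gt: "g t = f t" using t by (simp add: g_def)
   have comb: "integral {a..p} g + integral {p..q} g = integral {a..q} g" if "a <= p" "p <= q" for p q
    using that gi[of a q] by (intro Henstock_Kurzweil_Integration.integral_combine) auto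
   consider "y = t" | "t < y" | "y < t" by linarith
   thus "norm (integral {a..y} f - integral {a..t} f - (y - t) *R f t) <= e * norm (y - t)"
   proof cases
    case 2
    have "norm (integral {t..y} g - (y - t) *R g t) <= e * (y - t)"
     using aux[where v="integral {t..y} g" and h="y - t" and w="g t"] d1(2)[of "y - t"] y 2 by simp
    moreover have "integral {a..y} g - integral {a..t} g - (y - t) *R g t = integral {t..y} g - (y - t) *R g t"
     using comb[of t y] 2 t y by (auto simp: algebra_simps)
    ultimately show ?thesis using 2 t y by (simp add: Ig gt[symmetric])
   next
    case 3
    have "norm (integral {y..t} g - (t - y) *R g t) <= e * (t - y)"
     using aux[where v="integral {y..t} g" and h="t - y" and w="g t"] d2(2)[of "t - y"] y 3 refl[of "t - y"] by simp
    moreover have "integral {a..y} g - integral {a..t} g - (y - t) *R g t = - (integral {y..t} g - (t - y) *R g t)"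
     using comb[of y t] 3 t y by (auto simp: algebra_simps)
    ultimately show ?thesis using 3 t y by (simp add: Ig gt[symmetric] norm_minus_commute)
   qed simp
  qed
 qed
 have "negligible (N1 \<union> uminus ` N2)" using N1(1) N2' by simp
 thus ?thesis unfolding AE_lebesgue_iff by (rule negligible_subset) (use key in blast)
qed

text \<open>Subtracting the primitive of \<open>g\<close>, which is Lipschitz by the bound
  \<open>C\<close>, leaves a function whose derivative vanishes almost everywhere.\<close>

lemma abs_cont_on_integral:
 fixes f :: "real => 'e::euclidean_space"
 assumes ac: "abs_cont_on a b f" and "a <= b"
  and der: "ae {a..b} (%t. (f has_vector_derivative g t) (at t within {a..b}))"
  and g: "g integrable_on {a..b}"
  and C: "ae {a..b} (%t. norm (g t) <= C)" "0 <= C"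
 shows "f b - f a = integral {a..b} g"
proof -
 define G where "G s = integral {a..s} g" for s
 have "abs_cont_on a b G"
 proof (rule lipschitz_abs_cont_on)
  fix s t assume st: "a <= s" "s < t" "t <= b"
  have gst: "g integrable_on {s..t}" "g integrable_on {a..t}" using g st by (auto intro: integrable_on_subinterval)
  hence "G t - G s = integral {s..t} g" using Henstock_Kurzweil_Integration.integral_combine[of a s t g] st by (simp add: G_def algebra_simps)
  also have "norm ... <= C * (t - s)"
  proof (rule integral_norm_bound_AE[OF _ gst(1) _ C(2)])
   show "ae {s..t} (%x. norm (g x) <= C)" using C(1) by eventually_elim (use st in auto)
  qed (use st in simp)
  finally show "norm (G t - G s) <= C * (t - s)" .
 qed
 hence "abs_cont_on a b (%t. f t - G t)"
  by (rule abs_cont_on_dominated[OF ac, of _ 1]) (use norm_triangle_ineq4[of "f t - f s" "G t - G s" for s t] in "auto simp: diff_diff_eq2 diff_diff_eq algebra_simps")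
 moreover have "ae {a..b} (%t. ((%t. f t - G t) has_vector_derivative 0) (at t within {a..b}))"
  using der has_vector_derivative_indefinite_integral_AE[OF g]
 proof eventually_elim
  case (elim t)
  show ?case using has_vector_derivative_diff[of f "g t" "at t within {a..b}" "%s. integral {a..s} g" "g t"] elim by (simp add: G_def[abs_def])
 qed
 ultimately have "f b - G b = f a - G a" by (rule abs_cont_zero_derivative[OF _ \<open>a <= b\<close>])
 thus ?thesis by (simp add: G_def diff_eq_eq add.commute)
qed

section \<open>Strict derivatives and symmetry of second derivatives\<close>

definition strict_deriv :: "('a::real_normed_vector => 'b::real_normed_vector) => 'a => ('a => 'b) => bool" where
 "strict_deriv f x D <-> bounded_linear D &
   (ALL e>0. EX d>0. ALL y:ball x d. ALL z:ball x d. norm (f y - f z - D (y - z)) <= e * norm (y - z))"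

lemma strict_derivE:
 assumes "strict_deriv f x D" "e > 0"
 obtains d where "d > 0"
  "!!y z. y : ball x d ==> z : ball x d ==> norm (f y - f z - D (y - z)) <= e * norm (y - z)" using assms unfolding strict_deriv_def by blast

lemma strict_deriv_has_derivative:
 assumes "strict_deriv f x D"
 shows "(f has_derivative D) (at x)"
proof -
 have "EX d>0. ALL y. norm (y - x) < d --> norm (f y - f x - D (y - x)) <= e * norm (y - x)" if "e > 0" for e
 proof -
  obtain d where "d > 0"
   "!!y z. y : ball x d ==> z : ball x d ==> norm (f y - f z - D (y - z)) <= e * norm (y - z)"
   using strict_derivE[OF assms \<open>e > 0\<close>] by blast
  thus ?thesis by (intro exI[of _ d]) (auto simp: dist_norm norm_minus_commute)
 qed
 thus ?thesis using assms by (auto simp: has_derivative_at_alt strict_deriv_def)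
qed

text \<open>The gain of strictness: both points vary, so a Lipschitz bound near \<open>x\<close>
  results. Later it carries Lipschitz and absolutely continuous curves from one chart to
  another.\<close>

lemma strict_deriv_lipschitz:
 assumes "strict_deriv f x D"
 obtains d K where "d > 0" "K > 0"
  "!!y z. y : ball x d ==> z : ball x d ==> norm (f y - f z) <= K * norm (y - z)"
proof -
 obtain d where d: "d > 0"
  "!!y z. y : ball x d ==> z : ball x d ==> norm (f y - f z - D (y - z)) <= 1 * norm (y - z)" using strict_derivE[OF assms, of 1] by auto
 have D: "bounded_linear D" using assms by (simp add: strict_deriv_def)
 obtain B where B: "B > 0" "!!v. norm (D v) <= norm v * B" using bounded_linear.pos_bounded[OF D] by blast
 show thesis
 proof (rule that[of d "1 + B"])
  fix y z assume yz: "y : ball x d" "z : ball x d"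
  have "norm (f y - f z) <= norm (f y - f z - D (y - z)) + norm (D (y - z))" using norm_triangle_ineq[of "f y - f z - D (y - z)" "D (y - z)"] by simp
  thus "norm (f y - f z) <= (1 + B) * norm (y - z)" using d(2)[OF yz] B(2)[of "y - z"] by (simp add: algebra_simps)
 qed (use d B in auto)
qed

text \<open>\<open>times_diff_on\<close> gives continuity of the derivative for each fixed direction
  only. In finite dimension the basis directions control the operator norm (hence the tolerance
  \<open>e / n\<close> with \<open>n\<close> the dimension), and the mean value inequality around
  the reference point \<open>x\<close> gives the two-point estimate.\<close>

lemma smooth_on_strict_deriv:
 fixes f :: "'a::euclidean_space => 'b::real_normed_vector"
 assumes S: "open S" "x : S" and f: "smooth_on S f"
 shows "strict_deriv f x (frechet_derivative f (at x))"
proof -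
 let ?D = "%y. frechet_derivative f (at y)"
 have df: "(f has_derivative ?D y) (at y)" if "y : S" for y
  using f[unfolded smooth_on_def, rule_format, of 1] that by (simp add: frechet_derivative_works)
 have cont: "continuous_on S (%y. ?D y v)" for v using f[unfolded smooth_on_def, rule_format, of 1] by simp
 have bl: "bounded_linear (?D y)" if "y : S" for y using df[OF that] by (rule has_derivative_bounded_linear)
 have "EX d>0. ALL y:ball x d. ALL z:ball x d. norm (f y - f z - ?D x (y - z)) <= e * norm (y - z)" if "e > 0" for e
 proof -
  define n where "n = real DIM('a)"
  have n: "n > 0" by (simp add: n_def)
  have "\<forall>\<^sub>F y in at x. ALL b:Basis. norm (?D y b - ?D x b) < e / n"
  proof (rule eventually_ball_finite)
   show "ALL b:Basis. \<forall>\<^sub>F y in at x. norm (?D y b - ?D x b) < e / n"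
   proof
    fix b :: 'a
    have "((%y. ?D y b) ---> ?D x b) (at x)" using cont[of b, unfolded continuous_on_def, rule_format, OF S(2)] at_within_open[OF S(2,1)] by simp
    thus "\<forall>\<^sub>F y in at x. norm (?D y b - ?D x b) < e / n"
     using tendstoD[of _ _ "at x" "e / n"] \<open>e > 0\<close> n unfolding dist_norm[symmetric] by simp
   qed
  qed simp
  then obtain d1 where d1: "d1 > 0" "!!y b. y : ball x d1 ==> b : Basis ==> norm (?D y b - ?D x b) <= e / n"
  proof -
   assume ev: "\<forall>\<^sub>F y in at x. ALL b:Basis. norm (?D y b - ?D x b) < e / n"
    and th: "!!d1. d1 > 0 ==> (!!y b. y : ball x d1 ==> b : Basis ==> norm (?D y b - ?D x b) <= e / n) ==> thesis"
   obtain d where d: "d > 0" "!!y. y ~= x ==> dist y x < d ==> ALL b:Basis. norm (?D y b - ?D x b) < e / n" using ev unfolding eventually_at by auto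
   show thesis
   proof (rule th[OF d(1)])
    fix y b :: 'a assume "y : ball x d" "b : Basis"
    thus "norm (?D y b - ?D x b) <= e / n" using d(2)[of y] \<open>e > 0\<close> n by (cases "y = x") (auto simp: dist_commute less_imp_le)
   qed
  qed
  obtain d2 where d2: "d2 > 0" "ball x d2 \<subseteq> S" using S openE by blast
  define d where "d = min d1 d2"
  have on: "onorm (%v. ?D y v - ?D x v) <= e" if "y : ball x d" for y
  proof (rule onorm_bound)
   fix v :: 'a
   have yS: "y : S" using that d2 by (auto simp: d_def)
   interpret y: bounded_linear "?D y" using bl yS .
   interpret x: bounded_linear "?D x" using bl S by blast
   have "?D y v - ?D x v = (SUM b:Basis. (v \<bullet> b) *R (?D y b - ?D x b))" by (subst (1 2) euclidean_representation[of v, symmetric])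
     (simp add: y.sum x.sum y.scaleR x.scaleR sum_subtractf[symmetric] scaleR_diff_right)
   also have "norm ... <= (SUM b:(Basis::'a set). norm v * (e / n))"
   proof (intro order_trans[OF norm_sum] sum_mono)
    fix b :: 'a assume "b : Basis"
    thus "norm ((v \<bullet> b) *R (?D y b - ?D x b)) <= norm v * (e / n)"
     unfolding norm_scaleR using d1(2)[of y b] that by (intro mult_mono Basis_le_norm) (auto simp: d_def)
   qed
   also have "... = e * norm v" using n by (simp add: n_def)
   finally show "norm (?D y v - ?D x v) <= e * norm v" .
  qed (use \<open>e > 0\<close> in simp)
  have "norm (f y - f z - ?D x (y - z)) <= e * norm (y - z)" if "y : ball x d" "z : ball x d" for y z
  proof -
   have "norm (f y - f z - ?D x (y - z)) <= norm (y - z) * e"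
   proof (rule differentiable_bound_linearization[where S="ball x d" and f'="?D" and ?x0.0=x])
    fix t :: real assume "t : {0..1}"
    thus "z + t *R (y - z) : ball x d" using convex_ball[of x d] that by (auto simp: convex_alt algebra_simps)
   next
    fix w assume "w : ball x d"
    hence "w : S" using d2 by (auto simp: d_def)
    thus "(f has_derivative ?D w) (at w within ball x d)" using has_derivative_at_withinI[OF df] by blast
   next
    fix w assume "w : ball x d"
    thus "onorm (?D w - ?D x) <= e" using on[of w] by (simp only: fun_diff_def)
   next
    show "x : ball x d" using d1 d2 by (simp add: d_def)
   qed
   thus ?thesis by (simp add: mult.commute)
  qed
  thus ?thesis using d1 d2 by (intro exI[of _ d]) (auto simp: d_def)
 qed
 thus ?thesis unfolding strict_deriv_def using bl[OF S(2)] by blast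
qed

lemma smooth_on_frechet_derivative:
 "smooth_on S f ==> smooth_on S (%x. frechet_derivative f (at x) v)" unfolding smooth_on_def by (metis times_diff_on.simps(2))

text \<open>Mean value inequality in \<open>s\<close> for the increment of \<open>f\<close> in
  direction \<open>h *R q\<close>, taken at the moving point \<open>x + s *R p\<close> and
  diminished by its expected linear growth \<open>(s * h) *R D q\<close>.\<close>

lemma second_derivative_bound:
 fixes f :: "'a::real_normed_vector => 'b::real_normed_vector"
 assumes S: "open S" "x : S" and df: "ALL y:S. (f has_derivative f' y) (at y)"
  and D: "strict_deriv (%y. f' y p) x D" and "e > 0"
 shows "\<forall>\<^sub>F h in at_right 0. norm (f (x + h *R p + h *R q) - f (x + h *R p) - f (x + h *R q) + f x - (h * h) *R D q)
   <= e * norm q * (h * h)"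
proof -
 interpret D: bounded_linear D using D by (simp add: strict_deriv_def)
 obtain d1 where d1: "d1 > 0"
  "!!y z. y : ball x d1 ==> z : ball x d1 ==> norm (f' y p - f' z p - D (y - z)) <= e * norm (y - z)"
  using strict_derivE[OF D \<open>e > 0\<close>] by blast
 obtain d2 where d2: "d2 > 0" "ball x d2 \<subseteq> S" using S openE by blast
 define d where "d = min d1 d2 / (norm p + norm q + 1)"
 have pos: "norm p + norm q + 1 > 0" by (smt (verit) norm_ge_zero)
 have "d > 0" using d1 d2 pos by (simp add: d_def)
 have small: "x + s *R p + t *R q : ball x (min d1 d2)" if "abs s < d" "abs t < d" for s t
 proof -
  have "dist x (x + s *R p + t *R q) = norm (s *R p + t *R q)" by (metis add.assoc dist_norm add_diff_cancel_left' norm_minus_commute)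
  also have "... <= abs s * norm p + abs t * norm q" using norm_triangle_ineq[of "s *R p" "t *R q"] by simp
  also have "... <= d * norm p + d * norm q" using that by (intro add_mono mult_right_mono) auto
  also have "... < d * (norm p + norm q + 1)" using \<open>d > 0\<close> by (simp add: algebra_simps)
  also have "... = min d1 d2" using pos by (simp add: d_def)
  finally show ?thesis by simp
 qed
 have "norm (f (x + h *R p + h *R q) - f (x + h *R p) - f (x + h *R q) + f x - (h * h) *R D q)
   <= e * norm q * (h * h)" if h: "0 < h" "h < d" for h
 proof -
  define k where "k s = f (x + s *R p + h *R q) - f (x + s *R p) - (s * h) *R D q" for s
  have kd: "(k has_derivative (%t. t *R (f' (x + s *R p + h *R q) p - f' (x + s *R p) p - h *R D q))) (at s within {0..h})"
   if s: "s : {0..h}" for s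
  proof -
   have 1: "x + s *R p + h *R q : S" "x + s *R p : S" using small[of s h] small[of s 0] s h d2 \<open>d > 0\<close> by auto
   interpret f1: bounded_linear "f' (x + s *R p + h *R q)" using df[rule_format, OF 1(1)] by (rule has_derivative_bounded_linear)
   interpret f2: bounded_linear "f' (x + s *R p)" using df[rule_format, OF 1(2)] by (rule has_derivative_bounded_linear)
   have a: "((%s. f (x + s *R p + h *R q)) has_derivative (%t. f' (x + s *R p + h *R q) (t *R p))) (at s within {0..h})"
    by (rule has_derivative_compose[where f="%s. x + s *R p + h *R q", OF _ df[rule_format, OF 1(1)]])
     (auto intro!: derivative_eq_intros)
   note a = a[unfolded f1.scaleR]
   have b: "((%s. f (x + s *R p)) has_derivative (%t. f' (x + s *R p) (t *R p))) (at s within {0..h})"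
    by (rule has_derivative_compose[where f="%s. x + s *R p", OF _ df[rule_format, OF 1(2)]])
     (auto intro!: derivative_eq_intros)
   note b = b[unfolded f2.scaleR]
   have c: "((%s. (s * h) *R D q) has_derivative (%t. (t * h) *R D q)) (at s within {0..h})" by (auto intro!: derivative_eq_intros)
   show ?thesis unfolding k_def[abs_def] by (rule has_derivative_eq_rhs[OF has_derivative_diff[OF has_derivative_diff[OF a b] c]])
     (auto simp: algebra_simps)
  qed
  have "norm (k h - k 0) <= (e * norm q * h) * norm (h - 0)"
  proof (rule differentiable_bound[where S="{0..h}"])
   fix s assume s: "s : {0..h}"
   let ?v = "f' (x + s *R p + h *R q) p - f' (x + s *R p) p - h *R D q"
   have "norm ?v <= e * norm (h *R q)" using d1(2)[of "x + s *R p + h *R q" "x + s *R p"] small[of s h] small[of s 0] s h \<open>d > 0\<close>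
    by (simp add: D.scaleR)
   hence "norm ?v <= e * norm q * h" using h by (simp add: mult_ac)
   hence "norm (t *R ?v) <= (e * norm q * h) * norm t" for t using mult_left_mono[of "norm ?v" "e * norm q * h" "norm t"] by (simp add: mult_ac)
   thus "onorm (%t. t *R ?v) <= e * norm q * h" using h \<open>e > 0\<close> by (intro onorm_bound) auto
  qed (use kd h in auto)
  thus ?thesis using h by (simp add: k_def algebra_simps)
 qed
 thus ?thesis unfolding eventually_at_right_field using \<open>d > 0\<close> by blast
qed

text \<open>The second difference is symmetric in \<open>p\<close> and \<open>q\<close>, while its
  leading term is \<open>D q\<close> in one reading and \<open>E p\<close> in the other.\<close>

lemma second_derivative_symmetric:
 fixes f :: "'a::real_normed_vector => 'b::real_normed_vector"
 assumes S: "open S" "x : S" and df: "ALL y:S. (f has_derivative f' y) (at y)"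
  and D: "strict_deriv (%y. f' y p) x D" and E: "strict_deriv (%y. f' y q) x E"
 shows "D q = E p"
proof -
 have "norm (D q - E p) <= e * (norm p + norm q)" if "e > 0" for e
 proof -
  have "\<forall>\<^sub>F h in at_right 0. (h::real) > 0" by (simp add: eventually_at_right_less)
  with second_derivative_bound[OF S df D \<open>e > 0\<close>, where q=q] second_derivative_bound[OF S df E \<open>e > 0\<close>, where q=p]
  have "\<forall>\<^sub>F h in at_right (0::real). norm (D q - E p) <= e * (norm p + norm q)"
  proof eventually_elim
   case (elim h)
   let ?X = "f (x + h *R p + h *R q) - f (x + h *R p) - f (x + h *R q) + f x"
   have "norm ((h * h) *R (D q - E p)) = norm ((?X - (h * h) *R E p) - (?X - (h * h) *R D q))" by (simp add: algebra_simps)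
   also have "... <= norm (?X - (h * h) *R E p) + norm (?X - (h * h) *R D q)" by (rule norm_triangle_ineq4)
   also have "... <= e * norm p * (h * h) + e * norm q * (h * h)" using elim by (intro add_mono) (simp_all add: algebra_simps)
   finally have "(h * h) * norm (D q - E p) <= (h * h) * (e * (norm p + norm q))" unfolding norm_scaleR by (simp add: algebra_simps)
   thus ?case using elim(3) by (simp add: mult_le_cancel_left)
  qed
  thus ?thesis by (simp add: eventually_const)
 qed
 note * = this
 have "norm (D q - E p) <= 0"
 proof (rule field_le_epsilon)
  fix e :: real assume "e > 0"
  have pos: "norm p + norm q + 1 > 0" by (smt (verit) norm_ge_zero)
  have "norm (D q - E p) <= e / (norm p + norm q + 1) * (norm p + norm q)" using *[of "e / (norm p + norm q + 1)"] \<open>e > 0\<close> pos by simp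
  also have "... <= 0 + e" using \<open>e > 0\<close> pos by (simp add: field_simps)
  finally show "norm (D q - E p) <= 0 + e" .
 qed
 thus ?thesis by simp
qed

section \<open>Lie groups in a coordinate ball\<close>

text \<open>Makes locally valid bounds uniform on a compact set. Monotonicity in a single natural
  number lets a radius and a constant be treated together.\<close>

lemma compact_uniform_nat:
 assumes "compact Q" and "!!g. g : Q ==> EX V n. open V & g : V & (ALL h:V. P h (n::nat))"
  and mono: "!!h n m. P h n ==> n <= m ==> P h m"
 obtains n where "!!g. g : Q ==> P g n"
proof -
 define V where "V n = \<Union>{V. open V & (ALL h:V. P h n)}" for n
 have "!!n. open (V n)" by (auto simp: V_def)
 moreover have "Q \<subseteq> (\<Union>n. V n)" using assms(2) by (auto simp: V_def) blast
 ultimately obtain S where S: "finite S" "Q \<subseteq> (\<Union>n\<in>S. V n)" using compactE_image[OF assms(1), of UNIV V] by auto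
 have "P g (Max (insert 0 S))" if "g : Q" for g
 proof -
  from S \<open>g : Q\<close> obtain n where n: "n : S" "g : V n" by blast
  hence "P g n" by (auto simp: V_def)
  thus ?thesis by (rule mono) (use n S in auto)
 qed
 thus thesis using \<open>!!n. (!!g. g : Q ==> P g n) ==> thesis\<close> by blast
qed

lemma has_derivative_norm_le:
 fixes D :: "'a::real_normed_vector => 'b::real_normed_vector"
 assumes D: "(g has_derivative D) (at 0)" and "\<r> > 0"
  and le: "!!b. norm b < \<r> ==> norm (g b - g 0) <= c * norm b"
 shows "norm (D v) <= c * norm v"
proof -
 interpret D: bounded_linear D using D by (rule has_derivative_bounded_linear)
 have "norm (D v) <= (c + e) * norm v" if "e > 0" for e
 proof -
  obtain d where d: "d > 0" "!!y. norm y < d ==> norm (g y - g 0 - D y) <= e * norm y"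
   using D \<open>e > 0\<close> unfolding has_derivative_at_alt by (metis diff_zero)
  define t where "t = min d \<r> / (norm v + 1) / 2"
  have nv: "norm v + 1 > 0" by (smt (verit) norm_ge_zero)
  have t: "t > 0" using d \<open>\<r> > 0\<close> nv by (simp add: t_def)
  have "t * norm v < min d \<r>"
  proof -
   have "t * norm v <= t * (norm v + 1)" using t by simp
   also have "... = min d \<r> / 2" using nv unfolding t_def by (metis less_irrefl nonzero_eq_divide_eq times_divide_eq_left divide_divide_eq_left' mult.commute)
   also have "... < min d \<r>" using d(1) \<open>\<r> > 0\<close> by linarith
   finally show ?thesis .
  qed
  hence tv: "norm (t *R v) < d" "norm (t *R v) < \<r>" using t by auto
  have "norm (D (t *R v)) <= norm (g (t *R v) - g 0) + norm (g (t *R v) - g 0 - D (t *R v))"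
   using norm_triangle_ineq4[of "g (t *R v) - g 0" "g (t *R v) - g 0 - D (t *R v)"] by simp
  also have "... <= (c + e) * norm (t *R v)" using d(2)[OF tv(1)] le[OF tv(2)] by (simp add: algebra_simps)
  finally have "t * norm (D v) <= t * ((c + e) * norm v)" using t by (simp add: D.scaleR algebra_simps)
  thus ?thesis using t by simp
 qed
 note * = this
 show ?thesis
 proof (rule field_le_epsilon)
  fix e :: real assume "e > 0"
  have nv: "norm v + 1 > 0" by (smt (verit) norm_ge_zero)
  have "norm (D v) <= (c + e / (norm v + 1)) * norm v" using * \<open>e > 0\<close> nv by simp
  also have "... <= c * norm v + e" using \<open>e > 0\<close> nv by (simp add: field_simps)
  finally show "norm (D v) <= c * norm v + e" .
 qed
qed

text \<open>\<open>\<k>\<close> is a coordinate centred at the identity with local inverse \<open>\<pi>\<close>; \<open>F a\<close> is the value at \<open>\<pi> a\<close>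
  of the left-invariant fields and \<open>br\<close> the bracket. The radius \<open>R\<close> is so small that the
  multiplication differs little from addition.\<close>

locale local_lie =
 fixes G :: "'g::t2_space monoid" (structure)
  and \<k> :: "'g => 'e::euclidean_space" and \<pi> :: "'e => 'g"
  and F :: "'e => 'e => 'e" and br :: "'e => 'e => 'e" and R r L :: real
 assumes grp: "group G" and carrier: "carrier G = UNIV"
  and cont_mult: "continuous_on UNIV (%(x, y). x \<otimes> y)"
  and cont_inv: "continuous_on UNIV (%x. inv x)"
  and radii: "0 < r" "r <= R" "0 <= L"
  and \<k>_\<pi>: "!!a. norm a < R ==> \<k> (\<pi> a) = a"
  and \<pi>_0: "\<pi> 0 = \<one>"
  and \<pi>_cont: "continuous_on (ball 0 R) \<pi>"
  and \<pi>_open: "!!\<r>. 0 < \<r> ==> \<r> <= R ==> open (\<pi> ` ball 0 \<r>)"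
  and prod_small: "!!a b. norm a < r ==> norm b < r ==> \<pi> a \<otimes> \<pi> b : \<pi> ` ball 0 R"
  and div_small: "!!a b. norm a < r ==> norm b < r ==> inv (\<pi> a) \<otimes> \<pi> b : \<pi> ` ball 0 R"
  and strict: "!!a b a' b'. norm a < R ==> norm b < R ==> norm a' < R ==> norm b' < R ==>
   norm (\<k> (\<pi> a \<otimes> \<pi> b) - \<k> (\<pi> a' \<otimes> \<pi> b') - (a - a') - (b - b')) <= (norm (a - a') + norm (b - b')) / 4"
  and strict_0: "!!e. e > 0 ==> EX d>0. ALL a b. norm a < d --> norm b < d -->
   norm (\<k> (\<pi> a \<otimes> \<pi> b) - a - b) <= e * (norm a + norm b)"
  and F_der: "!!a. norm a < R ==> ((%b. \<k> (\<pi> a \<otimes> \<pi> b)) has_derivative F a) (at 0)"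
  and F_lip: "!!a a' v. norm a < R ==> norm a' < R ==> norm (F a v - F a' v) <= L * norm (a - a') * norm v"
  and conj_diff: "!!x. (%b. \<k> (x \<otimes> \<pi> b \<otimes> inv x)) differentiable (at 0)"
  and Ad_der': "!!w. ((%a. frechet_derivative (%b. \<k> (\<pi> a \<otimes> \<pi> b \<otimes> inv (\<pi> a))) (at 0) w)
   has_derivative (%v. br v w)) (at 0)"
begin

abbreviation chart_norm ("\<n>") where "\<n> x \<equiv> norm (\<k> x)"

interpretation group G by (rule grp)

lemma gsimps:
 "(x \<otimes> y) \<otimes> z = x \<otimes> (y \<otimes> z)" "\<one> \<otimes> x = x" "x \<otimes> \<one> = x" "inv x \<otimes> x = \<one>" "x \<otimes> inv x = \<one>"
 "inv x \<otimes> (x \<otimes> y) = y" "x \<otimes> (inv x \<otimes> y) = y" "inv (x \<otimes> y) = inv y \<otimes> inv x" "inv (inv x) = x" "inv \<one> = \<one>"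
proof -
 show 1: "(x \<otimes> y) \<otimes> z = x \<otimes> (y \<otimes> z)" for x y z by (simp add: m_assoc carrier)
 show "inv x \<otimes> (x \<otimes> y) = y" "x \<otimes> (inv x \<otimes> y) = y" by (simp_all add: 1[symmetric] carrier)
qed (simp_all add: carrier inv_mult_group)

lemma inv_mult_eq_one_iff: "inv x \<otimes> y = \<one> <-> x = y" by (metis gsimps(3,4,7))

lemma mult_right_cancel: "y \<otimes> x = z \<otimes> x <-> y = z" by (metis gsimps(1,3,5))

section \<open>Coordinate neighbourhoods of the identity\<close>

definition U :: "real => 'g set" where "U \<r> = \<pi> ` ball 0 \<r>"

lemma R_pos: "0 < R" using radii by simp

lemma U_mono: "\<r> <= \<r>' ==> U \<r> \<subseteq> U \<r>'" by (auto simp: U_def)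

lemma \<pi>_in_U [intro]: "norm a < \<r> ==> \<pi> a : U \<r>" by (auto simp: U_def)

lemma U_D: "x : U \<r> ==> \<r> <= R ==> \<n> x < \<r> & \<pi> (\<k> x) = x" by (auto simp: U_def \<k>_\<pi>)

lemma U_iff: "\<r> <= R ==> x : U \<r> <-> x : U R & \<n> x < \<r>"
 using U_D[of x \<r>] U_D[of x R] \<pi>_in_U[of "\<k> x" \<r>] by (metis U_mono order_refl subsetD)

lemma open_U: "0 < \<r> ==> \<r> <= R ==> open (U \<r>)" by (simp add: U_def \<pi>_open)

lemma one_in_U [simp]: "0 < \<r> ==> \<one> : U \<r>" using \<pi>_in_U[of 0 \<r>] by (simp add: \<pi>_0)

lemma \<k>_one [simp]: "\<k> \<one> = 0" using \<k>_\<pi>[of 0] R_pos by (simp add: \<pi>_0)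

lemma \<k>_eq_0: "x : U R ==> \<k> x = 0 ==> x = \<one>" using U_D[of x R] \<pi>_0 by auto

lemma tendsto_mult_G: "(f ---> x) X ==> (g ---> y) X ==> ((%t. f t \<otimes> g t) ---> x \<otimes> y) X"
proof -
 assume "(f ---> x) X" "(g ---> y) X"
 hence "((%t. (f t, g t)) ---> (x, y)) X" by (rule tendsto_Pair)
 moreover have "isCont (%(x, y). x \<otimes> y) (x, y)" using cont_mult by (simp add: continuous_on_eq_continuous_at)
 ultimately show ?thesis using isCont_tendsto_compose by fastforce
qed

lemma tendsto_inv_G: "(f ---> x) X ==> ((%t. inv (f t)) ---> inv x) X"
 using cont_inv by (auto simp: continuous_on_eq_continuous_at intro: isCont_tendsto_compose)

lemma continuous_on_mult_G [continuous_intros]: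
 "continuous_on S f ==> continuous_on S g ==> continuous_on S (%t. f t \<otimes> g t)" unfolding continuous_on_def by (auto intro: tendsto_mult_G)

lemma continuous_on_inv_G [continuous_intros]:
 "continuous_on S f ==> continuous_on S (%t. inv (f t))" unfolding continuous_on_def by (auto intro: tendsto_inv_G)

lemma tendsto_\<pi>_nhds: "(\<pi> ---> \<one>) (nhds 0)"
proof -
 have "isCont \<pi> 0" using \<pi>_cont R_pos by (simp add: continuous_on_eq_continuous_at)
 thus ?thesis unfolding isCont_def tendsto_at_iff_tendsto_nhds unfolding \<pi>_0 .
qed

lemma tendsto_\<pi>: "(f ---> 0) X ==> ((%t. \<pi> (f t)) ---> \<one>) X" by (rule filterlim_compose[OF tendsto_\<pi>_nhds])

lemma eventually_in_U: "(f ---> \<one>) X ==> 0 < \<r> ==> \<r> <= R ==> \<forall>\<^sub>F t in X. f t : U \<r>"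
 using topological_tendstoD[of f \<one> X "U \<r>"] open_U by auto

lemma tendsto_\<k>: "(f ---> \<one>) X ==> ((%t. \<k> (f t)) ---> 0) X"
proof (rule tendstoI)
 fix e :: real assume "(f ---> \<one>) X" "e > 0"
 hence "\<forall>\<^sub>F t in X. f t : U (min e R)" using R_pos by (intro eventually_in_U) auto
 thus "\<forall>\<^sub>F t in X. dist (\<k> (f t)) 0 < e" by eventually_elim (use U_D[of _ "min e R"] in auto)
qed

lemma tendsto_oneI: "(!!\<r>. 0 < \<r> ==> \<r> <= R ==> \<forall>\<^sub>F t in X. f t : U \<r>) ==> (f ---> \<one>) X"
proof (rule topological_tendstoI)
 fix S assume ev: "!!\<r>. 0 < \<r> ==> \<r> <= R ==> \<forall>\<^sub>F t in X. f t : U \<r>" and S: "open S" "\<one> : S"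
 have "\<forall>\<^sub>F a in nhds 0. \<pi> a : S" by (rule topological_tendstoD[OF tendsto_\<pi>_nhds S])
 then obtain d where d: "d > 0" "!!a. dist a 0 < d ==> \<pi> a : S" unfolding eventually_nhds_metric by blast
 from ev[of "min d R"] d R_pos have "\<forall>\<^sub>F t in X. f t : U (min d R)" by simp
 thus "\<forall>\<^sub>F t in X. f t : S" by eventually_elim (use d in "auto simp: U_def")
qed

lemma tendsto_translate_iff: "((%t. inv x \<otimes> f t) ---> \<one>) X <-> (f ---> x) X"
proof
 assume "((%t. inv x \<otimes> f t) ---> \<one>) X"
 from tendsto_mult_G[OF tendsto_const this, of x] show "(f ---> x) X" by (simp add: gsimps)
next
 assume "(f ---> x) X"
 from tendsto_mult_G[OF tendsto_const this, of "inv x"] show "((%t. inv x \<otimes> f t) ---> \<one>) X" by (simp add: gsimps)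
qed

lemma U_nhd:
 assumes "open S" "\<one> : S"
 obtains \<r> where "0 < \<r>" "\<r> <= R" "U \<r> \<subseteq> S"
proof -
 have "\<forall>\<^sub>F a in nhds 0. \<pi> a : S" by (rule topological_tendstoD[OF tendsto_\<pi>_nhds assms])
 then obtain d where d: "d > 0" "!!a. dist a 0 < d ==> \<pi> a : S" unfolding eventually_nhds_metric by blast
 show thesis by (rule that[of "min d R"]) (use d R_pos in "auto simp: U_def")
qed

lemma mult_nhd:
 assumes "open S" "x \<otimes> y : S"
 obtains V W where "open V" "open W" "x : V" "y : W" "!!v w. v : V ==> w : W ==> v \<otimes> w : S"
proof -
 have "open ((%(x, y). x \<otimes> y) -` S)" using cont_mult assms(1) by (simp add: continuous_on_open_vimage)
 then obtain V W where "open V" "open W" "(x, y) : V \<times> W" "V \<times> W \<subseteq> (%(x, y). x \<otimes> y) -` S"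
  using open_prod_elim[of "(%(x, y). x \<otimes> y) -` S" "(x, y)"] assms(2) by auto
 thus thesis by (intro that[of V W]) auto
qed

lemma open_translate: "open S ==> open {y. x \<otimes> y : S}" "open S ==> open {y. y \<otimes> x : S}" "open S ==> open {y. inv y : S}"
proof -
 have c: "continuous_on UNIV (%y. x \<otimes> y)" "continuous_on UNIV (%y. y \<otimes> x)" "continuous_on UNIV (%y. inv y)"
  by (intro continuous_intros)+
 show "open S ==> open {y. x \<otimes> y : S}" "open S ==> open {y. y \<otimes> x : S}" "open S ==> open {y. inv y : S}"
  using c[unfolded continuous_on_open_vimage[OF open_UNIV]] by (auto simp: vimage_def)
qed

lemma norm_mult_le:
 assumes "norm a < R" "norm b < R"
 shows "\<n> (\<pi> a \<otimes> \<pi> b) <= 2 * (norm a + norm b)" "norm (\<k> (\<pi> a \<otimes> \<pi> b) - a) <= 2 * norm b"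
proof -
 have "norm (\<k> (\<pi> a \<otimes> \<pi> b) - a - b) <= (norm a + norm b) / 4" using strict[of a b 0 0] assms R_pos by (simp add: \<pi>_0 gsimps)
 thus "\<n> (\<pi> a \<otimes> \<pi> b) <= 2 * (norm a + norm b)" by norm
 have "norm (\<k> (\<pi> a \<otimes> \<pi> b) - a - b) <= norm b / 4" using strict[of a b a 0] assms R_pos by (simp add: \<pi>_0 gsimps \<k>_\<pi>)
 thus "norm (\<k> (\<pi> a \<otimes> \<pi> b) - a) <= 2 * norm b" by norm
qed

lemma mult_small: "x : U r ==> y : U r ==> x \<otimes> y : U R & \<n> (x \<otimes> y) <= 2 * (\<n> x + \<n> y)"
 using prod_small[of "\<k> x" "\<k> y"] norm_mult_le[of "\<k> x" "\<k> y"] U_D[of x r] U_D[of y r] radii by (auto simp: U_def)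

text \<open>With \<open>?n\<close> the coordinate of the quotient, compare
  \<open>\<pi> a \<otimes> \<pi> ?n\<close> with \<open>\<pi> a \<otimes> \<pi> 0\<close> by
  \<open>strict\<close>: the difference \<open>b - a\<close> is \<open>?n\<close> up to a quarter of
  its norm.\<close>

lemma div_le:
 assumes "norm a < r" "norm b < r"
 shows "\<n> (inv (\<pi> a) \<otimes> \<pi> b) <= 2 * norm (b - a)" "inv (\<pi> a) \<otimes> \<pi> b : U R"
proof -
 let ?n = "\<k> (inv (\<pi> a) \<otimes> \<pi> b)"
 show *: "inv (\<pi> a) \<otimes> \<pi> b : U R" using div_small[OF assms] by (simp add: U_def)
 have n: "norm ?n < R" "\<pi> ?n = inv (\<pi> a) \<otimes> \<pi> b" using U_D[OF *] by auto
 have "norm (\<k> (\<pi> a \<otimes> \<pi> ?n) - \<k> (\<pi> a \<otimes> \<pi> 0) - ?n) <= norm ?n / 4"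
  using strict[of a ?n a 0] assms radii n(1) by simp
 hence "norm (b - a - ?n) <= norm ?n / 4" using assms radii by (simp add: n(2) gsimps \<pi>_0 \<k>_\<pi>)
 thus "norm ?n <= 2 * norm (b - a)" by norm
qed

lemma inv_small: "x : U r ==> inv x : U R & \<n> (inv x) <= 2 * \<n> x" using div_le[of "\<k> x" 0] U_D[of x r] radii by (auto simp: \<pi>_0 gsimps)

text \<open>The conjugate \<open>?y\<close> satisfies \<open>?y \<otimes> z = z \<otimes> x\<close>.
  Both products are sums of coordinates up to a quarter of the norm of \<open>?y\<close> or of
  \<open>x\<close>, so \<open>\<n> ?y \<le> 5/3 * \<n> x\<close>; no derivative of the conjugation
  is involved, which makes the bound uniform in \<open>z\<close>.\<close>

lemma conj_small:
 obtains \<r> where "0 < \<r>" "\<r> <= R"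
  "!!z x. z : U \<r> ==> x : U \<r> ==> z \<otimes> x \<otimes> inv z : U R & \<n> (z \<otimes> x \<otimes> inv z) <= 2 * \<n> x"
proof -
 obtain V W where VW: "open V" "open W" "\<one> : V" "\<one> : W" "!!v w. v : V ==> w : W ==> v \<otimes> w : U R"
  using mult_nhd[of "U R" \<one> \<one>] open_U[of R] R_pos by (auto simp: gsimps)
 obtain V1 V2 where V: "open V1" "open V2" "\<one> : V1" "\<one> : V2" "!!v w. v : V1 ==> w : V2 ==> v \<otimes> w : V"
  using mult_nhd[of V \<one> \<one>] VW by (auto simp: gsimps)
 define O' where "O' = V1 Int V2 Int {y. inv y : W}"
 have "open O'" "\<one> : O'" using VW V open_translate(3)[of W] by (auto simp: O'_def gsimps)
 then obtain \<r> where \<r>: "0 < \<r>" "\<r> <= R" "U \<r> \<subseteq> O'" by (rule U_nhd)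
 show thesis
 proof (rule that[OF \<r>(1,2)])
  fix z x assume zx: "z : U \<r>" "x : U \<r>"
  let ?y = "z \<otimes> x \<otimes> inv z"
  have y: "?y : U R" using zx \<r>(3) V(5)[of z x] VW(5)[of "z \<otimes> x" "inv z"] by (auto simp: O'_def)
  have z': "\<n> z < R" "\<pi> (\<k> z) = z" and x': "\<n> x < R" "\<pi> (\<k> x) = x"
   and y': "\<n> ?y < R" "\<pi> (\<k> ?y) = ?y" using U_D zx y \<r>(2) by (auto intro: less_le_trans)
  have 1: "norm (\<k> (z \<otimes> x) - \<k> z - \<k> x) <= \<n> x / 4"
   using strict[of "\<k> z" "\<k> x" "\<k> z" 0] z' x' R_pos by (simp add: \<pi>_0 gsimps)
  have 2: "norm (\<k> (?y \<otimes> z) - \<k> z - \<k> ?y) <= \<n> ?y / 4"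
   using strict[of "\<k> ?y" "\<k> z" 0 "\<k> z"] z' y' R_pos by (simp add: \<pi>_0 gsimps)
  have "?y \<otimes> z = z \<otimes> x" by (simp add: gsimps)
  with 1 2 have "\<n> ?y <= 2 * \<n> x" by simp norm
  with y show "?y : U R & \<n> ?y <= 2 * \<n> x" by simp
 qed
qed

section \<open>The adjoint representation\<close>

definition Ad :: "'g => 'e => 'e" where
 "Ad x = frechet_derivative (%b. \<k> (x \<otimes> \<pi> b \<otimes> inv x)) (at 0)"

lemma Ad_has_derivative: "((%b. \<k> (x \<otimes> \<pi> b \<otimes> inv x)) has_derivative Ad x) (at 0)"
 using conj_diff frechet_derivative_works by (auto simp: Ad_def)

lemma bounded_linear_Ad: "bounded_linear (Ad x)" using Ad_has_derivative by (rule has_derivative_bounded_linear)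

lemmas linear_Ad = bounded_linear.linear[OF bounded_linear_Ad]
lemmas Ad_simps = linear_add[OF linear_Ad] linear_diff[OF linear_Ad] linear_scale[OF linear_Ad]
 linear_0[OF linear_Ad] linear_neg[OF linear_Ad] linear_sum[OF linear_Ad]

lemma Ad_one: "Ad \<one> v = v"
proof -
 have "((%b. b) has_derivative Ad \<one>) (at 0)"
  using R_pos by (intro has_derivative_transform_within_open[OF Ad_has_derivative[of \<one>], of "ball 0 R"])
   (auto simp: gsimps \<k>_\<pi>)
 from has_derivative_unique[OF this has_derivative_ident] show ?thesis by simp
qed

lemma tendsto_conj: "((%b. x \<otimes> \<pi> b \<otimes> inv x) ---> \<one>) (nhds 0)"
proof -
 have "((%b. x \<otimes> \<pi> b \<otimes> inv x) ---> x \<otimes> \<one> \<otimes> inv x) (nhds 0)"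
  by (intro tendsto_mult_G tendsto_const tendsto_\<pi>) (rule filterlim_ident)
 thus ?thesis by (simp add: gsimps)
qed

lemma Ad_mult: "Ad (x \<otimes> y) v = Ad x (Ad y v)"
proof -
 have 0: "\<k> (y \<otimes> \<pi> 0 \<otimes> inv y) = 0" by (simp add: \<pi>_0 gsimps)
 have "((%b. \<k> (x \<otimes> \<pi> (\<k> (y \<otimes> \<pi> b \<otimes> inv y)) \<otimes> inv x)) has_derivative (%v. Ad x (Ad y v))) (at 0)"
  by (rule has_derivative_compose[OF Ad_has_derivative]) (use Ad_has_derivative[of x] in "simp add: 0")
 moreover have "\<forall>\<^sub>F b in nhds 0. y \<otimes> \<pi> b \<otimes> inv y : U R" using eventually_in_U[OF tendsto_conj] R_pos by blast
 hence "\<forall>\<^sub>F b in nhds 0. \<k> (x \<otimes> \<pi> (\<k> (y \<otimes> \<pi> b \<otimes> inv y)) \<otimes> inv x) = \<k> (x \<otimes> y \<otimes> \<pi> b \<otimes> inv (x \<otimes> y))"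
  by eventually_elim (use U_D in "simp add: gsimps")
 ultimately have "((%b. \<k> (x \<otimes> y \<otimes> \<pi> b \<otimes> inv (x \<otimes> y))) has_derivative (%v. Ad x (Ad y v))) (at 0)"
  by (auto simp: eventually_nhds_conv_at elim!: has_derivative_transform_eventually)
 from has_derivative_unique[OF Ad_has_derivative this] show ?thesis by (auto dest: fun_cong)
qed

lemma Ad_inv: "Ad (inv x) (Ad x v) = v" "Ad x (Ad (inv x) v) = v" by (simp_all add: Ad_mult[symmetric] gsimps Ad_one)

lemma Ad_der: "((%a. Ad (\<pi> a) w) has_derivative (%v. br v w)) (at 0)" using Ad_der' by (simp add: Ad_def)

lemma bounded_linear_br: "bounded_linear (%v. br v w)" using Ad_der by (rule has_derivative_bounded_linear)

lemma linear_br_right: "linear (br v)"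
proof (rule linearI)
 show "br v (w + w') = br v w + br v w'" for w w'
 proof -
  have "((%a. Ad (\<pi> a) (w + w')) has_derivative (%v. br v w + br v w')) (at 0)" unfolding Ad_simps by (intro has_derivative_add Ad_der)
  from has_derivative_unique[OF Ad_der this] show ?thesis by (rule fun_cong)
 qed
 show "br v (c *R w) = c *R br v w" for c w
 proof -
  have "((%a. Ad (\<pi> a) (c *R w)) has_derivative (%v. c *R br v w)) (at 0)" unfolding Ad_simps by (intro has_derivative_scaleR_right Ad_der)
  from has_derivative_unique[OF Ad_der this] show ?thesis by (rule fun_cong)
 qed
qed

lemma linear_br_left: "linear (%v. br v w)" using bounded_linear_br by (rule bounded_linear.linear)

text \<open>Differentiability of \<open>Ad\<close> at the identity concerns one vector at a time;
  applied to the finitely many basis vectors it becomes an estimate uniform in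
  \<open>v\<close>.\<close>

lemma Ad_near:
 obtains \<r> K where "0 < \<r>" "\<r> <= R" "0 <= K"
  "!!x v. x : U \<r> ==> norm (Ad x v - v) <= K * \<n> x * norm v"
proof -
 have "EX d>0. EX k>=0. ALL a. norm a < d --> norm (Ad (\<pi> a) w - w) <= k * norm a" for w
 proof -
  obtain B where B: "0 < B" "!!v. norm (br v w) <= norm v * B" using bounded_linear.pos_bounded[OF bounded_linear_br] by blast
  obtain d where d: "d > 0" "!!a. norm (a - 0) < d ==> norm (Ad (\<pi> a) w - Ad (\<pi> 0) w - br (a - 0) w) <= 1 * norm (a - 0)"
   using Ad_der[of w, unfolded has_derivative_at_alt] zero_less_one by blast
  have "norm (Ad (\<pi> a) w - w) <= (1 + B) * norm a" if "norm a < d" for a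
  proof -
   have "norm (Ad (\<pi> a) w - w - br a w) <= norm a" using d(2)[of a] that by (simp add: \<pi>_0 Ad_one)
   with B(2)[of a] have "norm (Ad (\<pi> a) w - w) <= norm a + norm a * B" using norm_triangle_sub[of "Ad (\<pi> a) w - w" "br a w"] by linarith
   thus ?thesis by (simp add: algebra_simps)
  qed
  thus ?thesis using d B by (intro exI[of _ d] conjI exI[of _ "1 + B"]) auto
 qed
 then obtain d k where d: "!!w. d w > 0" and k: "!!w. k w >= 0"
  "!!w a. norm a < d w ==> norm (Ad (\<pi> a) w - w) <= k w * norm a" by metis
 define \<r> where "\<r> = min R (Min (d ` Basis))"
 define K where "K = (SUM i:Basis. k i)"
 have \<r>: "0 < \<r>" "\<r> <= R" using R_pos d by (auto simp: \<r>_def)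
 show thesis
 proof (rule that[OF \<r>])
  show "0 <= K" using k by (auto simp: K_def intro: sum_nonneg)
  fix x v assume "x : U \<r>"
  hence x: "\<n> x < \<r>" "\<pi> (\<k> x) = x" using U_D \<r> by auto
  have "Ad x v - v = (SUM i:Basis. (v \<bullet> i) *R (Ad x i - i))" by (subst (1 2) euclidean_representation[of v, symmetric])
    (simp only: Ad_simps scaleR_diff_right sum_subtractf)
  also have "norm ... <= (SUM i:Basis. norm v * (k i * \<n> x))"
  proof (intro order_trans[OF norm_sum] sum_mono)
   fix i :: 'e assume i: "i : Basis"
   hence "\<r> <= d i" by (auto simp: \<r>_def intro: min.coboundedI2)
   hence "norm (Ad x i - i) <= k i * \<n> x" using k(2)[of "\<k> x" i] x by simp
   thus "norm ((v \<bullet> i) *R (Ad x i - i)) <= norm v * (k i * \<n> x)" unfolding norm_scaleR using i by (intro mult_mono Basis_le_norm) auto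
  qed
  also have "... = K * \<n> x * norm v" by (simp add: K_def sum_distrib_left sum_distrib_right mult_ac)
  finally show "norm (Ad x v - v) <= K * \<n> x * norm v" .
 qed
qed

text \<open>Continuity at the identity spreads to every \<open>x\<close> because
  \<open>Ad y v = Ad (y \<otimes> inv x) (Ad x v)\<close>.\<close>

lemma continuous_on_Ad': "continuous_on UNIV (%x. Ad x v)" unfolding continuous_on_def
proof
 fix x :: 'g
 have 1: "((%y. Ad y w) ---> w) (nhds \<one>)" for w
 proof -
  obtain \<r> K where K: "0 < \<r>" "\<r> <= R" "0 <= K" "!!x v. x : U \<r> ==> norm (Ad x v - v) <= K * \<n> x * norm v" by (rule Ad_near) blast
  have "((%y. K * \<n> y * norm w) ---> K * norm (0::'e) * norm w) (nhds \<one>)" by (intro tendsto_intros tendsto_\<k> filterlim_ident)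
  hence "((%y. K * \<n> y * norm w) ---> 0) (nhds \<one>)" by simp
  moreover have "\<forall>\<^sub>F y in nhds \<one>. norm (Ad y w - w) <= K * \<n> y * norm w"
   using eventually_in_U[OF filterlim_ident K(1,2)] by eventually_elim (use K in auto)
  ultimately have "((%y. Ad y w - w) ---> 0) (nhds \<one>)" by (rule Lim_null_comparison[rotated])
  thus ?thesis by (simp add: LIM_zero_iff)
 qed
 have "((%y. y \<otimes> inv x) ---> x \<otimes> inv x) (at x within UNIV)" by (intro tendsto_mult_G tendsto_ident_at tendsto_const)
 hence "((%y. y \<otimes> inv x) ---> \<one>) (at x within UNIV)" by (simp add: gsimps)
 from filterlim_compose[OF 1 this, of "Ad x v"]
 show "((%x. Ad x v) ---> Ad x v) (at x within UNIV)" by (simp add: Ad_mult[symmetric] gsimps)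
qed

lemma continuous_on_Ad: "continuous_on S f ==> continuous_on S (%t. Ad (f t) v)" by (rule continuous_on_compose2[OF continuous_on_Ad']) auto

text \<open>For \<open>h\<close> near \<open>g\<close> the conjugate of \<open>x\<close> by
  \<open>h\<close> is the conjugate of \<open>g \<otimes> x \<otimes> inv g\<close> by the small
  element \<open>h \<otimes> inv g\<close>. The latter is handled by \<open>conj_small\<close>,
  conjugation by the fixed \<open>g\<close> by its derivative \<open>Ad g\<close>.\<close>

lemma conj_compact:
 assumes "compact Q"
 obtains \<r> K where "0 < \<r>" "\<r> <= R" "0 <= K"
  "!!g x. g : Q ==> x : U \<r> ==> g \<otimes> x \<otimes> inv g : U R & \<n> (g \<otimes> x \<otimes> inv g) <= K * \<n> x"
proof -
 \<comment> \<open>One number encodes the radius \<open>R / (n + 1)\<close> and the constant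
   \<open>n\<close>; enlarging it weakens the claim, as \<open>compact_uniform_nat\<close>
   requires.\<close>
 define P where "P g n <-> (ALL x:U (R / (real n + 1)). g \<otimes> x \<otimes> inv g : U R &
  \<n> (g \<otimes> x \<otimes> inv g) <= real n * \<n> x)" for g n
 obtain n where n: "!!g. g : Q ==> P g n"
 proof (rule compact_uniform_nat[OF assms, of P])
  show "P h m" if "P h n" "n <= m" for h n m
  proof -
   have "R / (real m + 1) <= R / (real n + 1)" using that R_pos by (intro divide_left_mono) auto
   moreover have "real n * \<n> x <= real m * \<n> x" for x using that by (intro mult_right_mono) auto
   ultimately show ?thesis using that(1) U_mono unfolding P_def by (meson order_trans subsetD)
  qed
  fix g assume "g : Q"
  obtain \<r> where \<r>: "0 < \<r>" "\<r> <= R"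
   "!!z x. z : U \<r> ==> x : U \<r> ==> z \<otimes> x \<otimes> inv z : U R & \<n> (z \<otimes> x \<otimes> inv z) <= 2 * \<n> x"
   by (rule conj_small) blast
  obtain B where B: "B > 0" "!!v. norm (Ad g v) <= norm v * B" using bounded_linear.pos_bounded[OF bounded_linear_Ad] by blast
  obtain d1 where d1: "d1 > 0" "!!b. norm (b - 0) < d1 ==>
    norm (\<k> (g \<otimes> \<pi> b \<otimes> inv g) - \<k> (g \<otimes> \<pi> 0 \<otimes> inv g) - Ad g (b - 0)) <= 1 * norm (b - 0)"
   using Ad_has_derivative[of g, unfolded has_derivative_at_alt] zero_less_one by blast
  obtain d2 where d2: "d2 > 0" "!!b. dist b 0 < d2 ==> g \<otimes> \<pi> b \<otimes> inv g : U \<r>"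
   using eventually_in_U[OF tendsto_conj \<r>(1,2), of g] unfolding eventually_nhds_metric by blast
  obtain n :: nat where n: "n > R / min R (min d1 d2)" "n > 2 * (1 + B)" by (metis max_less_iff_conj reals_Archimedean2)
  have m0: "min R (min d1 d2) > 0" using R_pos d1 d2 by simp
  have n': "R / (real n + 1) < min R (min d1 d2)"
  proof -
   have "R < real n * min R (min d1 d2)" using n(1) m0 by (simp add: pos_divide_less_eq)
   also have "... <= min R (min d1 d2) * (real n + 1)" using m0 by (simp add: algebra_simps)
   finally show ?thesis using pos_divide_less_eq[of "real n + 1" R "min R (min d1 d2)"] by linarith
  qed
  show "EX V n. open V & g : V & (ALL h:V. P h n)"
  proof (intro exI[of _ "{h. h \<otimes> inv g : U \<r>}"] exI[of _ n] conjI ballI)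
   show "open {h. h \<otimes> inv g : U \<r>}" by (intro open_translate open_U \<r>)
   show "g : {h. h \<otimes> inv g : U \<r>}" using \<r> by (simp add: gsimps)
   fix h assume h: "h : {h. h \<otimes> inv g : U \<r>}"
   show "P h n" unfolding P_def
   proof
    fix x assume x: "x : U (R / (real n + 1))"
    have x': "\<n> x < min R (min d1 d2)" "\<pi> (\<k> x) = x" using U_D[OF x] n' by (auto intro: less_trans)
    let ?y = "g \<otimes> x \<otimes> inv g"
    have y: "?y : U \<r>" using d2(2)[of "\<k> x"] x' by simp
    have "norm (\<k> ?y - Ad g (\<k> x)) <= \<n> x" using d1(2)[of "\<k> x"] x' by (simp add: \<pi>_0 gsimps)
    hence "\<n> ?y <= \<n> x + \<n> x * B" using B(2)[of "\<k> x"] norm_triangle_sub[of "\<k> ?y" "Ad g (\<k> x)"] by linarith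
    hence y2: "\<n> ?y <= (1 + B) * \<n> x" by (simp add: algebra_simps)
    have e: "h \<otimes> x \<otimes> inv h = (h \<otimes> inv g) \<otimes> ?y \<otimes> inv (h \<otimes> inv g)" by (simp add: gsimps)
    have "h \<otimes> x \<otimes> inv h : U R" "\<n> (h \<otimes> x \<otimes> inv h) <= 2 * \<n> ?y"
     using \<r>(3)[OF _ y, of "h \<otimes> inv g"] h unfolding e by auto
    moreover have "2 * \<n> ?y <= (2 * (1 + B)) * \<n> x" using y2 mult_left_mono[OF y2, of 2] by (simp only: mult.assoc)
    moreover have "... <= real n * \<n> x" using n by (intro mult_right_mono) auto
    ultimately show "h \<otimes> x \<otimes> inv h : U R & \<n> (h \<otimes> x \<otimes> inv h) <= real n * \<n> x" by linarith
   qed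
  qed
 qed blast
 show thesis by (rule that[of "R / (real n + 1)" "real n"]) (use n R_pos in "auto simp: P_def field_simps")
qed

end

section \<open>Logarithmic derivatives\<close>

lemma has_vector_derivative_iff_eventually:
 "(f has_vector_derivative v) (at t within S) <->
  (ALL e>0. \<forall>\<^sub>F s in at t within S. norm (f s - f t - (s - t) *R v) <= e * abs (s - t))"
 by (simp add: has_vector_derivative_def has_derivative_within_alt2 bounded_linear_scaleR_left)

lemma has_vector_derivative_cong_at_within:
 assumes "(f has_vector_derivative v) (at t within S)" "\<forall>\<^sub>F s in at t within S. f s = g s" "f t = g t"
 shows "(g has_vector_derivative v) (at t within S)" unfolding has_vector_derivative_iff_eventually
proof (intro allI impI)
 fix e :: real assume "e > 0"
 hence "\<forall>\<^sub>F s in at t within S. norm (f s - f t - (s - t) *R v) <= e * abs (s - t)"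
  using assms(1) unfolding has_vector_derivative_iff_eventually by blast
 with assms(2) show "\<forall>\<^sub>F s in at t within S. norm (g s - g t - (s - t) *R v) <= e * abs (s - t)"
  by eventually_elim (use assms(3) in simp)
qed

lemma has_vector_derivative_chain:
 assumes "(g has_derivative D) (at (y t))" "(y has_vector_derivative v) (at t within S)"
 shows "((%s. g (y s)) has_vector_derivative D v) (at t within S)"
proof -
 interpret D: bounded_linear D using assms(1) by (rule has_derivative_bounded_linear)
 show ?thesis using has_derivative_compose[OF assms(2)[unfolded has_vector_derivative_def] assms(1)] by (simp add: has_vector_derivative_def D.scaleR)
qed

context local_lie
begin

text \<open>A curve through the identity with chart velocity \<open>v\<close> at time
  \<open>t\<close>. Membership in \<open>U R\<close> is demanded because nothing is known about the
  values of \<open>\<k>\<close> outside the coordinate ball.\<close>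

definition germ :: "(real => 'g) => real set => real => 'e => bool" where
 "germ f S t v <-> f t = \<one> & (\<forall>\<^sub>F s in at t within S. f s : U R) &
   ((%s. \<k> (f s)) has_vector_derivative v) (at t within S)"

definition logder :: "(real => 'g) => real set => real => 'e => bool" where
 "logder \<c> S t v <-> germ (%s. inv (\<c> t) \<otimes> \<c> s) S t v"

lemma germ_iff:
 "germ f S t v <-> f t = \<one> & (\<forall>\<^sub>F s in at t within S. f s : U R) &
  (ALL e>0. \<forall>\<^sub>F s in at t within S. norm (\<k> (f s) - (s - t) *R v) <= e * abs (s - t))"
 unfolding germ_def has_vector_derivative_iff_eventually by auto

lemma germ_cong:
 assumes "germ f S t v" "\<forall>\<^sub>F s in at t within S. f s = g s" "g t = \<one>"
 shows "germ g S t v" unfolding germ_iff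
proof (intro conjI allI impI)
 show "\<forall>\<^sub>F s in at t within S. g s : U R"
  using assms(1)[unfolded germ_iff, THEN conjunct2, THEN conjunct1] assms(2) by eventually_elim simp
 show "\<forall>\<^sub>F s in at t within S. norm (\<k> (g s) - (s - t) *R v) <= e * abs (s - t)" if "e > 0" for e
  using assms(1)[unfolded germ_iff, THEN conjunct2, THEN conjunct2, rule_format, OF that] assms(2) by eventually_elim simp
qed fact

lemma germ_subset: "germ f S t v ==> S' \<subseteq> S ==> germ f S' t v" unfolding germ_def
 by (auto intro: has_vector_derivative_within_subset simp: at_le filter_leD[OF at_le])

lemma germ_tendsto: "germ f S t v ==> (f ---> \<one>) (at t within S)"
proof (rule tendsto_oneI)
 fix \<r> assume g: "germ f S t v" and \<r>: "0 < \<r>" "\<r> <= R"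
 have "((%s. \<k> (f s)) ---> \<k> (f t)) (at t within S)" using g unfolding germ_def by (metis continuous_within has_vector_derivative_continuous)
 hence "((%s. \<k> (f s)) ---> 0) (at t within S)" using g by (simp add: germ_def)
 hence "\<forall>\<^sub>F s in at t within S. \<n> (f s) < \<r>" using tendstoD[of "%s. \<k> (f s)" 0 "at t within S" \<r>] \<r> by simp
 moreover have "\<forall>\<^sub>F s in at t within S. f s : U R" using g by (simp add: germ_def)
 ultimately show "\<forall>\<^sub>F s in at t within S. f s : U \<r>" by eventually_elim (simp add: U_iff[OF \<r>(2)])
qed

lemma germ_bound:
 assumes "germ f S t v"
 shows "\<forall>\<^sub>F s in at t within S. \<n> (f s) <= (norm v + 1) * abs (s - t)"
proof -
 have "\<forall>\<^sub>F s in at t within S. norm (\<k> (f s) - (s - t) *R v) <= 1 * abs (s - t)"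
  using assms unfolding germ_iff using zero_less_one by blast
 thus ?thesis
 proof eventually_elim
  case (elim s)
  have "norm ((s - t) *R v) = norm v * abs (s - t)" by simp
  thus ?case using elim norm_triangle_sub[of "\<k> (f s)" "(s - t) *R v"] unfolding distrib_right by linarith
 qed
qed

text \<open>By \<open>strict_0\<close> multiplication is addition up to an error of smaller order,
  so velocities at the identity add. In the proof \<open>p\<close> bounds the sum of the two speeds,
  each enlarged by 1.\<close>

lemma germ_mult:
 assumes f: "germ f S t v" and g: "germ g S t w"
 shows "germ (%s. f s \<otimes> g s) S t (v + w)" unfolding germ_iff
proof (intro conjI allI impI)
 show "f t \<otimes> g t = \<one>" using f g by (simp add: germ_def gsimps)
 show "\<forall>\<^sub>F s in at t within S. f s \<otimes> g s : U R"
  using tendsto_mult_G[OF germ_tendsto[OF f] germ_tendsto[OF g]] eventually_in_U[of _ _ R] R_pos by (simp add: gsimps)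
 fix e :: real assume "e > 0"
 define p where "p = norm v + norm w + 2"
 define e1 where "e1 = e / 2 / p"
 have pos: "p > 0" unfolding p_def by (smt (verit) norm_ge_zero)
 have e1: "e1 > 0" using \<open>e > 0\<close> pos by (simp add: e1_def)
 obtain d where d: "d > 0" "!!a b. norm a < d ==> norm b < d ==> norm (\<k> (\<pi> a \<otimes> \<pi> b) - a - b) <= e1 * (norm a + norm b)"
  using strict_0[OF e1] by blast
 have e4: "e / 4 > 0" using \<open>e > 0\<close> by simp
 have m: "0 < min d R" "min d R <= R" using d R_pos by auto
 have "\<forall>\<^sub>F s in at t within S. norm (\<k> (f s) - (s - t) *R v) <= e / 4 * abs (s - t)"
  "\<forall>\<^sub>F s in at t within S. norm (\<k> (g s) - (s - t) *R w) <= e / 4 * abs (s - t)" using f g e4 unfolding germ_iff by blast+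
 with germ_bound[OF f] germ_bound[OF g] eventually_in_U[OF germ_tendsto[OF f] m] eventually_in_U[OF germ_tendsto[OF g] m]
 show "\<forall>\<^sub>F s in at t within S. norm (\<k> (f s \<otimes> g s) - (s - t) *R (v + w)) <= e * abs (s - t)"
 proof eventually_elim
  case (elim s)
  have fs: "\<n> (f s) < d" "\<pi> (\<k> (f s)) = f s" and gs: "\<n> (g s) < d" "\<pi> (\<k> (g s)) = g s" using elim(3,4) U_D[OF _ m(2)] by auto
  have "norm (\<k> (f s \<otimes> g s) - \<k> (f s) - \<k> (g s)) <= e1 * (\<n> (f s) + \<n> (g s))" using d(2)[OF fs(1) gs(1)] fs gs by simp
  also have "... <= e1 * (p * abs (s - t))" using elim(1,2) e1 by (intro mult_left_mono) (auto simp: p_def algebra_simps)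
  also have "... = e / 2 * abs (s - t)" using pos by (simp add: e1_def)
  finally have 1: "norm (\<k> (f s \<otimes> g s) - \<k> (f s) - \<k> (g s)) <= e / 2 * abs (s - t)" .
  have "\<k> (f s \<otimes> g s) - (s - t) *R (v + w) = (\<k> (f s \<otimes> g s) - \<k> (f s) - \<k> (g s)) +
   ((\<k> (f s) - (s - t) *R v) + (\<k> (g s) - (s - t) *R w))" by (simp add: algebra_simps)
  also have "norm ... <= e / 2 * abs (s - t) + (e / 4 * abs (s - t) + e / 4 * abs (s - t))"
   by (intro norm_triangle_le add_mono 1 elim norm_triangle_mono)
  finally show ?case by (simp add: algebra_simps)
 qed
qed

lemma germ_inv:
 assumes f: "germ f S t v"
 shows "germ (%s. inv (f s)) S t (- v)" unfolding germ_iff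
proof (intro conjI allI impI)
 show "inv (f t) = \<one>" using f by (simp add: germ_def gsimps)
 have ti: "((%s. inv (f s)) ---> \<one>) (at t within S)" using tendsto_inv_G[OF germ_tendsto[OF f]] by (simp add: gsimps)
 show "\<forall>\<^sub>F s in at t within S. inv (f s) : U R" using eventually_in_U[OF ti, of R] R_pos by simp
 fix e :: real assume "e > 0"
 define p where "p = norm v + 1"
 \<comment> \<open>The factor 3 comes from
   \<open>\<n> (f s) + \<n> (inv (f s)) \<le> 3 * \<n> (f s)\<close>, a consequence of
   \<open>inv_small\<close>.\<close>
 define e1 where "e1 = e / 2 / (3 * p)"
 have pos: "p > 0" unfolding p_def by (smt (verit) norm_ge_zero)
 have e1: "e1 > 0" using \<open>e > 0\<close> pos by (simp add: e1_def)
 obtain d where d: "d > 0" "!!a b. norm a < d ==> norm b < d ==> norm (\<k> (\<pi> a \<otimes> \<pi> b) - a - b) <= e1 * (norm a + norm b)"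
  using strict_0[OF e1] by blast
 have e4: "e / 2 > 0" using \<open>e > 0\<close> by simp
 have m: "0 < min d r" "min d r <= R" "min d r <= r" using d radii by auto
 have "\<forall>\<^sub>F s in at t within S. norm (\<k> (f s) - (s - t) *R v) <= e / 2 * abs (s - t)" using f e4 unfolding germ_iff by blast
 with germ_bound[OF f] eventually_in_U[OF germ_tendsto[OF f] m(1,2)] eventually_in_U[OF ti m(1,2)]
 show "\<forall>\<^sub>F s in at t within S. norm (\<k> (inv (f s)) - (s - t) *R (- v)) <= e * abs (s - t)"
 proof eventually_elim
  case (elim s)
  have fs: "\<n> (f s) < d" "\<pi> (\<k> (f s)) = f s" and gs: "\<n> (inv (f s)) < d" "\<pi> (\<k> (inv (f s))) = inv (f s)"
   using elim(2,3) U_D[OF _ m(2)] by auto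
  have "\<n> (inv (f s)) <= 2 * \<n> (f s)" using inv_small[of "f s"] elim(2) U_mono[OF m(3)] by auto
  have "norm (- \<k> (f s) - \<k> (inv (f s))) <= e1 * (\<n> (f s) + \<n> (inv (f s)))" using d(2)[OF fs(1) gs(1)] fs gs by (simp add: gsimps)
  also have "... <= e1 * (3 * (p * abs (s - t)))" using elim(1) e1 \<open>\<n> (inv (f s)) <= _\<close> by (intro mult_left_mono) (auto simp: p_def)
  also have "... = e / 2 * abs (s - t)" using pos by (simp add: e1_def)
  finally have 1: "norm (- \<k> (f s) - \<k> (inv (f s))) <= e / 2 * abs (s - t)" .
  have "\<k> (inv (f s)) - (s - t) *R (- v) = - ((- \<k> (f s) - \<k> (inv (f s))) + (\<k> (f s) - (s - t) *R v))" by (simp add: algebra_simps)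
  also have "norm ... <= e / 2 * abs (s - t) + e / 2 * abs (s - t)" unfolding norm_minus_cancel by (intro norm_triangle_mono 1 elim)
  finally show ?case by (simp add: algebra_simps)
 qed
qed

lemma germ_conj:
 assumes f: "germ f S t v"
 shows "germ (%s. x \<otimes> f s \<otimes> inv x) S t (Ad x v)"
proof -
 have 0: "\<k> (f t) = 0" "f t = \<one>" using f by (auto simp: germ_def)
 have "((%s. \<k> (x \<otimes> \<pi> (\<k> (f s)) \<otimes> inv x)) has_vector_derivative Ad x v) (at t within S)"
  by (rule has_vector_derivative_chain[of "%b. \<k> (x \<otimes> \<pi> b \<otimes> inv x)"])
   (use Ad_has_derivative[of x] f in "auto simp: 0 germ_def")
 moreover have ev: "\<forall>\<^sub>F s in at t within S. \<pi> (\<k> (f s)) = f s"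
  using f[unfolded germ_def, THEN conjunct2, THEN conjunct1] by eventually_elim (use U_D in auto)
 have "((%s. x \<otimes> f s \<otimes> inv x) ---> x \<otimes> \<one> \<otimes> inv x) (at t within S)"
  by (intro tendsto_mult_G tendsto_const germ_tendsto[OF f])
 hence t1: "((%s. x \<otimes> f s \<otimes> inv x) ---> \<one>) (at t within S)" by (simp add: gsimps)
 have evR: "\<forall>\<^sub>F s in at t within S. x \<otimes> f s \<otimes> inv x : U R" using eventually_in_U[OF t1, of R] R_pos by simp
 moreover have "\<forall>\<^sub>F s in at t within S. x \<otimes> \<pi> (\<k> (f s)) \<otimes> inv x : U R" using evR ev by eventually_elim simp
 ultimately have "germ (%s. x \<otimes> \<pi> (\<k> (f s)) \<otimes> inv x) S t (Ad x v)" by (simp add: germ_def 0 \<pi>_0 gsimps)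
 thus ?thesis by (rule germ_cong) (use ev 0 in "auto simp: gsimps elim: eventually_mono")
qed

lemma germ_Ad:
 assumes f: "germ f S t v"
 shows "((%s. Ad (f s) w) has_vector_derivative br v w) (at t within S)"
proof -
 have 0: "\<k> (f t) = 0" "f t = \<one>" using f by (auto simp: germ_def)
 have "((%s. Ad (\<pi> (\<k> (f s))) w) has_vector_derivative br v w) (at t within S)" by (rule has_vector_derivative_chain[of "%b. Ad (\<pi> b) w"])
   (use Ad_der[of w] f in "auto simp: 0 germ_def")
 moreover have ev: "\<forall>\<^sub>F s in at t within S. \<pi> (\<k> (f s)) = f s"
  using f[unfolded germ_def, THEN conjunct2, THEN conjunct1] by eventually_elim (use U_D in auto)
 hence "\<forall>\<^sub>F s in at t within S. Ad (\<pi> (\<k> (f s))) w = Ad (f s) w" by eventually_elim simp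
 ultimately show ?thesis by (rule has_vector_derivative_cong_at_within) (simp add: 0 \<pi>_0)
qed

lemma logder_subset: "logder \<c> S t v ==> S' \<subseteq> S ==> logder \<c> S' t v" unfolding logder_def by (rule germ_subset)

lemma logder_translate: "logder (%s. x \<otimes> \<c> s) S t v <-> logder \<c> S t v" by (simp add: logder_def gsimps)

lemma logder_mult:
 assumes "logder \<c> S t v" "logder \<c>' S t w"
 shows "logder (%s. \<c> s \<otimes> \<c>' s) S t (Ad (inv (\<c>' t)) v + w)"
proof -
 have "germ (%s. (inv (\<c>' t) \<otimes> (inv (\<c> t) \<otimes> \<c> s) \<otimes> inv (inv (\<c>' t))) \<otimes> (inv (\<c>' t) \<otimes> \<c>' s)) S t
   (Ad (inv (\<c>' t)) v + w)" using assms unfolding logder_def by (intro germ_mult germ_conj)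
 thus ?thesis by (simp add: logder_def gsimps)
qed

lemma logder_inv:
 assumes "logder \<c> S t v"
 shows "logder (%s. inv (\<c> s)) S t (- Ad (\<c> t) v)"
proof -
 have "germ (%s. inv (\<c> t \<otimes> (inv (\<c> t) \<otimes> \<c> s) \<otimes> inv (\<c> t))) S t (- Ad (\<c> t) v)"
  using assms unfolding logder_def by (intro germ_inv germ_conj)
 thus ?thesis by (simp add: logder_def gsimps)
qed

text \<open>Lipschitz for the left-invariant quantity \<open>\<n> (inv x \<otimes> y)\<close>, which
  is meaningful only for nearby points; hence the uniform scale \<open>\<d>\<close> below which the
  bound is required.\<close>

definition left_lip :: "real set => (real => 'g) => bool" where
 "left_lip S \<c> <-> (EX K>=0. EX \<d>>0. ALL s:S. ALL t:S. abs (s - t) < \<d> -->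
   inv (\<c> s) \<otimes> \<c> t : U R & \<n> (inv (\<c> s) \<otimes> \<c> t) <= K * abs (s - t))"

lemma left_lipI:
 assumes "0 <= K" "0 < \<d>" "!!s t. s : S ==> t : S ==> abs (s - t) < \<d> ==>
   inv (\<c> s) \<otimes> \<c> t : U R & \<n> (inv (\<c> s) \<otimes> \<c> t) <= K * abs (s - t)"
 shows "left_lip S \<c>" using assms unfolding left_lip_def by blast

lemma left_lip_small:
 assumes "left_lip S \<c>" "0 < \<r>" "\<r> <= R"
 obtains K \<d> where "0 <= K" "0 < \<d>" "!!s t. s : S ==> t : S ==> abs (s - t) < \<d> ==>
   inv (\<c> s) \<otimes> \<c> t : U \<r> & \<n> (inv (\<c> s) \<otimes> \<c> t) <= K * abs (s - t)"
proof -
 obtain K \<d> where K: "0 <= K" "0 < \<d>" "!!s t. s : S ==> t : S ==> abs (s - t) < \<d> ==>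
   inv (\<c> s) \<otimes> \<c> t : U R & \<n> (inv (\<c> s) \<otimes> \<c> t) <= K * abs (s - t)" using assms(1) unfolding left_lip_def by blast
 define d where "d = min \<d> (\<r> / (K + 1))"
 show thesis
 proof (rule that[OF K(1), of d])
  show "0 < d" using K assms by (simp add: d_def)
  fix s t assume st: "s : S" "t : S" "abs (s - t) < d"
  hence st': "abs (s - t) < \<d>" "abs (s - t) < \<r> / (K + 1)" by (auto simp: d_def)
  from st'(2) have "abs (s - t) * (K + 1) < \<r>" using K(1) pos_less_divide_eq[of "K + 1"] by simp
  hence "K * abs (s - t) < \<r>" using abs_ge_zero[of "s - t"] by (simp add: algebra_simps)
  thus "inv (\<c> s) \<otimes> \<c> t : U \<r> & \<n> (inv (\<c> s) \<otimes> \<c> t) <= K * abs (s - t)"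
   using K(3)[OF st(1,2) st'(1)] U_iff[OF assms(3)] by auto
 qed
qed

lemma left_lip_continuous_on:
 assumes "left_lip S \<c>"
 shows "continuous_on S \<c>" unfolding continuous_on_def
proof
 fix s assume "s : S"
 have "((%t. inv (\<c> s) \<otimes> \<c> t) ---> \<one>) (at s within S)"
 proof (rule tendsto_oneI)
  fix \<r> assume "0 < \<r>" "\<r> <= R"
  with assms obtain K \<d> where K: "0 <= K" "0 < \<d>" "!!s t. s : S ==> t : S ==> abs (s - t) < \<d> ==>
   inv (\<c> s) \<otimes> \<c> t : U \<r> & \<n> (inv (\<c> s) \<otimes> \<c> t) <= K * abs (s - t)" by (rule left_lip_small) blast
  thus "\<forall>\<^sub>F t in at s within S. inv (\<c> s) \<otimes> \<c> t : U \<r>"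
   unfolding eventually_at using \<open>s : S\<close> by (intro exI[of _ \<d>]) (auto simp: dist_real_def abs_minus_commute)
 qed
 thus "(\<c> ---> \<c> s) (at s within S)" by (simp add: tendsto_translate_iff)
qed

lemma left_lip_subset: "left_lip S \<c> ==> S' \<subseteq> S ==> left_lip S' \<c>" unfolding left_lip_def by (meson subsetD)

lemma left_lip_translate: "left_lip S (%t. x \<otimes> \<c> t) <-> left_lip S \<c>" by (simp add: left_lip_def gsimps)

text \<open>The left quotient of two inverses is a left quotient of the original curve conjugated by
  \<open>\<c> s\<close>, and the conjugating elements range over a compact set.\<close>

lemma left_lip_inv:
 assumes "left_lip S \<c>" "compact S"
 shows "left_lip S (%t. inv (\<c> t))"
proof -
 have "compact (\<c> ` S)" using left_lip_continuous_on[OF assms(1)] assms(2) by (rule compact_continuous_image)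
 then obtain \<r> C where C: "0 < \<r>" "\<r> <= R" "0 <= C"
  "!!g x. g : \<c> ` S ==> x : U \<r> ==> g \<otimes> x \<otimes> inv g : U R & \<n> (g \<otimes> x \<otimes> inv g) <= C * \<n> x"
  by (rule conj_compact) blast
 from assms(1) C(1,2) obtain K \<d> where K: "0 <= K" "0 < \<d>" "!!s t. s : S ==> t : S ==> abs (s - t) < \<d> ==>
   inv (\<c> s) \<otimes> \<c> t : U \<r> & \<n> (inv (\<c> s) \<otimes> \<c> t) <= K * abs (s - t)" by (rule left_lip_small) blast
 show ?thesis
 proof (rule left_lipI[of "C * K" \<d>])
  fix s t assume st: "s : S" "t : S" "abs (s - t) < \<d>"
  have *: "inv (\<c> t) \<otimes> \<c> s : U \<r>" "\<n> (inv (\<c> t) \<otimes> \<c> s) <= K * abs (s - t)"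
   using K(3)[of t s] st by (auto simp: abs_minus_commute)
  have eq: "inv (inv (\<c> s)) \<otimes> inv (\<c> t) = \<c> s \<otimes> (inv (\<c> t) \<otimes> \<c> s) \<otimes> inv (\<c> s)" by (simp add: gsimps)
  show "inv (inv (\<c> s)) \<otimes> inv (\<c> t) : U R & \<n> (inv (inv (\<c> s)) \<otimes> inv (\<c> t)) <= C * K * abs (s - t)"
   unfolding eq using C(4)[of "\<c> s", OF _ *(1)] st(1) mult_left_mono[OF *(2) C(3)] by (auto simp: mult.assoc)
 qed (use C K in auto)
qed

lemma left_lip_mult:
 assumes "left_lip S \<c>" "left_lip S \<c>'" "compact S"
 shows "left_lip S (%t. \<c> t \<otimes> \<c>' t)"
proof -
 have "compact ((%t. inv (\<c>' t)) ` S)" using left_lip_continuous_on[OF assms(2)] assms(3) by (intro compact_continuous_image continuous_intros)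
 then obtain \<r> C where C: "0 < \<r>" "\<r> <= R" "0 <= C"
  "!!g x. g : (%t. inv (\<c>' t)) ` S ==> x : U \<r> ==> g \<otimes> x \<otimes> inv g : U R & \<n> (g \<otimes> x \<otimes> inv g) <= C * \<n> x"
  by (rule conj_compact) blast
 \<comment> \<open>Chosen so that the conjugate \<open>?z\<close>, of norm at most
   \<open>C * \<n> ?x\<close>, still lies in \<open>U r\<close>, where \<open>mult_small\<close>
   applies.\<close>
 define \<r>1 where "\<r>1 = min \<r> (r / (C + 1))"
 have \<r>1: "0 < \<r>1" "\<r>1 <= R" "\<r>1 <= \<r>" using C radii by (auto simp: \<r>1_def)
 from assms(1) \<r>1(1,2) obtain K \<d> where K: "0 <= K" "0 < \<d>" "!!s t. s : S ==> t : S ==> abs (s - t) < \<d> ==>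
   inv (\<c> s) \<otimes> \<c> t : U \<r>1 & \<n> (inv (\<c> s) \<otimes> \<c> t) <= K * abs (s - t)" by (rule left_lip_small) blast
 from assms(2) radii(1,2) obtain K' \<d>' where K': "0 <= K'" "0 < \<d>'" "!!s t. s : S ==> t : S ==> abs (s - t) < \<d>' ==>
   inv (\<c>' s) \<otimes> \<c>' t : U r & \<n> (inv (\<c>' s) \<otimes> \<c>' t) <= K' * abs (s - t)" by (rule left_lip_small) blast
 show ?thesis
 proof (rule left_lipI[of "2 * (C * K + K')" "min \<d> \<d>'"])
  fix s t assume st: "s : S" "t : S" "abs (s - t) < min \<d> \<d>'"
  let ?x = "inv (\<c> s) \<otimes> \<c> t" and ?y = "inv (\<c>' s) \<otimes> \<c>' t" and ?g = "inv (\<c>' s)"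
  let ?z = "?g \<otimes> ?x \<otimes> inv ?g"
  have x: "?x : U \<r>1" "\<n> ?x <= K * abs (s - t)" and y: "?y : U r" "\<n> ?y <= K' * abs (s - t)" using K(3)[of s t] K'(3)[of s t] st by auto
  have z: "?z : U R" "\<n> ?z <= C * \<n> ?x" using C(4)[of ?g ?x] x U_mono[OF \<r>1(3)] st by auto
  have "\<n> ?x < r / (C + 1)" using U_D[OF x(1) \<r>1(2)] by (simp add: \<r>1_def)
  hence "\<n> ?x * (C + 1) < r" using C(3) pos_less_divide_eq[of "C + 1"] by simp
  hence "C * \<n> ?x < r" using C(3) by (simp add: algebra_simps) (smt (verit) norm_ge_zero)
  hence "?z : U r" using z U_iff[OF radii(2)] by auto
  note ms = mult_small[OF this y(1)]
  have eq: "inv (\<c> s \<otimes> \<c>' s) \<otimes> (\<c> t \<otimes> \<c>' t) = ?z \<otimes> ?y" by (simp add: gsimps)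
  have "\<n> ?z + \<n> ?y <= (C * K + K') * abs (s - t)" using z(2) mult_left_mono[OF x(2) C(3)] y(2) by (simp add: algebra_simps)
  hence "2 * (\<n> ?z + \<n> ?y) <= 2 * (C * K + K') * abs (s - t)" unfolding mult.assoc by (rule mult_left_mono) simp
  thus "inv (\<c> s \<otimes> \<c>' s) \<otimes> (\<c> t \<otimes> \<c>' t) : U R &
   \<n> (inv (\<c> s \<otimes> \<c>' s) \<otimes> (\<c> t \<otimes> \<c>' t)) <= 2 * (C * K + K') * abs (s - t)"
   unfolding eq using ms order_trans by blast
 qed (use C K K' in auto)
qed

section \<open>The left-invariant frame in coordinates\<close>

lemma F_linear: "norm a < R ==> linear (F a)" using has_derivative_linear[OF F_der] .

lemma F_near:
 assumes "norm a < R"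
 shows "norm (F a v - v) <= norm v / 4"
proof -
 have "((%b. \<k> (\<pi> a \<otimes> \<pi> b) - b) has_derivative (%v. F a v - v)) (at 0)"
  using F_der[OF assms] by (auto intro!: derivative_eq_intros)
 from has_derivative_norm_le[OF this R_pos, of "1/4" v] show ?thesis using strict[OF assms _ assms, of _ 0] R_pos by (simp add: algebra_simps)
qed

lemma F_bounds:
 assumes "norm a < R"
 shows "norm (F a v) <= 2 * norm v" "norm v <= 2 * norm (F a v)"
 using F_near[OF assms, of v] norm_triangle_sub[of "F a v" v] norm_triangle_sub[of v "F a v"] by (auto simp: norm_minus_commute)

lemma F_0: "F 0 v = v"
proof -
 have "((%b. b) has_derivative F 0) (at 0)" using R_pos by (intro has_derivative_transform_within_open[OF F_der[of 0], of "ball 0 R"])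
   (auto simp: gsimps \<k>_\<pi> \<pi>_0)
 from has_derivative_unique[OF this has_derivative_ident] show ?thesis by simp
qed

lemma continuous_on_F: "continuous_on (ball 0 R) (%a. F a v)"
proof (rule continuous_on_subset[OF lipschitz_on_continuous_on])
 show "(L * norm v)-lipschitz_on (ball 0 R) (%a. F a v)" using F_lip radii by (intro lipschitz_onI) (auto simp: dist_norm mult_ac)
qed simp

text \<open>The coordinate \<open>?n s\<close> of the left quotient satisfies
  \<open>F (y t) (?n s) = y s - y t\<close> up to smaller order, and \<open>F (y t)\<close> has an
  inverse bounded by 2; this determines the velocity of \<open>?n\<close>.\<close>

lemma chart_logder:
 assumes y: "(y has_vector_derivative F (y t) w) (at t within S)" and "norm (y t) < r"
 shows "logder (%s. \<pi> (y s)) S t w" unfolding logder_def germ_iff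
proof (intro conjI allI impI)
 let ?n = "%s. \<k> (inv (\<pi> (y t)) \<otimes> \<pi> (y s))"
 show "inv (\<pi> (y t)) \<otimes> \<pi> (y t) = \<one>" by (simp add: gsimps)
 have yr: "\<forall>\<^sub>F s in at t within S. norm (y s) < r"
 proof -
  have "(y ---> y t) (at t within S)" using has_vector_derivative_continuous[OF y] by (simp add: continuous_within)
  thus ?thesis using assms(2) order_tendstoD(2) tendsto_norm by blast
 qed
 thus "\<forall>\<^sub>F s in at t within S. inv (\<pi> (y t)) \<otimes> \<pi> (y s) : U R" by eventually_elim (use div_le(2) assms(2) in blast)
 have aR: "norm (y t) < R" using assms(2) radii by simp
 interpret F: bounded_linear "F (y t)" using F_der[OF aR] by (rule has_derivative_bounded_linear)
 fix e :: real assume "e > 0"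
 define p where "p = 2 * (norm (F (y t) w) + 1) + 1"
 define e1 where "e1 = e / 2 / p"
 have pos: "p > 0" unfolding p_def by (intro add_nonneg_pos mult_nonneg_nonneg add_nonneg_nonneg norm_ge_zero zero_le_numeral zero_le_one zero_less_one)
 have e1: "e1 > 0" using \<open>e > 0\<close> pos by (simp add: e1_def)
 obtain d where d: "d > 0" "!!b. norm b < d ==> norm (\<k> (\<pi> (y t) \<otimes> \<pi> b) - y t - F (y t) b) <= e1 * norm b"
 proof -
  have "\<k> (\<pi> (y t) \<otimes> \<pi> 0) = y t" by (simp add: \<pi>_0 gsimps \<k>_\<pi> aR)
  thus thesis using F_der[OF aR, unfolded has_derivative_at_alt, THEN conjunct2, rule_format, OF e1] that by auto
 qed
 have "\<forall>\<^sub>F s in at t within S. norm (y s - y t - (s - t) *R F (y t) w) <= e1 * abs (s - t)"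
  "\<forall>\<^sub>F s in at t within S. norm (y s - y t - (s - t) *R F (y t) w) <= 1 * abs (s - t)"
  using y e1 zero_less_one unfolding has_vector_derivative_iff_eventually by blast+
 moreover have "\<forall>\<^sub>F s in at t within S. norm (y s - y t) < d / 2"
  using has_vector_derivative_continuous[OF y] d(1) tendstoD[of y "y t" "at t within S" "d / 2"] by (simp add: continuous_within dist_norm)
 ultimately show "\<forall>\<^sub>F s in at t within S. norm (?n s - (s - t) *R w) <= e * abs (s - t)" using yr
 proof eventually_elim
  case (elim s)
  have n1: "norm (?n s) <= 2 * norm (y s - y t)" and nU: "inv (\<pi> (y t)) \<otimes> \<pi> (y s) : U R" using div_le assms(2) elim(4) by auto
  have ysR: "norm (y s) < R" using elim(4) radii by simp
  have "norm (?n s) < d" using n1 elim(3) by simp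
  from d(2)[OF this] have a: "norm (y s - y t - F (y t) (?n s)) <= e1 * norm (?n s)" using U_D[OF nU] by (simp add: gsimps \<k>_\<pi> ysR)
  have b: "norm (y s - y t) <= (norm (F (y t) w) + 1) * abs (s - t)"
  proof -
   have "norm ((s - t) *R F (y t) w) = norm (F (y t) w) * abs (s - t)" by simp
   thus ?thesis using elim(2) norm_triangle_sub[of "y s - y t" "(s - t) *R F (y t) w"] unfolding distrib_right by linarith
  qed
  have "F (y t) (?n s - (s - t) *R w) = (y s - y t - (s - t) *R F (y t) w) - (y s - y t - F (y t) (?n s))" by (simp add: F.diff F.scaleR)
  hence "norm (F (y t) (?n s - (s - t) *R w)) <= e1 * abs (s - t) + e1 * norm (?n s)"
   by (simp only:) (rule order_trans[OF norm_triangle_ineq4 add_mono[OF elim(1) a]])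
  also have "... <= e1 * abs (s - t) + e1 * (2 * ((norm (F (y t) w) + 1) * abs (s - t)))" using e1 n1 b by (intro add_left_mono mult_left_mono) auto
  also have "... = e1 * p * abs (s - t)" by (simp add: p_def algebra_simps)
  also have "... = e / 2 * abs (s - t)" using pos by (simp add: e1_def)
  finally have "norm (F (y t) (?n s - (s - t) *R w)) <= e / 2 * abs (s - t)" .
  with F_bounds(2)[OF aR, of "?n s - (s - t) *R w"] show ?case by simp
 qed
qed

lemma chart_left_lip:
 assumes "!!s t. s : S ==> t : S ==> norm (y t - y s) <= K * abs (s - t)" "!!s. s : S ==> norm (y s) < r"
 shows "left_lip S (%s. \<pi> (y s))"
proof (rule left_lipI[of "2 * abs K" 1])
 fix s t assume st: "s : S" "t : S" "abs (s - t) < 1"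
 have "\<n> (inv (\<pi> (y s)) \<otimes> \<pi> (y t)) <= 2 * norm (y t - y s)" "inv (\<pi> (y s)) \<otimes> \<pi> (y t) : U R"
  using div_le assms(2) st by blast+
 moreover have "norm (y t - y s) <= abs K * abs (s - t)" using assms(1)[OF st(1,2)] by (smt (verit) abs_ge_zero abs_ge_self mult_right_mono)
 ultimately show "inv (\<pi> (y s)) \<otimes> \<pi> (y t) : U R &
   \<n> (inv (\<pi> (y s)) \<otimes> \<pi> (y t)) <= 2 * abs K * abs (s - t)" by simp
qed simp_all

lemma logder_chart:
 assumes "logder \<c> S t v" "inv x \<otimes> \<c> t : U r"
 shows "((%s. \<k> (inv x \<otimes> \<c> s)) has_vector_derivative F (\<k> (inv x \<otimes> \<c> t)) v) (at t within S)"
proof -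
 let ?a = "\<k> (inv x \<otimes> \<c> t)"
 let ?f = "%s. inv (\<c> t) \<otimes> \<c> s"
 have a: "norm ?a < r" "\<pi> ?a = inv x \<otimes> \<c> t" using U_D[OF assms(2)] radii by auto
 have g: "germ ?f S t v" using assms(1) by (simp add: logder_def)
 have f0: "\<k> (?f t) = 0" by (simp add: gsimps)
 have "((%s. \<k> (\<pi> ?a \<otimes> \<pi> (\<k> (?f s)))) has_vector_derivative F ?a v) (at t within S)"
  by (rule has_vector_derivative_chain[of "%b. \<k> (\<pi> ?a \<otimes> \<pi> b)"]) (use F_der[of ?a] a(1) radii g in "auto simp: f0 germ_def")
 thus ?thesis
 proof (rule has_vector_derivative_cong_at_within)
  have "\<forall>\<^sub>F s in at t within S. ?f s : U R" using g by (simp add: germ_def)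
  thus "\<forall>\<^sub>F s in at t within S. \<k> (\<pi> ?a \<otimes> \<pi> (\<k> (?f s))) = \<k> (inv x \<otimes> \<c> s)"
   by eventually_elim (use U_D a in "auto simp: gsimps")
 qed (use a in "simp add: f0 \<pi>_0 gsimps")
qed

text \<open>On intervals shorter than \<open>\<d>\<close> the quotient stays in the coordinate ball,
  and its coordinate is Lipschitz with derivative zero almost everywhere; connectedness of the
  interval does the rest.\<close>

lemma left_lip_constant:
 assumes lip: "left_lip {0..T} \<c>" and ae: "ae {0..T} (%t. logder \<c> {0..T} t 0)"
  and t: "t : {0..T}"
 shows "\<c> t = \<c> 0"
proof -
 obtain K \<d> where K: "0 <= K" "0 < \<d>" "!!s t. s : {0..T} ==> t : {0..T} ==> abs (s - t) < \<d> ==>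
   inv (\<c> s) \<otimes> \<c> t : U r & \<n> (inv (\<c> s) \<otimes> \<c> t) <= K * abs (s - t)" using left_lip_small[OF lip radii(1,2)] by blast
 have loc: "\<c> a = \<c> b" if ab: "a : {0..T}" "b : {0..T}" "a <= b" "b - a < \<d>" for a b
 proof -
  let ?y = "%s. \<k> (inv (\<c> a) \<otimes> \<c> s)"
  have "abs_cont_on a b ?y"
  proof (rule lipschitz_abs_cont_on)
   fix s t assume st: "a <= s" "s < t" "t <= b"
   have 1: "inv (\<c> a) \<otimes> \<c> s : U R" using K(3)[of a s] U_mono[OF radii(2)] st ab by auto
   have 2: "inv (\<c> s) \<otimes> \<c> t : U R" "\<n> (inv (\<c> s) \<otimes> \<c> t) <= K * abs (s - t)"
    using K(3)[of s t] U_mono[OF radii(2)] st ab by auto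
   have e: "(inv (\<c> a) \<otimes> \<c> s) \<otimes> (inv (\<c> s) \<otimes> \<c> t) = inv (\<c> a) \<otimes> \<c> t" by (simp add: gsimps)
   have "norm (?y t - ?y s) <= 2 * \<n> (inv (\<c> s) \<otimes> \<c> t)"
    using norm_mult_le(2)[of "?y s" "\<k> (inv (\<c> s) \<otimes> \<c> t)"] U_D[OF 1] U_D[OF 2(1)] by (simp add: e)
   also have "... <= 2 * K * (t - s)" using 2(2) st by simp
   finally show "norm (?y t - ?y s) <= 2 * K * (t - s)" .
  qed
  moreover have "ae {a..b} (%t. (?y has_vector_derivative 0) (at t within {a..b}))" using ae
  proof eventually_elim
   case (elim t)
   show ?case
   proof
    assume t: "t : {a..b}"
    hence "inv (\<c> a) \<otimes> \<c> t : U r" using K(3)[of a t] ab by auto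
    have "logder \<c> {a..b} t 0" using elim t ab by (auto intro: logder_subset[where S="{0..T}"])
    hence "(?y has_vector_derivative F (?y t) 0) (at t within {a..b})" by (rule logder_chart) fact
    moreover have "norm (?y t) < R" using \<open>inv (\<c> a) \<otimes> \<c> t : U r\<close> U_D radii by fastforce
    ultimately show "(?y has_vector_derivative 0) (at t within {a..b})" using linear_0[OF F_linear] by simp
   qed
  qed
  ultimately have "?y b = ?y a" using ab(3) abs_cont_zero_derivative by blast
  hence "?y b = 0" by (simp add: gsimps)
  moreover have "inv (\<c> a) \<otimes> \<c> b : U R" using K(3)[of a b] U_mono[OF radii(2)] ab by auto
  ultimately show ?thesis using \<k>_eq_0 inv_mult_eq_one_iff by blast
 qed
 show ?thesis
 proof (rule connected_local_const[of "{0..T}"])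
  show "ALL a:{0..T}. \<forall>\<^sub>F b in at a within {0..T}. \<c> a = \<c> b"
  proof
   fix a assume a: "a : {0..T}"
   show "\<forall>\<^sub>F b in at a within {0..T}. \<c> a = \<c> b" unfolding eventually_at
   proof (intro exI[of _ \<d>] conjI ballI impI)
    fix b assume "b : {0..T}" "b ~= a & dist b a < \<d>"
    thus "\<c> a = \<c> b" using loc[of a b] loc[of b a] a by (cases "a <= b") (auto simp: dist_real_def)
   qed (fact K(2))
  qed
 qed (use t in auto)
qed

text \<open>A variant that assumes no Lipschitz bound but a vanishing derivative at every point. It
  serves for the deformation parameter in \<open>lie_hom_local\<close>.\<close>

lemma logder_zero_constant:
 assumes ld: "!!t. t : {0..T} ==> logder \<c> {0..T} t 0" and t: "t : {0..T}"
 shows "\<c> t = \<c> 0"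
proof (rule connected_local_const[of "{0..T}"])
 show "ALL a:{0..T}. \<forall>\<^sub>F b in at a within {0..T}. \<c> a = \<c> b"
 proof
  fix a assume a: "a : {0..T}"
  let ?y = "%s. \<k> (inv (\<c> a) \<otimes> \<c> s)"
  have "((%s. inv (\<c> a) \<otimes> \<c> s) ---> \<one>) (at a within {0..T})" using ld[OF a] unfolding logder_def by (rule germ_tendsto)
  from eventually_in_U[OF this radii(1,2)] obtain d where d: "d > 0"
   "!!s. s : {0..T} ==> s ~= a ==> dist s a < d ==> inv (\<c> a) \<otimes> \<c> s : U r" unfolding eventually_at by blast
  have d': "inv (\<c> a) \<otimes> \<c> s : U r" if "s : {0..T} Int ball a d" for s
   using d(2)[of s] that radii by (cases "s = a") (auto simp: dist_commute gsimps)
  have "?y b = ?y a" if b: "b : {0..T} Int ball a d" for b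
  proof (rule has_derivative_zero_unique[of "{0..T} Int ball a d" ?y])
   show "convex ({0..T} Int ball a d)" by (auto intro!: convex_Int)
   fix s assume s: "s : {0..T} Int ball a d"
   have "logder \<c> ({0..T} Int ball a d) s 0" using ld[of s] s by (auto intro: logder_subset[where S="{0..T}"])
   hence "(?y has_vector_derivative F (?y s) 0) (at s within {0..T} Int ball a d)" by (rule logder_chart) (rule d'[OF s])
   moreover have "norm (?y s) < R" using d'[OF s] U_D radii by fastforce
   ultimately show "(?y has_derivative (%h. 0)) (at s within {0..T} Int ball a d)"
    using linear_0[OF F_linear] by (simp add: has_vector_derivative_def)
  qed (use a b d in auto)
  hence eq: "\<c> a = \<c> b" if "b : {0..T} Int ball a d" for b
   using that \<k>_eq_0[of "inv (\<c> a) \<otimes> \<c> b"] d'[OF that] U_mono[OF radii(2)] inv_mult_eq_one_iff[of "\<c> a" "\<c> b"]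
   by (auto simp: gsimps)
  thus "\<forall>\<^sub>F b in at a within {0..T}. \<c> a = \<c> b"
   unfolding eventually_at using d(1) by (intro exI[of _ d]) (auto simp: dist_commute)
 qed
qed (use t in auto)

text \<open>Solutions are taken in the class \<open>left_lip\<close>, which is closed under products
  and inverses; that this loses nothing against merely absolutely continuous curves is the content
  of \<open>solves_unique\<close>.\<close>

definition sol :: "real => (real => 'e) => (real => 'g) => bool" where
 "sol T u \<c> <-> left_lip {0..T} \<c> & \<c> 0 = \<one> &
   (AE t in lebesgue. t : {0..T} --> logder \<c> {0..T} t (u t))"

text \<open>The curve \<open>\<c> t \<otimes> inv (\<c>' t)\<close> has logarithmic derivative
  \<open>Ad (\<c>' t) (u t) - Ad (\<c>' t) (u t)\<close>.\<close>

lemma sol_unique: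
 assumes "sol T u \<c>" "sol T u \<c>'" "t : {0..T}"
 shows "\<c> t = \<c>' t"
proof -
 have "\<c> t \<otimes> inv (\<c>' t) = \<c> 0 \<otimes> inv (\<c>' 0)"
 proof (rule left_lip_constant[of T "%t. \<c> t \<otimes> inv (\<c>' t)", OF _ _ assms(3)])
  show "left_lip {0..T} (%t. \<c> t \<otimes> inv (\<c>' t))" using assms unfolding sol_def by (intro left_lip_mult left_lip_inv) auto
  have "ae {0..T} (%t. logder \<c> {0..T} t (u t))"
   "ae {0..T} (%t. logder \<c>' {0..T} t (u t))" using assms unfolding sol_def by auto
  thus "ae {0..T} (%t. logder (%t. \<c> t \<otimes> inv (\<c>' t)) {0..T} t 0)"
  proof eventually_elim
   case (elim t)
   show ?case
   proof
    assume "t : {0..T}"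
    with elim have "logder (%t. \<c> t \<otimes> inv (\<c>' t)) {0..T} t
     (Ad (inv (inv (\<c>' t))) (u t) + (- Ad (\<c>' t) (u t)))" by (intro logder_mult logder_inv) auto
    thus "logder (%t. \<c> t \<otimes> inv (\<c>' t)) {0..T} t 0" by (simp add: gsimps)
   qed
  qed
 qed
 hence "\<c> t \<otimes> inv (\<c>' t) = \<one>" using assms by (simp add: sol_def gsimps)
 thus ?thesis by (metis gsimps(1,2,4,3))
qed

end

section \<open>Local existence of flows\<close>

lemma AE_lebesgue_affine:
 fixes P :: "real => bool"
 assumes "AE t in lebesgue. P t" "c ~= 0"
 shows "AE t in lebesgue. P (a + c * t)"
proof -
 have "negligible ((%x. (x - a) / c) ` {t. ~ P t})" using assms(1) unfolding AE_lebesgue_iff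
  by (rule negligible_differentiable_image_negligible[OF order_refl])
   (auto simp: differentiable_on_def intro!: derivative_intros simp: assms(2))
 moreover have "{t. ~ P (a + c * t)} \<subseteq> (%x. (x - a) / c) ` {t. ~ P t}"
 proof
  fix t assume t: "t : {t. ~ P (a + c * t)}"
  have "t = ((a + c * t) - a) / c" using assms(2) by simp
  with t show "t : (%x. (x - a) / c) ` {t. ~ P t}" by blast
 qed
 ultimately show ?thesis unfolding AE_lebesgue_iff by (rule negligible_subset)
qed

lemma measurable_lebesgue_affine:
 fixes u :: "real => 'e::euclidean_space"
 assumes "u : borel_measurable lebesgue" "c ~= 0"
 shows "(%t. u (a + c * t)) : borel_measurable lebesgue"
proof -
 have "(%x::real. a + (SUM j:Basis. (c * (x \<bullet> j)) *R j)) : lebesgue \<rightarrow>\<^sub>M lebesgue"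
  by (rule lebesgue_affine_measurable) (use assms in auto)
 hence "(%x::real. a + c * x) : lebesgue \<rightarrow>\<^sub>M lebesgue" by simp
 from measurable_compose[OF this assms(1)] show ?thesis .
qed

text \<open>Bounds are required on every interval \<open>{0..T}\<close>, so that concatenation,
  restarting and stretching of time do not leave the class.\<close>

definition ctrl :: "(real => 'e::euclidean_space) => bool" where
 "ctrl u <-> u : borel_measurable lebesgue &
   (ALL T. EX C. AE t in lebesgue. t : {0..T} --> norm (u t) <= C)"

lemma ctrlI:
 assumes "u : borel_measurable lebesgue"
  "!!T. EX C. ae {0..T} (%t. norm (u t) <= C)"
 shows "ctrl u" using assms by (auto simp: ctrl_def)

lemma ctrl_measurable [measurable_dest]: "ctrl u ==> u : borel_measurable lebesgue" by (simp add: ctrl_def)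

lemma ctrlE:
 assumes "ctrl u"
 obtains C where "0 <= C" "ae {0..T} (%t. norm (u t) <= C)"
proof -
 obtain C where "ae {0..T} (%t. norm (u t) <= C)" using assms by (auto simp: ctrl_def)
 hence "ae {0..T} (%t. norm (u t) <= max C 0)" by eventually_elim auto
 thus thesis by (rule that[rotated]) simp
qed

lemma ctrl_bounded:
 assumes "u : borel_measurable lebesgue" "!!t. norm (u t) <= C"
 shows "ctrl u" by (rule ctrlI[OF assms(1)]) (use assms(2) in auto)

lemma ctrl_const [simp]: "ctrl (%t. v)" by (rule ctrl_bounded[of _ "norm v"]) auto

lemma ctrl_add: "ctrl u ==> ctrl v ==> ctrl (%t. u t + v t)"
proof (rule ctrlI)
 fix T assume u: "ctrl u" and v: "ctrl v"
 obtain C where "ae {0..T} (%t. norm (u t) <= C)" using u by (rule ctrlE)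
 moreover obtain D where "ae {0..T} (%t. norm (v t) <= D)" using v by (rule ctrlE)
 ultimately have "ae {0..T} (%t. norm (u t + v t) <= C + D)" by eventually_elim (auto intro: norm_triangle_mono)
 thus "EX C. ae {0..T} (%t. norm (u t + v t) <= C)" by blast
qed auto

text \<open>Covers the time-dependent linear substitutions made later: \<open>Ad (flow u t)\<close>,
  \<open>F (y t)\<close> and \<open>\<Omega> (y t)\<close>.\<close>

lemma ctrl_linear_image:
 assumes lin: "!!t. linear (P t)" and cont: "!!i. i : Basis ==> continuous_on UNIV (%t. P t i)" and u: "ctrl u"
 shows "ctrl (%t. P t (u t) :: 'f::euclidean_space)"
proof (rule ctrlI)
 have eq: "P t (u t) = (SUM i:Basis. (u t \<bullet> i) *R P t i)" for t by (subst euclidean_representation[of "u t", symmetric])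
   (simp only: linear_sum[OF lin] linear_scale[OF lin])
 have "(%t. P t i) : borel_measurable lebesgue" if "i : Basis" for i
  using borel_measurable_continuous_onI[OF cont[OF that]] by (simp add: measurable_completion)
 thus "(%t. P t (u t)) : borel_measurable lebesgue" unfolding eq using u
  by (intro borel_measurable_sum borel_measurable_scaleR borel_measurable_inner) (auto simp: ctrl_def)
 fix T :: real
 obtain C where C: "0 <= C" "ae {0..T} (%t. norm (u t) <= C)" using u by (rule ctrlE)
 have "EX B. ALL t:{0..T}. norm (P t i) <= B" if "i : Basis" for i
 proof -
  have "compact ((%t. P t i) ` {0..T})" by (intro compact_continuous_image continuous_on_subset[OF cont[OF that]]) auto
  thus ?thesis using compact_imp_bounded bounded_iff by (metis imageI)
 qed
 then obtain B where B: "!!i t. i : Basis ==> t : {0..T} ==> norm (P t i) <= B i" by metis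
 have "ae {0..T} (%t. norm (P t (u t)) <= (SUM i:(Basis::'a set). C * B i))" using C(2)
 proof eventually_elim
  case (elim t)
  show ?case
  proof
   assume t: "t : {0..T}"
   show "norm (P t (u t)) <= (SUM i:(Basis::'a set). C * B i)" unfolding eq
   proof (intro order_trans[OF norm_sum] sum_mono)
    fix i :: 'a assume i: "i : Basis"
    have "abs (u t \<bullet> i) <= C" using Basis_le_norm[OF i, of "u t"] elim t by auto
    thus "norm ((u t \<bullet> i) *R P t i) <= C * B i" unfolding norm_scaleR using B[OF i t] C(1) by (intro mult_mono) auto
   qed
  qed
 qed
 thus "EX C. ae {0..T} (%t. norm (P t (u t)) <= C)" by blast
qed

lemma ctrl_linear: "linear f ==> ctrl u ==> ctrl (%t. f (u t) :: 'f::euclidean_space)" by (rule ctrl_linear_image) auto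

lemma ctrl_scaleR: "ctrl u ==> ctrl (%t. c *R u t)" by (rule ctrl_linear[OF linear_scale_self])

lemma ctrl_diff: "ctrl u ==> ctrl v ==> ctrl (%t. u t - v t)" using ctrl_add[of u "%t. (-1) *R v t"] ctrl_scaleR[of v "-1"] by simp

lemma ctrl_affine:
 assumes u: "ctrl u" and "0 <= a" "0 < c"
 shows "ctrl (%t. u (a + c * t))"
proof (rule ctrlI)
 show "(%t. u (a + c * t)) : borel_measurable lebesgue" using u assms by (intro measurable_lebesgue_affine) (auto simp: ctrl_def)
 fix T :: real
 obtain C where "ae {0..a + c * T} (%t. norm (u t) <= C)" using u by (rule ctrlE)
 hence "AE t in lebesgue. a + c * t : {0..a + c * T} --> norm (u (a + c * t)) <= C" by (rule AE_lebesgue_affine) (use assms in simp)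
 hence "ae {0..T} (%t. norm (u (a + c * t)) <= C)" by eventually_elim (use assms in auto)
 thus "EX C. ae {0..T} (%t. norm (u (a + c * t)) <= C)" by blast
qed

text \<open>The zero extension matters: for \<open>t > S\<close> the time \<open>S - t\<close> is
  negative, where a control need not be bounded.\<close>

lemma ctrl_reverse:
 assumes u: "ctrl u"
 shows "ctrl (%t. if t <= S then u (S - t) else 0)"
proof (rule ctrlI)
 have "(%t. u (S + (-1) * t)) : borel_measurable lebesgue" using u by (intro measurable_lebesgue_affine) (auto simp: ctrl_def)
 thus "(%t. if t <= S then u (S - t) else 0) : borel_measurable lebesgue" by (intro measurable_If) auto
 fix T :: real
 obtain C where C: "0 <= C" "ae {0..S} (%t. norm (u t) <= C)" using u by (rule ctrlE)
 have "AE t in lebesgue. S + (-1) * t : {0..S} --> norm (u (S + (-1) * t)) <= C" by (rule AE_lebesgue_affine[OF C(2)]) simp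
 hence "ae {0..T} (%t. norm (if t <= S then u (S - t) else 0) <= C)" by eventually_elim (use C(1) in auto)
 thus "EX C. ae {0..T} (%t. norm (if t <= S then u (S - t) else 0) <= C)" by blast
qed

lemma ctrl_concat:
 assumes u: "ctrl u" and v: "ctrl v"
 shows "ctrl (%t. if t < S then u t else v (t - S))"
proof (rule ctrlI)
 have "(%t. v (- S + 1 * t)) : borel_measurable lebesgue" using v by (intro measurable_lebesgue_affine) (auto simp: ctrl_def)
 thus "(%t. if t < S then u t else v (t - S)) : borel_measurable lebesgue" using u by (intro measurable_If) (auto simp: ctrl_def)
 fix T :: real
 obtain C where C: "ae {0..T} (%t. norm (u t) <= C)" using u by (rule ctrlE)
 obtain D where D: "ae {0..T - S} (%t. norm (v t) <= D)" using v by (rule ctrlE)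
 have "AE t in lebesgue. - S + 1 * t : {0..T - S} --> norm (v (- S + 1 * t)) <= D" by (rule AE_lebesgue_affine[OF D]) simp
 with C have "ae {0..T} (%t. norm (if t < S then u t else v (t - S)) <= max C D)" by eventually_elim auto
 thus "EX C. ae {0..T} (%t. norm (if t < S then u t else v (t - S)) <= C)" by blast
qed

lemma ctrl_absolutely_integrable:
 assumes u: "ctrl u" and "0 <= a"
 shows "u absolutely_integrable_on {a..b}"
proof -
 obtain C where C: "0 <= C" "ae {0..b} (%t. norm (u t) <= C)" using u by (rule ctrlE)
 define v where "v t = (if norm (u t) <= C then u t else 0)" for t
 have "v : borel_measurable lebesgue" unfolding v_def using ctrl_measurable[OF u] by measurable
 hence "v absolutely_integrable_on {a..b}" using C(1) by (intro measurable_bounded_by_integrable_imp_absolutely_integrable[where g="%_. C"])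
   (auto simp: v_def measurable_restrict_space1)
 moreover have "negligible {t. ~ (t : {0..b} --> norm (u t) <= C)}" using C(2) by (simp add: AE_lebesgue_iff)
 ultimately show ?thesis by (rule absolutely_integrable_spike) (use assms(2) in "auto simp: v_def")
qed

lemma ctrl_integrable: "ctrl u ==> 0 <= a ==> u integrable_on {a..b}"
 using ctrl_absolutely_integrable[of u a b] by (simp add: absolutely_integrable_on_def)

lemma ctrl_norm_integrable: "ctrl u ==> 0 <= a ==> (%t. norm (u t)) integrable_on {a..b}"
 using ctrl_absolutely_integrable[of u a b] by (simp add: absolutely_integrable_on_def)

lemma integral_cong_AE_lebesgue:
 fixes f g :: "real => 'e::banach"
 assumes "ae S (%t. f t = g t)"
 shows "integral S f = integral S g" using assms by (intro integral_spike[of "{t. ~ (t : S --> f t = g t)}"]) (auto simp: AE_lebesgue_iff)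

lemma integral_nonneg_mono_interval:
 fixes f :: "real => real"
 assumes "f integrable_on {a..b}" "!!t. 0 <= f t" "a <= c" "d <= b"
 shows "integral {c..d} f <= integral {a..b} f" using assms by (intro integral_subset_le integrable_on_subinterval[OF assms(1)]) auto

text \<open>Picard iteration in the norm \<open>sup\<^sub>t exp (- \<lambda> t) |y t|\<close>, which makes it a contraction on the whole
  half-line.\<close>

lemma caratheodory_exists:
 fixes \<Phi> :: "'e::euclidean_space => 'e => 'e" and u :: "real => 'e"
 assumes lin: "!!a. linear (\<Phi> a)" and bd: "!!a v. norm (\<Phi> a v) <= 2 * norm v"
  and lip: "!!a b v. norm (\<Phi> a v - \<Phi> b v) <= L * norm (a - b) * norm v" and "0 <= L"
  and u: "u : borel_measurable lebesgue" "!!t. norm (u t) <= C"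
 obtains y where "continuous_on UNIV y" "!!t. 0 <= t ==> y t = integral {0..t} (%s. \<Phi> (y s) (u s))"
proof -
 have C: "0 <= C" using u(2)[of 0] by (meson norm_ge_zero order_trans)
 \<comment> \<open>The integrand has Lipschitz constant \<open>L * C\<close>, and integrating
   \<open>exp (l * s)\<close> divides by \<open>l\<close>; the contraction factor is
   \<open>L * C / l \<le> 1 / 2\<close>. The summand 1 keeps \<open>l\<close> positive.\<close>
 define l where "l = 2 * L * C + 1"
 have l: "l > 0" using \<open>0 <= L\<close> C by (simp add: l_def add_nonneg_pos)
 have \<Phi>c: "continuous_on UNIV (%a. \<Phi> a v)" for v
 proof (rule lipschitz_on_continuous_on)
  show "(L * norm v)-lipschitz_on UNIV (%a. \<Phi> a v)" using lip \<open>0 <= L\<close> by (intro lipschitz_onI) (auto simp: dist_norm mult_ac)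
 qed
 have cu: "ctrl u" using u by (rule ctrl_bounded)
 have cI: "ctrl (%s. \<Phi> (y s) (u s))" if "continuous_on UNIV y" for y
  by (rule ctrl_linear_image[OF lin _ cu]) (rule continuous_on_compose2[OF \<Phi>c that], simp)
 have bI: "norm (\<Phi> a (u t)) <= 2 * C" for a t using bd[of a "u t"] u(2)[of t] by linarith
 \<comment> \<open>\<open>Y\<close> is the rescaled unknown:
   \<open>y s = exp (l * s) *R Y s\<close>. The plain supremum distance of \<open>Y\<close> is then
   the weighted one of \<open>y\<close>.\<close>
 define I where "I Y t = integral {0..t} (%s. \<Phi> (exp (l * s) *R Y s) (u s))" for Y :: "real => 'e" and t
 have cY: "ctrl (%s. \<Phi> (exp (l * s) *R Y s) (u s))" if "continuous_on UNIV Y" for Y by (rule cI) (intro continuous_intros that)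
 have I_lip: "norm (I Y (max 0 t) - I Y (max 0 s)) <= 2 * C * abs (t - s)" if Y: "continuous_on UNIV Y" for Y s t
 proof -
  have *: "norm (I Y t - I Y s) <= 2 * C * (t - s)" if "0 <= s" "s <= t" for s t
  proof -
   have "I Y t - I Y s = integral {s..t} (%s. \<Phi> (exp (l * s) *R Y s) (u s))"
    unfolding I_def using Henstock_Kurzweil_Integration.integral_combine[OF that ctrl_integrable[OF cY[OF Y] order_refl]] by (simp add: algebra_simps)
   also have "norm ... <= 2 * C * (t - s)" using that C bI ctrl_integrable[OF cY[OF Y] that(1)] by (intro integral_norm_bound_AE) auto
   finally show ?thesis .
  qed
  have "norm (I Y (max 0 t) - I Y (max 0 s)) <= 2 * C * abs (max 0 t - max 0 s)" using *[of "max 0 s" "max 0 t"] *[of "max 0 t" "max 0 s"]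
   by (cases "max 0 s <= max 0 t") (auto simp: norm_minus_commute abs_if)
  also have "... <= 2 * C * abs (t - s)" using C by (intro mult_left_mono) auto
  finally show ?thesis .
 qed
 have I_cont: "continuous_on UNIV (%t. I Y (max 0 t))" if "continuous_on UNIV Y" for Y by (rule lipschitz_on_continuous_on[of "2 * C"])
   (use I_lip[OF that] C in "auto intro!: lipschitz_onI simp: dist_norm")
 have I_0: "I Y 0 = 0" for Y by (simp add: I_def)
 \<comment> \<open>\<open>max 0 t\<close> extends the curves constantly to negative times, which
   makes them bounded continuous functions on the whole line, a complete space.\<close>
 define \<Psi> where "\<Psi> Y t = exp (- l * max 0 t) *R I (apply_bcontfun Y) (max 0 t)" for Y :: "real \<Rightarrow>\<^sub>C 'e" and t
 have \<Psi>_cont: "\<Psi> Y : bcontfun" for Y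
 proof (rule bcontfun_normI[where b="2 * C / l"])
  show "continuous_on UNIV (\<Psi> Y)" unfolding \<Psi>_def[abs_def] by (intro continuous_intros I_cont) auto
  fix t
  have "norm (I Y (max 0 t)) <= 2 * C * max 0 t" using I_lip[of "apply_bcontfun Y" t 0] by (auto simp: I_0 max_def)
  hence "norm (\<Psi> Y t) <= exp (- l * max 0 t) * (2 * C * max 0 t)" by (simp add: \<Psi>_def mult_left_mono)
  also have "... <= 2 * C / l"
  proof -
   have "l * max 0 t <= exp (l * max 0 t)" using exp_ge_add_one_self[of "l * max 0 t"] by linarith
   hence "exp (- l * max 0 t) * (l * max 0 t) <= 1" by (simp add: exp_minus field_simps)
   hence "2 * C * (exp (- l * max 0 t) * (l * max 0 t)) <= 2 * C * 1" using C by (intro mult_left_mono) auto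
   thus ?thesis using l by (simp add: field_simps)
  qed
  finally show "norm (\<Psi> Y t) <= 2 * C / l" .
 qed
 define \<Psi>' where "\<Psi>' Y = Bcontfun (\<Psi> Y)" for Y
 have ap: "apply_bcontfun (\<Psi>' Y) = \<Psi> Y" for Y unfolding \<Psi>'_def using \<Psi>_cont by (rule Bcontfun_inverse)
 have contr: "dist (\<Psi>' Y) (\<Psi>' Z) <= 1/2 * dist Y Z" for Y Z
 proof (rule dist_bound)
  fix t :: real
  define d where "d = dist Y Z"
  have d: "0 <= d" and d_norm: "d = norm (Y - Z)" by (simp_all add: d_def dist_norm)
  define \<tau> where "\<tau> = max 0 t"
  have \<tau>: "0 <= \<tau>" by (simp add: \<tau>_def)
  let ?f = "%Y s. \<Phi> (exp (l * s) *R apply_bcontfun Y s) (u s)"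
  have int: "?f Y integrable_on {0..\<tau>}" for Y by (rule ctrl_integrable[OF cY]) auto
  have ei: "((%s. L * C * d * exp (l * s)) has_integral (L * C * d * exp (l * \<tau>) / l - L * C * d * exp (l * 0) / l)) {0..\<tau>}"
   using \<tau> l by (intro fundamental_theorem_of_calculus)
    (auto intro!: derivative_eq_intros simp: has_real_derivative_iff_has_vector_derivative[symmetric])
  have "norm (integral {0..\<tau>} (%s. ?f Y s - ?f Z s)) <= integral {0..\<tau>} (%s. L * C * d * exp (l * s))"
  proof (rule Henstock_Kurzweil_Integration.integral_norm_bound_integral)
   show "(%s. ?f Y s - ?f Z s) integrable_on {0..\<tau>}" by (intro integrable_diff int)
   show "(%s. L * C * d * exp (l * s)) integrable_on {0..\<tau>}" using ei by blast
   fix s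
   have "norm (exp (l * s) *R apply_bcontfun Y s - exp (l * s) *R apply_bcontfun Z s) <= exp (l * s) * d"
    using dist_bounded[of Y s Z] by (simp add: d_def dist_norm scaleR_diff_right[symmetric])
   hence "norm (?f Y s - ?f Z s) <= L * (exp (l * s) * d) * C" using \<open>0 <= L\<close> u(2)[of s] d C
    by (intro order_trans[OF lip] mult_mono) auto
   thus "norm (?f Y s - ?f Z s) <= L * C * d * exp (l * s)" by (simp add: mult_ac)
  qed
  also have "... <= L * C * d * exp (l * \<tau>) / l" using integral_unique[OF ei] \<open>0 <= L\<close> C d l by simp
  also have "... <= 1/2 * d * exp (l * \<tau>)"
  proof -
   have "L * C / l <= 1/2" using l by (simp add: l_def field_simps)
   hence "L * C / l * (d * exp (l * \<tau>)) <= 1/2 * (d * exp (l * \<tau>))" using d by (intro mult_right_mono) auto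
   thus ?thesis by (simp add: mult_ac)
  qed
  finally have "norm (I Y \<tau> - I Z \<tau>) <= 1/2 * d * exp (l * \<tau>)" unfolding I_def using int by (simp add: integral_diff)
  hence "exp (- l * \<tau>) * norm (I Y \<tau> - I Z \<tau>) <= exp (- l * \<tau>) * (1/2 * d * exp (l * \<tau>))" by (intro mult_left_mono) auto
  also have "... = 1/2 * d" by (simp add: exp_minus)
  finally show "dist (apply_bcontfun (\<Psi>' Y) t) (apply_bcontfun (\<Psi>' Z) t) <= 1/2 * dist Y Z"
   by (simp add: ap \<Psi>_def dist_norm \<tau>_def[symmetric] d_norm[symmetric] scaleR_diff_right[symmetric])
 qed
 obtain Y where Y: "\<Psi>' Y = Y" using banach_fix_type[of "1/2" \<Psi>'] contr by auto
 define y where "y t = exp (l * max 0 t) *R apply_bcontfun Y (max 0 t)" for t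
 show thesis
 proof (rule that[of y])
  have "continuous_on UNIV (%t. apply_bcontfun Y (max 0 t))"
   by (rule continuous_on_compose2[OF continuous_on_apply_bcontfun[of UNIV]]) (auto intro!: continuous_intros)
  thus "continuous_on UNIV y" unfolding y_def[abs_def] by (intro continuous_intros)
  fix t :: real assume t: "0 <= t"
  have "apply_bcontfun Y t = \<Psi> Y t" using ap[of Y] Y by simp
  hence "y t = I Y t" using t by (simp add: y_def \<Psi>_def exp_minus)
  also have "... = integral {0..t} (%s. \<Phi> (y s) (u s))" unfolding I_def by (rule integral_cong) (simp add: y_def)
  finally show "y t = integral {0..t} (%s. \<Phi> (y s) (u s))" .
 qed
qed

section \<open>The flow of a bounded control\<close>

context local_lie
begin

lemma logder_affine:
 assumes ld: "logder \<c> S (a + c * t) v" and S': "!!\<tau>. \<tau> : S' ==> a + c * \<tau> : S" and "c ~= 0"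
 shows "logder (%\<tau>. \<c> (a + c * \<tau>)) S' t (c *R v)" unfolding logder_def germ_iff
proof (intro conjI allI impI)
 have lim: "filterlim (%\<tau>. a + c * \<tau>) (at (a + c * t) within S) (at t within S')" unfolding filterlim_at
 proof
  show "\<forall>\<^sub>F x in at t within S'. a + c * x : S & a + c * x ~= a + c * t"
   using S' \<open>c ~= 0\<close> unfolding eventually_at by (intro exI[of _ 1]) auto
  show "((%\<tau>. a + c * \<tau>) ---> a + c * t) (at t within S')" by (intro tendsto_intros)
 qed
 show "inv (\<c> (a + c * t)) \<otimes> \<c> (a + c * t) = \<one>" by (simp add: gsimps)
 show "\<forall>\<^sub>F s in at t within S'. inv (\<c> (a + c * t)) \<otimes> \<c> (a + c * s) : U R"
  using ld[unfolded logder_def germ_iff, THEN conjunct2, THEN conjunct1] by (rule eventually_compose_filterlim[OF _ lim])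
 fix e :: real assume "e > 0"
 hence "e / abs c > 0" using \<open>c ~= 0\<close> by simp
 hence "\<forall>\<^sub>F s in at (a + c * t) within S.
   norm (\<k> (inv (\<c> (a + c * t)) \<otimes> \<c> s) - (s - (a + c * t)) *R v) <= e / abs c * abs (s - (a + c * t))"
  using ld unfolding logder_def germ_iff by blast
 from eventually_compose_filterlim[OF this lim]
 show "\<forall>\<^sub>F s in at t within S'. norm (\<k> (inv (\<c> (a + c * t)) \<otimes> \<c> (a + c * s)) - (s - t) *R c *R v) <= e * abs (s - t)"
 proof eventually_elim
  case (elim s)
  have 1: "a + c * s - (a + c * t) = (s - t) * c" by (simp add: algebra_simps)
  have 2: "e / abs c * abs ((s - t) * c) = e * abs (s - t)" using \<open>c ~= 0\<close> by (simp add: abs_mult)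
  show ?case using elim unfolding 1 2 scaleR_scaleR .
 qed
qed

lemma left_lip_comp:
 assumes lip: "left_lip S \<c>" and f: "!!t. t : S' ==> f t : S" "!!s t. abs (f s - f t) <= c * abs (s - t)" and "0 < c"
 shows "left_lip S' (%t. \<c> (f t))"
proof -
 obtain K \<d> where K: "0 <= K" "0 < \<d>" "!!s t. s : S ==> t : S ==> abs (s - t) < \<d> ==>
   inv (\<c> s) \<otimes> \<c> t : U R & \<n> (inv (\<c> s) \<otimes> \<c> t) <= K * abs (s - t)"
  using left_lip_small[OF lip R_pos order_refl] by blast
 show ?thesis
 proof (rule left_lipI[of "K * c" "\<d> / c"])
  fix s t assume st: "s : S'" "t : S'" "abs (s - t) < \<d> / c"
  hence "abs (f s - f t) < \<d>" using f(2)[of s t] \<open>0 < c\<close> by (simp add: field_simps)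
  thus "inv (\<c> (f s)) \<otimes> \<c> (f t) : U R & \<n> (inv (\<c> (f s)) \<otimes> \<c> (f t)) <= K * c * abs (s - t)"
   using K(3)[OF f(1)[OF st(1)] f(1)[OF st(2)]] mult_left_mono[OF f(2) K(1), of s t] by (simp add: mult.assoc)
 qed (use K \<open>0 < c\<close> in auto)
qed

lemma logder_local:
 assumes ld: "logder \<c> S t v" and O: "open O'" "t : O'" "S' Int O' \<subseteq> S"
  and eq: "!!s. s : S' Int O' ==> \<c>' s = \<c> s" "\<c>' t = \<c> t"
 shows "logder \<c>' S' t v"
proof -
 have at: "at t within S' = at t within (S' Int O')" by (rule at_within_nhd[OF O(2,1)]) auto
 have "germ (%s. inv (\<c> t) \<otimes> \<c> s) (S' Int O') t v" using ld O(3) unfolding logder_def by (rule germ_subset)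
 hence "germ (%s. inv (\<c>' t) \<otimes> \<c>' s) (S' Int O') t v" by (rule germ_cong) (auto simp: eventually_at eq gsimps intro!: exI[of _ 1])
 thus ?thesis unfolding logder_def germ_def at .
qed

lemma sol_cong:
 assumes "sol T u \<c>" "!!t. t : {0..T} ==> \<c>' t = \<c> t" "\<c>' 0 = \<c> 0"
  "ae {0..T} (%t. u t = v t)"
 shows "sol T v \<c>'" unfolding sol_def
proof (intro conjI)
 show "left_lip {0..T} \<c>'" using assms(1,2) by (simp add: sol_def left_lip_def)
 have "ae {0..T} (%t. logder \<c> {0..T} t (u t))" using assms(1) by (simp add: sol_def)
 with assms(4) show "ae {0..T} (%t. logder \<c>' {0..T} t (v t))"
 proof eventually_elim
  case (elim t)
  show ?case
  proof
   assume "t : {0..T}"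
   with elim have "logder \<c> {0..T} t (v t)" by simp
   thus "logder \<c>' {0..T} t (v t)" by (rule logder_local[of _ _ _ _ UNIV]) (use assms(2) \<open>t : {0..T}\<close> in auto)
  qed
 qed
 show "\<c>' 0 = \<one>" using assms by (simp add: sol_def)
qed

text \<open>\<open>c\<close> may be negative: \<open>c = -1\<close> with \<open>a = T\<close> is
  time reversal, \<open>c = 1\<close> restarts the solution at time \<open>a\<close>.\<close>

lemma sol_affine:
 assumes s: "sol T u \<c>" and c: "c ~= 0" "!!t. t : {0..T'} ==> a + c * t : {0..T}"
 shows "sol T' (%t. c *R u (a + c * t)) (%t. inv (\<c> a) \<otimes> \<c> (a + c * t))" unfolding sol_def
proof (intro conjI)
 show "left_lip {0..T'} (%t. inv (\<c> a) \<otimes> \<c> (a + c * t))" unfolding left_lip_translate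
 proof (rule left_lip_comp[of "{0..T}" _ _ _ "abs c"])
  show "abs ((a + c * s) - (a + c * t)) <= abs c * abs (s - t)" for s t by (simp add: abs_mult[symmetric] algebra_simps)
 qed (use s c in "auto simp: sol_def")
 have "ae {0..T} (%t. logder \<c> {0..T} t (u t))" using s by (simp add: sol_def)
 hence "AE t in lebesgue. a + c * t : {0..T} --> logder \<c> {0..T} (a + c * t) (u (a + c * t))" using c(1) by (rule AE_lebesgue_affine)
 thus "ae {0..T'} (%t. logder (%t. inv (\<c> a) \<otimes> \<c> (a + c * t)) {0..T'} t (c *R u (a + c * t)))"
 proof eventually_elim
  case (elim t)
  show ?case unfolding logder_translate using elim c by (auto intro!: logder_affine[where S="{0..T}"])
 qed
qed (simp add: gsimps)

lemma sol_subinterval: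
 assumes s: "sol T u \<c>" and "T' <= T"
 shows "sol T' u \<c>"
proof -
 have "sol T' (%t. 1 *R u (0 + 1 * t)) (%t. inv (\<c> 0) \<otimes> \<c> (0 + 1 * t))" using s by (rule sol_affine) (use assms(2) in auto)
 thus ?thesis using s by (simp add: sol_def gsimps)
qed

lemma sol_concat:
 assumes s: "sol T u \<c>" and s': "sol T' u' \<c>'" and T: "0 <= T" "0 <= T'"
 shows "sol (T + T') (%t. if t < T then u t else u' (t - T)) (%t. if t <= T then \<c> t else \<c> T \<otimes> \<c>' (t - T))"
  (is "sol _ ?u ?\<c>") unfolding sol_def
proof (intro conjI)
 have g0: "\<c> 0 = \<one>" "\<c>' 0 = \<one>" using s s' by (auto simp: sol_def)
 thus "?\<c> 0 = \<one>" using T by simp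
 \<comment> \<open>Clamping the times writes the concatenation as a product of two curves defined on
   the whole interval, so that \<open>left_lip_mult\<close> applies.\<close>
 have eq: "?\<c> = (%t. \<c> (min t T) \<otimes> \<c>' (max (t - T) 0))" by (auto simp: fun_eq_iff g0 min_def max_def gsimps)
 show "left_lip {0..T + T'} ?\<c>" unfolding eq by (rule left_lip_mult[OF left_lip_comp[of "{0..T}" _ _ _ 1] left_lip_comp[of "{0..T'}" _ _ _ 1]])
   (use s s' T in "auto simp: sol_def min_def max_def")
 have 1: "ae {0..T} (%t. logder \<c> {0..T} t (u t))" using s by (simp add: sol_def)
 have "ae {0..T'} (%t. logder \<c>' {0..T'} t (u' t))" using s' by (simp add: sol_def)
 from AE_lebesgue_affine[OF this, of 1 "- T"]
 have 2: "AE t in lebesgue. - T + 1 * t : {0..T'} --> logder \<c>' {0..T'} (- T + 1 * t) (u' (- T + 1 * t))" by simp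
 have "AE t in lebesgue. t ~= T" by (simp add: AE_lebesgue_iff)
 with 1 2 show "ae {0..T + T'} (%t. logder ?\<c> {0..T + T'} t (?u t))"
 proof eventually_elim
  case (elim t)
  show ?case
  proof
   assume t: "t : {0..T + T'}"
   consider "t < T" | "T < t" using elim(3) by linarith
   thus "logder ?\<c> {0..T + T'} t (?u t)"
   proof cases
    case 1
    hence "logder \<c> {0..T} t (u t)" using elim(1) t by simp
    hence "logder ?\<c> {0..T + T'} t (u t)" by (rule logder_local[where O'="{..<T}"]) (use 1 in auto)
    thus ?thesis using 1 by simp
   next
    case 2
    hence "logder \<c>' {0..T'} (- T + 1 * t) (u' (- T + 1 * t))" using elim(2) t by simp
    hence "logder (%t. \<c>' (- T + 1 * t)) {T..T + T'} t (1 *R u' (- T + 1 * t))" by (rule logder_affine) auto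
    hence "logder (%t. \<c> T \<otimes> \<c>' (- T + 1 * t)) {T..T + T'} t (1 *R u' (- T + 1 * t))" by (simp only: logder_translate)
    hence "logder ?\<c> {0..T + T'} t (1 *R u' (- T + 1 * t))" by (rule logder_local[where O'="{T<..}"]) (use 2 in auto)
    thus ?thesis using 2 by simp
   qed
  qed
 qed
qed

text \<open>Turns an almost-everywhere bound into the pointwise bound that
  \<open>caratheodory_exists\<close> needs, changing \<open>u\<close> on \<open>{0..T}\<close> only
  in a null set.\<close>

definition clamp_u :: "real => real => (real => 'e) => real => 'e" where
 "clamp_u T C u t = (if t : {0..T} & norm (u t) <= C then u t else 0)"

text \<open>The last claim is differentiability at the zero control with a quadratic remainder:
  \<open>F (y s)\<close> differs from \<open>F 0\<close>, the identity, by at most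
  \<open>L * norm (y s)\<close>, and \<open>norm (y s)\<close> is bounded by twice the L1 norm of
  the control.\<close>

lemma small_sol_exists:
 assumes u: "ctrl u" and T: "0 <= T" and small: "integral {0..T} (%t. norm (u t)) <= r / 8"
 obtains \<c> where "sol T u \<c>"
  "!!t. t : {0..T} ==> \<c> t : U r & \<n> (\<c> t) <= 2 * integral {0..T} (%t. norm (u t))"
  "norm (\<k> (\<c> T) - integral {0..T} u) <= 2 * L * (integral {0..T} (%t. norm (u t)))\<^sup>2"
proof -
 obtain C where C: "0 <= C" "ae {0..T} (%t. norm (u t) <= C)" using u by (rule ctrlE)
 define v where "v = clamp_u T C u"
 have vb: "norm (v t) <= C" for t using C(1) by (auto simp: v_def clamp_u_def)
 have vm: "v : borel_measurable lebesgue"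
 proof -
  have [measurable]: "u : borel_measurable lebesgue" "(%t::real. t) : borel_measurable lebesgue"
   using u by (auto simp: ctrl_def measurable_completion)
  show ?thesis unfolding v_def clamp_u_def[abs_def] by measurable
 qed
 have cv: "ctrl v" using vm vb by (rule ctrl_bounded)
 have uv: "ae {0..T} (%t. v t = u t)" using C(2) by eventually_elim (auto simp: v_def clamp_u_def)
 define I where "I = integral {0..T} (%t. norm (v t))"
 have I_eq: "I = integral {0..T} (%t. norm (u t))" unfolding I_def by (rule integral_cong_AE_lebesgue) (use uv in eventually_elim, auto)
 have iv: "integral {0..T} v = integral {0..T} u" using uv by (rule integral_cong_AE_lebesgue)
 have "0 <= I" unfolding I_def by (rule Henstock_Kurzweil_Integration.integral_nonneg[OF ctrl_norm_integrable[OF cv]]) auto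
 hence I: "0 <= I" "I <= r / 8" using small by (auto simp: I_eq)
 \<comment> \<open>Projection to the ball of radius \<open>r / 2\<close> makes the vector field
   global and Lipschitz. The solution satisfies \<open>norm (y t) \<le> 2 * I \<le> r / 4\<close>,
   so the projection never acts on it.\<close>
 define q where "q = closest_point (cball (0::'e) (r / 2))"
 have qin: "norm (q a) <= r / 2" for a using closest_point_in_set[of "cball (0::'e) (r / 2)" a] radii by (simp add: q_def)
 have qR: "norm (q a) < R" for a using qin[of a] radii by linarith
 have qid: "norm a <= r / 2 ==> q a = a" for a using closest_point_self[of a "cball (0::'e) (r / 2)"] by (simp add: q_def)
 have qlip: "norm (q a - q b) <= norm (a - b)" for a b
  using closest_point_lipschitz[of "cball (0::'e) (r / 2)" a b] radii by (simp add: q_def dist_norm)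
 obtain y where y: "continuous_on UNIV y" "!!t. 0 <= t ==> y t = integral {0..t} (%s. F (q (y s)) (v s))"
 proof (rule caratheodory_exists[of "%a. F (q a)" L v C])
  show "norm (F (q a) v - F (q b) v) <= L * norm (a - b) * norm v" for a b v
  proof -
   have "L * norm (q a - q b) * norm v <= L * norm (a - b) * norm v" using qlip radii(3) by (intro mult_right_mono mult_left_mono) auto
   thus ?thesis using F_lip[OF qR qR, of a v b] by linarith
  qed
 qed (use F_linear[OF qR] F_bounds(1)[OF qR] radii vb vm in auto)
 let ?f = "%s. F (q (y s)) (v s)"
 have "continuous_on UNIV (%s. F (q (y s)) i)" for i
 proof (rule continuous_on_compose2[OF continuous_on_F])
  have "continuous_on UNIV q" by (rule lipschitz_on_continuous_on[of 1]) (use qlip in "auto intro!: lipschitz_onI simp: dist_norm")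
  thus "continuous_on UNIV (%s. q (y s))" by (rule continuous_on_compose2) (use y in auto)
 qed (use qR in auto)
 hence cf: "ctrl ?f" by (rule ctrl_linear_image[OF F_linear[OF qR] _ cv])
 have fb: "norm (?f s) <= 2 * norm (v s)" for s using F_bounds(1)[OF qR] .
 have fb': "norm (?f s) <= 2 * C" for s using fb[of s] vb[of s] by linarith
 have ynorm: "norm (y t) <= 2 * I" if t: "t : {0..T}" for t
 proof -
  have "norm (y t) = norm (integral {0..t} ?f)" using y t by simp
  also have "... <= integral {0..t} (%s. 2 * norm (v s))" by (rule Henstock_Kurzweil_Integration.integral_norm_bound_integral)
    (use fb cf cv in "auto intro!: ctrl_integrable integrable_on_mult_right ctrl_norm_integrable")
  also have "... <= integral {0..T} (%s. 2 * norm (v s))"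
   using t cv by (intro integral_nonneg_mono_interval) (auto intro!: integrable_on_mult_right ctrl_norm_integrable)
  also have "... = 2 * I" by (simp add: I_def)
  finally show ?thesis .
 qed
 have yr: "norm (y t) <= r / 2" "norm (y t) < r" "q (y t) = y t" if "t : {0..T}" for t using ynorm[OF that] I radii qid[of "y t"] by auto
 have ylip: "norm (y t - y s) <= 2 * C * abs (s - t)" if "s : {0..T}" "t : {0..T}" for s t
 proof -
  have *: "norm (y t - y s) <= 2 * C * (t - s)" if "0 <= s" "s <= t" for s t
  proof -
   have "y t - y s = integral {s..t} ?f" using Henstock_Kurzweil_Integration.integral_combine[OF that ctrl_integrable[OF cf order_refl]] y that
    by (simp add: algebra_simps)
   also have "norm ... <= 2 * C * (t - s)" using that C fb' ctrl_integrable[OF cf that(1)] by (intro integral_norm_bound_AE) auto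
   finally show ?thesis .
  qed
  show ?thesis using *[of s t] *[of t s] that by (cases "s <= t") (auto simp: norm_minus_commute)
 qed
 have y0: "y 0 = 0" using y(2)[of 0] by simp
 have "sol T v (%t. \<pi> (y t))" unfolding sol_def
 proof (intro conjI)
  show "left_lip {0..T} (%t. \<pi> (y t))" using ylip yr by (intro chart_left_lip) auto
  show "\<pi> (y 0) = \<one>" by (simp add: y0 \<pi>_0)
  have "ae {0..T} (%t. ((%s. integral {0..s} ?f) has_vector_derivative ?f t) (at t within {0..T}))"
   by (intro has_vector_derivative_indefinite_integral_AE ctrl_integrable cf order_refl)
  thus "ae {0..T} (%t. logder (%t. \<pi> (y t)) {0..T} t (v t))"
  proof eventually_elim
   case (elim t)
   show ?case
   proof
    assume t: "t : {0..T}"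
    hence "(y has_vector_derivative ?f t) (at t within {0..T})"
     using elim y(2) by (intro has_vector_derivative_transform[of t _ y "%s. integral {0..s} ?f"]) auto
    thus "logder (%t. \<pi> (y t)) {0..T} t (v t)" using yr[OF t] by (intro chart_logder) auto
   qed
  qed
 qed
 hence "sol T u (%t. \<pi> (y t))" by (rule sol_cong) (use uv in auto)
 moreover have "\<pi> (y t) : U r & \<n> (\<pi> (y t)) <= 2 * integral {0..T} (%t. norm (u t))" if "t : {0..T}" for t
  using yr[OF that] ynorm[OF that] radii by (auto simp: \<k>_\<pi> I_eq[symmetric])
 moreover have "norm (\<k> (\<pi> (y T)) - integral {0..T} u) <= 2 * L * (integral {0..T} (%t. norm (u t)))\<^sup>2"
 proof -
  have TT: "T : {0..T}" using T by simp
  have "\<k> (\<pi> (y T)) - integral {0..T} u = integral {0..T} (%s. ?f s - v s)" using yr[OF TT] radii y(2)[OF T] cf cv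
   by (simp add: \<k>_\<pi> iv[symmetric] integral_diff ctrl_integrable)
  also have "norm ... <= integral {0..T} (%s. L * (2 * I) * norm (v s))"
  proof (rule Henstock_Kurzweil_Integration.integral_norm_bound_integral)
   show "(%s. ?f s - v s) integrable_on {0..T}" by (intro integrable_diff ctrl_integrable cf cv order_refl)
   show "(%s. L * (2 * I) * norm (v s)) integrable_on {0..T}" by (intro integrable_on_mult_right ctrl_norm_integrable cv order_refl)
   fix s assume s: "s : {0..T}"
   have "norm (?f s - v s) = norm (F (y s) (v s) - F 0 (v s))" by (simp add: F_0 yr[OF s])
   also have "... <= L * norm (y s - 0) * norm (v s)" using yr[OF s] radii by (intro F_lip) auto
   also have "... <= L * (2 * I) * norm (v s)" using ynorm[OF s] radii(3) by (intro mult_right_mono mult_left_mono) auto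
   finally show "norm (?f s - v s) <= L * (2 * I) * norm (v s)" .
  qed
  also have "... = 2 * L * I\<^sup>2" by (simp add: I_def power2_eq_square)
  finally show ?thesis by (simp add: I_eq)
 qed
 ultimately show thesis by (rule that)
qed

lemma sol_exists:
 assumes u: "ctrl u" and T: "0 <= T"
 shows "EX \<c>. sol T u \<c>"
proof -
 obtain C where C: "0 <= C" "ae {0..T} (%t. norm (u t) <= C)" using u by (rule ctrlE)
 \<comment> \<open>So many pieces that the L1 norm on each is at most
   \<open>C * \<tau> \<le> r / 8\<close>, the smallness asked for by
   \<open>small_sol_exists\<close>.\<close>
 obtain n :: nat where n: "real n > C * T * 8 / r" using reals_Archimedean2 by blast
 define \<tau> where "\<tau> = T / real (Suc n)"
 have \<tau>: "0 <= \<tau>" "C * \<tau> <= r / 8" "real (Suc n) * \<tau> = T"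
 proof -
  show "0 <= \<tau>" "real (Suc n) * \<tau> = T" using T by (auto simp: \<tau>_def)
  have "C * T * 8 < real n * r" using n radii by (simp add: field_simps)
  also have "... <= real (Suc n) * r" using radii by simp
  finally have "C * T <= r / 8 * real (Suc n)" by (simp add: mult.commute)
  thus "C * \<tau> <= r / 8" unfolding \<tau>_def times_divide_eq_right by (subst pos_divide_le_eq) auto
 qed
 have "EX \<c>. sol (real k * \<tau>) u \<c>" if "k <= Suc n" for k using that
 proof (induction k)
  case 0
  have "AE t in lebesgue. t ~= (0::real)" by (simp add: AE_lebesgue_iff)
  hence "ae {0..0} (%t. logder (%_. \<one>) {0..0} t (u t))" by eventually_elim auto
  hence "sol 0 u (%_. \<one>)" unfolding sol_def by (auto simp: gsimps R_pos intro!: left_lipI[of 0 1])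
  thus ?case by auto
 next
  case (Suc k)
  then obtain \<c> where \<c>: "sol (real k * \<tau>) u \<c>" by auto
  let ?v = "%t. u (real k * \<tau> + 1 * t)"
  have cv: "ctrl ?v" using u \<tau> by (intro ctrl_affine) auto
  have "real (Suc k) * \<tau> <= real (Suc n) * \<tau>" using Suc.prems \<tau>(1) by (intro mult_right_mono) auto
  hence le: "real k * \<tau> + \<tau> <= T" using \<tau>(3) by (simp add: algebra_simps)
  have "AE t in lebesgue. real k * \<tau> + 1 * t : {0..T} --> norm (?v t) <= C" by (rule AE_lebesgue_affine[OF C(2)]) simp
  hence "ae {0..\<tau>} (%t. norm (norm (?v t)) <= C)" by eventually_elim (use le \<tau> in auto)
  hence "norm (integral {0..\<tau>} (%t. norm (?v t))) <= C * (\<tau> - 0)"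
   using \<tau>(1) C(1) by (intro integral_norm_bound_AE ctrl_norm_integrable cv) auto
  hence "integral {0..\<tau>} (%t. norm (?v t)) <= r / 8" using \<tau>(2) by simp
  then obtain \<c>' where "sol \<tau> ?v \<c>'" using small_sol_exists[OF cv \<tau>(1)] by blast
  from sol_concat[OF \<c> this] \<tau>(1) have
   "sol (real k * \<tau> + \<tau>) (%t. if t < real k * \<tau> then u t else ?v (t - real k * \<tau>))
    (%t. if t <= real k * \<tau> then \<c> t else \<c> (real k * \<tau>) \<otimes> \<c>' (t - real k * \<tau>))" by simp
  hence "sol (real (Suc k) * \<tau>) u (%t. if t <= real k * \<tau> then \<c> t else \<c> (real k * \<tau>) \<otimes> \<c>' (t - real k * \<tau>))"
   by (simp add: algebra_simps cong: if_cong)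
  thus ?case by blast
 qed
 from this[of "Suc n"] show ?thesis using \<tau>(3) by auto
qed

text \<open>The value \<open>\<one>\<close> at all nonpositive times makes \<open>flow u\<close>
  continuous on the whole line and removes sign hypotheses from many rules.\<close>

definition flow :: "(real => 'e) => real => 'g" where
 "flow u t = (if t <= 0 then \<one> else (THE x. EX \<c>. sol t u \<c> & \<c> t = x))"

lemma flow_eq:
 assumes "sol T u \<c>" "t : {0..T}"
 shows "flow u t = \<c> t"
proof (cases "t = 0")
 case True
 thus ?thesis using assms by (simp add: flow_def sol_def)
next
 case False
 have s: "sol t u \<c>" using assms by (auto intro: sol_subinterval)
 have "(THE x. EX \<c>. sol t u \<c> & \<c> t = x) = \<c> t" using s assms(2) by (intro the_equality) (auto intro: sol_unique)
 thus ?thesis using False assms(2) by (simp add: flow_def)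
qed

lemma flow_sol:
 assumes "ctrl u" "0 <= T"
 shows "sol T u (flow u)"
proof -
 obtain \<c> where \<c>: "sol T u \<c>" using sol_exists assms by blast
 thus ?thesis by (rule sol_cong) (use flow_eq[OF \<c>] assms(2) in auto)
qed

lemma flow_0 [simp]: "t <= 0 ==> flow u t = \<one>" by (simp add: flow_def)

lemma continuous_on_flow:
 assumes u: "ctrl u"
 shows "continuous_on UNIV (flow u)"
proof -
 have "isCont (%t. flow u (max 0 t)) t" for t
 proof -
  have "continuous_on {0..max 0 t + 1} (flow u)" using flow_sol[OF u, of "max 0 t + 1"] by (auto simp: sol_def intro: left_lip_continuous_on)
  hence "continuous_on {..t + 1} (%t. flow u (max 0 t))" by (rule continuous_on_compose2) (auto intro!: continuous_intros)
  thus ?thesis by (rule continuous_on_interior) simp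
 qed
 moreover have "flow u (max 0 t) = flow u t" for t by (cases "t <= 0") (auto simp: max_def)
 ultimately show ?thesis by (simp add: continuous_on_eq_continuous_at)
qed

lemma flow_cong_AE:
 assumes "ctrl u" "ae {0..T} (%t. u t = v t)"
 shows "flow v T = flow u T"
proof (cases "0 <= T")
 case True
 thus ?thesis using flow_eq[OF sol_cong[OF flow_sol[OF assms(1) True] _ _ assms(2)], of "flow u" T] by simp
qed simp

lemma flow_cong: "ctrl u ==> (!!t. 0 <= t ==> t < T ==> u t = v t) ==> flow v T = flow u T"
proof (rule flow_cong_AE)
 assume "!!t. 0 <= t ==> t < T ==> u t = v t"
 moreover have "AE t in lebesgue. t ~= T" by (simp add: AE_lebesgue_iff)
 ultimately show "ae {0..T} (%t. u t = v t)" by (auto elim!: eventually_mono)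
qed

lemma flow_affine:
 assumes u: "ctrl u" and "0 <= a" "0 < c" "0 <= t"
 shows "flow u (a + c * t) = flow u a \<otimes> flow (%t. c *R u (a + c * t)) t"
proof -
 have "sol t (%t. c *R u (a + c * t)) (%t. inv (flow u a) \<otimes> flow u (a + c * t))"
  by (rule sol_affine[OF flow_sol[of u "a + c * t"]]) (use assms in "auto intro!: mult_left_mono")
 from flow_eq[OF this, of t] assms show ?thesis by (simp add: gsimps)
qed

lemma flow_add:
 "ctrl u ==> 0 <= s ==> 0 <= t ==> flow u (s + t) = flow u s \<otimes> flow (%t. u (s + t)) t" using flow_affine[of u s 1 t] by simp

lemma flow_scale:
 "ctrl u ==> 0 < c ==> 0 <= t ==> flow u (c * t) = flow (%t. c *R u (c * t)) t" using flow_affine[of u 0 c t] by (simp add: gsimps)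

lemma flow_concat:
 assumes u: "ctrl u" and v: "ctrl v" and "0 <= s" "0 <= t"
 shows "flow (%t. if t < s then u t else v (t - s)) (s + t) = flow u s \<otimes> flow v t"
 using flow_eq[OF sol_concat[OF flow_sol[OF u] flow_sol[OF v]], of s t "s + t"] assms by (cases "t = 0") (auto simp: gsimps)

lemma flow_reverse:
 assumes u: "ctrl u" and "0 <= T"
 shows "flow (%t. - (if t <= T then u (T - t) else 0)) T = inv (flow u T)"
proof -
 have "sol T (%t. (-1) *R u (T + (-1) * t)) (%t. inv (flow u T) \<otimes> flow u (T + (-1) * t))" using flow_sol[OF assms] by (rule sol_affine) auto
 hence "sol T (%t. - (if t <= T then u (T - t) else 0)) (%t. inv (flow u T) \<otimes> flow u (T + (-1) * t))" by (rule sol_cong) auto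
 from flow_eq[OF this, of T] show ?thesis using assms(2) by (simp add: gsimps)
qed

lemma ctrl_Ad_flow: "ctrl u ==> ctrl h ==> ctrl (%t. Ad (flow u t) (h t))"
 by (rule ctrl_linear_image[OF linear_Ad]) (auto intro: continuous_on_Ad continuous_on_flow)

text \<open>Variation of constants: the product on the right has logarithmic derivative
  \<open>Ad (inv (flow u t)) (Ad (flow u t) (h t)) + u t\<close>.\<close>

lemma flow_variation:
 assumes u: "ctrl u" and h: "ctrl h"
 shows "flow (%t. u t + h t) T = flow (%t. Ad (flow u t) (h t)) T \<otimes> flow u T"
proof (cases "0 <= T")
 case True
 let ?H = "%t. Ad (flow u t) (h t)"
 have sH: "sol T ?H (flow ?H)" by (intro flow_sol ctrl_Ad_flow u h True)
 have su: "sol T u (flow u)" by (intro flow_sol u True)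
 have "sol T (%t. u t + h t) (%t. flow ?H t \<otimes> flow u t)" unfolding sol_def
 proof (intro conjI)
  show "left_lip {0..T} (%t. flow ?H t \<otimes> flow u t)" using sH su by (intro left_lip_mult) (auto simp: sol_def)
  show "flow ?H 0 \<otimes> flow u 0 = \<one>" by (simp add: gsimps)
  have "ae {0..T} (%t. logder (flow ?H) {0..T} t (?H t))"
   "ae {0..T} (%t. logder (flow u) {0..T} t (u t))" using sH su by (auto simp: sol_def)
  thus "ae {0..T} (%t. logder (%t. flow ?H t \<otimes> flow u t) {0..T} t (u t + h t))"
  proof eventually_elim
   case (elim t)
   show ?case
   proof
    assume "t : {0..T}"
    with elim have "logder (%t. flow ?H t \<otimes> flow u t) {0..T} t (Ad (inv (flow u t)) (?H t) + u t)" by (intro logder_mult) auto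
    thus "logder (%t. flow ?H t \<otimes> flow u t) {0..T} t (u t + h t)" by (simp add: Ad_inv add.commute)
   qed
  qed
 qed
 from flow_eq[OF this, of T] True show ?thesis by simp
qed (simp add: gsimps)

lemma flow_small:
 assumes u: "ctrl u" and T: "0 <= T" and small: "integral {0..T} (%t. norm (u t)) <= r / 8"
 shows "flow u T : U r" "\<n> (flow u T) <= 2 * integral {0..T} (%t. norm (u t))"
  "norm (\<k> (flow u T) - integral {0..T} u) <= 2 * L * (integral {0..T} (%t. norm (u t)))\<^sup>2"
proof -
 obtain \<c> where \<c>: "sol T u \<c>"
  "!!t. t : {0..T} ==> \<c> t : U r & \<n> (\<c> t) <= 2 * integral {0..T} (%t. norm (u t))"
  "norm (\<k> (\<c> T) - integral {0..T} u) <= 2 * L * (integral {0..T} (%t. norm (u t)))\<^sup>2" using small_sol_exists[OF assms] by blast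
 moreover have "flow u T = \<c> T" using flow_eq[OF \<c>(1), of T] T by simp
 ultimately show "flow u T : U r" "\<n> (flow u T) <= 2 * integral {0..T} (%t. norm (u t))"
  "norm (\<k> (flow u T) - integral {0..T} u) <= 2 * L * (integral {0..T} (%t. norm (u t)))\<^sup>2" using T by auto
qed

end

section \<open>The differential of the flow\<close>

text \<open>Cut \<open>[s, t]\<close> into equal pieces shorter than \<open>\<d>\<close> and
  telescope; the constant does not change.\<close>

lemma uniformly_locally_lipschitz_imp_lipschitz:
 fixes f :: "real => 'a::real_normed_vector"
 assumes "0 < \<d>" and loc: "!!s t. a <= s ==> s <= t ==> t <= b ==> t - s < \<d> ==> norm (f t - f s) <= K * (t - s)"
  and st: "a <= s" "s <= t" "t <= b"
 shows "norm (f t - f s) <= K * (t - s)"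
proof -
 obtain n :: nat where n: "real n > (t - s) / \<d>" using reals_Archimedean2 by blast
 define h where "h = (t - s) / real (Suc n)"
 have h: "0 <= h" "h < \<d>" "real (Suc n) * h = t - s"
 proof -
  show "0 <= h" "real (Suc n) * h = t - s" using st by (auto simp: h_def)
  have "t - s < real (Suc n) * \<d>" using n \<open>0 < \<d>\<close> by (simp add: field_simps)
  thus "h < \<d>" unfolding h_def by (subst pos_divide_less_eq) (auto simp: mult.commute)
 qed
 have "f t - f s = (\<Sum>i<Suc n. f (s + real (Suc i) * h) - f (s + real i * h))"
  using h(3) sum_lessThan_telescope[of "%i. f (s + real i * h)" "Suc n"] by simp
 also have "norm ... <= (\<Sum>i<Suc n. K * h)"
 proof (intro order_trans[OF norm_sum] sum_mono)
  fix i assume i: "i : {..<Suc n}"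
  have "real (Suc i) * h <= real (Suc n) * h" using i h(1) by (intro mult_right_mono) auto
  hence 1: "s + real (Suc i) * h <= b" using h(3) st by linarith
  have 2: "s + real (Suc i) * h - (s + real i * h) = h" by (simp add: algebra_simps)
  have "0 <= real i * h" using h by simp
  have "s + real i * h <= s + real (Suc i) * h" using 2 h(1) by linarith
  thus "norm (f (s + real (Suc i) * h) - f (s + real i * h)) <= K * h"
   using loc[of "s + real i * h" "s + real (Suc i) * h"] 1 h st \<open>0 <= real i * h\<close> unfolding 2 by linarith
 qed
 also have "... = K * (real (Suc n) * h)" by simp
 finally show ?thesis unfolding h(3) .
qed

context local_lie
begin

text \<open>Uniform continuity on a compact metric space. The target carries no metric, so nearness
  is expressed by left quotients and the argument runs through convergent subsequences.\<close>

lemma unif_small: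
 assumes "compact S" "continuous_on S f" "0 < \<r>" "\<r> <= R"
 obtains d where "d > 0" "!!p q. p : S ==> q : S ==> dist p (q::'x::metric_space) < d ==> inv (f p) \<otimes> f q : U \<r>"
proof (rule ccontr)
 assume "~ thesis"
 hence "EX p q. p : S & q : S & dist p q < 1 / real (Suc n) & inv (f p) \<otimes> f q \<notin> U \<r>" for n using that[of "1 / real (Suc n)"] by auto
 then obtain p q where pq: "!!n. p n : S" "!!n. q n : S" "!!n. dist (p n) (q n) < 1 / real (Suc n)"
  "!!n. inv (f (p n)) \<otimes> f (q n) \<notin> U \<r>" by metis
 obtain l s where l: "l : S" "strict_mono (s :: nat => nat)" "(p \<circ> s) \<longlonglongrightarrow> l"
  using assms(1) pq(1) unfolding compact_def by blast
 have ds: "(%n. dist (p (s n)) (q (s n))) \<longlonglongrightarrow> 0"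
 proof (rule tendsto_sandwich[of "%_. 0"])
  show "\<forall>\<^sub>F n in sequentially. dist (p (s n)) (q (s n)) <= 1 / real (Suc (s n))"
   by (rule always_eventually) (blast intro: less_imp_le pq(3))
  have "(%n. 1 / real (Suc n)) \<longlonglongrightarrow> 0" by (rule lim_1_over_n[THEN LIMSEQ_Suc])
  from LIMSEQ_subseq_LIMSEQ[OF this l(2)] show "(%n. 1 / real (Suc (s n))) \<longlonglongrightarrow> 0" by (simp add: o_def)
 qed auto
 have ql: "(%n. q (s n)) \<longlonglongrightarrow> l" unfolding tendsto_dist_iff[of _ l]
 proof (rule tendsto_sandwich[of "%_. 0"])
  show "(%n. dist (p (s n)) (q (s n)) + dist (p (s n)) l) \<longlonglongrightarrow> 0"
   using tendsto_add[OF ds tendsto_dist[OF l(3) tendsto_const[of l]]] by (simp add: o_def)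
  show "\<forall>\<^sub>F n in sequentially. dist (q (s n)) l <= dist (p (s n)) (q (s n)) + dist (p (s n)) l"
   by (rule always_eventually) (auto intro: dist_triangle3)
 qed auto
 have "(%n. f (p (s n))) \<longlonglongrightarrow> f l" "(%n. f (q (s n))) \<longlonglongrightarrow> f l"
  using assms(2) l ql pq unfolding continuous_on_sequentially by (auto simp: o_def)
 hence "(%n. inv (f (p (s n))) \<otimes> f (q (s n))) \<longlonglongrightarrow> inv (f l) \<otimes> f l" by (intro tendsto_mult_G tendsto_inv_G)
 hence "(%n. inv (f (p (s n))) \<otimes> f (q (s n))) \<longlonglongrightarrow> \<one>" by (simp add: gsimps)
 from eventually_in_U[OF this assms(3,4)] show False using pq(4) by simp
qed

lemma Ad_compact_bound:
 assumes "compact Q"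
 obtains B where "0 <= B" "!!g v. g : Q ==> norm (Ad g v) <= B * norm v"
proof -
 have "EX b. ALL g:Q. norm (Ad g i) <= b" for i
 proof -
  have "compact ((%g. Ad g i) ` Q)" by (intro compact_continuous_image continuous_on_subset[OF continuous_on_Ad'] assms) auto
  thus ?thesis using compact_imp_bounded bounded_iff by (metis imageI)
 qed
 then obtain b where b: "!!i g. g : Q ==> norm (Ad g i) <= b i" by metis
 define B where "B = (SUM i:Basis. abs (b i))"
 show thesis
 proof (rule that[of B])
  show "0 <= B" by (simp add: B_def sum_nonneg)
  fix g v assume g: "g : Q"
  have "Ad g v = (SUM i:Basis. (v \<bullet> i) *R Ad g i)" by (subst euclidean_representation[of v, symmetric]) (simp only: Ad_simps)
  also have "norm ... <= (SUM i:Basis. norm v * abs (b i))"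
  proof (intro order_trans[OF norm_sum] sum_mono)
   fix i :: 'e assume "i : Basis"
   thus "norm ((v \<bullet> i) *R Ad g i) <= norm v * abs (b i)" unfolding norm_scaleR using b[OF g, of i] by (intro mult_mono Basis_le_norm) auto
  qed
  also have "... = B * norm v" by (simp add: B_def sum_distrib_right sum_distrib_left mult.commute)
  finally show "norm (Ad g v) <= B * norm v" .
 qed
qed

lemma flow_compact: "ctrl u ==> compact (flow u ` {a..b})" by (intro compact_continuous_image continuous_on_subset[OF continuous_on_flow]) auto

text \<open>The norm in which the flow is differentiated: it is weak enough for averages to converge
  and strong enough for the quadratic remainder.\<close>

abbreviation L1 :: "real => (real => 'e) => real" where
 "L1 T u \<equiv> integral {0..T} (%t. norm (u t))"

lemma L1_nonneg: "ctrl u ==> 0 <= L1 T u" by (intro Henstock_Kurzweil_Integration.integral_nonneg ctrl_norm_integrable) auto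

lemma L1_le:
 assumes "ctrl u" "ctrl v" "ae {0..T} (%t. norm (v t) <= B * norm (u t))"
 shows "L1 T v <= B * L1 T u"
proof -
 have "L1 T v = integral {0..T} (%t. min (norm (v t)) (B * norm (u t)))" by (rule integral_cong_AE_lebesgue) (use assms(3) in eventually_elim, auto)
 also have "... <= integral {0..T} (%t. B * norm (u t))"
 proof (rule integral_le)
  have "ae {0..T} (%t. min (norm (v t)) (B * norm (u t)) = norm (v t))" using assms(3) by eventually_elim auto
  thus "(%t. min (norm (v t)) (B * norm (u t))) integrable_on {0..T}" unfolding AE_lebesgue_iff
   by (rule integrable_spike[OF ctrl_norm_integrable[OF assms(2) order_refl, of T]]) auto
  show "(%t. B * norm (u t)) integrable_on {0..T}" by (intro integrable_on_mult_right ctrl_norm_integrable assms order_refl)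
 qed auto
 finally show ?thesis by simp
qed

text \<open>Since \<open>flow (u + h) = flow (Ad (flow u) h) \<cdot> flow u\<close>, the endpoint map is differentiable everywhere as
  soon as it is differentiable at \<open>0\<close>.\<close>

lemma flow_derivative:
 assumes u: "ctrl u" and T: "0 <= T"
 obtains K \<r> where "0 <= K" "0 < \<r>"
  "!!h. ctrl h ==> L1 T h <= \<r> ==> flow (%t. u t + h t) T \<otimes> inv (flow u T) : U r"
  "!!h. ctrl h ==> L1 T h <= \<r> ==> \<n> (flow (%t. u t + h t) T \<otimes> inv (flow u T)) <= K * L1 T h"
  "!!h. ctrl h ==> L1 T h <= \<r> ==> norm (\<k> (flow (%t. u t + h t) T \<otimes> inv (flow u T)) -
    integral {0..T} (%t. Ad (flow u t) (h t))) <= K * (L1 T h)\<^sup>2"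
  "!!h. ctrl h ==> norm (integral {0..T} (%t. Ad (flow u t) (h t))) <= K * L1 T h"
proof -
 obtain B where B: "0 <= B" "!!g v. g : flow u ` {0..T} ==> norm (Ad g v) <= B * norm v" by (rule Ad_compact_bound[OF flow_compact[OF u]]) blast
 \<comment> \<open>One constant for three estimates: \<open>2 * L * B^2\<close> for the remainder,
   \<open>2 * B\<close> for the increment, \<open>B\<close> for the linear term, where
   \<open>B\<close> bounds \<open>Ad\<close> along the flow.\<close>
 define K where "K = 2 * L * B\<^sup>2 + 2 * B + B"
 define \<r> where "\<r> = r / 8 / (B + 1)"
 let ?H = "%h t. Ad (flow u t) (h t)"
 have LH: "L1 T (?H h) <= B * L1 T h" if "ctrl h" for h by (rule L1_le[OF that ctrl_Ad_flow[OF u that]]) (use B in auto)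
 have var: "flow (%t. u t + h t) T \<otimes> inv (flow u T) = flow (?H h) T" if "ctrl h" for h
  using flow_variation[OF u that, of T] by (simp add: gsimps)
 have small: "L1 T (?H h) <= r / 8" if "ctrl h" "L1 T h <= \<r>" for h
 proof -
  have "B * L1 T h <= B * \<r>" using that(2) B(1) by (rule mult_left_mono)
  also have "... <= (B + 1) * \<r>" using B(1) radii by (intro mult_right_mono) (auto simp: \<r>_def)
  also have "... = r / 8"
  proof -
   have "b * (r / 8 / b) = r / 8" if "b ~= 0" for b using that by simp
   from this[of "B + 1"] show ?thesis using B(1) by (simp only: \<r>_def)
  qed
  finally show ?thesis using LH[OF that(1)] by linarith
 qed
 have K0: "0 <= 2 * L * B\<^sup>2" "0 <= B" using B(1) radii(3) by auto
 show thesis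
 proof (rule that[of K \<r>])
  show "0 <= K" unfolding K_def using K0 by linarith
  show "0 < \<r>" using B(1) radii by (simp add: \<r>_def)
  fix h :: "real => 'e" assume h: "ctrl h"
  have h0: "0 <= L1 T h" using h by (rule L1_nonneg)
  note ch = ctrl_Ad_flow[OF u h]
  have "norm (integral {0..T} (?H h)) <= L1 T (?H h)" by (rule Henstock_Kurzweil_Integration.integral_norm_bound_integral)
    (auto intro: ctrl_integrable ctrl_norm_integrable ch)
  also have "... <= B * L1 T h" by (rule LH[OF h])
  also have "... <= K * L1 T h" using h0 K0 by (intro mult_right_mono) (auto simp: K_def)
  finally show "norm (integral {0..T} (?H h)) <= K * L1 T h" .
  assume hs: "L1 T h <= \<r>"
  note fs = flow_small[OF ch T small[OF h hs]]
  show "flow (%t. u t + h t) T \<otimes> inv (flow u T) : U r" unfolding var[OF h] by (rule fs)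
  have "\<n> (flow (?H h) T) <= 2 * (B * L1 T h)" using fs(2) LH[OF h] by linarith
  also have "... <= K * L1 T h" using h0 K0 by (simp add: K_def distrib_right)
  finally show "\<n> (flow (%t. u t + h t) T \<otimes> inv (flow u T)) <= K * L1 T h" unfolding var[OF h] .
  have "(L1 T (?H h))\<^sup>2 <= (B * L1 T h)\<^sup>2" using LH[OF h] L1_nonneg[OF ch] by (intro power_mono)
  hence "2 * L * (L1 T (?H h))\<^sup>2 <= 2 * L * (B * L1 T h)\<^sup>2" using radii(3) by (intro mult_left_mono) auto
  also have "... = (2 * L * B\<^sup>2) * (L1 T h)\<^sup>2" by (simp add: power_mult_distrib)
  also have "... <= K * (L1 T h)\<^sup>2" using K0 by (intro mult_right_mono) (auto simp: K_def)
  finally show "norm (\<k> (flow (%t. u t + h t) T \<otimes> inv (flow u T)) - integral {0..T} (?H h)) <= K * (L1 T h)\<^sup>2"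
   unfolding var[OF h] using fs(3) by linarith
 qed
qed

lemma flow_L1_tendsto:
 assumes u: "ctrl u" and v: "\<forall>\<^sub>F n in X. ctrl (v n)" and lim: "((%n. L1 T (%t. v n t - u t)) ---> 0) X"
 shows "((%n. flow (v n) T) ---> flow u T) X"
proof (cases "0 <= T")
 case True
 obtain K \<r> where K: "0 <= K" "0 < \<r>"
  "!!h. ctrl h ==> L1 T h <= \<r> ==> flow (%t. u t + h t) T \<otimes> inv (flow u T) : U r"
  "!!h. ctrl h ==> L1 T h <= \<r> ==> \<n> (flow (%t. u t + h t) T \<otimes> inv (flow u T)) <= K * L1 T h" by (rule flow_derivative[OF u True]) blast
 have "((%n. flow (v n) T \<otimes> inv (flow u T)) ---> \<one>) X"
 proof (rule tendsto_oneI)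
  fix e assume e: "0 < e" "e <= R"
  have m: "min \<r> (e / (K + 1)) > 0" using K e by simp
  have "\<forall>\<^sub>F n in X. L1 T (%t. v n t - u t) < min \<r> (e / (K + 1))" using order_tendstoD(2)[OF lim m] .
  with v show "\<forall>\<^sub>F n in X. flow (v n) T \<otimes> inv (flow u T) : U e"
  proof eventually_elim
   case (elim n)
   let ?h = "%t. v n t - u t"
   have h: "ctrl ?h" using elim u by (intro ctrl_diff)
   have s: "L1 T ?h <= \<r>" using elim by simp
   have 1: "flow (v n) T \<otimes> inv (flow u T) : U r" "\<n> (flow (v n) T \<otimes> inv (flow u T)) <= K * L1 T ?h"
    using K(3,4)[OF h s] by simp_all
   have "L1 T ?h < e / (K + 1)" using elim by simp
   hence "L1 T ?h * (K + 1) < e" using K(1) pos_less_divide_eq[of "K + 1"] by simp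
   hence "K * L1 T ?h < e" using L1_nonneg[OF h, of T] by (simp add: algebra_simps)
   thus ?case using 1 U_iff[OF e(2)] U_mono[OF radii(2)] by auto
  qed
 qed
 from tendsto_mult_G[OF this tendsto_const, of "flow u T"] show ?thesis by (simp add: gsimps)
qed simp

section \<open>Lie algebra homomorphisms and the adjoint action\<close>

definition lie_hom :: "('e => 'e) => bool" where
 "lie_hom \<d> <-> linear \<d> & (ALL v w. \<d> (br v w) = br (\<d> v) (\<d> w))"

lemma Ad_product_derivative:
 assumes z: "germ z S t w" and y: "(y has_vector_derivative y') (at t within S)"
 shows "((%s. Ad (z s) (y s)) has_vector_derivative br w (y t) + y') (at t within S)"
proof -
 have z1: "z t = \<one>" using z by (simp add: germ_def)
 have eq: "Ad x v = (SUM i:Basis. (v \<bullet> i) *R Ad x i)" for x v by (subst euclidean_representation[of v, symmetric]) (simp only: Ad_simps)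
 have "((%s. (y s \<bullet> i) *R Ad (z s) i) has_vector_derivative (y t \<bullet> i) *R br w i + (y' \<bullet> i) *R i) (at t within S)"
  if "i : Basis" for i
 proof -
  have "((%s. y s \<bullet> i) has_vector_derivative y' \<bullet> i) (at t within S)"
   by (rule bounded_linear.has_vector_derivative[OF bounded_linear_inner_left y])
  hence "((%s. y s \<bullet> i) has_real_derivative y' \<bullet> i) (at t within S)" by (simp add: has_real_derivative_iff_has_vector_derivative)
  from has_vector_derivative_scaleR[OF this germ_Ad[OF z, of i]]
  show ?thesis by (simp add: z1 Ad_one)
 qed
 hence "((%s. SUM i:Basis. (y s \<bullet> i) *R Ad (z s) i) has_vector_derivative
   (SUM i:Basis. (y t \<bullet> i) *R br w i + (y' \<bullet> i) *R i)) (at t within S)" by (intro has_vector_derivative_sum)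
 moreover have "(SUM i:Basis. (y t \<bullet> i) *R br w i + (y' \<bullet> i) *R i) = br w (y t) + y'"
 proof -
  have "(SUM i:Basis. (y t \<bullet> i) *R br w i) = br w (SUM i:Basis. (y t \<bullet> i) *R i)"
   by (simp only: linear_sum[OF linear_br_right] linear_scale[OF linear_br_right])
  thus ?thesis by (simp add: sum.distrib euclidean_representation)
 qed
 ultimately show ?thesis unfolding eq[symmetric] by simp
qed

lemma Ad_left_lip:
 assumes lip: "left_lip {0..T} \<c>"
 obtains K \<d> where "0 <= K" "0 < \<d>"
  "!!s t v. s : {0..T} ==> t : {0..T} ==> abs (s - t) < \<d> ==> norm (Ad (inv (\<c> s) \<otimes> \<c> t) v - v) <= K * abs (s - t) * norm v"
proof -
 obtain \<r> K where K: "0 < \<r>" "\<r> <= R" "0 <= K" "!!x v. x : U \<r> ==> norm (Ad x v - v) <= K * \<n> x * norm v" by (rule Ad_near) blast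
 obtain C \<d> where C: "0 <= C" "0 < \<d>" "!!s t. s : {0..T} ==> t : {0..T} ==> abs (s - t) < \<d> ==>
   inv (\<c> s) \<otimes> \<c> t : U \<r> & \<n> (inv (\<c> s) \<otimes> \<c> t) <= C * abs (s - t)" using left_lip_small[OF lip K(1,2)] by blast
 show thesis
 proof (rule that[of "K * C" \<d>])
  fix s t v assume st: "s : {0..T}" "t : {0..T}" "abs (s - t) < \<d>"
  have "norm (Ad (inv (\<c> s) \<otimes> \<c> t) v - v) <= K * \<n> (inv (\<c> s) \<otimes> \<c> t) * norm v" using K(4) C(3)[OF st] by blast
  also have "... <= K * (C * abs (s - t)) * norm v" using C(3)[OF st] K(3) by (intro mult_right_mono mult_left_mono) auto
  finally show "norm (Ad (inv (\<c> s) \<otimes> \<c> t) v - v) <= K * C * abs (s - t) * norm v" by (simp add: mult.assoc)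
 qed (use K C in auto)
qed

text \<open>Along the two flows consider
  \<open>p s = Ad (?g s) (\<d> (Ad (inv (?\<c> s)) v))\<close>. Its derivative vanishes almost
  everywhere because \<open>\<d>\<close> respects brackets, and it is Lipschitz; comparing
  \<open>p 0\<close> with \<open>p T\<close> gives the claim.\<close>

lemma Ad_flow_lie_hom:
 assumes \<d>: "lie_hom \<d>" and u: "ctrl u"
 shows "Ad (flow (%t. \<d> (u t)) T) (\<d> w) = \<d> (Ad (flow u T) w)"
proof (cases "0 <= T")
 case True
 have lin: "linear \<d>" and hom: "!!v w. \<d> (br v w) = br (\<d> v) (\<d> w)" using \<d> by (auto simp: lie_hom_def)
 have bl: "bounded_linear \<d>" using lin by (rule linear_conv_bounded_linear[THEN iffD1])
 have cu: "ctrl (%t. \<d> (u t))" by (rule ctrl_linear[OF lin u])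
 let ?g = "flow (%t. \<d> (u t))" and ?\<c> = "flow u"
 define v where "v = Ad (?\<c> T) w"
 define y where "y s = \<d> (Ad (inv (?\<c> s)) v)" for s
 define p where "p s = Ad (?g s) (y s)" for s
 have sg: "sol T (%t. \<d> (u t)) ?g" and s\<c>: "sol T u ?\<c>" using flow_sol u cu True by auto
 have lg: "left_lip {0..T} ?g" and l\<c>: "left_lip {0..T} (%t. inv (?\<c> t))" using sg s\<c> by (auto simp: sol_def intro: left_lip_inv)
 obtain D where D: "0 < D" "!!v. norm (\<d> v) <= norm v * D" using bounded_linear.pos_bounded[OF bl] by blast
 obtain B1 where B1: "0 <= B1" "!!s v. s : {0..T} ==> norm (Ad (?g s) v) <= B1 * norm v"
  by (rule Ad_compact_bound[OF flow_compact[OF cu, of 0 T]]) blast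
 have "compact ((%t. inv (?\<c> t)) ` {0..T})"
  by (intro compact_continuous_image continuous_intros continuous_on_subset[OF continuous_on_flow[OF u]]) auto
 then obtain B2 where B2: "0 <= B2" "!!s v. s : {0..T} ==> norm (Ad (inv (?\<c> s)) v) <= B2 * norm v" by (rule Ad_compact_bound) blast
 obtain K1 d1 where K1: "0 <= K1" "0 < d1"
  "!!s t v. s : {0..T} ==> t : {0..T} ==> abs (s - t) < d1 ==> norm (Ad (inv (?g s) \<otimes> ?g t) v - v) <= K1 * abs (s - t) * norm v"
  using Ad_left_lip[OF lg] by blast
 obtain K2 d2 where K2: "0 <= K2" "0 < d2"
  "!!s t v. s : {0..T} ==> t : {0..T} ==> abs (s - t) < d2 ==> norm (Ad (inv (inv (?\<c> s)) \<otimes> inv (?\<c> t)) v - v) <= K2 * abs (s - t) * norm v"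
  using Ad_left_lip[OF l\<c>] by blast
 have ylip: "norm (y t - y s) <= (B2 * (K2 * norm v)) * D * (t - s)" if "0 <= s" "s <= t" "t <= T" "t - s < d2" for s t
 proof -
  define z where "z = Ad (inv (inv (?\<c> s)) \<otimes> inv (?\<c> t)) v"
  have "Ad (inv (?\<c> t)) v = Ad (inv (?\<c> s)) z" unfolding z_def Ad_mult[symmetric] by (simp only: gsimps)
  hence eq: "y t - y s = \<d> (Ad (inv (?\<c> s)) (z - v))" by (simp only: y_def linear_diff[OF lin] linear_diff[OF linear_Ad])
  have "norm (z - v) <= K2 * abs (s - t) * norm v" unfolding z_def by (rule K2(3)) (use that in auto)
  hence "B2 * norm (z - v) <= B2 * (K2 * abs (s - t) * norm v)" by (rule mult_left_mono[OF _ B2(1)])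
  moreover have "norm (Ad (inv (?\<c> s)) (z - v)) <= B2 * norm (z - v)" by (rule B2(2)) (use that in auto)
  ultimately have "norm (Ad (inv (?\<c> s)) (z - v)) <= B2 * (K2 * abs (s - t) * norm v)" by linarith
  from mult_right_mono[OF this less_imp_le[OF D(1)]] D(2)[of "Ad (inv (?\<c> s)) (z - v)"]
  have "norm (y t - y s) <= B2 * (K2 * abs (s - t) * norm v) * D" unfolding eq by linarith
  thus ?thesis using that by (simp add: mult_ac)
 qed
 have ybd: "norm (y s) <= B2 * norm v * D" if "s : {0..T}" for s
  unfolding y_def using D(2)[of "Ad (inv (?\<c> s)) v"] mult_right_mono[OF B2(2)[OF that, of v] less_imp_le[OF D(1)]] by linarith
 define M where "M = B1 * (K1 * (B2 * norm v * D) + (B2 * (K2 * norm v)) * D)"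
 have plip: "norm (p t - p s) <= M * (t - s)" if st: "0 <= s" "s <= t" "t <= T" "t - s < min d1 d2" for s t
 proof -
  define z where "z = Ad (inv (?g s) \<otimes> ?g t) (y t)"
  have "p t = Ad (?g s) z" unfolding z_def p_def Ad_mult[symmetric] by (simp only: gsimps)
  hence eq: "p t - p s = Ad (?g s) ((z - y t) + (y t - y s))" by (simp add: p_def linear_diff[OF linear_Ad, symmetric])
  have "norm (z - y t) <= K1 * abs (s - t) * norm (y t)" unfolding z_def by (rule K1(3)) (use st in auto)
  moreover have "norm (y t) <= B2 * norm v * D" by (rule ybd) (use st in auto)
  hence "K1 * abs (s - t) * norm (y t) <= K1 * abs (s - t) * (B2 * norm v * D)" by (rule mult_left_mono) (use K1(1) in simp)
  moreover have "norm (y t - y s) <= B2 * (K2 * norm v) * D * (t - s)" by (rule ylip) (use st in auto)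
  ultimately have "norm ((z - y t) + (y t - y s)) <= K1 * (t - s) * (B2 * norm v * D) + B2 * (K2 * norm v) * D * (t - s)"
   using norm_triangle_ineq[of "z - y t" "y t - y s"] st by simp
  from mult_left_mono[OF this B1(1)] B1(2)[of s "(z - y t) + (y t - y s)"]
  have "norm (p t - p s) <= B1 * (K1 * (t - s) * (B2 * norm v * D) + B2 * (K2 * norm v) * D * (t - s))" unfolding eq using st by simp
  thus ?thesis by (simp add: M_def algebra_simps)
 qed
 have "abs_cont_on 0 T p"
 proof (rule lipschitz_abs_cont_on)
  fix s t assume "0 <= s" "s < t" "t <= T"
  thus "norm (p t - p s) <= M * (t - s)"
   by (intro uniformly_locally_lipschitz_imp_lipschitz[of "min d1 d2" 0 T p M, OF _ plip]) (use K1(2) K2(2) in auto)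
 qed
 moreover have "ae {0..T} (%t. (p has_vector_derivative 0) (at t within {0..T}))"
 proof -
  have "ae {0..T} (%t. logder ?g {0..T} t (\<d> (u t)))"
   "ae {0..T} (%t. logder ?\<c> {0..T} t (u t))" using sg s\<c> by (auto simp: sol_def)
  thus ?thesis
  proof eventually_elim
   case (elim t)
   show ?case
   proof
    assume t: "t : {0..T}"
    have gg: "germ (%s. inv (?g t) \<otimes> ?g s) {0..T} t (\<d> (u t))"
     and g\<c>: "germ (%s. inv (inv (?\<c> t) \<otimes> ?\<c> s)) {0..T} t (- u t)" using elim t by (auto simp: logder_def intro: germ_inv)
    have "((%s. \<d> (Ad (inv (inv (?\<c> t) \<otimes> ?\<c> s)) (Ad (inv (?\<c> t)) v))) has_vector_derivative
      \<d> (br (- u t) (Ad (inv (?\<c> t)) v))) (at t within {0..T})" by (rule bounded_linear.has_vector_derivative[OF bl germ_Ad[OF g\<c>]])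
    hence y': "(y has_vector_derivative - br (\<d> (u t)) (y t)) (at t within {0..T})"
     by (simp add: y_def[abs_def] Ad_mult[symmetric] gsimps hom linear_neg[OF lin] linear_neg[OF linear_br_left])
    have "((%s. Ad (?g t) (Ad (inv (?g t) \<otimes> ?g s) (y s))) has_vector_derivative
      Ad (?g t) (br (\<d> (u t)) (y t) + (- br (\<d> (u t)) (y t)))) (at t within {0..T})"
     by (rule bounded_linear.has_vector_derivative[OF bounded_linear_Ad Ad_product_derivative[OF gg y']])
    thus "(p has_vector_derivative 0) (at t within {0..T})" by (simp add: p_def[abs_def] Ad_mult[symmetric] gsimps Ad_simps)
   qed
  qed
 qed
 ultimately have "p T = p 0" by (rule abs_cont_zero_derivative[OF _ True])
 thus ?thesis by (simp add: p_def y_def v_def Ad_inv Ad_one gsimps)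
qed (simp add: Ad_one)

end

section \<open>Integration of Lie algebra homomorphisms\<close>

context local_lie
begin

text \<open>The Maurer-Cartan form in coordinates: a curve \<open>\<pi> (y t)\<close> in the ball
  has control \<open>\<Omega> (y t)\<close> applied to the velocity of \<open>y\<close>.\<close>

definition \<Omega> :: "'e => 'e => 'e" where "\<Omega> a = inv_into UNIV (F a)"

lemma F_inj: "norm a < R ==> inj (F a)"
proof -
 assume a: "norm a < R"
 have "x = 0" if "F a x = 0" for x using F_bounds(2)[OF a, of x] that by simp
 thus "inj (F a)" unfolding linear_injective_0[OF F_linear[OF a]] by blast
qed

lemma F_surj: "norm a < R ==> surj (F a)" using F_inj F_linear linear_injective_imp_surjective by blast

lemma F_\<Omega>: "norm a < R ==> F a (\<Omega> a v) = v" "norm a < R ==> \<Omega> a (F a v) = v"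
 by (simp_all add: \<Omega>_def surj_f_inv_f[OF F_surj] inv_f_f[OF F_inj])

lemma \<Omega>_linear: "norm a < R ==> linear (\<Omega> a)"
proof (rule linearI)
 assume a: "norm a < R"
 show "\<Omega> a (v + w) = \<Omega> a v + \<Omega> a w" for v w
  using F_\<Omega>(2)[OF a, of "\<Omega> a v + \<Omega> a w"] by (simp add: linear_add[OF F_linear[OF a]] F_\<Omega>[OF a])
 show "\<Omega> a (c *R v) = c *R \<Omega> a v" for c v
  using F_\<Omega>(2)[OF a, of "c *R \<Omega> a v"] by (simp add: linear_scale[OF F_linear[OF a]] F_\<Omega>[OF a])
qed

lemma \<Omega>_bound: "norm a < R ==> norm (\<Omega> a v) <= 2 * norm v" using F_bounds(2)[of a "\<Omega> a v"] by (simp add: F_\<Omega>)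

lemma \<Omega>_lip:
 assumes a: "norm a < R" and b: "norm b < R"
 shows "norm (\<Omega> a v - \<Omega> b v) <= 4 * L * norm (a - b) * norm v"
proof -
 have "\<Omega> a v - \<Omega> b v = \<Omega> a (F b (\<Omega> b v) - F a (\<Omega> b v))"
  by (simp add: linear_diff[OF \<Omega>_linear[OF a]] F_\<Omega> a b)
 also have "norm ... <= 2 * norm (F b (\<Omega> b v) - F a (\<Omega> b v))" by (rule \<Omega>_bound[OF a])
 also have "... <= 2 * (L * norm (b - a) * norm (\<Omega> b v))" using F_lip[OF b a] by (intro mult_left_mono) auto
 also have "... <= 2 * (L * norm (b - a) * (2 * norm v))" using \<Omega>_bound[OF b] radii(3) by (intro mult_left_mono) auto
 finally show ?thesis by (simp add: norm_minus_commute mult_ac)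
qed

lemma continuous_on_\<Omega>: "continuous_on (ball 0 R) (%a. \<Omega> a v)"
proof (rule lipschitz_on_continuous_on)
 show "(4 * L * norm v)-lipschitz_on (ball 0 R) (%a. \<Omega> a v)" using \<Omega>_lip radii by (intro lipschitz_onI) (auto simp: dist_norm mult_ac)
qed

lemma tendsto_\<k>':
 assumes "(f ---> x) X" "x : U R"
 shows "((%t. \<k> (f t)) ---> \<k> x) X"
proof -
 have lim: "((%t. inv x \<otimes> f t) ---> \<one>) X" using assms(1) by (simp add: tendsto_translate_iff)
 have "((%t. 2 * \<n> (inv x \<otimes> f t)) ---> 2 * norm (0::'e)) X" by (intro tendsto_intros tendsto_\<k> lim)
 hence "((%t. 2 * \<n> (inv x \<otimes> f t)) ---> 0) X" by simp
 moreover have "\<forall>\<^sub>F t in X. norm (\<k> (f t) - \<k> x) <= 2 * \<n> (inv x \<otimes> f t)" using eventually_in_U[OF lim R_pos order_refl]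
 proof eventually_elim
  case (elim t)
  show ?case using norm_mult_le(2)[of "\<k> x" "\<k> (inv x \<otimes> f t)"] U_D[OF elim] U_D[OF assms(2)] by (simp add: gsimps)
 qed
 ultimately have "((%t. \<k> (f t) - \<k> x) ---> 0) X" by (rule Lim_null_comparison[rotated])
 thus ?thesis by (simp add: LIM_zero_iff)
qed

lemma chart_flow:
 assumes y: "continuous_on UNIV y" "!!t. norm (y t) < r" "y 0 = 0" and w: "ctrl w"
  and lip: "!!s t. s : {0..T} ==> t : {0..T} ==> norm (y t - y s) <= K * abs (s - t)"
  and der: "ae {0..T} (%t. (y has_vector_derivative w t) (at t within {0..T}))"
 shows "ctrl (%t. \<Omega> (y t) (w t))" "!!t. t : {0..T} ==> flow (%t. \<Omega> (y t) (w t)) t = \<pi> (y t)"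
proof -
 have yR: "norm (y t) < R" for t using y(2)[of t] radii by simp
 show c: "ctrl (%t. \<Omega> (y t) (w t))"
 proof (rule ctrl_linear_image[OF \<Omega>_linear[OF yR] _ w])
  show "continuous_on UNIV (%t. \<Omega> (y t) i)" for i by (rule continuous_on_compose2[OF continuous_on_\<Omega> y(1)]) (use yR in auto)
 qed
 have "sol T (%t. \<Omega> (y t) (w t)) (%t. \<pi> (y t))" unfolding sol_def
 proof (intro conjI)
  show "left_lip {0..T} (%t. \<pi> (y t))" using lip y(2) by (rule chart_left_lip)
  show "\<pi> (y 0) = \<one>" by (simp add: y(3) \<pi>_0)
  show "ae {0..T} (%t. logder (%t. \<pi> (y t)) {0..T} t (\<Omega> (y t) (w t)))"
   using der by eventually_elim (auto intro!: chart_logder simp: F_\<Omega> yR y(2))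
 qed
 thus "!!t. t : {0..T} ==> flow (%t. \<Omega> (y t) (w t)) t = \<pi> (y t)" by (rule flow_eq)
qed

lemma flow_zero [simp]: "flow (%t. 0) T = \<one>"
proof (cases "0 <= T")
 case True
 have "\<n> (flow (%t. 0) T) <= 2 * L1 T (%t. 0)" "flow (%t. 0) T : U r" using flow_small[of "%t. 0" T] True radii by auto
 thus ?thesis using \<k>_eq_0 U_mono[OF radii(2)] by auto
qed simp

text \<open>The control of the coordinate ray from the identity to \<open>\<pi> a\<close>; clipping
  \<open>t\<close> to the unit interval keeps it defined and bounded at all times.\<close>

definition ray :: "'e => real => 'e" where
 "ray a t = \<Omega> (max 0 (min 1 t) *R a) a"

lemma ray_flow:
 assumes a: "norm a < r"
 shows "ctrl (ray a)" "!!t. t : {0..1} ==> flow (ray a) t = \<pi> (t *R a)"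
proof -
 let ?y = "%t. max 0 (min 1 t) *R a"
 have y1: "continuous_on UNIV ?y" by (intro continuous_intros)
 have y2: "norm (?y t) < r" for t
 proof -
  have "norm (?y t) <= 1 * norm a" unfolding norm_scaleR by (intro mult_right_mono) auto
  thus ?thesis using a by simp
 qed
 have y3: "?y 0 = 0" by simp
 have lip: "norm (?y t - ?y s) <= norm a * abs (s - t)" for s t
  unfolding scaleR_diff_left[symmetric] norm_scaleR by (subst mult.commute, intro mult_left_mono) auto
 have der: "ae {0..1} (%t. (?y has_vector_derivative a) (at t within {0..1}))"
 proof (intro AE_I2 impI)
  fix t :: real assume t: "t : {0..1}"
  have "((%t. t *R a) has_vector_derivative a) (at t within {0..1})" by (auto intro!: derivative_eq_intros)
  thus "(?y has_vector_derivative a) (at t within {0..1})" by (rule has_vector_derivative_transform[rotated 2]) (use t in auto)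
 qed
 note cf = chart_flow[OF y1 y2 y3 ctrl_const lip der]
 show "ctrl (ray a)" unfolding ray_def[abs_def] by (rule cf(1))
 show "!!t. t : {0..1} ==> flow (ray a) t = \<pi> (t *R a)" unfolding ray_def[abs_def] using cf(2) by auto
qed

lemma ray_bound: "norm a < r ==> norm (ray a t) <= 2 * norm a"
proof -
 assume a: "norm a < r"
 have "norm (max 0 (min 1 t) *R a) <= 1 * norm a" unfolding norm_scaleR by (intro mult_right_mono) auto
 thus ?thesis unfolding ray_def using a radii by (intro \<Omega>_bound) auto
qed

text \<open>The radial contraction of a curve in the coordinate ball: the controls \<open>k\<^sub>s\<close> of the curves
  \<open>\<pi> (s y)\<close> depend Lipschitz continuously on \<open>s\<close>.\<close>

lemma radial_controls:
 assumes k: "ctrl k" and T: "0 <= T" and small: "!!t. t : {0..T} ==> flow k t : U r"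
 obtains ks C where "0 <= C" "!!s. s : {0..1} ==> ctrl (ks s)"
  "!!s. s : {0..1} ==> flow (ks s) T = \<pi> (s *R \<k> (flow k T))"
  "!!s s'. s : {0..1} ==> s' : {0..1} ==> L1 T (%t. ks s' t - ks s t) <= C * abs (s - s')"
  "!!t. t : {0..T} ==> ks 1 t = k t" "!!t. ks 0 t = 0"
proof -
 \<comment> \<open>Freezing the curve after time \<open>T\<close> keeps it in the ball at all times,
   as \<open>chart_flow\<close> demands; on \<open>{0..T}\<close> nothing changes.\<close>
 define y where "y t = \<k> (flow k (min t T))" for t
 have yU: "flow k (min t T) : U r" for t using small[of "min t T"] T radii by (cases "t <= 0") auto
 have yr: "norm (y t) < r" for t using U_D[OF yU radii(2)] by (simp add: y_def)
 have yR: "norm (y t) < R" for t using yr[of t] radii by simp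
 have y0: "y 0 = 0" using T by (simp add: y_def)
 have yc: "continuous_on UNIV y" unfolding continuous_on_def y_def[abs_def]
 proof (intro ballI tendsto_\<k>')
  fix t :: real
  have "continuous_on UNIV (%t. flow k (min t T))" by (rule continuous_on_compose2[OF continuous_on_flow[OF k]]) (auto intro!: continuous_intros)
  thus "((%t. flow k (min t T)) ---> flow k (min t T)) (at t within UNIV)" by (simp add: continuous_on_def)
  show "flow k (min t T) : U R" using yU U_mono[OF radii(2)] by blast
 qed
 have s\<c>: "sol T k (flow k)" using flow_sol k T .
 define w where "w t = F (y t) (k t)" for t
 have cw: "ctrl w" unfolding w_def
 proof (rule ctrl_linear_image[OF F_linear[OF yR] _ k])
  show "continuous_on UNIV (%t. F (y t) i)" for i by (rule continuous_on_compose2[OF continuous_on_F yc]) (use yR in auto)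
 qed
 have wb: "norm (w t) <= 2 * norm (k t)" for t unfolding w_def by (rule F_bounds(1)[OF yR])
 have yder: "ae {0..T} (%t. (y has_vector_derivative w t) (at t within {0..T}))"
 proof -
  have "ae {0..T} (%t. logder (flow k) {0..T} t (k t))" using s\<c> by (simp add: sol_def)
  thus ?thesis
  proof eventually_elim
   case (elim t)
   show ?case
   proof
    assume t: "t : {0..T}"
    hence "((%s. \<k> (inv \<one> \<otimes> flow k s)) has_vector_derivative F (\<k> (inv \<one> \<otimes> flow k t)) (k t)) (at t within {0..T})"
     using elim small[OF t] by (intro logder_chart) (auto simp: gsimps)
    thus "(y has_vector_derivative w t) (at t within {0..T})" by (rule has_vector_derivative_transform[rotated 2, THEN has_vector_derivative_eq_rhs])
      (use t in "auto simp: y_def w_def gsimps")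
   qed
  qed
 qed
 obtain K where ylip: "0 <= K" "!!s t. s : {0..T} ==> t : {0..T} ==> norm (y t - y s) <= K * abs (s - t)"
 proof -
  obtain K \<d> where K: "0 <= K" "0 < \<d>" "!!s t. s : {0..T} ==> t : {0..T} ==> abs (s - t) < \<d> ==>
    inv (flow k s) \<otimes> flow k t : U R & \<n> (inv (flow k s) \<otimes> flow k t) <= K * abs (s - t)"
   using left_lip_small[of "{0..T}" "flow k" R] s\<c> R_pos unfolding sol_def by blast
  have loc: "norm (y t - y s) <= 2 * K * (t - s)" if "0 <= s" "s <= t" "t <= T" "t - s < \<d>" for s t
  proof -
   have 1: "inv (flow k s) \<otimes> flow k t : U R" "\<n> (inv (flow k s) \<otimes> flow k t) <= K * (t - s)" using K(3)[of s t] that by auto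
   have 2: "flow k s : U R" using small[of s] U_mono[OF radii(2)] that by auto
   show ?thesis using norm_mult_le(2)[of "\<k> (flow k s)" "\<k> (inv (flow k s) \<otimes> flow k t)"] U_D[OF 1(1)] U_D[OF 2] 1(2) that
    by (simp add: gsimps y_def)
  qed
  have *: "norm (y t - y s) <= 2 * K * (t - s)" if "0 <= s" "s <= t" "t <= T" for s t
   by (rule uniformly_locally_lipschitz_imp_lipschitz[OF K(2) loc that])
  show thesis
  proof (rule that[of "2 * K"])
   fix s t assume st: "s : {0..T}" "t : {0..T}"
   show "norm (y t - y s) <= 2 * K * abs (s - t)" using *[of s t] *[of t s] st by (cases "s <= t") (auto simp: norm_minus_commute)
  qed (use K in simp)
 qed
 define ks where "ks s t = \<Omega> (s *R y t) (s *R w t)" for s t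
 have syr: "norm (s *R y t) < r" if "s : {0..1}" for s t
 proof -
  have "norm (s *R y t) <= 1 * norm (y t)" unfolding norm_scaleR using that by (intro mult_right_mono) auto
  thus ?thesis using yr[of t] by simp
 qed
 have syR: "norm (s *R y t) < R" if "s : {0..1}" for s t using syr[OF that, of t] radii by simp
 have cf: "ctrl (ks s)" "!!t. t : {0..T} ==> flow (ks s) t = \<pi> (s *R y t)" if s: "s : {0..1}" for s
 proof -
  have 1: "continuous_on UNIV (%t. s *R y t)" by (intro continuous_intros yc)
  have 2: "norm (s *R y t' - s *R y t) <= (abs s * K) * abs (t - t')" if "t : {0..T}" "t' : {0..T}" for t t'
   using mult_left_mono[OF ylip(2)[OF that], of "abs s"] by (simp add: scaleR_diff_right[symmetric] mult.assoc)
  have 3: "ae {0..T} (%t. ((%t. s *R y t) has_vector_derivative s *R w t) (at t within {0..T}))"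
   using yder by eventually_elim (auto intro!: bounded_linear.has_vector_derivative[OF bounded_linear_scaleR_right])
  have 4: "s *R y 0 = 0" by (simp add: y0)
  show "ctrl (ks s)" unfolding ks_def[abs_def] using 1 syr[OF s] 4 ctrl_scaleR[OF cw] 2 3 by (rule chart_flow(1))
  show "flow (ks s) t = \<pi> (s *R y t)" if "t : {0..T}" for t
   unfolding ks_def[abs_def] using 1 syr[OF s] 4 ctrl_scaleR[OF cw] 2 3 that by (rule chart_flow(2))
 qed
 define C where "C = (4 * L * R + 2) * 2"
 have C0: "0 <= C" using radii by (simp add: C_def)
 show thesis
 proof (rule that[of "C * L1 T k" ks])
  show "0 <= C * L1 T k" using C0 L1_nonneg[OF k] by simp
  show "ctrl (ks s)" if "s : {0..1}" for s using cf(1)[OF that] .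
  show "flow (ks s) T = \<pi> (s *R \<k> (flow k T))" if "s : {0..1}" for s using cf(2)[OF that, of T] T by (simp add: y_def)
  show "ks 1 t = k t" if "t : {0..T}" for t by (simp add: ks_def w_def F_\<Omega> yR)
  show "ks 0 t = 0" for t using linear_0[OF \<Omega>_linear[of 0]] R_pos by (simp add: ks_def)
  fix s s' :: real assume s: "s : {0..1}" "s' : {0..1}"
  have "norm (ks s' t - ks s t) <= (C * abs (s - s')) * norm (k t)" for t
  proof -
   have "ks s' t - ks s t = (\<Omega> (s' *R y t) (s' *R w t) - \<Omega> (s *R y t) (s' *R w t)) + \<Omega> (s *R y t) ((s' - s) *R w t)"
    by (simp add: ks_def linear_diff[OF \<Omega>_linear[OF syR[OF s(1)]]] scaleR_diff_left)
   also have "norm ... <= 4 * L * (abs (s - s') * R) * (1 * norm (w t)) + 2 * (abs (s - s') * norm (w t))"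
   proof (rule norm_triangle_mono)
    have "norm (\<Omega> (s' *R y t) (s' *R w t) - \<Omega> (s *R y t) (s' *R w t)) <= 4 * L * norm (s' *R y t - s *R y t) * norm (s' *R w t)"
     by (rule \<Omega>_lip) (use syR s in auto)
    also have "... <= 4 * L * (abs (s - s') * R) * (1 * norm (w t))"
    proof (intro mult_mono mult_left_mono)
     show "norm (s' *R y t - s *R y t) <= abs (s - s') * R"
      unfolding scaleR_diff_left[symmetric] norm_scaleR using yR[of t] by (auto intro!: mult_mono simp: abs_minus_commute)
     show "norm (s' *R w t) <= 1 * norm (w t)" unfolding norm_scaleR using s by (intro mult_right_mono) auto
    qed (use radii in auto)
    finally show "norm (\<Omega> (s' *R y t) (s' *R w t) - \<Omega> (s *R y t) (s' *R w t)) <= 4 * L * (abs (s - s') * R) * (1 * norm (w t))" .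
    show "norm (\<Omega> (s *R y t) ((s' - s) *R w t)) <= 2 * (abs (s - s') * norm (w t))"
     using \<Omega>_bound[OF syR[OF s(1)], of t "(s' - s) *R w t"] by (simp add: abs_minus_commute)
   qed
   also have "... = (4 * L * R + 2) * abs (s - s') * norm (w t)" by (simp add: algebra_simps)
   also have "... <= (4 * L * R + 2) * abs (s - s') * (2 * norm (k t))" using wb[of t] radii by (intro mult_left_mono) auto
   also have "... = (C * abs (s - s')) * norm (k t)" by (simp add: C_def algebra_simps)
   finally show ?thesis .
  qed
  hence "L1 T (%t. ks s' t - ks s t) <= (C * abs (s - s')) * L1 T k" using cf(1) s k by (intro L1_le ctrl_diff) auto
  thus "L1 T (%t. ks s' t - ks s t) <= C * L1 T k * abs (s - s')" by (simp add: mult_ac)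
 qed
qed

text \<open>Both right increments are given by \<open>flow_derivative\<close> up to a quadratic
  error, and \<open>Ad_flow_lie_hom\<close> takes \<open>\<d>\<close> out of the integral in the
  linear term. So the increment of the image is \<open>\<d>\<close> of the increment of the
  original.\<close>

lemma lie_hom_local_step:
 assumes \<d>: "lie_hom \<d>" and T: "0 <= T" and ks: "!!s. s : {0..1::real} ==> ctrl (ks s)"
  and lip: "0 <= C" "!!s s'. s : {0..1} ==> s' : {0..1} ==> L1 T (%t. ks s' t - ks s t) <= C * abs (s - s')"
  and s: "s : {0..1}"
 obtains d M where "0 < d" "0 <= M" "!!s'. s' : {0..1} ==> abs (s' - s) < d ==>
   flow (%t. \<d> (ks s' t)) T \<otimes> inv (flow (%t. \<d> (ks s t)) T) : U r &
   norm (\<k> (flow (%t. \<d> (ks s' t)) T \<otimes> inv (flow (%t. \<d> (ks s t)) T)) -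
    \<d> (\<k> (flow (ks s') T \<otimes> inv (flow (ks s) T)))) <= M * (s' - s)\<^sup>2"
proof -
 have lin: "linear \<d>" using \<d> by (simp add: lie_hom_def)
 hence bl: "bounded_linear \<d>" by (simp add: linear_conv_bounded_linear)
 obtain D where D: "0 < D" "!!v. norm (\<d> v) <= norm v * D" using bounded_linear.pos_bounded[OF bl] by blast
 have cd: "ctrl (%t. \<d> (ks s t))" using ks[OF s] by (rule ctrl_linear[OF lin])
 obtain K \<r> where K: "0 <= K" "0 < \<r>"
  "!!h. ctrl h ==> L1 T h <= \<r> ==> norm (\<k> (flow (%t. ks s t + h t) T \<otimes> inv (flow (ks s) T)) -
    integral {0..T} (%t. Ad (flow (ks s) t) (h t))) <= K * (L1 T h)\<^sup>2" by (rule flow_derivative[OF ks[OF s] T]) blast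
 obtain K' \<r>' where K': "0 <= K'" "0 < \<r>'"
  "!!h. ctrl h ==> L1 T h <= \<r>' ==> flow (%t. \<d> (ks s t) + h t) T \<otimes> inv (flow (%t. \<d> (ks s t)) T) : U r"
  "!!h. ctrl h ==> L1 T h <= \<r>' ==> norm (\<k> (flow (%t. \<d> (ks s t) + h t) T \<otimes> inv (flow (%t. \<d> (ks s t)) T)) -
    integral {0..T} (%t. Ad (flow (%t. \<d> (ks s t)) t) (h t))) <= K' * (L1 T h)\<^sup>2" by (rule flow_derivative[OF cd T]) blast
 define d where "d = min \<r> (\<r>' / D) / (C + 1)"
 define M where "M = K' * (D * C)\<^sup>2 + D * (K * C\<^sup>2)"
 have d0: "0 < d" using K K' D lip by (simp add: d_def)
 show thesis
 proof (rule that[OF d0])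
  show "0 <= M" using K K' D by (simp add: M_def)
  fix s' assume s': "s' : {0..1}" "abs (s' - s) < d"
  define h where "h t = ks s' t - ks s t" for t
  have ch: "ctrl h" unfolding h_def by (intro ctrl_diff ks s s')
  have Lh: "L1 T h <= C * abs (s' - s)" using lip(2)[OF s s'(1)] by (simp add: h_def abs_minus_commute)
  have h0: "0 <= L1 T h" by (rule L1_nonneg[OF ch])
  have "C * abs (s' - s) <= (C + 1) * abs (s' - s)" by (intro mult_right_mono) auto
  also have "... <= (C + 1) * d" using s'(2) lip(1) by (intro mult_left_mono) auto
  also have "... = min \<r> (\<r>' / D)"
  proof -
   have "b * (x / b) = x" if "b ~= 0" for b x :: real using that by simp
   from this[of "C + 1"] show ?thesis unfolding d_def using lip(1) by auto
  qed
  finally have h1: "L1 T h <= \<r>" "L1 T h <= \<r>' / D" using Lh by auto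
  have cdh: "ctrl (%t. \<d> (h t))" using ch by (rule ctrl_linear[OF lin])
  have Ldh: "L1 T (%t. \<d> (h t)) <= D * L1 T h" by (rule L1_le[OF ch cdh]) (use D(2) in "auto simp: mult.commute")
  have "D * L1 T h <= D * (\<r>' / D)" using h1(2) D(1) by (intro mult_left_mono) auto
  hence dh1: "L1 T (%t. \<d> (h t)) <= \<r>'" using Ldh D(1) by simp
  let ?a = "flow (%t. \<d> (ks s' t)) T \<otimes> inv (flow (%t. \<d> (ks s t)) T)"
  let ?b = "flow (ks s') T \<otimes> inv (flow (ks s) T)"
  let ?I = "integral {0..T} (%t. Ad (flow (ks s) t) (h t))"
  have e1: "(%t. ks s t + h t) = ks s'" by (simp add: h_def fun_eq_iff)
  have e2: "(%t. \<d> (ks s t) + \<d> (h t)) = (%t. \<d> (ks s' t))" by (simp add: h_def fun_eq_iff linear_add[OF lin, symmetric])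
  have e3: "integral {0..T} (%t. Ad (flow (%t. \<d> (ks s t)) t) (\<d> (h t))) = \<d> ?I"
  proof -
   have "integral {0..T} (%t. Ad (flow (%t. \<d> (ks s t)) t) (\<d> (h t))) = integral {0..T} (\<d> \<circ> (%t. Ad (flow (ks s) t) (h t)))"
    by (rule integral_cong) (simp add: Ad_flow_lie_hom[OF \<d> ks[OF s]])
   also have "... = \<d> ?I" by (rule integral_linear[OF ctrl_integrable[OF ctrl_Ad_flow[OF ks[OF s] ch] order_refl] bl])
   finally show ?thesis .
  qed
  have A: "?a : U r" "norm (\<k> ?a - \<d> ?I) <= K' * (L1 T (%t. \<d> (h t)))\<^sup>2" using K'(3,4)[OF cdh dh1] unfolding e2 e3 by auto
  have B: "norm (\<k> ?b - ?I) <= K * (L1 T h)\<^sup>2" using K(3)[OF ch h1(1)] unfolding e1 .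
  have sq: "(L1 T h)\<^sup>2 <= C\<^sup>2 * (s' - s)\<^sup>2" using power_mono[OF Lh h0, of 2] by (simp add: power_mult_distrib)
  have "L1 T (%t. \<d> (h t)) <= (D * C) * abs (s' - s)" using Ldh mult_left_mono[OF Lh less_imp_le[OF D(1)]] by (simp add: mult.assoc)
  from power_mono[OF this L1_nonneg[OF cdh], of 2]
  have sq': "(L1 T (%t. \<d> (h t)))\<^sup>2 <= (D * C)\<^sup>2 * (s' - s)\<^sup>2" by (simp add: power_mult_distrib)
  have "norm (\<d> (\<k> ?b - ?I)) <= (K * (L1 T h)\<^sup>2) * D" using D(2)[of "\<k> ?b - ?I"] mult_right_mono[OF B less_imp_le[OF D(1)]] by linarith
  also have "... <= (K * (C\<^sup>2 * (s' - s)\<^sup>2)) * D" using sq K(1) D(1) by (intro mult_right_mono mult_left_mono) auto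
  finally have B': "norm (\<d> (\<k> ?b) - \<d> ?I) <= (K * (C\<^sup>2 * (s' - s)\<^sup>2)) * D" by (simp add: linear_diff[OF lin])
  have A': "norm (\<k> ?a - \<d> ?I) <= K' * ((D * C)\<^sup>2 * (s' - s)\<^sup>2)" using A(2) mult_left_mono[OF sq' K'(1)] by linarith
  have "norm (\<k> ?a - \<d> (\<k> ?b)) <= norm (\<k> ?a - \<d> ?I) + norm (\<d> (\<k> ?b) - \<d> ?I)"
   using norm_triangle_ineq4[of "\<k> ?a - \<d> ?I" "\<d> (\<k> ?b) - \<d> ?I"] by simp
  also have "... <= M * (s' - s)\<^sup>2" using A' B' by (simp add: M_def algebra_simps)
  finally show "?a : U r & norm (\<k> ?a - \<d> (\<k> ?b)) <= M * (s' - s)\<^sup>2" using A(1) by simp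
 qed
qed

text \<open>Under the radial contraction the image curves of both controls have, to first order, the same
  right increments, because those of the original curves depend on the common endpoint only.\<close>

lemma lie_hom_local:
 assumes \<d>: "lie_hom \<d>" and k: "ctrl k" "ctrl k'" and T: "0 <= T" "0 <= T'"
  and small: "!!t. t : {0..T} ==> flow k t : U r" "!!t. t : {0..T'} ==> flow k' t : U r"
  and eq: "flow k T = flow k' T'"
 shows "flow (%t. \<d> (k t)) T = flow (%t. \<d> (k' t)) T'"
proof -
 have lin: "linear \<d>" using \<d> by (simp add: lie_hom_def)
 obtain ks C where ks: "0 <= C" "!!s. s : {0..1} ==> ctrl (ks s)"
  "!!s. s : {0..1} ==> flow (ks s) T = \<pi> (s *R \<k> (flow k T))"
  "!!s s'. s : {0..1} ==> s' : {0..1} ==> L1 T (%t. ks s' t - ks s t) <= C * abs (s - s')"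
  "!!t. t : {0..T} ==> ks 1 t = k t" "!!t. ks 0 t = 0" by (rule radial_controls[OF k(1) T(1) small(1)]) blast+
 obtain ks' C' where ks': "0 <= C'" "!!s. s : {0..1} ==> ctrl (ks' s)"
  "!!s. s : {0..1} ==> flow (ks' s) T' = \<pi> (s *R \<k> (flow k' T'))"
  "!!s s'. s : {0..1} ==> s' : {0..1} ==> L1 T' (%t. ks' s' t - ks' s t) <= C' * abs (s - s')"
  "!!t. t : {0..T'} ==> ks' 1 t = k' t" "!!t. ks' 0 t = 0" by (rule radial_controls[OF k(2) T(2) small(2)]) blast+
 let ?\<psi> = "%s. flow (%t. \<d> (ks s t)) T" and ?\<psi>' = "%s. flow (%t. \<d> (ks' s t)) T'"
 have fe: "flow (ks' s) T' = flow (ks s) T" if "s : {0..1}" for s using ks(3) ks'(3) that eq by simp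
 have "logder (%s. inv (?\<psi> s) \<otimes> ?\<psi>' s) {0..1} s 0" if s: "s : {0..1}" for s
 proof -
  obtain d M where dM: "0 < d" "0 <= M" "!!s'. s' : {0..1} ==> abs (s' - s) < d ==>
   ?\<psi> s' \<otimes> inv (?\<psi> s) : U r & norm (\<k> (?\<psi> s' \<otimes> inv (?\<psi> s)) - \<d> (\<k> (flow (ks s') T \<otimes> inv (flow (ks s) T)))) <= M * (s' - s)\<^sup>2"
   by (rule lie_hom_local_step[OF \<d> T(1) ks(2) ks(1) ks(4) s]) blast+
  obtain d' M' where dM': "0 < d'" "0 <= M'" "!!s'. s' : {0..1} ==> abs (s' - s) < d' ==>
   ?\<psi>' s' \<otimes> inv (?\<psi>' s) : U r & norm (\<k> (?\<psi>' s' \<otimes> inv (?\<psi>' s)) - \<d> (\<k> (flow (ks' s') T' \<otimes> inv (flow (ks' s) T')))) <= M' * (s' - s)\<^sup>2"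
   by (rule lie_hom_local_step[OF \<d> T(2) ks'(2) ks'(1) ks'(4) s]) blast+
  let ?a = "%s'. ?\<psi> s' \<otimes> inv (?\<psi> s)" and ?a' = "%s'. ?\<psi>' s' \<otimes> inv (?\<psi>' s)"
  have key: "inv (?a s') \<otimes> ?a' s' : U R & \<n> (inv (?a s') \<otimes> ?a' s') <= 2 * (M + M') * (s' - s)\<^sup>2"
   if s': "s' : {0..1}" "abs (s' - s) < min d d'" for s'
  proof -
   have 1: "?a s' : U r" "?a' s' : U r" using dM(3)[of s'] dM'(3)[of s'] s' by auto
   have 2: "\<n> (?a s') < r" "\<pi> (\<k> (?a s')) = ?a s'" "\<n> (?a' s') < r" "\<pi> (\<k> (?a' s')) = ?a' s'"
    using U_D[OF 1(1) radii(2)] U_D[OF 1(2) radii(2)] by auto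
   let ?c = "\<d> (\<k> (flow (ks s') T \<otimes> inv (flow (ks s) T)))"
   have "norm (\<k> (?a s') - ?c) <= M * (s' - s)\<^sup>2" "norm (\<k> (?a' s') - ?c) <= M' * (s' - s)\<^sup>2"
    using dM(3)[of s'] dM'(3)[of s'] s' by (simp_all add: fe[OF s] fe[OF s'(1)])
   hence "norm (\<k> (?a' s') - \<k> (?a s')) <= (M + M') * (s' - s)\<^sup>2"
    using norm_triangle_ineq4[of "\<k> (?a' s') - ?c" "\<k> (?a s') - ?c"] by (simp add: algebra_simps)
   hence "2 * norm (\<k> (?a' s') - \<k> (?a s')) <= 2 * (M + M') * (s' - s)\<^sup>2" unfolding mult.assoc by (rule mult_left_mono) simp
   thus ?thesis using div_le[OF 2(1,3)] unfolding 2 by linarith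
  qed
  have "germ (%s'. inv (?a s') \<otimes> ?a' s') {0..1} s 0" unfolding germ_iff
  proof (intro conjI allI impI)
   show "inv (?a s) \<otimes> ?a' s = \<one>" by (simp add: gsimps)
   show "\<forall>\<^sub>F s' in at s within {0..1}. inv (?a s') \<otimes> ?a' s' : U R" unfolding eventually_at using key dM(1) dM'(1)
    by (intro exI[of _ "min d d'"]) (auto simp: dist_real_def)
   fix e :: real assume e: "e > 0"
   define m where "m = min (min d d') (e / (2 * (M + M') + 1))"
   have m0: "m > 0" using e dM dM' by (simp add: m_def add_nonneg_pos)
   show "\<forall>\<^sub>F s' in at s within {0..1}. norm (\<k> (inv (?a s') \<otimes> ?a' s') - (s' - s) *R 0) <= e * abs (s' - s)"
    unfolding eventually_at
   proof (intro exI[of _ m] conjI ballI impI m0)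
    fix s' assume s': "s' : {0..1}" "s' ~= s & dist s' s < m"
    hence 1: "abs (s' - s) < min d d'" "abs (s' - s) < e / (2 * (M + M') + 1)" by (auto simp: m_def dist_real_def)
    have p: "2 * (M + M') + 1 > 0" using dM(2) dM'(2) by (simp add: add_nonneg_pos)
    have "2 * (M + M') * abs (s' - s) <= (2 * (M + M') + 1) * abs (s' - s)" by (intro mult_right_mono) auto
    also have "... <= e" using 1(2) p by (simp add: pos_less_divide_eq mult.commute)
    finally have "2 * (M + M') * abs (s' - s) * abs (s' - s) <= e * abs (s' - s)" by (rule mult_right_mono) simp
    moreover have "2 * (M + M') * (s' - s)\<^sup>2 = 2 * (M + M') * abs (s' - s) * abs (s' - s)" by (simp add: power2_eq_square abs_mult[symmetric])
    ultimately show "norm (\<k> (inv (?a s') \<otimes> ?a' s') - (s' - s) *R 0) <= e * abs (s' - s)"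
     using key[OF s'(1) 1(1)] by (simp only: scaleR_zero_right diff_zero) linarith
   qed
  qed
  \<comment> \<open>Both right increments are within a quadratic error of the same vector, so their
    quotient has velocity zero; conjugation turns it into the left quotient of the curve
    \<open>inv (?\<psi> s) \<otimes> ?\<psi>' s\<close>.\<close>
  from germ_conj[OF this, of "inv (?\<psi>' s)"]
  show ?thesis by (simp add: logder_def gsimps Ad_simps)
 qed
 \<comment> \<open>At \<open>s = 0\<close> both controls vanish and both endpoints are
   \<open>\<one>\<close>; at \<open>s = 1\<close> they are the given ones.\<close>
 from logder_zero_constant[of 1, OF this, of 1]
 have "inv (?\<psi> 1) \<otimes> ?\<psi>' 1 = inv (?\<psi> 0) \<otimes> ?\<psi>' 0" by simp
 also have "... = \<one>" by (simp add: ks(6) ks'(6) linear_0[OF lin] gsimps)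
 finally have "?\<psi> 1 = ?\<psi>' 1" by (simp add: inv_mult_eq_one_iff)
 moreover have "?\<psi> 1 = flow (%t. \<d> (k t)) T" by (rule flow_cong) (use ctrl_linear[OF lin k(1)] ks(5) in auto)
 moreover have "?\<psi>' 1 = flow (%t. \<d> (k' t)) T'" by (rule flow_cong) (use ctrl_linear[OF lin k(2)] ks'(5) in auto)
 ultimately show ?thesis by simp
qed

section \<open>The local homomorphism and its monodromy\<close>

lemma lie_hom_linear: "lie_hom \<d> ==> linear \<d>" by (simp add: lie_hom_def)

lemma ctrl_lie_hom: "lie_hom \<d> ==> ctrl k ==> ctrl (%t. \<d> (k t))" by (rule ctrl_linear[OF lie_hom_linear])

text \<open>The homomorphism near the identity, computed along a coordinate ray; by
  \<open>ext0_eq\<close> any other path inside \<open>U r\<close> gives the same value.\<close>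

definition ext0 :: "('e => 'e) => 'g => 'g" where
 "ext0 \<d> x = flow (%t. \<d> (ray (\<k> x) t)) 1"

lemma ray_path: "norm a < r ==> t : {0..1} ==> flow (ray a) t : U r"
proof -
 assume a: "norm a < r" and t: "t : {0..1}"
 have "norm (t *R a) <= 1 * norm a" unfolding norm_scaleR using t by (intro mult_right_mono) auto
 thus ?thesis using ray_flow(2)[OF a t] a by auto
qed

lemma ext0_eq:
 assumes \<d>: "lie_hom \<d>" and k: "ctrl k" and T: "0 <= T"
  and small: "!!t. t : {0..T} ==> flow k t : U r"
 shows "flow (%t. \<d> (k t)) T = ext0 \<d> (flow k T)"
proof -
 let ?a = "\<k> (flow k T)"
 have a: "norm ?a < r" "\<pi> ?a = flow k T" using U_D[OF small radii(2)] T by auto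
 show ?thesis unfolding ext0_def by (rule lie_hom_local[OF \<d> k ray_flow(1)[OF a(1)] T zero_le_one small ray_path[OF a(1)]])
   (use ray_flow(2)[OF a(1), of 1] a in auto)
qed

lemma ext0_one: "lie_hom \<d> ==> ext0 \<d> \<one> = \<one>" using ext0_eq[of \<d> "%t. 0" 0] radii by simp

text \<open>Run the ray to \<open>x\<close> and then the translated ray to
  \<open>x \<otimes> y\<close>. The radius \<open>r / 4\<close> keeps this path in
  \<open>U r\<close>, because a product has at most twice the sum of the norms.\<close>

lemma ext0_mult:
 assumes \<d>: "lie_hom \<d>" and x: "x : U (r / 4)" and y: "y : U (r / 4)"
 shows "ext0 \<d> (x \<otimes> y) = ext0 \<d> x \<otimes> ext0 \<d> y"
proof -
 have r4: "r / 4 <= R" "r / 4 <= r" using radii by auto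
 let ?a = "\<k> x" and ?b = "\<k> y"
 have a: "norm ?a < r / 4" "\<pi> ?a = x" and b: "norm ?b < r / 4" "\<pi> ?b = y" using U_D[OF x r4(1)] U_D[OF y r4(1)] by auto
 have a': "norm ?a < r" and b': "norm ?b < r" using a b radii by auto
 note ra = ray_flow[OF a'] and rb = ray_flow[OF b']
 let ?k = "%t. if t < 1 then ray ?a t else ray ?b (t - 1)"
 have ck: "ctrl ?k" by (rule ctrl_concat[OF ra(1) rb(1)])
 have k1: "flow ?k t = \<pi> (t *R ?a)" if "t : {0..1}" for t using flow_cong[OF ra(1), of t ?k] ra(2)[OF that] that by auto
 have k2: "flow ?k (1 + t) = x \<otimes> \<pi> (t *R ?b)" if "t : {0..1}" for t
  using flow_concat[OF ra(1) rb(1), of 1 t] ra(2)[of 1] rb(2)[OF that] a that by simp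
 have "flow ?k t : U r" if t: "t : {0..1 + 1}" for t
 proof (cases "t <= 1")
  case True
  have "norm (t *R ?a) <= 1 * norm ?a" unfolding norm_scaleR using t True by (intro mult_right_mono) auto
  thus ?thesis using k1[of t] t True a' by auto
 next
  case False
  have "norm ((t - 1) *R ?b) <= 1 * norm ?b" unfolding norm_scaleR using t False by (intro mult_right_mono) auto
  hence "norm ((t - 1) *R ?b) < r / 4" using b by simp
  hence s: "\<pi> ((t - 1) *R ?b) : U (r / 4)" by auto
  have "x \<otimes> \<pi> ((t - 1) *R ?b) : U R"
   "\<n> (x \<otimes> \<pi> ((t - 1) *R ?b)) <= 2 * (norm ?a + \<n> (\<pi> ((t - 1) *R ?b)))"
   using mult_small[of x "\<pi> ((t - 1) *R ?b)"] x s U_mono[OF r4(2)] by auto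
  moreover have "\<n> (\<pi> ((t - 1) *R ?b)) < r / 4" using U_D[OF s r4(1)] by simp
  ultimately have "x \<otimes> \<pi> ((t - 1) *R ?b) : U r" using a(1) U_iff[OF radii(2)] by auto
  thus ?thesis using k2[of "t - 1"] t False by simp
 qed
 from ext0_eq[OF \<d> ck _ this]
 have "flow (%t. \<d> (?k t)) (1 + 1) = ext0 \<d> (flow ?k (1 + 1))" by simp
 also have "flow ?k (1 + 1) = x \<otimes> y" using k2[of 1] b by simp
 also have "(%t. \<d> (?k t)) = (%t. if t < 1 then \<d> (ray ?a t) else \<d> (ray ?b (t - 1)))" by auto
 also have "flow (%t. if t < 1 then \<d> (ray ?a t) else \<d> (ray ?b (t - 1))) (1 + 1) = ext0 \<d> x \<otimes> ext0 \<d> y"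
  unfolding ext0_def by (rule flow_concat[OF ctrl_lie_hom[OF \<d> ra(1)] ctrl_lie_hom[OF \<d> rb(1)]]) simp_all
 finally show ?thesis by simp
qed

text \<open>Transport of the local homomorphism along the chain \<open>a 0, ..., a n\<close>; only
  left quotients of neighbours enter.\<close>

fun tprod :: "('e => 'e) => (nat => 'g) => nat => 'g" where
 "tprod \<d> a 0 = \<one>"
| "tprod \<d> a (Suc n) = tprod \<d> a n \<otimes> ext0 \<d> (inv (a n) \<otimes> a (Suc n))"

text \<open>Two neighbouring rows of a fine grid give the same product, up to the transition elements at
  their ends; this is the monodromy argument.\<close>

lemma tprod_neighbours:
 assumes \<d>: "lie_hom \<d>"
  and "!!i. i < n ==> inv (a i) \<otimes> a (Suc i) : U (r / 4)" "!!i. i < n ==> inv (b i) \<otimes> b (Suc i) : U (r / 4)"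
  and "!!i. i <= n ==> inv (a i) \<otimes> b i : U (r / 4)"
 shows "tprod \<d> a n \<otimes> ext0 \<d> (inv (a n) \<otimes> b n) = ext0 \<d> (inv (a 0) \<otimes> b 0) \<otimes> tprod \<d> b n" using assms(2-)
proof (induction n)
 case 0
 thus ?case by (simp add: gsimps)
next
 case (Suc n)
 have "ext0 \<d> (inv (a n) \<otimes> a (Suc n)) \<otimes> ext0 \<d> (inv (a (Suc n)) \<otimes> b (Suc n)) = ext0 \<d> (inv (a n) \<otimes> b (Suc n))"
  using ext0_mult[OF \<d> Suc.prems(1)[of n] Suc.prems(3)[of "Suc n"]] by (simp add: gsimps)
 moreover have "ext0 \<d> (inv (a n) \<otimes> b n) \<otimes> ext0 \<d> (inv (b n) \<otimes> b (Suc n)) = ext0 \<d> (inv (a n) \<otimes> b (Suc n))"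
  using ext0_mult[OF \<d> Suc.prems(3)[of n] Suc.prems(2)[of n]] by (simp add: gsimps)
 moreover have "tprod \<d> a n \<otimes> ext0 \<d> (inv (a n) \<otimes> b n) = ext0 \<d> (inv (a 0) \<otimes> b 0) \<otimes> tprod \<d> b n"
  using Suc by simp
 ultimately show ?case by (metis gsimps(1) tprod.simps(2))
qed

text \<open>Lay a grid over a contraction of the loop, so fine that neighbouring values differ by
  elements of \<open>U (r / 4)\<close>. The constant row has trivial product, hence so has every
  row, and the row of the loop itself computes the flow of the image control.\<close>

lemma lie_hom_loop:
 assumes \<d>: "lie_hom \<d>" and sc: "simply_connected (UNIV :: 'g set)"
  and k: "ctrl k" and T: "0 <= T" and loop: "flow k T = \<one>"
 shows "flow (%t. \<d> (k t)) T = \<one>"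
proof -
 have r4: "0 < r / 4" "r / 4 <= R" using radii by auto
 define p where "p t = flow k (T * t)" for t
 have contp: "continuous_on {0..1} p" unfolding p_def by (rule continuous_on_compose2[OF continuous_on_flow[OF k]]) (auto intro!: continuous_intros)
 have "path p" "pathfinish p = pathstart p" using contp loop by (auto simp: path_def pathfinish_def pathstart_def p_def)
 moreover have "path (%t. \<one>)" "pathfinish (%t. \<one>) = pathstart (%t. \<one>)" by (auto simp: path_def pathfinish_def pathstart_def)
 ultimately have "homotopic_loops UNIV p (%t. \<one>)" using sc unfolding simply_connected_def by blast
 then obtain H where H: "continuous_on ({0..1::real} \<times> {0..1::real}) H"
  "!!t. t : {0..1} ==> H (0, t) = p t" "!!t. t : {0..1} ==> H (1, t) = \<one>"
  "!!s. s : {0..1} ==> H (s, 1) = H (s, 0)" unfolding homotopic_loops by (auto simp: pathfinish_def pathstart_def)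
 obtain d1 where d1: "d1 > 0" "!!p q. p : {0..1} \<times> {0..1} ==> q : {0..1} \<times> {0..1} ==> dist p q < d1 ==> inv (H p) \<otimes> H q : U (r / 4)"
  by (rule unif_small[OF _ H(1) r4]) (auto intro: compact_Times)
 obtain d2 where d2: "d2 > 0" "!!s t. s : {0..T} ==> t : {0..T} ==> dist s t < d2 ==> inv (flow k s) \<otimes> flow k t : U r"
  by (rule unif_small[OF compact_Icc continuous_on_subset[OF continuous_on_flow[OF k] subset_UNIV, of "{0..T}"] radii(1,2)]) blast
 obtain m :: nat where m: "real m > max (1 / d1) (T / d2)" using reals_Archimedean2 by blast
 define n where "n = Suc m"
 have n: "real n > 0" "1 / real n < d1" "T / real n < d2"
 proof -
  show n0: "real n > 0" by (simp add: n_def)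
  have "1 / d1 < real n" "T / d2 < real n" using m by (auto simp: n_def)
  thus "1 / real n < d1" "T / real n < d2" using d1(1) d2(1) n0 by (auto simp: pos_divide_less_eq mult.commute)
 qed
 have grid: "real i / real n : {0..1}" if "i <= n" for i using that n(1) by (auto simp: pos_divide_le_eq)
 have step: "real (Suc i) / real n - real i / real n = 1 / real n" for i by (simp add: diff_divide_distrib[symmetric])
 define a where "a j i = H (real j / real n, real i / real n)" for j i :: nat
 have a1: "inv (a j i) \<otimes> a j (Suc i) : U (r / 4)" if "i < n" "j <= n" for i j unfolding a_def
 proof (rule d1(2))
  show "dist (real j / real n, real i / real n) (real j / real n, real (Suc i) / real n) < d1"
   using step[of i] n abs_minus_commute[of "real i / real n" "real (Suc i) / real n"] by (simp add: dist_Pair_Pair dist_real_def del: of_nat_Suc)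
 qed (use that grid[of i] grid[of "Suc i"] grid[of j] in auto)
 have a2: "inv (a j i) \<otimes> a (Suc j) i : U (r / 4)" if "i <= n" "j < n" for i j unfolding a_def
 proof (rule d1(2))
  show "dist (real j / real n, real i / real n) (real (Suc j) / real n, real i / real n) < d1"
   using step[of j] n abs_minus_commute[of "real j / real n" "real (Suc j) / real n"] by (simp add: dist_Pair_Pair dist_real_def del: of_nat_Suc)
 qed (use that grid[of j] grid[of "Suc j"] grid[of i] in auto)
 have ends: "a j n = a j 0" if "j <= n" for j using H(4)[OF grid[OF that]] n(1) by (simp add: a_def)
 \<comment> \<open>The contraction is a free homotopy of loops, so the base point moves and
   neighbouring products are only conjugate. Being trivial is invariant under conjugation, which is
   why the induction starts at the constant row.\<close>
 have rows: "tprod \<d> (a (n - j)) n = \<one>" if "j <= n" for j using that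
 proof (induction j)
  case 0
  have "tprod \<d> (a n) i = \<one>" if "i <= n" for i using that
  proof (induction i)
   case (Suc i)
   hence "a n i = \<one>" "a n (Suc i) = \<one>" using H(3) grid n(1) by (auto simp: a_def)
   thus ?case using Suc by (simp add: gsimps ext0_one[OF \<d>])
  qed simp
  thus ?case by simp
 next
  case (Suc j)
  define i where "i = n - Suc j"
  have i: "i < n" "n - j = Suc i" using Suc.prems by (auto simp: i_def)
  have "tprod \<d> (a i) n \<otimes> ext0 \<d> (inv (a i n) \<otimes> a (Suc i) n) = ext0 \<d> (inv (a i 0) \<otimes> a (Suc i) 0) \<otimes> tprod \<d> (a (Suc i)) n"
   by (rule tprod_neighbours[OF \<d>]) (use a1 a2 i in auto)
  moreover have "tprod \<d> (a (Suc i)) n = \<one>" using Suc i by simp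
  ultimately have "tprod \<d> (a i) n \<otimes> ext0 \<d> (inv (a i 0) \<otimes> a (Suc i) 0) = \<one> \<otimes> ext0 \<d> (inv (a i 0) \<otimes> a (Suc i) 0)"
   using ends[of i] ends[of "Suc i"] i by (simp add: gsimps)
  thus ?case unfolding mult_right_cancel i_def .
 qed
 \<comment> \<open>On this row each factor is the flow of the image control over one cell, by
   \<open>ext0_eq\<close>, and \<open>flow_add\<close> glues the cells.\<close>
 have "tprod \<d> (a 0) i = flow (%t. \<d> (k t)) (T * (real i / real n))" if "i <= n" for i using that
 proof (induction i)
  case (Suc i)
  define s where "s = T * (real i / real n)"
  define h where "h = T / real n"
  have sh: "T * (real (Suc i) / real n) = s + h" by (simp add: s_def h_def algebra_simps add_divide_distrib)
  have s0: "0 <= s" "0 <= h" using T n by (auto simp: s_def h_def)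
  have le: "s + h <= T" unfolding sh[symmetric] using grid[of "Suc i"] Suc.prems T by (intro mult_left_le) auto
  have "flow (%t. \<d> (k t)) (s + h) = flow (%t. \<d> (k t)) s \<otimes> flow (%t. \<d> (k (s + t))) h"
   by (rule flow_add[OF ctrl_lie_hom[OF \<d> k] s0])
  also have "flow (%t. \<d> (k (s + t))) h = ext0 \<d> (flow (%t. k (s + t)) h)"
  proof (rule ext0_eq[OF \<d> _ s0(2)])
   show "ctrl (%t. k (s + t))" using ctrl_affine[OF k s0(1), of 1] by simp
   fix t assume t: "t : {0..h}"
   have "flow (%t. k (s + t)) t = inv (flow k s) \<otimes> flow k (s + t)" using flow_add[OF k s0(1), of t] t by (simp add: gsimps)
   moreover have "inv (flow k s) \<otimes> flow k (s + t) : U r" by (rule d2(2)) (use t s0 le n(3) in "auto simp: dist_real_def h_def")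
   ultimately show "flow (%t. k (s + t)) t : U r" by simp
  qed
  also have "flow (%t. k (s + t)) h = inv (flow k s) \<otimes> flow k (s + h)" using flow_add[OF k s0] by (simp add: gsimps)
  also have "flow k s = a 0 i" using H(2)[OF grid, of i] Suc.prems by (simp add: a_def p_def s_def)
  also have "flow k (s + h) = a 0 (Suc i)" using H(2)[OF grid, of "Suc i"] Suc.prems by (simp add: a_def p_def sh[symmetric])
  finally show ?case using Suc unfolding sh by (simp add: s_def)
 qed simp
 from this[of n] rows[of n] show ?thesis using n(1) by simp
qed

text \<open>One control followed by the reverse of the other is a loop, to which
  \<open>lie_hom_loop\<close> applies.\<close>

lemma lie_hom_endpoint:
 assumes \<d>: "lie_hom \<d>" and sc: "simply_connected (UNIV :: 'g set)"
  and k: "ctrl k" "ctrl k'" and T: "0 <= T" "0 <= T'" and eq: "flow k T = flow k' T'"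
 shows "flow (%t. \<d> (k t)) T = flow (%t. \<d> (k' t)) T'"
proof -
 have lin: "linear \<d>" using \<d> by (simp add: lie_hom_def)
 let ?rev = "%k t. - (if t <= T' then k (T' - t) else 0)"
 have cr: "ctrl (?rev k)" if "ctrl k" for k :: "real => 'e" using ctrl_scaleR[OF ctrl_reverse[OF that], of "-1" T'] by simp
 let ?c = "%t. if t < T then k t else ?rev k' (t - T)"
 have cc: "ctrl ?c" by (intro ctrl_concat cr k)
 have "flow ?c (T + T') = \<one>" using flow_concat[OF k(1) cr[OF k(2)] T] flow_reverse[OF k(2) T(2)] eq by (simp add: gsimps)
 from lie_hom_loop[OF \<d> sc cc _ this] T have "flow (%t. \<d> (?c t)) (T + T') = \<one>" by simp
 moreover have "(%t. \<d> (?c t)) = (%t. if t < T then \<d> (k t) else ?rev (%t. \<d> (k' t)) (t - T))"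
  by (auto simp: fun_eq_iff linear_neg[OF lin] linear_0[OF lin])
 ultimately have "flow (%t. \<d> (k t)) T \<otimes> inv (flow (%t. \<d> (k' t)) T') = \<one>"
  using flow_concat[OF ctrl_lie_hom[OF \<d> k(1)] cr[OF ctrl_lie_hom[OF \<d> k(2)]] T]
   flow_reverse[OF ctrl_lie_hom[OF \<d> k(2)] T(2)] by simp
 thus ?thesis by (metis gsimps(1,2,3,4))
qed

section \<open>Extension of homomorphisms to the whole group\<close>

lemma flow_surj:
 assumes "connected (UNIV :: 'g set)"
 shows "EX k T. ctrl k & 0 <= T & flow k T = x"
proof -
 \<comment> \<open>\<open>S\<close> is closed under products and contains \<open>U r\<close>.
   Translates of \<open>U r\<close> show that it is open, and if \<open>inv y \<otimes> x\<close> is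
   in \<open>U r\<close> with \<open>y\<close> in \<open>S\<close>, then so is \<open>x\<close>;
   hence the complement is open as well.\<close>
 define S where "S = {x. EX k T. ctrl k & 0 <= T & flow k T = x}"
 have US: "U r \<subseteq> S"
 proof
  fix x assume "x : U r"
  hence a: "\<n> x < r" "\<pi> (\<k> x) = x" using U_D radii by auto
  thus "x : S" unfolding S_def using ray_flow[OF a(1)] by (intro CollectI exI[of _ "ray (\<k> x)"] exI[of _ 1]) auto
 qed
 have mult: "x \<otimes> y : S" if "x : S" "y : S" for x y
 proof -
  obtain k T k' T' where k: "ctrl k" "0 <= T" "flow k T = x" "ctrl k'" "0 <= T'" "flow k' T' = y"
   using \<open>x : S\<close> \<open>y : S\<close> by (auto simp: S_def)
  thus ?thesis unfolding S_def using flow_concat[OF k(1,4,2,5)]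
   by (intro CollectI exI[of _ "%t. if t < T then k t else k' (t - T)"] exI[of _ "T + T'"]) (auto intro: ctrl_concat)
 qed
 have "open S"
 proof (subst open_subopen, intro ballI)
  fix x assume "x : S"
  have "open {y. inv x \<otimes> y : U r}" by (intro open_translate open_U radii)
  moreover have "{y. inv x \<otimes> y : U r} \<subseteq> S"
  proof
   fix y assume "y : {y. inv x \<otimes> y : U r}"
   hence "x \<otimes> (inv x \<otimes> y) : S" using US by (intro mult[OF \<open>x : S\<close>]) auto
   thus "y : S" by (simp add: gsimps)
  qed
  ultimately show "EX T. open T & x : T & T \<subseteq> S" using radii by (intro exI[of _ "{y. inv x \<otimes> y : U r}"]) (auto simp: gsimps)
 qed
 moreover have "open (- S)"
 proof (subst open_subopen, intro ballI)
  fix x assume x: "x : - S"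
  have "open {y. inv y \<otimes> x : U r}"
  proof -
   have "open {z. inv z : {w. w \<otimes> x : U r}}" by (intro open_translate open_U radii)
   thus ?thesis by simp
  qed
  moreover have "{y. inv y \<otimes> x : U r} \<subseteq> - S"
  proof (rule subsetI, rule ComplI)
   fix y assume y: "y : {y. inv y \<otimes> x : U r}" "y : S"
   hence "y \<otimes> (inv y \<otimes> x) : S" using US by (intro mult[OF y(2)]) auto
   with x show False by (simp add: gsimps)
  qed
  ultimately show "EX T. open T & x : T & T \<subseteq> - S" using radii by (intro exI[of _ "{y. inv y \<otimes> x : U r}"]) (auto simp: gsimps)
 qed
 ultimately have "S = UNIV" using assms[unfolded connected_clopen, rule_format, of S] US one_in_U[OF radii(1)]
  by (auto simp: open_openin[symmetric] closed_closedin[symmetric] closed_def)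
 hence "x : S" by simp
 thus ?thesis by (simp add: S_def)
qed

text \<open>The value is read off from an arbitrarily chosen control leading to \<open>x\<close>;
  \<open>lie_hom_endpoint\<close>, and with it simple connectedness, makes the choice
  immaterial.\<close>

definition ext :: "('e => 'e) => 'g => 'g" where
 "ext \<d> x = (let p = SOME p. ctrl (fst p) & 0 <= snd p & flow (fst p) (snd p) = x
   in flow (%t. \<d> (fst p t)) (snd p))"

context
 assumes conn: "connected (UNIV :: 'g set)" and sc: "simply_connected (UNIV :: 'g set)"
begin

lemma ext_flow:
 assumes \<d>: "lie_hom \<d>" and k: "ctrl k" and T: "0 <= T"
 shows "ext \<d> (flow k T) = flow (%t. \<d> (k t)) T"
proof -
 let ?P = "%p. ctrl (fst p) & 0 <= snd p & flow (fst p) (snd p) = flow k T"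
 have "?P (k, T)" using k T by simp
 hence "?P (SOME p. ?P p)" by (rule someI)
 thus ?thesis unfolding ext_def Let_def by (intro lie_hom_endpoint[OF \<d> sc]) (use k T in auto)
qed

lemma ext_mult:
 assumes \<d>: "lie_hom \<d>"
 shows "ext \<d> (x \<otimes> y) = ext \<d> x \<otimes> ext \<d> y"
proof -
 obtain k T where k: "ctrl k" "0 <= T" "flow k T = x" using flow_surj[OF conn] by blast
 obtain k' T' where k': "ctrl k'" "0 <= T'" "flow k' T' = y" using flow_surj[OF conn] by blast
 let ?c = "%t. if t < T then k t else k' (t - T)"
 have "ext \<d> (x \<otimes> y) = flow (%t. \<d> (?c t)) (T + T')"
  using flow_concat[OF k(1) k'(1) k(2) k'(2)] k k' ext_flow[OF \<d> ctrl_concat[OF k(1) k'(1)], of "T + T'" T] by simp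
 also have "(%t. \<d> (?c t)) = (%t. if t < T then \<d> (k t) else \<d> (k' (t - T)))" by auto
 also have "flow ... (T + T') = ext \<d> x \<otimes> ext \<d> y"
  using flow_concat[OF ctrl_lie_hom[OF \<d> k(1)] ctrl_lie_hom[OF \<d> k'(1)] k(2) k'(2)]
   ext_flow[OF \<d> k(1,2)] ext_flow[OF \<d> k'(1,2)] k k' by simp
 finally show ?thesis .
qed

lemma ext_one: "lie_hom \<d> ==> ext \<d> \<one> = \<one>" using ext_mult[of \<d> \<one> \<one>] by (metis gsimps(2,6) gsimps(4))

lemma ext_inv: "lie_hom \<d> ==> ext \<d> (inv x) = inv (ext \<d> x)" using ext_mult[of \<d> x "inv x"] ext_one[of \<d>] by (metis gsimps(3,5,6))

lemma ext_Ad: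
 assumes \<d>: "lie_hom \<d>"
 shows "Ad (ext \<d> x) (\<d> v) = \<d> (Ad x v)"
proof -
 obtain k T where k: "ctrl k" "0 <= T" "flow k T = x" using flow_surj[OF conn] by blast
 thus ?thesis using Ad_flow_lie_hom[OF \<d> k(1), of T] ext_flow[OF \<d> k(1,2)] by simp
qed

text \<open>Near the identity the chosen control may be a ray, whose size is at most twice the norm
  of its end; \<open>flow_small\<close> then bounds the image. Multiplicativity carries continuity
  to all other points.\<close>

lemma continuous_on_ext:
 assumes \<d>: "lie_hom \<d>"
 shows "continuous_on UNIV (ext \<d>)"
proof -
 have bl: "bounded_linear \<d>" using lie_hom_linear[OF \<d>] by (simp add: linear_conv_bounded_linear)
 obtain D where D: "0 < D" "!!v. norm (\<d> v) <= norm v * D" using bounded_linear.pos_bounded[OF bl] by blast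
 have 1: "((%y. ext \<d> y) ---> \<one>) (nhds \<one>)"
 proof (rule tendsto_oneI)
  fix \<r> assume \<r>: "0 < \<r>" "\<r> <= R"
  define e where "e = min r (min (r / 8) (\<r> / 2) / (2 * D))"
  have e: "0 < e" "e <= r" "e <= R" using \<r> D radii by (auto simp: e_def)
  have "\<forall>\<^sub>F y in nhds \<one>. y : U e" using eventually_in_U[OF filterlim_ident e(1,3)] .
  thus "\<forall>\<^sub>F y in nhds \<one>. ext \<d> y : U \<r>"
  proof eventually_elim
   case (elim y)
   hence y: "\<n> y < e" "\<pi> (\<k> y) = y" using U_D e(3) by auto
   hence yr: "\<n> y < r" using e by simp
   note rf = ray_flow[OF yr]
   have cd: "ctrl (%t. \<d> (ray (\<k> y) t))" by (rule ctrl_lie_hom[OF \<d> rf(1)])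
   have ey: "ext \<d> y = flow (%t. \<d> (ray (\<k> y) t)) 1" using ext_flow[OF \<d> rf(1), of 1] rf(2)[of 1] y by simp
   have "L1 1 (%t. \<d> (ray (\<k> y) t)) <= integral {0..1} (%t::real. 2 * \<n> y * D)"
   proof (rule integral_le)
    fix t :: real
    show "norm (\<d> (ray (\<k> y) t)) <= 2 * \<n> y * D"
     using D(2)[of "ray (\<k> y) t"] mult_right_mono[OF ray_bound[OF yr, of t] less_imp_le[OF D(1)]] by linarith
   qed (auto intro: ctrl_norm_integrable[OF cd])
   hence 1: "L1 1 (%t. \<d> (ray (\<k> y) t)) <= \<n> y * (2 * D)" by simp
   have "\<n> y < min (r / 8) (\<r> / 2) / (2 * D)" using y(1) by (simp add: e_def)
   hence "\<n> y * (2 * D) < min (r / 8) (\<r> / 2)" using D(1) by (simp add: pos_less_divide_eq)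
   hence 2: "L1 1 (%t. \<d> (ray (\<k> y) t)) <= r / 8" "L1 1 (%t. \<d> (ray (\<k> y) t)) < \<r> / 2" using 1 by auto
   show ?case using flow_small(1,2)[OF cd zero_le_one 2(1)] 2(2) U_iff[OF \<r>(2)] U_mono[OF radii(2)] unfolding ey by auto
  qed
 qed
 show ?thesis unfolding continuous_on_def
 proof
  fix x :: 'g
  have "((%y. inv x \<otimes> y) ---> \<one>) (at x within UNIV)" unfolding tendsto_translate_iff by (rule tendsto_ident_at)
  from tendsto_mult_G[OF tendsto_const filterlim_compose[OF 1 this], of "ext \<d> x"]
  show "(ext \<d> ---> ext \<d> x) (at x within UNIV)" by (simp add: ext_mult[OF \<d>, symmetric] gsimps)
 qed
qed

end

end

section \<open>Dilations\<close>

context local_lie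
begin

section \<open>\<open>Ad\<close> respects the bracket; the Jacobi identity\<close>

lemma germ_line:
 assumes "t : S"
 shows "germ (%s. \<pi> ((s - t) *R v)) S t v" unfolding germ_def
proof (intro conjI)
 have lim: "((%s. (s - t) *R v) ---> (t - t) *R v) (at t within S)" by (intro tendsto_intros)
 hence lim0: "((%s. (s - t) *R v) ---> 0) (at t within S)" by simp
 show "\<forall>\<^sub>F s in at t within S. \<pi> ((s - t) *R v) : U R" by (rule eventually_in_U[OF tendsto_\<pi>[OF lim0] R_pos order_refl])
 have "((%s. (s - t) *R v) has_vector_derivative v) (at t within S)" by (auto intro!: derivative_eq_intros)
 moreover have "\<forall>\<^sub>F s in at t within S. norm ((s - t) *R v) < R" using tendstoD[OF lim0 R_pos] by simp
 hence "\<forall>\<^sub>F s in at t within S. (s - t) *R v = \<k> (\<pi> ((s - t) *R v))" by eventually_elim (simp add: \<k>_\<pi>)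
 ultimately show "((%s. \<k> (\<pi> ((s - t) *R v))) has_vector_derivative v) (at t within S)"
  by (rule has_vector_derivative_cong_at_within) (simp add: \<pi>_0)
qed (simp add: \<pi>_0)

text \<open>Differentiate \<open>Ad\<close> along \<open>x \<otimes> ?f s \<otimes> inv x\<close> in
  two ways: directly, and by pulling \<open>Ad x\<close> out.\<close>

lemma Ad_br: "Ad x (br a b) = br (Ad x a) (Ad x b)"
proof -
 let ?f = "%s::real. \<pi> ((s - 0) *R a)"
 have g: "germ ?f UNIV 0 a" by (rule germ_line) simp
 have "((%s. Ad (x \<otimes> ?f s \<otimes> inv x) (Ad x b)) has_vector_derivative br (Ad x a) (Ad x b)) (at 0)" by (rule germ_Ad[OF germ_conj[OF g]])
 moreover have "((%s. Ad x (Ad (?f s) b)) has_vector_derivative Ad x (br a b)) (at 0)"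
  by (rule bounded_linear.has_vector_derivative[OF bounded_linear_Ad germ_Ad[OF g]])
 moreover have "Ad (x \<otimes> ?f s \<otimes> inv x) (Ad x b) = Ad x (Ad (?f s) b)" for s unfolding Ad_mult[symmetric] by (simp only: gsimps)
 ultimately show ?thesis by (simp add: vector_derivative_unique_at)
qed

lemma bounded_bilinear_br: "bounded_bilinear br"
 using linear_br_left linear_br_right by (simp add: bilinear_conv_bounded_bilinear[symmetric] bilinear_def)

text \<open>The derivative of \<open>Ad_br\<close> along a curve through the identity with velocity
  \<open>w\<close>.\<close>

lemma jacobi: "br w (br v z) = br (br w v) z + br v (br w z)"
proof -
 let ?f = "%s::real. \<pi> ((s - 0) *R w)"
 have g: "germ ?f UNIV 0 w" by (rule germ_line) simp
 have "((%s. br (Ad (?f s) v) (Ad (?f s) z)) has_vector_derivative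
   br (Ad (?f 0) v) (br w z) + br (br w v) (Ad (?f 0) z)) (at 0)"
  by (rule bounded_bilinear.has_vector_derivative[OF bounded_bilinear_br germ_Ad[OF g] germ_Ad[OF g]])
 moreover have "((%s. Ad (?f s) (br v z)) has_vector_derivative br w (br v z)) (at 0)" by (rule germ_Ad[OF g])
 ultimately show ?thesis by (simp add: Ad_br vector_derivative_unique_at \<pi>_0 Ad_one add.commute)
qed

end

section \<open>The grading and the dilations of the algebra\<close>

locale stratified_lie = local_lie G \<k> \<pi> F br R r L
 for G :: "'g::t2_space monoid" (structure)
  and \<k> :: "'g => 'e::euclidean_space" and \<pi> :: "'e => 'g"
  and F :: "'e => 'e => 'e" and br :: "'e => 'e => 'e" and R r L :: real +
 fixes gs :: "nat => 'e set" and s :: nat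
 assumes s_ge_1: "1 <= s" and gs_subspace: "!!k. k : {1..s} ==> subspace (gs k)"
  and gs_decomp: "!!x. \<exists>!f. (ALL k:{1..s}. f k : gs k) & (ALL k. k \<notin> {1..s} --> f k = 0) & x = (\<Sum>k=1..s. f k)"
  and gs_br: "!!k. k : {1..<s} ==> span {br v w | v w. v : gs 1 & w : gs k} = gs (Suc k)"
  and gs_br_top: "span {br v w | v w. v : gs 1 & w : gs s} = {0}"
  and conn: "connected (UNIV :: 'g set)" and sc: "simply_connected (UNIV :: 'g set)"
begin

text \<open>Zero outside \<open>{1..s}\<close>, so that the grading rule \<open>layer_br\<close>
  holds without any bound on the sum of the degrees.\<close>

definition layer :: "nat => 'e set" where
 "layer k = (if k : {1..s} then gs k else {0})"

lemma layer_subspace: "subspace (layer k)" using gs_subspace by (auto simp: layer_def)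

lemma layer_br_1: "1 <= k ==> v : layer 1 ==> w : layer k ==> br v w : layer (Suc k)"
proof -
 assume k: "1 <= k" and v: "v : layer 1" and w: "w : layer k"
 have v1: "v : gs 1" using v s_ge_1 by (simp add: layer_def)
 consider "k < s" | "k = s" | "s < k" by linarith
 thus ?thesis
 proof cases
  case 1
  hence "br v w : span {br v w | v w. v : gs 1 & w : gs k}" using v1 w k by (intro span_base) (auto simp: layer_def)
  thus ?thesis using gs_br[of k] 1 k by (simp add: layer_def)
 next
  case 2
  hence "br v w : span {br v w | v w. v : gs 1 & w : gs s}" using v1 w k by (intro span_base) (auto simp: layer_def)
  thus ?thesis using gs_br_top 2 by (simp add: layer_def)
 next
  case 3
  hence "w = 0" using w by (simp add: layer_def)
  thus ?thesis using 3 by (simp add: linear_0[OF linear_br_right] layer_def)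
 qed
qed

text \<open>The stratification speaks only of brackets with the first layer. Writing an element of
  layer \<open>i + 1\<close> as a combination of brackets \<open>br a b\<close>, the Jacobi identity
  reduces the degree of the left factor.\<close>

lemma layer_br: "1 <= i ==> 1 <= j ==> v : layer i ==> w : layer j ==> br v w : layer (i + j)"
proof (induction i arbitrary: j v w rule: nat_induct_at_least)
 case base
 thus ?case using layer_br_1[of j v w] by simp
next
 case (Suc i)
 show ?case
 proof (cases "Suc i <= s")
  case True
  hence v: "v : span {br a b | a b. a : gs 1 & b : gs i}" using gs_br[of i] Suc by (simp add: layer_def)
  have "subspace {v. br v w : layer (Suc i + j)}" using layer_subspace[of "Suc i + j"]
   by (auto simp: subspace_def linear_0[OF linear_br_left] linear_add[OF linear_br_left] linear_scale[OF linear_br_left])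
  moreover have "{br a b | a b. a : gs 1 & b : gs i} \<subseteq> {v. br v w : layer (Suc i + j)}"
  proof (clarsimp)
   fix a b assume "a : gs (Suc 0)" "b : gs i"
   hence ab: "a : layer 1" "b : layer i" using s_ge_1 True Suc.hyps by (auto simp: layer_def)
   have e: "br (br a b) w = br a (br b w) - br b (br a w)" using jacobi[of a b w] by simp
   have "br b w : layer (i + j)" using Suc ab by blast
   hence 1: "br a (br b w) : layer (Suc (i + j))" using ab Suc by (intro layer_br_1) auto
   have "br a w : layer (Suc j)" using ab Suc.prems by (intro layer_br_1) auto
   hence "br b (br a w) : layer (i + Suc j)" using Suc.IH[of "Suc j" b "br a w"] ab by simp
   thus "br (br a b) w : layer (Suc (i + j))" unfolding e using 1 layer_subspace subspace_diff by fastforce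
  qed
  ultimately have "span {br a b | a b. a : gs 1 & b : gs i} \<subseteq> {v. br v w : layer (Suc i + j)}" by (rule span_minimal[rotated])
  thus ?thesis using v by auto
 next
  case False
  hence "v = 0" using Suc.prems by (simp add: layer_def)
  thus ?thesis using subspace_0[OF layer_subspace] by (simp add: linear_0[OF linear_br_left])
 qed
qed

definition comp :: "'e => nat => 'e" where
 "comp x = (THE f. (ALL k:{1..s}. f k : gs k) & (ALL k. k \<notin> {1..s} --> f k = 0) & x = (\<Sum>k=1..s. f k))"

lemma comp_props: "comp x k : layer k" "x = (\<Sum>k=1..s. comp x k)"
proof -
 have "(ALL k:{1..s}. comp x k : gs k) & (ALL k. k \<notin> {1..s} --> comp x k = 0) & x = (\<Sum>k=1..s. comp x k)"
  unfolding comp_def by (rule theI'[OF gs_decomp])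
 thus "comp x k : layer k" "x = (\<Sum>k=1..s. comp x k)" by (auto simp: layer_def)
qed

lemma comp_eqI:
 assumes "!!k. f k : layer k" "x = (\<Sum>k=1..s. f k)"
 shows "comp x = f"
proof -
 have "(ALL k:{1..s}. f k : gs k) & (ALL k. k \<notin> {1..s} --> f k = 0) & x = (\<Sum>k=1..s. f k)"
  using assms(2) assms(1) by (auto simp: layer_def split: if_splits) (metis singletonD)+
 thus ?thesis unfolding comp_def by (rule the1_equality[OF gs_decomp])
qed

lemma comp_add: "comp (x + y) = (%k. comp x k + comp y k)" using comp_props(2)[of x] comp_props(2)[of y]
 by (intro comp_eqI subspace_add[OF layer_subspace] comp_props) (simp add: sum.distrib)

lemma comp_scale: "comp (c *R x) = (%k. c *R comp x k)" using comp_props(2)[of x]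
 by (intro comp_eqI subspace_scale[OF layer_subspace] comp_props) (simp add: scaleR_sum_right[symmetric])

lemma comp_layer:
 assumes "1 <= k" "x : layer k"
 shows "comp x = (%j. if j = k then x else 0)"
proof (rule comp_eqI)
 show "(if j = k then x else 0) : layer j" for j using assms subspace_0[OF layer_subspace] by auto
 show "x = (\<Sum>j=1..s. if j = k then x else 0)" using assms by (cases "k <= s") (auto simp: layer_def)
qed

definition dil :: "real => 'e => 'e" where
 "dil c x = (\<Sum>k=1..s. c ^ k *R comp x k)"

lemma dil_linear: "linear (dil c)"
 by (rule linearI) (simp_all add: dil_def comp_add comp_scale scaleR_add_right sum.distrib scaleR_sum_right mult.commute)

lemma dil_layer:
 assumes "1 <= k" "x : layer k"
 shows "dil c x = c ^ k *R x"
proof (cases "k <= s")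
 case True
 have "dil c x = (\<Sum>j=1..s. if j = k then c ^ k *R x else 0)" unfolding dil_def comp_layer[OF assms] by (intro sum.cong) auto
 thus ?thesis using True assms(1) by simp
next
 case False
 thus ?thesis using assms linear_0[OF dil_linear] by (simp add: layer_def)
qed

lemma layer_induct:
 assumes "linear f" "linear g" "!!k x. 1 <= k ==> x : layer k ==> f x = g x"
 shows "f x = g x"
proof -
 have "f x = (\<Sum>k=1..s. f (comp x k))" by (subst comp_props(2)[of x]) (simp only: linear_sum[OF assms(1)])
 also have "... = (\<Sum>k=1..s. g (comp x k))" using assms(3) comp_props(1) by (intro sum.cong) auto
 also have "... = g x" by (subst (2) comp_props(2)[of x]) (simp only: linear_sum[OF assms(2)])
 finally show ?thesis .
qed

lemma dil_lie_hom: "lie_hom (dil c)"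
proof -
 have 1: "dil c (br v w) = br (dil c v) (dil c w)" if v: "1 <= i" "v : layer i" for i v w
 proof (rule layer_induct[where f="%w. dil c (br v w)" and g="%w. br (dil c v) (dil c w)"])
  show "linear (%w. dil c (br v w))" "linear (%w. br (dil c v) (dil c w))"
   using linear_compose[OF linear_br_right dil_linear] linear_compose[OF dil_linear linear_br_right] by (simp_all add: o_def)
  fix j w assume w: "1 <= j" "w : layer j"
  show "dil c (br v w) = br (dil c v) (dil c w)" using dil_layer[OF _ layer_br[OF v(1) w(1) v(2) w(2)], of c] v(1)
   by (simp add: dil_layer[OF v] dil_layer[OF w] linear_scale[OF linear_br_left] linear_scale[OF linear_br_right] power_add)
 qed
 have "dil c (br v w) = br (dil c v) (dil c w)" for v w
 proof (rule layer_induct[where f="%v. dil c (br v w)" and g="%v. br (dil c v) (dil c w)"])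
  show "linear (%v. dil c (br v w))" "linear (%v. br (dil c v) (dil c w))"
   using linear_compose[OF linear_br_left dil_linear] linear_compose[OF dil_linear linear_br_left] by (simp_all add: o_def)
 qed (rule 1)
 thus ?thesis by (simp add: lie_hom_def dil_linear)
qed

lemma dil_dil: "dil c (dil d x) = dil (c * d) x"
proof (rule layer_induct[where f="%x. dil c (dil d x)" and g="dil (c * d)"])
 show "linear (%x. dil c (dil d x))" using linear_compose[OF dil_linear dil_linear] by (simp add: o_def)
 fix k x assume "1 <= k" "x : layer k"
 thus "dil c (dil d x) = dil (c * d) x" using subspace_scale[OF layer_subspace, of x k "d ^ k"]
  by (simp add: dil_layer linear_scale[OF dil_linear] power_mult_distrib)
qed (rule dil_linear)

lemma dil_1: "dil 1 x = x" by (rule layer_induct[where f="dil 1" and g="%x. x", OF dil_linear]) (simp_all add: dil_layer linear_iff)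

lemma dil_first: "x : gs 1 ==> dil c x = c *R x" using dil_layer[of 1 x c] s_ge_1 by (simp add: layer_def)

lemma dil_small: obtains C where "0 <= C" "!!c x. 0 <= c ==> c <= 1 ==> norm (dil c x) <= c * C * norm x"
proof -
 have lin: "linear (%x. comp x k)" for k by (rule linearI) (simp_all add: comp_add comp_scale)
 hence "bounded_linear (%x. comp x k)" for k by (simp add: linear_conv_bounded_linear)
 hence "EX B>0. ALL x. norm (comp x k) <= norm x * B" for k using bounded_linear.pos_bounded by blast
 then obtain B where B: "!!k. B k > 0" "!!k x. norm (comp x k) <= norm x * B k" by metis
 show thesis
 proof (rule that[of "\<Sum>k=1..s. B k"])
  show "0 <= (\<Sum>k=1..s. B k)" using B(1) by (intro sum_nonneg) (auto intro: less_imp_le)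
  fix c :: real and x assume c: "0 <= c" "c <= 1"
  have "norm (dil c x) <= (\<Sum>k=1..s. c * (norm x * B k))" unfolding dil_def
  proof (intro order_trans[OF norm_sum] sum_mono)
   fix k assume k: "k : {1..s}"
   have "c ^ k <= c ^ 1" using c k by (intro power_decreasing) auto
   thus "norm (c ^ k *R comp x k) <= c * (norm x * B k)" unfolding norm_scaleR using c B(2)[of x k] by (intro mult_mono) auto
  qed
  also have "... = c * (\<Sum>k=1..s. B k) * norm x" by (simp add: sum_distrib_left sum_distrib_right mult_ac)
  finally show "norm (dil c x) <= c * (\<Sum>k=1..s. B k) * norm x" .
 qed
qed

lemma generated:
 assumes J: "subspace J" "gs 1 \<subseteq> J" "!!v w. v : gs 1 ==> w : J ==> br v w : J"
 shows "J = UNIV"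
proof -
 have "gs k \<subseteq> J" if "1 <= k" "k <= s" for k using that
 proof (induction k rule: nat_induct_at_least)
  case base thus ?case using J(2) by simp
 next
  case (Suc k)
  hence "{br v w | v w. v : gs 1 & w : gs k} \<subseteq> J" using J(3) by auto
  hence "span {br v w | v w. v : gs 1 & w : gs k} \<subseteq> J" using J(1) by (rule span_minimal)
  thus ?case using gs_br[of k] Suc by simp
 qed
 hence "comp x k : J" if "k : {1..s}" for x k using comp_props(1)[of x k] that by (auto simp: layer_def)
 hence "(\<Sum>k=1..s. comp x k) : J" for x by (intro subspace_sum[OF J(1)])
 thus ?thesis using comp_props(2) by auto
qed

section \<open>Dilations of the group\<close>

abbreviation D :: "real => 'g => 'g" where "D c \<equiv> ext (dil c)"

lemmas D_mult = ext_mult[OF conn sc dil_lie_hom]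
lemmas D_inv = ext_inv[OF conn sc dil_lie_hom]
lemmas D_flow = ext_flow[OF conn sc dil_lie_hom]
lemmas D_Ad = ext_Ad[OF conn sc dil_lie_hom]
lemmas D_continuous = continuous_on_ext[OF conn sc dil_lie_hom]

text \<open>This links dilations with time: together with \<open>flow_scale\<close> it shows that
  stretching time by \<open>c\<close> applies \<open>D c\<close>.\<close>

lemma D_flow_first:
 assumes "ctrl u" "0 <= T" "!!t. 0 <= t ==> t < T ==> u t : gs 1"
 shows "D c (flow u T) = flow (%t. c *R u t) T"
proof -
 have "flow (%t. dil c (u t)) T = flow (%t. c *R u t) T" using assms by (intro flow_cong ctrl_scaleR) (auto simp: dil_first)
 thus ?thesis using D_flow assms by simp
qed

lemma D_D: "D c (D d x) = D (c * d) x"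
proof -
 obtain k T where k: "ctrl k" "0 <= T" "flow k T = x" using flow_surj[OF conn] by blast
 show ?thesis using D_flow[OF k(1,2), of d] D_flow[OF k(1,2), of "c * d"] D_flow[OF ctrl_lie_hom[OF dil_lie_hom k(1)] k(2), of c d] k(3)
  by (simp add: dil_dil)
qed

lemma D_1: "D 1 x = x"
proof -
 obtain k T where k: "ctrl k" "0 <= T" "flow k T = x" using flow_surj[OF conn] by blast
 show ?thesis using D_flow[OF k(1,2), of 1] k(3) by (simp add: dil_1)
qed

lemma D_inverse: "c ~= 0 ==> D c (D (1 / c) x) = x" "c ~= 0 ==> D (1 / c) (D c x) = x" by (simp_all add: D_D D_1)

text \<open>The dilated control tends to zero in L1 at rate \<open>1 / n\<close>, since every power
  \<open>c ^ k\<close> with \<open>k \<ge> 1\<close> is at most \<open>c\<close> on the unit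
  interval.\<close>

lemma tendsto_D_0: "(%n. D (1 / real n) x) \<longlonglongrightarrow> \<one>"
proof -
 obtain k T where k: "ctrl k" "0 <= T" "flow k T = x" using flow_surj[OF conn] by blast
 obtain C where C: "0 <= C" "!!c x. 0 <= c ==> c <= 1 ==> norm (dil c x) <= c * C * norm x" by (rule dil_small) blast
 have ck: "ctrl (%t. dil (1 / real n) (k t))" for n by (rule ctrl_lie_hom[OF dil_lie_hom k(1)])
 have "(%n. flow (%t. dil (1 / real n) (k t)) T) \<longlonglongrightarrow> flow (%t. 0) T"
 proof (rule flow_L1_tendsto)
  show "(%n. L1 T (%t. dil (1 / real n) (k t) - 0)) \<longlonglongrightarrow> 0"
  proof (rule tendsto_sandwich[of "%_. 0"])
   have "L1 T (%t. dil (1 / real n) (k t)) <= 1 / real n * C * L1 T k" if "n >= 1" for n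
    by (rule L1_le[OF k(1) ck]) (use C(2)[of "1 / real n"] that in auto)
   thus "\<forall>\<^sub>F n in sequentially. L1 T (%t. dil (1 / real n) (k t) - 0) <= 1 / real n * C * L1 T k"
    unfolding eventually_sequentially by auto
   have "(%n. 1 / real n * C * L1 T k) \<longlonglongrightarrow> 0 * C * L1 T k" by (intro tendsto_intros lim_1_over_n)
   thus "(%n. 1 / real n * C * L1 T k) \<longlonglongrightarrow> 0" by simp
   show "\<forall>\<^sub>F n in sequentially. 0 <= L1 T (%t. dil (1 / real n) (k t) - 0)" using L1_nonneg[OF ck] by simp
  qed simp
 qed (use ck in "auto intro: ctrl_const")
 thus ?thesis using D_flow[OF k(1,2)] k(3) by (simp add: flow_zero)
qed

end

section \<open>Submersions in right-translated coordinates\<close>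

context local_lie
begin

text \<open>\<open>submersion_at\<close> with the base point moved to the identity by a right
  translation, where the single coordinate \<open>\<k>\<close> serves; the two are compared in
  \<open>submersion_at_iff\<close>.\<close>

definition sub_at :: "('i => 'f::real_vector) set => (('i => 'f) => real) => (('i => 'f) => 'g) => ('i => 'f) => bool" where
 "sub_at V \<nu> f y <-> (EX \<r>>0. ALL h:V. \<nu> h < \<r> --> f (%i. y i + h i) \<otimes> inv (f y) : U R) &
   (EX D. has_derivative_in V \<nu> (%z. \<k> (f z \<otimes> inv (f y))) D y & D ` V = UNIV)"

lemma has_derivative_in_unique:
 assumes D: "has_derivative_in V \<nu> f D y" and D': "has_derivative_in V \<nu> f D' y"
  and h: "h : V" and V: "!!c. (%i. c *R h i) : V" and \<nu>: "!!c. \<nu> (%i. c *R h i) = abs c * \<nu> h" "0 <= \<nu> h"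
 shows "D h = D' h"
proof -
 have "norm (D h - D' h) <= e * (2 * \<nu> h)" if e: "e > 0" for e
 proof -
  obtain d where d: "d > 0" "!!h. h : V ==> \<nu> h < d ==> norm (f (%i. y i + h i) - f y - D h) <= e * \<nu> h"
   using D e unfolding has_derivative_in_def by blast
  obtain d' where d': "d' > 0" "!!h. h : V ==> \<nu> h < d' ==> norm (f (%i. y i + h i) - f y - D' h) <= e * \<nu> h"
   using D' e unfolding has_derivative_in_def by blast
  \<comment> \<open>\<open>\<nu>\<close> may be a seminorm with \<open>\<nu> h = 0\<close>; the
    summand 1 keeps the scaling factor positive in that case too.\<close>
  define c where "c = min d d' / 2 / (\<nu> h + 1)"
  have c: "c > 0" using d d' \<nu>(2) by (simp add: c_def)
  have "c * \<nu> h <= c * (\<nu> h + 1)" using c by simp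
  also have "... = min d d' / 2"
  proof -
   have "x / b * b = x" if "b ~= 0" for b x :: real using that by simp
   from this[of "\<nu> h + 1"] show ?thesis unfolding c_def using \<nu>(2) by fastforce
  qed
  also have "... < min d d'" using d(1) d'(1) by (simp add: min_def)
  finally have small: "\<nu> (%i. c *R h i) < d" "\<nu> (%i. c *R h i) < d'" using c by (auto simp: \<nu>(1))
  have s: "D (%i. c *R h i) = c *R D h" "D' (%i. c *R h i) = c *R D' h" using D D' h unfolding has_derivative_in_def by auto
  have "norm (c *R D h - c *R D' h) <= 2 * (e * (c * \<nu> h))" using d(2)[OF V small(1)] d'(2)[OF V small(2)] c
    norm_triangle_ineq4[of "f (%i. y i + c *R h i) - f y - c *R D' h" "f (%i. y i + c *R h i) - f y - c *R D h"] by (simp add: s \<nu>(1))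
  hence "c * norm (D h - D' h) <= c * (e * (2 * \<nu> h))" using c by (simp add: scaleR_diff_right[symmetric] mult_ac)
  thus ?thesis using c by simp
 qed
 note * = this
 have "norm (D h - D' h) <= 0"
 proof (rule field_le_epsilon)
  fix e :: real assume e: "e > 0"
  have "norm (D h - D' h) <= e / (2 * \<nu> h + 1) * (2 * \<nu> h)" using e \<nu>(2) by (intro *) simp
  also have "... <= e" using e \<nu>(2) by (simp add: divide_le_eq)
  finally show "norm (D h - D' h) <= 0 + e" by simp
 qed
 thus ?thesis by simp
qed

text \<open>\<open>dv u T\<close> is the differential of \<open>flow _ T\<close> at \<open>u\<close>, right-translated to the identity.\<close>

definition dv :: "(real => 'e) => real => (real => 'e) => 'e" where
 "dv u T h = integral {0..T} (%t. Ad (flow u t) (h t))"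

lemma dv_integrable: "ctrl u ==> ctrl h ==> 0 <= a ==> (%t. Ad (flow u t) (h t)) integrable_on {a..b}" by (intro ctrl_integrable ctrl_Ad_flow)

lemma dv_add: "ctrl u ==> ctrl h ==> ctrl k ==> dv u T (%t. h t + k t) = dv u T h + dv u T k"
 by (simp add: dv_def linear_add[OF linear_Ad] integral_add dv_integrable)

lemma dv_scale: "dv u T (%t. c *R h t) = c *R dv u T h" by (simp add: dv_def linear_scale[OF linear_Ad])

lemma ctrl_sum: "finite B ==> (!!b. b : B ==> ctrl (h b)) ==> ctrl (%t. SUM b:B. a b *R h b t)"
 by (induction B rule: finite_induct) (auto intro!: ctrl_add ctrl_scaleR)

lemma dv_sum: "finite B ==> ctrl u ==> (!!b. b : B ==> ctrl (h b)) ==>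
  dv u T (%t. SUM b:B. a b *R h b t) = (SUM b:B. a b *R dv u T (h b))"
proof (induction B rule: finite_induct)
 case empty thus ?case using dv_scale[of u T 0] by simp
next
 case (insert b B)
 thus ?case using dv_add[of u "%t. a b *R h b t" "%t. SUM b:B. a b *R h b t" T] by (simp add: ctrl_sum ctrl_scaleR dv_scale)
qed

lemma L1_sum:
 assumes "finite B" and h: "!!b. b : B ==> ctrl (h b)"
 shows "L1 T (%t. SUM b:B. a b *R h b t) <= (SUM b:B. abs (a b) * L1 T (h b))"
proof -
 have "L1 T (%t. SUM b:B. a b *R h b t) <= integral {0..T} (%t. SUM b:B. abs (a b) * norm (h b t))"
  using assms by (intro integral_le ctrl_norm_integrable integrable_sum integrable_on_mult_right ctrl_sum)
   (auto intro!: order_trans[OF norm_sum])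
 also have "... = (SUM b:B. abs (a b) * L1 T (h b))" using assms by (subst integral_sum) (auto intro!: ctrl_norm_integrable integrable_on_mult_right)
 finally show ?thesis .
qed

text \<open>Continuity in the parameter is the hypothesis of both Sussmann's and Brouwer's
  theorem.\<close>

lemma flow_affine_family_continuous:
 assumes u: "ctrl u" and h: "!!b. b : Basis ==> ctrl (h b)"
 shows "continuous_on UNIV (%a::'e. flow (%t. u t + (SUM b:Basis. (a \<bullet> b) *R h b t)) T)" unfolding continuous_on_def
proof
 fix a :: 'e
 let ?s = "%a t. SUM b:Basis. (a \<bullet> b) *R h b t"
 have c: "ctrl (?s a)" for a :: 'e by (intro ctrl_sum finite_Basis h)
 have e: "(u t + ?s n t) - (u t + ?s a t) = ?s (n - a) t" for n t by (simp add: inner_diff_left scaleR_diff_left sum_subtractf)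
 show "((%a. flow (%t. u t + ?s a t) T) ---> flow (%t. u t + ?s a t) T) (at a within UNIV)"
 proof (rule flow_L1_tendsto)
  show "((%n. L1 T (%t. (u t + ?s n t) - (u t + ?s a t))) ---> 0) (at a)" unfolding e
  proof (rule tendsto_sandwich[of "%_. 0"])
   have "L1 T (?s (n - a)) <= (SUM b:Basis. abs ((n - a) \<bullet> b) * L1 T (h b))" for n by (intro L1_sum finite_Basis h)
   thus "\<forall>\<^sub>F n in at a. L1 T (?s (n - a)) <= (SUM b:Basis. abs ((n - a) \<bullet> b) * L1 T (h b))" by simp
   have "((%n. SUM b:Basis. abs ((n - a) \<bullet> b) * L1 T (h b)) ---> (SUM b:Basis. abs ((a - a) \<bullet> b) * L1 T (h b))) (at a)"
    by (intro tendsto_intros)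
   thus "((%n. SUM b:Basis. abs ((n - a) \<bullet> b) * L1 T (h b)) ---> 0) (at a)" by simp
   show "\<forall>\<^sub>F n in at a. 0 <= L1 T (?s (n - a))" using L1_nonneg[OF c] by simp
  qed simp
 qed (use u c in "simp_all add: ctrl_add")
qed

end

text \<open>A finite-dimensional or \<open>L\<^sup>\<infinity>\<close> family \<open>\<Theta>\<close> of controls; the differential is computed in the
  coordinate \<open>\<k>\<close> after a right translation by the inverse of the base point.\<close>

locale control_family = local_lie G \<k> \<pi> F br R r L
 for G :: "'g::t2_space monoid" (structure)
  and \<k> :: "'g => 'e::euclidean_space" and \<pi> :: "'e => 'g"
  and F :: "'e => 'e => 'e" and br :: "'e => 'e => 'e" and R r L :: real +
 fixes VV :: "('i => 'e) set" and \<nu> :: "('i => 'e) => real" and \<Theta> :: "('i => 'e) => real => 'e"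
  and u0 :: "real => 'e" and T c0 :: real and f :: "('i => 'e) => 'g"
 assumes VV_add: "!!h k. h : VV ==> k : VV ==> (%i. h i + k i) : VV"
  and VV_scale: "!!h c. h : VV ==> (%i. c *R h i) : VV"
  and VV_0: "(%i. 0) : VV"
  and \<nu>_nonneg: "!!h. h : VV ==> 0 <= \<nu> h"
  and \<nu>_scale: "!!h c. h : VV ==> \<nu> (%i. c *R h i) = abs c * \<nu> h"
  and \<nu>_triangle: "!!h k. h : VV ==> k : VV ==> \<nu> (%i. h i + k i) <= \<nu> h + \<nu> k"
  and \<Theta>_ctrl: "!!h. h : VV ==> ctrl (\<Theta> h)"
  and \<Theta>_add: "!!h k t. h : VV ==> k : VV ==> \<Theta> (%i. h i + k i) t = \<Theta> h t + \<Theta> k t"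
  and \<Theta>_scale: "!!h c t. h : VV ==> \<Theta> (%i. c *R h i) t = c *R \<Theta> h t"
  and c0: "0 <= c0" "!!h. h : VV ==> L1 T (\<Theta> h) <= c0 * \<nu> h"
  and u0: "ctrl u0" and T: "0 <= T"
  and f_eq: "!!z. z : VV ==> f z = flow (%t. u0 t + \<Theta> z t) T"
begin

definition Dv :: "('i => 'e) => ('i => 'e) => 'e" where
 "Dv y h = dv (%t. u0 t + \<Theta> y t) T (\<Theta> h)"

lemma base_ctrl: "y : VV ==> ctrl (%t. u0 t + \<Theta> y t)" by (intro ctrl_add u0 \<Theta>_ctrl)

lemma \<Theta>_add': "h : VV ==> k : VV ==> \<Theta> (%i. h i + k i) = (%t. \<Theta> h t + \<Theta> k t)"
 and \<Theta>_scale': "h : VV ==> \<Theta> (%i. c *R h i) = (%t. c *R \<Theta> h t)" by (auto simp: \<Theta>_add \<Theta>_scale)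

lemma Dv_add: "y : VV ==> h : VV ==> k : VV ==> Dv y (%i. h i + k i) = Dv y h + Dv y k"
 by (simp add: Dv_def \<Theta>_add' dv_add base_ctrl \<Theta>_ctrl)

lemma Dv_scale: "y : VV ==> h : VV ==> Dv y (%i. c *R h i) = c *R Dv y h" by (simp add: Dv_def \<Theta>_scale' dv_scale)

lemma Dv_estimates:
 assumes y: "y : VV"
 obtains K \<r> where "0 <= K" "0 < \<r>" "!!h. h : VV ==> norm (Dv y h) <= K * \<nu> h"
  "!!h. h : VV ==> \<nu> h < \<r> ==> f (%i. y i + h i) \<otimes> inv (f y) : U r"
  "!!h. h : VV ==> \<nu> h < \<r> ==> norm (\<k> (f (%i. y i + h i) \<otimes> inv (f y)) - Dv y h) <= K * (\<nu> h)\<^sup>2"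
proof -
 let ?u = "%t. u0 t + \<Theta> y t"
 obtain K \<r> where K: "0 <= K" "0 < \<r>"
  "!!h. ctrl h ==> L1 T h <= \<r> ==> flow (%t. ?u t + h t) T \<otimes> inv (flow ?u T) : U r"
  "!!h. ctrl h ==> L1 T h <= \<r> ==> norm (\<k> (flow (%t. ?u t + h t) T \<otimes> inv (flow ?u T)) -
    integral {0..T} (%t. Ad (flow ?u t) (h t))) <= K * (L1 T h)\<^sup>2"
  "!!h. ctrl h ==> norm (integral {0..T} (%t. Ad (flow ?u t) (h t))) <= K * L1 T h" by (rule flow_derivative[OF base_ctrl[OF y] T]) blast
 have fe: "f (%i. y i + h i) = flow (%t. ?u t + \<Theta> h t) T" if "h : VV" for h
  using f_eq[OF VV_add[OF y that]] by (simp add: \<Theta>_add[OF y that] add.assoc)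
 have fy: "f y = flow ?u T" by (rule f_eq[OF y])
 show thesis
 proof (rule that[of "K * c0 + K * c0\<^sup>2" "\<r> / (c0 + 1)"])
  show "0 <= K * c0 + K * c0\<^sup>2" using K c0 by simp
  show "0 < \<r> / (c0 + 1)" using K c0 by simp
  fix h assume h: "h : VV"
  have n: "0 <= \<nu> h" by (rule \<nu>_nonneg[OF h])
  have "norm (Dv y h) <= K * L1 T (\<Theta> h)" unfolding Dv_def dv_def by (rule K(5)[OF \<Theta>_ctrl[OF h]])
  also have "... <= K * (c0 * \<nu> h)" by (rule mult_left_mono[OF c0(2)[OF h] K(1)])
  also have "... <= (K * c0 + K * c0\<^sup>2) * \<nu> h" using n K(1) by (simp add: distrib_right)
  finally show "norm (Dv y h) <= (K * c0 + K * c0\<^sup>2) * \<nu> h" .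
  assume s: "\<nu> h < \<r> / (c0 + 1)"
  have "\<nu> h * (c0 + 1) < \<r>" using s c0(1) by (subst (asm) pos_less_divide_eq) auto
  hence L: "L1 T (\<Theta> h) <= \<r>" using c0(2)[OF h] n by (simp add: algebra_simps)
  show "f (%i. y i + h i) \<otimes> inv (f y) : U r" unfolding fe[OF h] fy by (rule K(3)[OF \<Theta>_ctrl[OF h] L])
  have "norm (\<k> (f (%i. y i + h i) \<otimes> inv (f y)) - Dv y h) <= K * (L1 T (\<Theta> h))\<^sup>2"
   unfolding fe[OF h] fy Dv_def dv_def by (rule K(4)[OF \<Theta>_ctrl[OF h] L])
  also have "... <= K * (c0 * \<nu> h)\<^sup>2" by (intro mult_left_mono power_mono c0(2)[OF h] L1_nonneg \<Theta>_ctrl h K(1))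
  also have "... <= (K * c0 + K * c0\<^sup>2) * (\<nu> h)\<^sup>2" using K(1) c0(1) by (simp add: power_mult_distrib distrib_right)
  finally show "norm (\<k> (f (%i. y i + h i) \<otimes> inv (f y)) - Dv y h) <= (K * c0 + K * c0\<^sup>2) * (\<nu> h)\<^sup>2" .
 qed
qed

lemma Dv_has_derivative:
 assumes y: "y : VV"
 shows "has_derivative_in VV \<nu> (%z. \<k> (f z \<otimes> inv (f y))) (Dv y) y"
proof -
 obtain K \<r> where K: "0 <= K" "0 < \<r>" "!!h. h : VV ==> norm (Dv y h) <= K * \<nu> h"
  "!!h. h : VV ==> \<nu> h < \<r> ==> norm (\<k> (f (%i. y i + h i) \<otimes> inv (f y)) - Dv y h) <= K * (\<nu> h)\<^sup>2"
  by (rule Dv_estimates[OF y]) blast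
 have "EX \<d>>0. ALL h:VV. \<nu> h < \<d> --> norm (\<k> (f (%i. y i + h i) \<otimes> inv (f y)) - \<k> (f y \<otimes> inv (f y)) - Dv y h) <= \<epsilon> * \<nu> h"
  if e: "\<epsilon> > 0" for \<epsilon>
 proof (intro exI[of _ "min \<r> (\<epsilon> / (K + 1))"] conjI ballI impI)
  show "0 < min \<r> (\<epsilon> / (K + 1))" using K e by simp
  fix h assume h: "h : VV" "\<nu> h < min \<r> (\<epsilon> / (K + 1))"
  have n: "0 <= \<nu> h" by (rule \<nu>_nonneg[OF h(1)])
  have "\<nu> h < \<epsilon> / (K + 1)" using h by simp
  hence "\<nu> h * (K + 1) < \<epsilon>" using K(1) by (subst (asm) pos_less_divide_eq) auto
  hence "K * \<nu> h <= \<epsilon>" using n by (simp add: algebra_simps)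
  hence "K * (\<nu> h)\<^sup>2 <= \<epsilon> * \<nu> h" using mult_right_mono[OF _ n, of "K * \<nu> h" \<epsilon>] by (simp add: power2_eq_square mult.assoc)
  thus "norm (\<k> (f (%i. y i + h i) \<otimes> inv (f y)) - \<k> (f y \<otimes> inv (f y)) - Dv y h) <= \<epsilon> * \<nu> h"
   using K(4)[of h] h by (simp add: gsimps)
 qed
 thus ?thesis unfolding has_derivative_in_def using K(3) Dv_add[OF y] Dv_scale[OF y] by blast
qed

lemma sub_at_iff:
 assumes y: "y : VV"
 shows "sub_at VV \<nu> f y <-> Dv y ` VV = UNIV"
proof
 assume "sub_at VV \<nu> f y"
 then obtain D where D: "has_derivative_in VV \<nu> (%z. \<k> (f z \<otimes> inv (f y))) D y" "D ` VV = UNIV" unfolding sub_at_def by blast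
 have "D h = Dv y h" if "h : VV" for h
  by (rule has_derivative_in_unique[OF D(1) Dv_has_derivative[OF y] that VV_scale[OF that] \<nu>_scale[OF that] \<nu>_nonneg[OF that]])
 hence "Dv y ` VV = D ` VV" by (intro image_cong) auto
 with D(2) show "Dv y ` VV = UNIV" by simp
next
 assume o: "Dv y ` VV = UNIV"
 obtain K \<r> where K: "0 < \<r>" "0 <= K" "!!h. h : VV ==> \<nu> h < \<r> ==> f (%i. y i + h i) \<otimes> inv (f y) : U r"
  "!!h. h : VV ==> \<nu> h < \<r> ==> norm (\<k> (f (%i. y i + h i) \<otimes> inv (f y)) - Dv y h) <= K * (\<nu> h)\<^sup>2"
  by (rule Dv_estimates[OF y]) blast
 have "EX \<r>>0. ALL h:VV. \<nu> h < \<r> --> f (%i. y i + h i) \<otimes> inv (f y) : U R" using K(1,3) U_mono[OF radii(2)] by blast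
 thus "sub_at VV \<nu> f y" unfolding sub_at_def using Dv_has_derivative[OF y] o by blast
qed

lemma VV_sum: "finite B ==> (!!b. b : B ==> h b : VV) ==> (%i. SUM b:B. c b *R h b i) : VV &
  \<nu> (%i. SUM b:B. c b *R h b i) <= (SUM b:B. abs (c b) * \<nu> (h b)) &
  \<Theta> (%i. SUM b:B. c b *R h b i) = (%t. SUM b:B. c b *R \<Theta> (h b) t)"
proof (induction B rule: finite_induct)
 case empty
 thus ?case using VV_0 \<nu>_scale[OF VV_0, of 0] \<Theta>_scale'[OF VV_0, of 0] by simp
next
 case (insert b B)
 have 1: "(%i. c b *R h b i) : VV" "(%i. SUM b:B. c b *R h b i) : VV" using insert VV_scale by auto
 show ?case using insert VV_add[OF 1] \<nu>_triangle[OF 1] \<nu>_scale[of "h b" "c b"] \<Theta>_add'[OF 1] \<Theta>_scale'[of "h b" "c b"] by simp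
qed

text \<open>Preimages \<open>hh b\<close> of the basis vectors span a finite-dimensional family
  \<open>H\<close>. In the coordinate \<open>g\<close> the restricted map is continuous near 0 and
  has the identity as derivative at 0, which is all that Sussmann's theorem needs.\<close>

lemma open_at_if_surj:
 assumes y: "y : VV" and surj: "Dv y ` VV = UNIV"
 shows "open_at VV \<nu> f y" unfolding open_at_def
proof (intro allI impI)
 fix S assume S: "S \<subseteq> VV" "EX \<r>>0. ALL z:VV. \<nu> (%i. z i - y i) < \<r> --> z : S"
 then obtain \<r>0 where \<r>0: "\<r>0 > 0" "!!z. z : VV ==> \<nu> (%i. z i - y i) < \<r>0 ==> z : S" by blast
 obtain \<r>1 where K: "0 < \<r>1" "!!h. h : VV ==> \<nu> h < \<r>1 ==> f (%i. y i + h i) \<otimes> inv (f y) : U r"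
  by (rule Dv_estimates[OF y]) blast
 have "ALL b. EX h:VV. Dv y h = b" using surj by (metis UNIV_I imageE)
 then obtain hh where hh: "!!b. hh b : VV" "!!b. Dv y (hh b) = b" by metis
 define H where "H a = (%i. SUM b:Basis. (a \<bullet> b) *R hh b i)" for a :: 'e
 define M where "M = (SUM b:(Basis::'e set). \<nu> (hh b)) + 1"
 have M: "0 < M" unfolding M_def by (intro add_nonneg_pos sum_nonneg \<nu>_nonneg hh) simp
 note vs = VV_sum[of Basis hh "%b. a \<bullet> b" for a, OF finite_Basis hh(1), folded H_def]
 have HV: "H a : VV" for a using vs by blast
 have \<Theta>H: "\<Theta> (H a) = (%t. SUM b:Basis. (a \<bullet> b) *R \<Theta> (hh b) t)" for a using vs by blast
 have DH: "Dv y (H a) = a" for a using hh(2) unfolding Dv_def \<Theta>H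
  by (subst dv_sum) (auto intro: base_ctrl y \<Theta>_ctrl hh simp: euclidean_representation)
 have \<nu>H: "\<nu> (H a) <= M * norm a" for a
 proof -
  have "\<nu> (H a) <= (SUM b:Basis. abs (a \<bullet> b) * \<nu> (hh b))" using vs by blast
  also have "... <= (SUM b:Basis. norm a * \<nu> (hh b))" by (intro sum_mono mult_right_mono Basis_le_norm \<nu>_nonneg hh)
  finally show ?thesis by (simp add: M_def sum_distrib_left[symmetric] algebra_simps add_increasing)
 qed
 have small: "\<nu> (H a) < d" if "norm a < d / M" for a d using \<nu>H[of a] that M by (simp add: field_simps)
 define \<r>2 where "\<r>2 = min \<r>0 \<r>1 / M"
 have \<r>2: "0 < \<r>2" using \<r>0 K M by (simp add: \<r>2_def)
 define g where "g a = \<k> (f (%i. y i + H a i) \<otimes> inv (f y))" for a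
 have gU: "f (%i. y i + H a i) \<otimes> inv (f y) : U R" if "norm a < \<r>2" for a
  using K(2)[OF HV] small[OF that[unfolded \<r>2_def]] U_mono[OF radii(2)] by auto
 have "f (%i. y i + H a i) = flow (%t. (u0 t + \<Theta> y t) + (SUM b:Basis. (a \<bullet> b) *R \<Theta> (hh b) t)) T" for a
  using f_eq[OF VV_add[OF y HV]] by (simp add: \<Theta>_add'[OF y HV] \<Theta>H add.assoc)
 hence cont: "continuous_on UNIV (%a. f (%i. y i + H a i))"
  using flow_affine_family_continuous[OF base_ctrl[OF y], of "%b. \<Theta> (hh b)"] hh \<Theta>_ctrl by simp
 have contg: "continuous_on (ball 0 \<r>2) g" unfolding continuous_on_def
 proof
  fix a assume a: "a : ball (0::'e) \<r>2"
  have "((%a'. f (%i. y i + H a' i) \<otimes> inv (f y)) ---> f (%i. y i + H a i) \<otimes> inv (f y)) (at a)"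
   using cont by (intro tendsto_mult_G tendsto_const) (simp add: continuous_on_def)
  hence "(g ---> g a) (at a)" unfolding g_def using gU[of a] a by (intro tendsto_\<k>') auto
  thus "(g ---> g a) (at a within ball 0 \<r>2)" using tendsto_within_subset by blast
 qed
 have H0: "H 0 = (%i. 0)" by (simp add: H_def)
 have g0: "g 0 = 0" by (simp add: g_def H0 gsimps)
 have derg: "(g has_derivative (%a. a)) (at 0)" unfolding has_derivative_at_alt
 proof (intro conjI bounded_linear_ident allI impI)
  fix e :: real assume "e > 0"
  hence e: "e / M > 0" using M by simp
  then obtain \<d> where \<d>: "0 < \<d>" "!!h. h : VV ==> \<nu> h < \<d> ==>
    norm (\<k> (f (%i. y i + h i) \<otimes> inv (f y)) - \<k> (f y \<otimes> inv (f y)) - Dv y h) <= e / M * \<nu> h"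
   using Dv_has_derivative[OF y] unfolding has_derivative_in_def by blast
  show "EX d>0. ALL a. norm (a - 0) < d --> norm (g a - g 0 - (a - 0)) <= e * norm (a - 0)"
  proof (intro exI[of _ "\<d> / M"] conjI allI impI)
   fix a :: 'e assume "norm (a - 0) < \<d> / M"
   hence "norm (g a - g 0 - a) <= e / M * \<nu> (H a)" using \<d>(2)[OF HV small, of a] by (simp add: g_def H0 DH)
   also have "... <= e / M * (M * norm a)" using \<nu>H e by (intro mult_left_mono) auto
   finally show "norm (g a - g 0 - (a - 0)) <= e * norm (a - 0)" using M by simp
  qed (use \<d> M in simp)
 qed
 have "g 0 : interior (g ` ball 0 \<r>2)" by (rule sussmann_open_mapping[OF open_ball contg _ derg bounded_linear_ident])
   (use \<r>2 in "auto simp: fun_eq_iff")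
 then obtain e where e: "0 < e" "ball 0 e \<subseteq> g ` ball 0 \<r>2" unfolding g0 mem_interior by blast
 define e' where "e' = min e R"
 have e': "0 < e'" "e' <= R" "e' <= e" using e R_pos by (auto simp: e'_def)
 have sub: "{x. x \<otimes> inv (f y) : U e'} \<subseteq> f ` S"
 proof
  fix x assume "x : {x. x \<otimes> inv (f y) : U e'}"
  hence xU: "x \<otimes> inv (f y) : U R" "\<n> (x \<otimes> inv (f y)) < e'" using U_iff[OF e'(2)] by auto
  hence "\<k> (x \<otimes> inv (f y)) : g ` ball 0 \<r>2" using e(2) e'(3) by (auto simp: subset_iff)
  then obtain a where a: "norm a < \<r>2" "\<k> (x \<otimes> inv (f y)) = g a" by auto
  have "x \<otimes> inv (f y) = f (%i. y i + H a i) \<otimes> inv (f y)"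
   using a(2) U_D[OF xU(1) order_refl] U_D[OF gU[OF a(1)] order_refl] unfolding g_def by metis
  hence "x = f (%i. y i + H a i)" by (simp add: mult_right_cancel)
  moreover have "(%i. y i + H a i) : S" using \<r>0(2)[OF VV_add[OF y HV], of a] small[OF a(1)[unfolded \<r>2_def]] by simp
  ultimately show "x : f ` S" by blast
 qed
 have op: "open {x. x \<otimes> inv (f y) : U e'}" by (intro open_translate open_U e')
 show "f y : interior (f ` S)" by (rule interiorI[OF op _ sub]) (use e'(1) in "simp add: gsimps")
qed

end

section \<open>Regular controls\<close>

text \<open>Difference quotients lie in \<open>J\<close>, and a subspace of a finite-dimensional
  space is closed.\<close>

lemma vector_derivative_in_subspace:
 fixes f :: "real => 'e::euclidean_space"
 assumes J: "subspace J" and der: "(f has_vector_derivative d) (at t within S)"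
  and nt: "at t within S ~= bot" and f: "!!s. s : S ==> f s : J" "t : S"
 shows "d : J"
proof -
 have "EX y:J. dist y d < e" if e: "e > 0" for e
 proof -
  obtain \<d> where \<d>: "\<d> > 0" "!!s. s : S ==> norm (s - t) < \<d> ==>
    norm (f s - f t - (s - t) *R d) <= e / 2 * norm (s - t)"
   using der e unfolding has_vector_derivative_def has_derivative_within_alt by (meson half_gt_zero)
  obtain s where s: "s : S" "s ~= t" "dist s t < \<d>" using nt \<d>(1) unfolding trivial_limit_within islimpt_approachable by blast
  have "(1 / (s - t)) *R (f s - f t) : J" by (intro subspace_scale subspace_diff J f s)
  moreover have "norm ((1 / (s - t)) *R (f s - f t) - d) = norm (f s - f t - (s - t) *R d) / norm (s - t)"
  proof -
   have "(1 / (s - t)) *R (f s - f t) - d = (1 / (s - t)) *R (f s - f t - (s - t) *R d)" using s(2) by (simp add: scaleR_diff_right)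
   thus ?thesis by simp
  qed
  moreover have "... <= e / 2" using \<d>(2)[OF s(1)] s by (simp add: dist_norm divide_le_eq)
  ultimately have "norm ((1 / (s - t)) *R (f s - f t) - d) <= e / 2" by linarith
  with \<open>(1 / (s - t)) *R (f s - f t) : J\<close> e show ?thesis by (force simp: dist_norm)
 qed
 hence "ALL e>0. EX y:J. dist y d < e" by blast
 thus ?thesis using closed_subspace[OF J] by (simp add: closed_approachable)
qed

lemma AE_neq: "AE t in lebesgue. t ~= (S::real)" by (simp add: AE_lebesgue_iff)

context local_lie
begin

lemma dv_diff: "ctrl u ==> ctrl h ==> ctrl k ==> dv u T (%t. h t - k t) = dv u T h - dv u T k"
 by (simp add: dv_def linear_diff[OF linear_Ad] integral_diff dv_integrable)

lemma dv_cong_AE: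
 assumes u: "ctrl u" and uv: "ae {0..T} (%t. u t = v t)"
  and hk: "ae {0..T} (%t. h t = k t)"
 shows "dv v T k = dv u T h"
proof -
 have "flow v t = flow u t" if "t : {0..T}" for t by (rule flow_cong_AE[OF u]) (use uv in eventually_elim, use that in auto)
 thus ?thesis unfolding dv_def by (intro integral_cong_AE_lebesgue) (use hk in eventually_elim, auto)
qed

lemma dv_concat:
 assumes u: "ctrl u" "ctrl h" and v: "ctrl v" "ctrl k" and ST: "0 <= S" "0 <= T"
 shows "dv (%t. if t < S then u t else v (t - S)) (S + T) (%t. if t < S then h t else k (t - S)) =
  dv u S h + Ad (flow u S) (dv v T k)"
proof -
 let ?c = "%t. if t < S then u t else v (t - S)" and ?h = "%t. if t < S then h t else k (t - S)"
 let ?f = "%t. Ad (flow ?c t) (?h t)"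
 have "integral {0..S} ?f = dv u S h" unfolding dv_def
 proof (rule integral_cong_AE_lebesgue, use AE_neq[of S] in eventually_elim, rule impI)
  fix t assume "t ~= S" "t : {0..S}"
  moreover from this have "flow ?c t = flow u t" by (intro flow_cong u) auto
  ultimately show "?f t = Ad (flow u t) (h t)" by simp
 qed
 moreover have "integral {S..S + T} ?f = integral {0..T} (?f \<circ> (+) S)" by (simp add: integral_shift_Icc_real add.commute)
 moreover have "integral {0..T} (?f \<circ> (+) S) = integral {0..T} (%t. Ad (flow u S) (Ad (flow v t) (k t)))"
  by (rule integral_cong) (simp add: flow_concat[OF u(1) v(1) ST(1)] Ad_mult)
 moreover have "... = Ad (flow u S) (dv v T k)"
  unfolding dv_def by (rule integral_linear[OF dv_integrable[OF v order_refl] bounded_linear_Ad, unfolded o_def])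
 moreover have "integral {0..S} ?f + integral {S..S + T} ?f = integral {0..S + T} ?f"
  using ST by (intro Henstock_Kurzweil_Integration.integral_combine dv_integrable ctrl_concat u v) auto
 ultimately show ?thesis by (simp add: dv_def)
qed

lemma dv_bound:
 assumes "ctrl u"
 obtains C where "0 <= C" "!!h. ctrl h ==> norm (dv u T h) <= C * L1 T h"
proof -
 obtain B where B: "0 <= B" "!!g v. g : flow u ` {0..T} ==> norm (Ad g v) <= B * norm v" by (rule Ad_compact_bound[OF flow_compact[OF assms]]) blast
 have "norm (dv u T h) <= B * L1 T h" if h: "ctrl h" for h
 proof -
  have "norm (dv u T h) <= integral {0..T} (%t. B * norm (h t))" unfolding dv_def
   by (intro Henstock_Kurzweil_Integration.integral_norm_bound_integral dv_integrable assms h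
     integrable_on_mult_right ctrl_norm_integrable B(2)) auto
  thus ?thesis by simp
 qed
 with B(1) show thesis by (rule that)
qed

text \<open>By \<open>flow_variation\<close> the flow of \<open>u\<close> is the flow of the small
  control \<open>Ad (flow w t) (u t - w t)\<close> times the flow of \<open>w\<close>; so the two
  \<open>Ad\<close> differ by the action of an element near the identity, which
  \<open>Ad_near\<close> estimates.\<close>

lemma dv_lipschitz:
 assumes w: "ctrl w"
 obtains C d where "0 <= C" "0 < d" "!!u h. ctrl u ==> ctrl h ==> L1 T (%t. u t - w t) <= d ==>
  norm (dv u T h - dv w T h) <= C * L1 T (%t. u t - w t) * L1 T h"
proof -
 obtain B where B: "0 <= B" "!!g v. g : flow w ` {0..T} ==> norm (Ad g v) <= B * norm v" by (rule Ad_compact_bound[OF flow_compact[OF w]]) blast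
 obtain \<r> K where K: "0 < \<r>" "\<r> <= R" "0 <= K" "!!x v. x : U \<r> ==> norm (Ad x v - v) <= K * \<n> x * norm v" by (rule Ad_near) blast
 define d where "d = min (r / 8) (\<r> / 4) / (B + 1)"
 have d: "0 < d" using radii(1) K(1) B(1) by (simp add: d_def)
 have Bd: "B * d <= min (r / 8) (\<r> / 4)"
 proof -
  have "B * d <= (B + 1) * d" using d by simp
  thus ?thesis using B(1) by (simp add: d_def)
 qed
 have main: "norm (dv u T h - dv w T h) <= (K * (2 * B) * B) * L1 T (%t. u t - w t) * L1 T h"
  if u: "ctrl u" and h: "ctrl h" and s: "L1 T (%t. u t - w t) <= d" for u h
 proof -
  let ?k = "%t. u t - w t" and ?a = "%t. Ad (flow w t) (u t - w t)"
  have k: "ctrl ?k" "ctrl ?a" by (intro ctrl_Ad_flow ctrl_diff u w)+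
  have step: "norm (Ad (flow u t) v - Ad (flow w t) v) <= (K * (2 * B) * B) * L1 T ?k * norm v"
   if t: "t : {0..T}" for t v
  proof -
   have "L1 t ?a <= B * L1 t ?k" by (rule L1_le[OF k]) (use B(2) t in "auto intro!: AE_I2")
   also have "... <= B * L1 T ?k" using t B(1) by (intro mult_left_mono integral_nonneg_mono_interval ctrl_norm_integrable k) auto
   finally have La: "L1 t ?a <= B * L1 T ?k" .
   hence "L1 t ?a <= min (r / 8) (\<r> / 4)" using mult_left_mono[OF s B(1)] Bd by linarith
   hence y: "flow ?a t : U r" "\<n> (flow ?a t) <= 2 * L1 t ?a" "2 * L1 t ?a < \<r>" using flow_small[OF k(2), of t] t K(1) by auto
   have "flow ?a t : U \<r>" using y U_iff[OF K(2)] U_mono[OF radii(2)] by auto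
   from K(4)[OF this, of "Ad (flow w t) v"]
   have "norm (Ad (flow u t) v - Ad (flow w t) v) <= K * \<n> (flow ?a t) * norm (Ad (flow w t) v)"
    using flow_variation[OF w k(1), of t] by (simp add: Ad_mult)
   also have "... <= K * (2 * (B * L1 T ?k)) * (B * norm v)"
   proof (intro mult_mono)
    show "\<n> (flow ?a t) <= 2 * (B * L1 T ?k)" using y(2) La by linarith
    show "norm (Ad (flow w t) v) <= B * norm v" using B(2) t by auto
   qed (use K(3) B(1) L1_nonneg[OF k(1), of T] in "auto intro!: mult_nonneg_nonneg")
   finally show ?thesis by (simp add: mult_ac)
  qed
  have "norm (integral {0..T} (%t. Ad (flow u t) (h t) - Ad (flow w t) (h t))) <=
    integral {0..T} (%t. ((K * (2 * B) * B) * L1 T ?k) * norm (h t))"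
   by (intro Henstock_Kurzweil_Integration.integral_norm_bound_integral integrable_diff dv_integrable u w h
     integrable_on_mult_right ctrl_norm_integrable step) auto
  thus ?thesis using u w h by (simp add: dv_def integral_diff dv_integrable)
 qed
 show thesis by (rule that[OF _ d main]) (use K(3) B(1) in auto)
qed

lemma L1_add: "ctrl h ==> ctrl k ==> L1 T (%t. h t + k t) <= L1 T h + L1 T k" by (subst integral_add[symmetric])
  (auto intro!: integral_le ctrl_norm_integrable integrable_add ctrl_add norm_triangle_ineq)

lemma germ_flow_const: "germ (flow (%_. v)) {0..} 0 v" unfolding germ_def
proof (intro conjI)
 have small: "flow (%_. v) t : U r & norm (\<k> (flow (%_. v) t) - t *R v) <= 2 * L * (t * norm v)\<^sup>2"
  if "0 <= t" "t * norm v <= r / 8" for t using flow_small[OF ctrl_const, of t v] that by simp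
 define d where "d = r / 8 / (norm v + 1)"
 have d: "0 < d" using radii(1) by (simp add: d_def add_nonneg_pos)
 have td: "t * norm v <= r / 8" if "0 <= t" "t < d" for t
 proof -
  have "t * norm v <= d * (norm v + 1)" using that d by (intro mult_mono) auto
  also have "... = r / 8"
  proof -
   have "norm v + 1 ~= 0" using norm_ge_zero[of v] by linarith
   thus ?thesis unfolding d_def by (intro nonzero_eq_divide_eq[THEN iffD1]) auto
  qed
  finally show ?thesis .
 qed
 have "\<forall>\<^sub>F t in at 0 within {0..}. 0 <= t & t < d" unfolding eventually_at using d by (intro exI[of _ d]) (auto simp: dist_real_def)
 thus "\<forall>\<^sub>F t in at 0 within {0..}. flow (%_. v) t : U R" by eventually_elim (use small td U_mono[OF radii(2)] in blast)
 show "((%s. \<k> (flow (%_. v) s)) has_vector_derivative v) (at 0 within {0..})" unfolding has_vector_derivative_def has_derivative_within_alt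
 proof (intro conjI bounded_linear_scaleR_left allI impI)
  fix e :: real assume e: "e > 0"
  define C where "C = 2 * L * (norm v)\<^sup>2"
  have C: "0 <= C" using radii(3) by (simp add: C_def)
  show "EX d>0. ALL t:{0..}. norm (t - 0) < d -->
    norm (\<k> (flow (%_. v) t) - \<k> (flow (%_. v) 0) - (t - 0) *R v) <= e * norm (t - 0)"
  proof (intro exI[of _ "min d (e / (C + 1))"] conjI ballI impI)
   show "0 < min d (e / (C + 1))" using d e C by simp
   fix t :: real assume t: "t : {0..}" "norm (t - 0) < min d (e / (C + 1))"
   hence "t * (C + 1) < e" using C by (auto simp: pos_less_divide_eq)
   hence Ct: "C * t <= e" using t by (simp add: distrib_left mult.commute)
   have "norm (\<k> (flow (%_. v) t) - t *R v) <= (C * t) * t" using small[of t] td[of t] t by (simp add: C_def power2_eq_square mult_ac)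
   also have "... <= e * t" using Ct t by (intro mult_right_mono) auto
   finally show "norm (\<k> (flow (%_. v) t) - \<k> (flow (%_. v) 0) - (t - 0) *R v) <= e * norm (t - 0)" using t by (simp add: gsimps)
  qed
 qed
qed simp

end

section \<open>Horizontal controls and regularity\<close>

context stratified_lie
begin

definition horiz :: "(real => 'e) => bool" where
 "horiz h <-> ctrl h & (ALL t. h t : gs 1)"

definition reg :: "(real => 'e) => real => bool" where
 "reg u T <-> dv u T ` {h. horiz h} = UNIV"

lemma V_subspace: "subspace (gs 1)" using gs_subspace s_ge_1 by auto

lemma horiz_0: "horiz (%_. 0)" using subspace_0[OF V_subspace] by (simp add: horiz_def)

lemma horiz_add: "horiz h ==> horiz k ==> horiz (%t. h t + k t)" using subspace_add[OF V_subspace] by (auto simp: horiz_def ctrl_add)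

lemma horiz_scale: "horiz h ==> horiz (%t. c *R h t)" using subspace_scale[OF V_subspace] by (auto simp: horiz_def ctrl_scaleR)

lemma horiz_sum: "finite B ==> (!!b. b : B ==> horiz (h b)) ==> horiz (%t. SUM b:B. a b *R h b t)"
 unfolding horiz_def by (intro conjI ctrl_sum allI subspace_sum[OF V_subspace] subspace_scale[OF V_subspace]) auto

lemma horiz_concat: "horiz u ==> horiz v ==> horiz (%t. if t < S then u t else v (t - S))" using ctrl_concat[of u v S] by (auto simp: horiz_def)

lemma horiz_stretch: "horiz u ==> 0 < c ==> horiz (%t. u (c * t))" using ctrl_affine[of u 0 c] by (auto simp: horiz_def)

lemma horiz_ctrl: "horiz u ==> ctrl u" by (simp add: horiz_def)

lemma flow_stretch:
 assumes u: "horiz u" and c: "0 < c" and t: "0 <= t"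
 shows "flow u (c * t) = D c (flow (%t. u (c * t)) t)" using horiz_stretch[OF u c] u c t by (simp add: flow_scale horiz_def D_flow_first)

text \<open>Substitution in the integral gives a factor \<open>c\<close>; writing a horizontal
  vector as \<open>dil c\<close> of \<open>1 / c\<close> times itself, so that \<open>D_Ad\<close>
  applies, gives the factor \<open>1 / c\<close> that cancels it.\<close>

lemma dv_stretch:
 assumes u: "horiz u" and h: "horiz h" and c: "0 < c"
 shows "dv u c h = dil c (dv (%t. u (c * t)) 1 (%t. h (c * t)))"
proof -
 let ?f = "%t. Ad (flow u t) (h t)" and ?w = "%t. u (c * t)" and ?h = "%t. h (c * t)"
 have cs: "ctrl ?w" "ctrl ?h" using horiz_stretch[OF u c] horiz_stretch[OF h c] by (simp_all add: horiz_ctrl)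
 have "(?f has_integral dv u c h) (cbox 0 c)" unfolding dv_def using dv_integrable[of u h 0 c] u h by (simp add: horiz_def integrable_integral)
 from has_integral_affinity'[OF this c, of 0]
 have "dv u c h = c *R integral {0..1} (%t. ?f (c * t))" using c by (auto simp: integral_unique)
 also have "integral {0..1} (%t. ?f (c * t)) = integral {0..1} (%t. (1 / c) *R dil c (Ad (flow ?w t) (?h t)))"
 proof (rule integral_cong)
  fix t :: real assume t: "t : {0..1}"
  have "?h t = dil c ((1 / c) *R ?h t)" using h c by (simp add: dil_first horiz_def linear_scale[OF dil_linear])
  hence "?f (c * t) = Ad (D c (flow ?w t)) (dil c ((1 / c) *R ?h t))" using flow_stretch[OF u c, of t] t by simp
  thus "?f (c * t) = (1 / c) *R dil c (Ad (flow ?w t) (?h t))" by (simp only: D_Ad linear_scale[OF linear_Ad] linear_scale[OF dil_linear])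
 qed
 also have "... = (1 / c) *R integral {0..1} (%t. dil c (Ad (flow ?w t) (?h t)))" by simp
 also have "integral {0..1} (%t. dil c (Ad (flow ?w t) (?h t))) = dil c (dv ?w 1 ?h)" unfolding dv_def
  by (rule integral_linear[OF dv_integrable[OF cs order_refl] linear_conv_bounded_linear[THEN iffD1, OF dil_linear], unfolded o_def])
 finally show ?thesis using c by simp
qed

lemma surj_dil: "c ~= 0 ==> surj (dil c)" using dil_dil[of c "1 / c"] dil_1 by (metis divide_self_if mult.commute surjI times_divide_eq_left mult_1)

text \<open>Stretching permutes the horizontal perturbations, and \<open>dil c\<close> is
  bijective.\<close>

lemma reg_stretch:
 assumes u: "horiz u" and c: "0 < c"
 shows "reg u c <-> reg (%t. u (c * t)) 1"
proof -
 have inj: "inj (dil c)" using linear_surjective_imp_injective[OF dil_linear surj_dil] c by auto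
 have "(%h t. h (c * t)) ` {h. horiz h} = {h. horiz h}"
 proof (intro equalityI subsetI)
  fix h :: "real => 'e" assume "h : {h. horiz h}"
  thus "h : (%h t. h (c * t)) ` {h. horiz h}" using c horiz_stretch[of h "1 / c"] by (intro image_eqI[of _ _ "%t. h (1 / c * t)"]) auto
 qed (use horiz_stretch c in auto)
 hence "dv u c ` {h. horiz h} = dil c ` dv (%t. u (c * t)) 1 ` {h. horiz h}" using dv_stretch[OF u _ c] by (force simp: image_iff)
 thus ?thesis unfolding reg_def using inj surj_dil[of c] c by (metis inj_image_eq_iff less_numeral_extra(3))
qed

text \<open>Perturbing the first piece alone already reaches every vector; the second piece adds
  nothing to the differential.\<close>

lemma reg_concat:
 assumes u: "horiz u" "reg u S" and v: "horiz v" and ST: "0 <= S" "0 <= T"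
 shows "reg (%t. if t < S then u t else v (t - S)) (S + T)" unfolding reg_def
proof (intro equalityI subsetI UNIV_I)
 fix x :: 'e
 obtain h where h: "horiz h" "dv u S h = x" using u(2) unfolding reg_def by (metis UNIV_I imageE mem_Collect_eq)
 have "dv v T (%_. 0) = 0" using dv_scale[of v T 0] by simp
 hence "dv (%t. if t < S then u t else v (t - S)) (S + T) (%t. if t < S then h t else 0) = x"
  using dv_concat[OF horiz_ctrl[OF u(1)] horiz_ctrl[OF h(1)] horiz_ctrl[OF v] horiz_ctrl[OF horiz_0] ST] h(2) by (simp add: linear_0[OF linear_Ad])
 thus "x : dv (%t. if t < S then u t else v (t - S)) (S + T) ` {h. horiz h}"
  using horiz_concat[OF h(1) horiz_0, of S] by (intro image_eqI[of _ _ "%t. if t < S then h t else 0"]) auto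
qed

text \<open>Let \<open>M\<close> collect all \<open>Ad (flow v t) h\<close> with \<open>v\<close>
  admissible and \<open>h\<close> in the first layer. Prepending a constant admissible control shows
  that \<open>span M\<close> is invariant under \<open>Ad\<close> of constant flows; the derivative
  at time zero makes it stable under \<open>br\<close>, so it is everything. Maximality of the
  dimension places \<open>M\<close> in the translated image \<open>J\<close>.\<close>

lemma exists_regular:
 assumes X: "X : gs 1" and \<eta>: "0 < \<eta>"
 obtains w where "horiz w" "!!t. norm (w t - X) < \<eta>" "reg w 1"
proof -
 define adm where "adm u <-> horiz u & (ALL t. norm (u t - X) < \<eta>)" for u
 define K where "K = (%(u, T). dv u T ` {h. horiz h})"
 let ?cat = "%S u v t. if t < S then u t else v (t - S)"
 have adm_cat: "adm (?cat S u v)" if "adm u" "adm v" for S u v using that horiz_concat[of u v S] by (auto simp: adm_def)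
 have adm_const: "adm (%_. v)" if "v : gs 1" "norm (v - X) < \<eta>" for v using that by (simp add: adm_def horiz_def)
 have admX: "adm (%_. X)" using X \<eta> by (intro adm_const) auto
 have sub: "subspace (K (u, T))" if "adm u" for u T unfolding subspace_def
 proof (intro conjI ballI allI)
  show "0 : K (u, T)" using dv_scale[of u T 0] horiz_0 unfolding K_def by (auto intro!: image_eqI[of _ _ "%_. 0"])
  fix x assume "x : K (u, T)"
  then obtain h where h: "horiz h" "x = dv u T h" by (auto simp: K_def)
  show "c *R x : K (u, T)" for c unfolding K_def using h horiz_scale by (auto intro!: image_eqI[of _ _ "%t. c *R h t"] simp: dv_scale)
  fix y assume "y : K (u, T)"
  then obtain k where k: "horiz k" "y = dv u T k" by (auto simp: K_def)
  show "x + y : K (u, T)" unfolding K_def using h k horiz_add that by (auto intro!: image_eqI[of _ _ "%t. h t + k t"] simp: dv_add adm_def horiz_ctrl)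
 qed
 let ?P = "%p::(real => 'e) \<times> real. adm (fst p) & 0 < snd p"
 obtain p where p: "?P p" "!!q. ?P q ==> dim (K q) <= dim (K p)"
 proof -
  have "ALL q. ?P q --> dim (K q) < Suc DIM('e)" using dim_subset_UNIV le_imp_less_Suc by blast
  moreover have "?P ((%_. X), 1)" using admX by simp
  ultimately have "EX p. ?P p & (ALL q. ?P q --> dim (K q) <= dim (K p))" by (rule ex_has_greatest_nat[of ?P _ "%q. dim (K q)", rotated])
  thus thesis using that by blast
 qed
 obtain u T where uT: "p = (u, T)" by (cases p)
 have u: "adm u" "horiz u" "0 < T" using p(1) uT by (auto simp: adm_def)
 define g where "g = flow u T"
 \<comment> \<open>A control appended after \<open>u\<close> contributes \<open>Ad g\<close> of its
   own differential. By maximality this lies in \<open>K p\<close> already, so \<open>J\<close>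
   contains the differentials of all admissible controls.\<close>
 define J where "J = {x. Ad g x : K p}"
 have Jsub: "subspace J" unfolding J_def using sub[OF u(1), of T] uT by (auto simp: subspace_def Ad_simps)
 have mem: "dv v t h : J" if v: "adm v" "0 <= t" and h: "horiz h" for v t h
 proof -
  have hv: "horiz v" using v by (simp add: adm_def)
  let ?q = "(?cat T u v, T + t)"
  have 1: "dv u T k + Ad g (dv v t l) : K ?q" if "horiz k" "horiz l" for k l
   unfolding g_def dv_concat[OF horiz_ctrl[OF u(2)] horiz_ctrl[OF that(1)] horiz_ctrl[OF hv] horiz_ctrl[OF that(2)] less_imp_le[OF u(3)] v(2), symmetric]
   using horiz_concat[OF that, of T] by (auto simp: K_def)
  have "K p \<subseteq> K ?q"
  proof
   fix x assume "x : K p"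
   then obtain k where "horiz k" "x = dv u T k" using uT by (auto simp: K_def)
   with 1[OF this(1) horiz_0] show "x : K ?q" using dv_scale[of v t 0] by (simp add: linear_0[OF linear_Ad])
  qed
  moreover have "dim (K ?q) <= dim (K p)" using p(2)[of ?q] adm_cat[OF u(1) v(1)] u v by auto
  ultimately have "K p = K ?q" using sub[OF u(1)] sub[OF adm_cat[OF u(1) v(1)]] uT by (intro subspace_dim_equal) auto
  with 1[OF horiz_0 h] show ?thesis using dv_scale[of u T 0] by (simp add: J_def)
 qed
 define M where "M = {Ad (flow v t) h | v t h. adm v & 0 <= t & h : gs 1}"
 have "M \<subseteq> J"
 proof
  fix x assume "x : M"
  then obtain v t h where v: "adm v" "0 <= t" "h : gs 1" "x = Ad (flow v t) h" by (auto simp: M_def)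
  \<comment> \<open>Differentiating in the upper limit passes from the integrals to the integrand.
    The interval reaches beyond \<open>t\<close> so that \<open>t = 0\<close> is not
    isolated.\<close>
  have "((%s. integral {0..s} (%t. Ad (flow v t) h)) has_vector_derivative Ad (flow v t) h) (at t within {0..t+1})"
   using v by (intro integral_has_vector_derivative continuous_on_subset[OF continuous_on_Ad[OF continuous_on_flow]])
    (auto simp: adm_def horiz_ctrl)
  moreover have "at t within {0..t + 1} ~= bot" using v(2) by (simp add: trivial_limit_within islimpt_Icc)
  ultimately have "Ad (flow v t) h : J" using vector_derivative_in_subspace[OF Jsub, of _ "Ad (flow v t) h" t "{0..t+1}"] mem[OF v(1), of _ "%_. h"] v
   by (simp add: dv_def horiz_def)
  thus "x : J" using v by simp
 qed
 hence MJ: "span M \<subseteq> J" using Jsub by (rule span_minimal)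
 have inv: "Ad (flow (%_. v) t) x : span M" if v: "v : gs 1" "norm (v - X) < \<eta>" "0 <= t" and x: "x : span M" for v t x
 proof -
  have "Ad (flow (%_. v) t) y : M" if "y : M" for y
  proof -
   from that obtain v' t' h where v': "adm v'" "0 <= t'" "h : gs 1" "y = Ad (flow v' t') h" by (auto simp: M_def)
   have "Ad (flow (%_. v) t) y = Ad (flow (?cat t (%_. v) v') (t + t')) h"
    using v' v flow_concat[OF ctrl_const[of v], of v' t t'] by (simp add: adm_def horiz_ctrl Ad_mult)
   thus ?thesis unfolding M_def using adm_cat[OF adm_const[OF v(1,2)] v'(1), of t] v' v(3)
    by (intro CollectI exI[of _ "?cat t (%_. v) v'"] exI[of _ "t + t'"] exI[of _ h]) auto
  qed
  hence "Ad (flow (%_. v) t) ` span M \<subseteq> span M" unfolding linear_span_image[OF linear_Ad, symmetric] by (intro span_mono) auto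
  thus ?thesis using x by auto
 qed
 have br1: "br v x : span M" if v: "v : gs 1" "norm (v - X) < \<eta>" and x: "x : span M" for v x
  using inv[OF v] x by (intro vector_derivative_in_subspace[OF subspace_span germ_Ad[OF germ_flow_const]])
   (auto simp: at_within_Ici_at_right)
 have "br v x : span M" if v: "v : gs 1" and x: "x : span M" for v x
 proof -
  \<comment> \<open>Only vectors near \<open>X\<close> are admissible. Both \<open>X\<close> and
    \<open>X + e *R v\<close> are, and the difference of their brackets is \<open>e\<close> times
    the bracket with \<open>v\<close>.\<close>
  define e where "e = \<eta> / 2 / (norm v + 1)"
  have e: "0 < e" using \<eta> by (simp add: e_def add_nonneg_pos)
  have "e * norm v <= e * (norm v + 1)" using e by simp
  also have "... = \<eta> / 2"
  proof -
   have "norm v + 1 ~= 0" using norm_ge_zero[of v] by linarith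
   thus ?thesis unfolding e_def by (intro nonzero_eq_divide_eq[THEN iffD1]) auto
  qed
  finally have "norm (X + e *R v - X) < \<eta>" using \<eta> e by simp
  hence "br (X + e *R v) x : span M" using v X x by (intro br1 subspace_add[OF V_subspace] subspace_scale[OF V_subspace])
  moreover have "br X x : span M" using br1[OF X _ x] \<eta> by simp
  ultimately have "br (X + e *R v) x - br X x : span M" by (rule span_diff)
  hence "(1 / e) *R (br (X + e *R v) x - br X x) : span M" by (rule span_scale)
  thus ?thesis using e by (simp add: linear_add[OF linear_br_left] linear_scale[OF linear_br_left])
 qed
 moreover have "gs 1 \<subseteq> span M"
 proof
  fix h assume "h : gs 1"
  hence "h : M" unfolding M_def using admX by (intro CollectI exI[of _ "%_. X"] exI[of _ 0] exI[of _ h]) (auto simp: Ad_one)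
  thus "h : span M" by (rule span_base)
 qed
 ultimately have "span M = UNIV" by (intro generated subspace_span) auto
 hence J: "J = UNIV" using MJ by auto
 have "reg u T" unfolding reg_def
 proof (intro equalityI subsetI UNIV_I)
  fix x
  have "Ad (inv g) x : J" using J by simp
  thus "x : dv u T ` {h. horiz h}" by (simp add: J_def K_def uT Ad_inv)
 qed
 hence "reg (%t. u (T * t)) 1" using reg_stretch[OF u(2,3)] by simp
 with horiz_stretch[OF u(2,3)] u(1) show thesis by (intro that) (auto simp: adm_def)
qed

end

section \<open>Step controls\<close>

text \<open>Steps of length one, so that the flow at time \<open>p\<close> is the product of
  \<open>p\<close> exponentials. The shift by 1 matches tuples indexed from 1.\<close>

definition st :: "(nat => 'e) => real => 'e" where
 "st W t = W (nat \<lfloor>t\<rfloor> + 1)"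

text \<open>Cell averages on the unit interval; after \<open>t \<mapsto> m * t\<close> they are the
  values of a step control. Zero off \<open>{1..m}\<close> as tuples require.\<close>

definition avg :: "nat => (real => 'e::euclidean_space) => nat => 'e" where
 "avg m u i = (if i : {1..m} then real m *R integral {(real i - 1) / real m..real i / real m} u else 0)"

lemma tuples_0: "subspace V ==> (%i. 0) : tuples p V" by (simp add: tuples_def subspace_0)

lemma tuples_add: "subspace V ==> W : tuples p V ==> H : tuples p V ==> (%i. W i + H i) : tuples p V" by (auto simp: tuples_def subspace_add)

lemma tuples_scale: "subspace V ==> W : tuples p V ==> (%i. c *R W i) : tuples p V" by (auto simp: tuples_def subspace_scale)

lemma tuples_sum:
 "subspace V ==> (!!b. b : B ==> H b : tuples p V) ==> (%i. SUM b:B. a b *R H b i) : tuples p V"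
 unfolding tuples_def by (auto intro!: subspace_sum subspace_scale sum.neutral)

lemma st_sum: "st (%i. W i + (SUM b:B. a b *R H b i)) t = st W t + (SUM b:B. a b *R st (H b) t)" by (simp add: st_def)

lemma st_ctrl:
 assumes "W : tuples p V"
 shows "ctrl (st W)"
proof (rule ctrl_bounded)
 have "st W : borel_measurable borel" unfolding st_def by measurable
 thus "st W : borel_measurable lebesgue" by (simp add: measurable_completion)
 show "norm (st W t) <= (\<Sum>i=1..p. norm (W i))" for t using assms member_le_sum[of "nat \<lfloor>t\<rfloor> + 1" "{1..p}" "%i. norm (W i)"]
  by (cases "nat \<lfloor>t\<rfloor> + 1 : {1..p}") (auto simp: st_def tuples_def sum_nonneg)
qed

lemma st_index:
 assumes "0 < m" "t : {0..<1}"
 obtains i where "i : {1..m}" "(real i - 1) / real m <= t" "t < real i / real m" "!!W. st W (real m * t) = W i"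
proof -
 let ?k = "nat \<lfloor>real m * t\<rfloor>"
 have "real m * t < real m" using assms by simp
 hence k: "real ?k <= real m * t" "real m * t < real ?k + 1" "?k < m" using assms by (auto simp: nat_less_iff floor_less_iff; linarith)+
 show thesis by (rule that[of "?k + 1"]) (use k assms in "auto simp: st_def field_simps")
qed

lemma st_const: "t : {0..<real p} ==> st (const_tuple p X) t = X" by (auto simp: st_def const_tuple_def nat_less_iff floor_less_iff Suc_le_eq)

lemma avg_sum:
 assumes u: "ctrl u" and h: "!!b. b : B ==> ctrl (h b)" and B: "finite B"
 shows "avg m (%t. u t + (SUM b:B. a b *R h b t)) = (%i. avg m u i + (SUM b:B. a b *R avg m (h b) i))"
proof (intro ext)
 fix i
 have "integral {(real i - 1) / real m..real i / real m} (%t. u t + (SUM b:B. a b *R h b t)) =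
   integral {(real i - 1) / real m..real i / real m} u +
   (SUM b:B. a b *R integral {(real i - 1) / real m..real i / real m} (h b))" if "1 <= i"
 proof -
  have 0: "0 <= (real i - 1) / real m" using that by simp
  have "(%t. a b *R h b t) integrable_on {(real i - 1) / real m..real i / real m}" if "b : B" for b
   using h[OF that] 0 by (intro ctrl_integrable ctrl_scaleR)
  thus ?thesis using u 0 B by (simp add: integral_add ctrl_integrable integrable_sum integral_sum)
 qed
 thus "avg m (%t. u t + (SUM b:B. a b *R h b t)) i = avg m u i + (SUM b:B. a b *R avg m (h b) i)"
  unfolding avg_def by (cases "i : {1..m}") (simp_all add: scaleR_add_right scaleR_sum_right mult.commute if_not_P)
qed

lemma avg_near:
 assumes u: "ctrl u" and X: "ae {0..1} (%t. norm (u t - X) <= C)" "0 <= C" and i: "i : {1..m}"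
 shows "norm (avg m u i - X) <= C"
proof -
 let ?a = "(real i - 1) / real m" and ?b = "real i / real m"
 have m: "0 < real m" and ab: "0 <= ?a" "?a <= ?b" "?b <= 1" "?b - ?a = 1 / real m" using i by (auto simp: divide_simps)
 have "norm (integral {?a..?b} (%t. u t - X)) <= C * (?b - ?a)" using ab X(2) u by (intro integral_norm_bound_AE ctrl_integrable ctrl_diff ctrl_const)
   (use X(1) ab in "auto elim: eventually_mono")
 moreover have "integral {?a..?b} (%t. u t - X) = (1 / real m) *R (avg m u i - X)"
  using ab i m u by (subst integral_diff) (auto simp: ctrl_integrable avg_def scaleR_diff_right)
 ultimately show ?thesis using m unfolding ab(4) by (simp add: divide_le_eq)
qed

lemma ctrl_st_avg: "ctrl (%t. st (avg m u) (real m * t))"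
proof (cases "m = 0")
 case False
 have "avg m u : tuples m UNIV" by (auto simp: avg_def tuples_def)
 from st_ctrl[OF this] ctrl_affine[of "st (avg m u)" 0 "real m"] False show ?thesis by simp
qed simp

text \<open>On a cell containing \<open>t\<close> the average is a straddled difference quotient of the primitive, so the
  averages converge almost everywhere.\<close>

lemma st_avg_tendsto:
 assumes u: "ctrl u"
 shows "(%m. integral {0..1} (%t. norm (st (avg m u) (real m * t) - u t))) \<longlonglongrightarrow> 0"
proof -
 obtain C where C: "0 <= C" "ae {0..1} (%t. norm (u t) <= C)" by (rule ctrlE[OF u, of 1])
 have C0: "ae {0..1} (%t. norm (u t - 0) <= C)" using C(2) by simp
 let ?P = "%s. integral {0..s} u"
 \<comment> \<open>The point \<open>t = 1\<close> is excluded: there \<open>st\<close> picks the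
   index \<open>m + 1\<close>, at which \<open>avg\<close> is 0. Off the null set of bad points the
   integrand is replaced by 0, so that bound and limit hold everywhere.\<close>
 define good where "good t <-> t : {0..<1} & norm (u t) <= C & (?P has_vector_derivative u t) (at t within {0..1})" for t
 have good: "ae {0..1} (%t. good t)" using C(2) has_vector_derivative_indefinite_integral_AE[OF ctrl_integrable[OF u order_refl, of 1]] AE_neq[of 1]
  by eventually_elim (auto simp: good_def)
 define f where "f m t = (if good t then norm (st (avg m u) (real m * t) - u t) else 0)" for m t
 have eq: "integral {0..1} (f m) = integral {0..1} (%t. norm (st (avg m u) (real m * t) - u t))" for m
  by (rule integral_cong_AE_lebesgue) (use good in eventually_elim, auto simp: f_def)
 have int: "f m integrable_on {0..1}" for m
 proof (rule integrable_spike[where S="{t. ~ (t : {0..1} --> good t)}"])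
  show "(%t. norm (st (avg m u) (real m * t) - u t)) integrable_on {0..1}" by (intro ctrl_norm_integrable ctrl_diff ctrl_st_avg u) auto
 qed (use good in "auto simp: f_def AE_lebesgue_iff")
 have bound: "norm (f m t) <= 2 * C" if "0 < m" for m t
 proof (cases "good t")
  case True
  hence t: "t : {0..<1}" by (simp add: good_def)
  obtain i where i: "i : {1..m}" "(real i - 1) / real m <= t" "t < real i / real m" "!!W::nat => 'a. st W (real m * t) = W i"
   by (rule st_index[OF \<open>0 < m\<close>, where 'a='a and t=t]) (use t in simp_all)
  have "norm (avg m u i) <= C" using avg_near[OF u C0 C(1) i(1)] by simp
  thus ?thesis using True norm_triangle_ineq4[of "avg m u i" "u t"] by (simp add: f_def good_def i(4))
 qed (simp add: f_def C)
 have lim: "(%m. f m t) \<longlonglongrightarrow> 0" for t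
 proof (cases "good t")
  case True
  show ?thesis
  proof (rule LIMSEQ_I)
   fix e :: real assume e: "0 < e"
   obtain d where d: "d > 0" "!!s. s : {0..1} ==> norm (s - t) < d ==>
     norm (?P s - ?P t - (s - t) *R u t) <= e / 2 * norm (s - t)"
    using True e unfolding good_def has_vector_derivative_def has_derivative_within_alt by (meson half_gt_zero)
   obtain M where M: "1 / d < real M" using reals_Archimedean2 by blast
   show "EX M. ALL m>=M. norm (f m t - 0) < e"
   proof (intro exI[of _ "Suc M"] allI impI)
    fix m assume m: "Suc M <= m"
    hence "0 < m" "1 / d < real m" using M by auto
    hence md: "1 / real m < d" using d(1) by (simp add: field_simps)
    obtain i where i: "i : {1..m}" "(real i - 1) / real m <= t" "t < real i / real m" "!!W::nat => 'a. st W (real m * t) = W i"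
     by (rule st_index[OF \<open>0 < m\<close>, where 'a='a and t=t]) (use True in "simp_all add: good_def")
    let ?a = "(real i - 1) / real m" and ?b = "real i / real m"
    have ab: "0 <= ?a" "?b <= 1" "?b = ?a + 1 / real m" using i(1) by (auto simp: divide_simps)
    have "?P ?a + integral {?a..?b} u = ?P ?b" using ab u by (intro Henstock_Kurzweil_Integration.integral_combine ctrl_integrable) auto
    hence I: "integral {?a..?b} u = ?P ?b - ?P ?a" by (simp add: algebra_simps)
    have "?P ?b - ?P t - (?b - t) *R u t - (?P ?a - ?P t - (?a - t) *R u t) =
      (1 / real m) *R (avg m u i - u t)" using i(1) \<open>0 < m\<close> unfolding avg_def ab(3) I[unfolded ab(3)] by (simp add: algebra_simps)
    hence "norm ((1 / real m) *R (avg m u i - u t)) <=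
      norm (?P ?b - ?P t - (?b - t) *R u t) + norm (?P ?a - ?P t - (?a - t) *R u t)" by (metis norm_triangle_ineq4)
    also have "... <= e / 2 * norm (?b - t) + e / 2 * norm (?a - t)" using ab i md by (intro add_mono d(2); simp)
    also have "... = e / 2 * (1 / real m)" using i ab(3) by (simp add: algebra_simps)
    finally have "norm (avg m u i - u t) * (1 / real m) <= e / 2 * (1 / real m)" by simp
    hence "norm (avg m u i - u t) <= e / 2" by (rule mult_right_le_imp_le) (use \<open>0 < m\<close> in simp)
    thus "norm (f m t - 0) < e" using e by (simp add: f_def i(4))
   qed
  qed
 qed (simp add: f_def)
 \<comment> \<open>Shifted index, because the bound by \<open>2 * C\<close> is available for
   positive \<open>m\<close> only.\<close>
 have "(%m. integral {0..1} (f (Suc m))) \<longlonglongrightarrow> integral {0..1} (%t::real. 0::real)"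
  by (rule dominated_convergence(2)[where h="%_. 2 * C"]) (use int bound LIMSEQ_Suc[OF lim] in auto)
 hence "(%m. integral {0..1} (f (Suc m))) \<longlonglongrightarrow> 0" by simp
 from LIMSEQ_imp_Suc[OF this] show ?thesis unfolding eq .
qed

text \<open>A vanishing combination satisfies \<open>norm a \<le> norm a / 2\<close>, since each of
  the \<open>DIM('e)\<close> deviations contributes at most \<open>norm a / (2 * DIM('e))\<close>.
  So the family is linearly independent and spans.\<close>

lemma perturbed_basis:
 fixes x :: "'e::euclidean_space => 'e"
 assumes "!!b. b : Basis ==> norm (x b - b) <= 1 / (2 * real DIM('e))"
 obtains a where "(SUM b:Basis. (a \<bullet> b) *R x b) = z"
proof -
 let ?f = "%a. SUM b:Basis. (a \<bullet> b) *R x b"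
 have lin: "linear ?f" by (rule linearI) (simp_all add: inner_add_left scaleR_add_left sum.distrib scaleR_sum_right)
 have "a = 0" if "?f a = 0" for a :: 'e
 proof -
  have "norm a = norm (?f a - (SUM b:Basis. (a \<bullet> b) *R b))" by (simp only: that euclidean_representation) simp
  also have "... = norm (SUM b:Basis. (a \<bullet> b) *R (x b - b))" by (simp add: sum_subtractf scaleR_diff_right)
  also have "... <= (SUM b:(Basis::'e set). norm a * (1 / (2 * real DIM('e))))"
   by (intro order_trans[OF norm_sum] sum_mono, unfold norm_scaleR, intro mult_mono Basis_le_norm assms) auto
  finally show ?thesis by simp
 qed
 hence "inj ?f" unfolding linear_injective_0[OF lin] by blast
 hence "surj ?f" by (intro linear_injective_imp_surjective[OF lin]) auto
 then obtain a where "z = ?f a" by (rule surjE)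
 thus thesis by (intro that) (rule sym)
qed

section \<open>Regular step controls\<close>

context stratified_lie
begin

text \<open>Surjectivity from perturbations that are steps on the same unit grid, a
  finite-dimensional space; this is the submersion condition for the multiexponential.\<close>

definition reg_tuple :: "nat => (nat => 'e) => bool" where
 "reg_tuple m W <-> (%H. dv (st W) (real m) (st H)) ` tuples m (gs 1) = UNIV"

lemma st_horiz: "W : tuples p (gs 1) ==> horiz (st W)" using st_ctrl[of W p "gs 1"] subspace_0[OF V_subspace]
 by (auto simp: horiz_def st_def tuples_def)

lemma comp_1_linear: "linear (%x. comp x 1)" and comp_1_V: "comp x 1 : gs 1"
 and comp_1_id: "v : gs 1 ==> comp v 1 = v"
proof -
 show "linear (%x. comp x 1)" by (rule linearI) (simp_all add: comp_add comp_scale)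
 show "comp x 1 : gs 1" using comp_props(1)[of x 1] s_ge_1 by (simp add: layer_def)
 show "v : gs 1 ==> comp v 1 = v" using comp_layer[of 1 v] s_ge_1 by (simp add: layer_def)
qed

text \<open>The linear projection \<open>comp _ 1\<close> commutes with the integral and fixes the
  values of \<open>u\<close>, so averages stay in the first layer.\<close>

lemma avg_tuple:
 assumes u: "horiz u"
 shows "avg m u : tuples m (gs 1)"
proof -
 have "integral {(real i - 1) / real m..real i / real m} u : gs 1" if "1 <= i" for i
 proof -
  have "u integrable_on {(real i - 1) / real m..real i / real m}" using u that by (simp add: horiz_def ctrl_integrable)
  from integral_linear[OF this linear_conv_bounded_linear[THEN iffD1, OF comp_1_linear]]
  have "integral {(real i - 1) / real m..real i / real m} (%t. comp (u t) 1) : gs 1" unfolding o_def by (simp only: comp_1_V)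
  moreover have "(%t. comp (u t) 1) = u" using u comp_1_id unfolding horiz_def by blast
  ultimately show ?thesis by simp
 qed
 thus ?thesis using subspace_scale[OF V_subspace] by (auto simp: tuples_def avg_def)
qed

text \<open>Approximate surjectivity suffices: \<open>perturbed_basis\<close> tolerates an error of
  \<open>1 / (2 * DIM('e))\<close> in each basis direction, and \<open>dv_stretch\<close> passes
  between the unit interval and time \<open>m\<close>.\<close>

lemma reg_tupleI:
 assumes W: "W : tuples m (gs 1)" "0 < m" and H: "!!b. b : Basis ==> H b : tuples m (gs 1)"
  and near: "!!b. b : Basis ==>
   norm (dv (%t. st W (real m * t)) 1 (%t. st (H b) (real m * t)) - b) <= 1 / (2 * real DIM('e))"
 shows "reg_tuple m W" unfolding reg_tuple_def
proof (intro equalityI subsetI UNIV_I)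
 fix z :: 'e
 let ?w = "%t. st W (real m * t)" and ?h = "%b t. st (H b) (real m * t)"
 have m: "0 < real m" using W by simp
 obtain z' where z': "dil (real m) z' = z" using surj_dil[of "real m"] m by (metis less_numeral_extra(3) surjD)
 obtain a where a: "(SUM b:Basis. (a \<bullet> b) *R dv ?w 1 (?h b)) = z'" by (rule perturbed_basis[OF near]) auto
 have hw: "horiz (st W)" "horiz ?w" and hh: "b : Basis ==> horiz (?h b)" for b using horiz_stretch m st_horiz[OF W(1)] st_horiz[OF H] by auto
 define H' where "H' = (%i. 0 + (SUM b:Basis. (a \<bullet> b) *R H b i))"
 have H': "H' : tuples m (gs 1)" unfolding H'_def using tuples_sum[OF V_subspace, of Basis H] H by simp
 have "dv (st W) (real m) (st H') = dil (real m) (dv ?w 1 (%t. st H' (real m * t)))" by (rule dv_stretch[OF hw(1) st_horiz[OF H'] m])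
 also have "(%t. st H' (real m * t)) = (%t. SUM b:Basis. (a \<bullet> b) *R ?h b t)" unfolding H'_def st_sum by (simp add: st_def)
 also have "dv ?w 1 ... = z'" using a hw hh by (simp add: dv_sum horiz_ctrl)
 finally show "z : (%H. dv (st W) (real m) (st H)) ` tuples m (gs 1)" using z' H' by (metis imageI)
qed

lemma reg_basis:
 assumes "reg w 1"
 obtains h where "!!b. horiz (h b)" "!!b. dv w 1 (h b) = b"
proof -
 have "ALL b. EX h. horiz h & dv w 1 h = b" using assms unfolding reg_def by (metis UNIV_I imageE mem_Collect_eq)
 thus thesis using that by metis
qed

lemma eventually_mult_le_at_0:
 assumes "0 < (e::real)"
 shows "\<forall>\<^sub>F s in at_right 0. c * s <= e"
proof -
 have "((%s. c * s) ---> c * 0) (at_right 0)" by (intro tendsto_intros)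
 hence "\<forall>\<^sub>F s in at_right 0. c * s < e" by (rule order_tendstoD) (use assms in simp)
 thus ?thesis by eventually_elim simp
qed

text \<open>The base control is a step control already, so only the perturbations need averaging,
  and the differential at a fixed control is bounded in L1.\<close>

lemma reg_const_tuple:
 assumes X: "X : gs 1" and reg: "reg (%_. X) 1"
 shows "EX m>=1. reg_tuple m (const_tuple m X)"
proof -
 obtain h where h: "!!b. horiz (h b)" "!!b. dv (%_. X) 1 (h b) = b" using reg_basis[OF reg] by blast
 obtain B where B: "0 <= B" "!!h. ctrl h ==> norm (dv (%_. X) 1 h) <= B * L1 1 h" by (rule dv_bound[OF ctrl_const[of X], of 1]) blast
 let ?h = "%m b t. st (avg m (h b)) (real m * t)"
 have "(%m. B * (SUM b:Basis. L1 1 (%t. ?h m b t - h b t))) \<longlonglongrightarrow> B * (SUM b:(Basis::'e set). 0)"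
  by (intro tendsto_intros st_avg_tendsto horiz_ctrl h)
 hence "\<forall>\<^sub>F m in sequentially. B * (SUM b:Basis. L1 1 (%t. ?h m b t - h b t)) < 1 / (2 * real DIM('e))" by (rule order_tendstoD) simp
 hence "\<forall>\<^sub>F m in sequentially. 0 < m & B * (SUM b:Basis. L1 1 (%t. ?h m b t - h b t)) < 1 / (2 * real DIM('e))"
  using eventually_gt_at_top[of 0] by eventually_elim simp
 then obtain m where m: "0 < m" "B * (SUM b:Basis. L1 1 (%t. ?h m b t - h b t)) < 1 / (2 * real DIM('e))"
  using eventually_happens'[OF sequentially_bot] by blast
 have "reg_tuple m (const_tuple m X)"
 proof (rule reg_tupleI[OF _ m(1) avg_tuple[OF h(1)]])
  show "const_tuple m X : tuples m (gs 1)" using X by (auto simp: const_tuple_def tuples_def)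
  fix b :: 'e assume b: "b : Basis"
  have "ae {0..1} (%t. X = st (const_tuple m X) (real m * t))" using AE_neq[of 1] by eventually_elim (use m in "auto simp: st_const")
  hence "dv (%t. st (const_tuple m X) (real m * t)) 1 (?h m b) = dv (%_. X) 1 (?h m b)" by (intro dv_cong_AE ctrl_const) auto
  also have "... - b = dv (%_. X) 1 (%t. ?h m b t - h b t)" using h by (subst dv_diff) (auto simp: horiz_ctrl ctrl_st_avg)
  also have "norm ... <= B * L1 1 (%t. ?h m b t - h b t)" by (intro B ctrl_diff ctrl_st_avg horiz_ctrl h)
  also have "... <= B * (SUM b:Basis. L1 1 (%t. ?h m b t - h b t))"
   using b by (intro mult_left_mono B member_le_sum L1_nonneg ctrl_diff ctrl_st_avg horiz_ctrl h) auto
  finally show "norm (dv (%t. st (const_tuple m X) (real m * t)) 1 (?h m b) - b) <= 1 / (2 * real DIM('e))" using m(2) by simp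
 qed
 thus ?thesis using m(1) by (auto simp: Suc_le_eq)
qed

text \<open>Averaging \<open>w\<close> nearly keeps its endpoint and the surjectivity. The endpoint
  is restored exactly by adding \<open>SUM b:Basis. (a \<bullet> b) *R hm m b\<close>: in the
  coordinate at the old endpoint the effect \<open>g a\<close> is so close to \<open>a\<close> that
  Brouwer's theorem yields a zero of \<open>g\<close>.\<close>

lemma regular_step_approx:
 assumes w: "horiz w" "reg w 1" and X: "X : gs 1" and wX: "ae {0..1} (%t. norm (w t - X) <= \<eta>)"
  and \<eta>: "0 < \<eta>"
 obtains m W where "2 <= m" "W : tuples m (gs 1)" "!!i. i : {1..m} ==> norm (W i - X) <= 2 * \<eta>"
  "flow (%t. st W (real m * t)) 1 = flow w 1" "reg_tuple m W"
proof -
 note cw = horiz_ctrl[OF w(1)]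
 obtain h where h: "!!b. horiz (h b)" "!!b. dv w 1 (h b) = b" using reg_basis[OF w(2)] by blast
 note ch = horiz_ctrl[OF h(1)]
 obtain K \<r> where K: "0 <= K" "0 < \<r>"
  "!!k. ctrl k ==> L1 1 k <= \<r> ==> flow (%t. w t + k t) 1 \<otimes> inv (flow w 1) : U r"
  "!!k. ctrl k ==> L1 1 k <= \<r> ==> norm (\<k> (flow (%t. w t + k t) 1 \<otimes> inv (flow w 1)) - dv w 1 k) <= K * (L1 1 k)\<^sup>2"
  unfolding dv_def by (rule flow_derivative[OF cw zero_le_one]) blast
 obtain C d where C: "0 <= C" "0 < d" "!!u h. ctrl u ==> ctrl h ==> L1 1 (%t. u t - w t) <= d ==>
  norm (dv u 1 h - dv w 1 h) <= C * L1 1 (%t. u t - w t) * L1 1 h" by (rule dv_lipschitz[OF cw, of 1]) blast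
 obtain B where B: "0 <= B" "!!h. ctrl h ==> norm (dv w 1 h) <= B * L1 1 h" by (rule dv_bound[OF cw, of 1]) blast
 define M where "M = (SUM b:Basis. L1 1 (h b))"
 have M: "0 <= M" "b : Basis ==> L1 1 (h b) <= M" for b unfolding M_def by (auto intro!: sum_nonneg member_le_sum L1_nonneg ch)
 have "EX c>=0. ae {0..1} (%t. norm (h b t) <= c)" for b using ctrlE[OF ch, of 1] by metis
 then obtain c where c: "!!b. 0 <= c b" "!!b. ae {0..1} (%t. norm (h b t) <= c b)" by metis
 define M2 where "M2 = (SUM b:(Basis::'e set). c b)"
 have "\<forall>\<^sub>F s in at_right 0. 0 < s & s <= 1 & (M + 2) * s <= min \<r> d & (K * (M + 2)\<^sup>2) * s <= 1 / 2 &
   (C * (M + 2) * (M + 1) + B) * s <= 1 / (2 * real DIM('e)) & M2 * s <= \<eta>"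
  using eventually_mult_le_at_0[of 1 1] eventually_mult_le_at_0[of "min \<r> d" "M + 2"]
   eventually_mult_le_at_0[of "1 / 2" "K * (M + 2)\<^sup>2"] eventually_mult_le_at_0[OF \<eta>, of M2]
   eventually_mult_le_at_0[of "1 / (2 * real DIM('e))" "C * (M + 2) * (M + 1) + B"] K(2) C(2) by (intro eventually_conj eventually_at_right_less) auto
 \<comment> \<open>\<open>s\<close> is the radius of the parameter ball. In order: coefficients are
   at most 1; the controls stay where both estimates for \<open>w\<close> are valid; the quadratic
   error is at most \<open>s / 2\<close>; the differentials meet the tolerance of
   \<open>reg_tupleI\<close>; the correction moves the control by at most
   \<open>\<eta>\<close>.\<close>
 then obtain s where s: "0 < s" "s <= 1" "(M + 2) * s <= min \<r> d" "(K * (M + 2)\<^sup>2) * s <= 1 / 2"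
   "(C * (M + 2) * (M + 1) + B) * s <= 1 / (2 * real DIM('e))" "M2 * s <= \<eta>"
  using eventually_happens[of _ "at_right (0::real)"] by (metis (no_types, lifting) trivial_limit_at_right_real)
 define wm where "wm m = (%t. st (avg m w) (real m * t))" for m
 define hm where "hm m b = (%t. st (avg m (h b)) (real m * t))" for m b
 have cm: "ctrl (wm m)" "ctrl (hm m b)" for m b by (auto simp: wm_def hm_def ctrl_st_avg)
 define \<d> where "\<d> m = L1 1 (%t. wm m t - w t) + (SUM b:Basis. L1 1 (%t. hm m b t - h b t))" for m
 have "\<d> \<longlonglongrightarrow> 0 + (SUM b:(Basis::'e set). 0)" unfolding \<d>_def wm_def hm_def by (intro tendsto_intros st_avg_tendsto cw ch)
 hence "\<forall>\<^sub>F m in sequentially. \<d> m < s / (4 * (B + 1))" using s(1) B(1) by (intro order_tendstoD(2)) auto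
 hence "\<forall>\<^sub>F m in sequentially. 2 <= m & \<d> m < s / (4 * (B + 1))" using eventually_ge_at_top[of 2] by eventually_elim simp
 \<comment> \<open>Averages so fine that \<open>\<d> m\<close> and \<open>B * \<d> m\<close> are at
   most \<open>s / 4\<close>; the error in the linear term is then at most \<open>s / 2\<close>, the
   other half of the radius.\<close>
 then obtain m where m: "2 <= m" "\<d> m < s / (4 * (B + 1))" using eventually_happens'[OF sequentially_bot] by blast
 have m0: "0 < m" using m(1) by simp
 have \<d>1: "L1 1 (%t. wm m t - w t) <= \<d> m" "b : Basis ==> L1 1 (%t. hm m b t - h b t) <= \<d> m" "0 <= \<d> m" for b
 proof -
  have 1: "0 <= L1 1 (%t. wm m t - w t)" "0 <= (SUM b:Basis. L1 1 (%t. hm m b t - h b t))" by (intro sum_nonneg L1_nonneg ctrl_diff cm cw ch)+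
  thus "L1 1 (%t. wm m t - w t) <= \<d> m" "0 <= \<d> m" by (auto simp: \<d>_def)
  assume "b : Basis"
  hence "L1 1 (%t. hm m b t - h b t) <= (SUM b:Basis. L1 1 (%t. hm m b t - h b t))" by (intro member_le_sum L1_nonneg ctrl_diff cm ch) auto
  thus "L1 1 (%t. hm m b t - h b t) <= \<d> m" using 1 by (simp add: \<d>_def)
 qed
 have B\<d>: "4 * (B * \<d> m) + 4 * \<d> m <= s" using m(2) B(1) by (simp add: pos_less_divide_eq algebra_simps)
 have B\<d>0: "0 <= B * \<d> m" using B(1) \<d>1(3) by simp
 have \<d>s: "\<d> m <= s / 4" "B * \<d> m <= s / 4" using B\<d> B\<d>0 \<d>1(3) by linarith+
 define u where "u a t = wm m t + (SUM b:Basis. (a \<bullet> b) *R hm m b t)" for a t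
 have cu: "ctrl (u a)" for a unfolding u_def by (intro ctrl_add ctrl_sum finite_Basis cm)
 have k1: "L1 1 (%t. u a t - w t - (SUM b:Basis. (a \<bullet> b) *R h b t)) <= 2 * \<d> m"
  and k2: "L1 1 (%t. u a t - w t) <= (M + 2) * s" if a: "norm a <= s" for a
 proof -
  let ?k = "%t. u a t - w t - (SUM b:Basis. (a \<bullet> b) *R h b t)"
  have a1: "abs (a \<bullet> b) <= s" if "b : Basis" for b using Basis_le_norm[OF that, of a] a by simp
  have "u a t - w t - (SUM b:Basis. (a \<bullet> b) *R h b t) = (wm m t - w t) + (SUM b:Basis. (a \<bullet> b) *R (hm m b t - h b t))" for t
   by (simp add: u_def scaleR_diff_right sum_subtractf)
  hence "L1 1 ?k <= L1 1 (%t. wm m t - w t) + L1 1 (%t. SUM b:Basis. (a \<bullet> b) *R (hm m b t - h b t))"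
   by (simp only:) (intro L1_add ctrl_diff ctrl_sum finite_Basis cm cw ch)
  also have "L1 1 (%t. SUM b:Basis. (a \<bullet> b) *R (hm m b t - h b t)) <= (SUM b:Basis. abs (a \<bullet> b) * L1 1 (%t. hm m b t - h b t))"
   by (intro L1_sum finite_Basis ctrl_diff cm ch)
  also have "... <= (SUM b:Basis. 1 * L1 1 (%t. hm m b t - h b t))" using a1 s(2) by (intro sum_mono mult_right_mono L1_nonneg ctrl_diff cm ch) force
  also have "... <= \<d> m" using L1_nonneg[OF ctrl_diff[OF cm(1)[of m] cw], of 1] by (simp add: \<d>_def)
  finally show 1: "L1 1 ?k <= 2 * \<d> m" using \<d>1(1) by simp
  have "L1 1 (%t. ?k t + (SUM b:Basis. (a \<bullet> b) *R h b t)) <= L1 1 ?k + L1 1 (%t. SUM b:Basis. (a \<bullet> b) *R h b t)"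
   by (intro L1_add ctrl_diff ctrl_sum finite_Basis cu cw ch)
  also have "L1 1 (%t. SUM b:Basis. (a \<bullet> b) *R h b t) <= (SUM b:Basis. abs (a \<bullet> b) * L1 1 (h b))" by (intro L1_sum finite_Basis ch)
  also have "... <= (SUM b:Basis. s * L1 1 (h b))" by (intro sum_mono mult_right_mono L1_nonneg ch a1)
  also have "... = M * s" by (simp add: M_def sum_distrib_left mult.commute)
  finally have "L1 1 (%t. u a t - w t) <= 2 * \<d> m + M * s" using 1 by simp
  thus "L1 1 (%t. u a t - w t) <= (M + 2) * s" using \<d>s s(1) by (simp add: distrib_right)
 qed
 have cuw: "ctrl (%t. u a t - w t)" for a by (intro ctrl_diff cu cw)
 define g where "g a = \<k> (flow (u a) 1 \<otimes> inv (flow w 1))" for a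
 have gU: "flow (u a) 1 \<otimes> inv (flow w 1) : U R" and gest: "norm (g a - a) <= s" if a: "norm a <= s" for a
 proof -
  have kr: "L1 1 (%t. u a t - w t) <= \<r>" using k2[OF a] s(3) by simp
  show "flow (u a) 1 \<otimes> inv (flow w 1) : U R" using K(3)[OF cuw kr] U_mono[OF radii(2)] by auto
  have "norm (g a - dv w 1 (%t. u a t - w t)) <= K * (L1 1 (%t. u a t - w t))\<^sup>2" using K(4)[OF cuw kr] by (simp add: g_def)
  also have "... <= K * ((M + 2) * s)\<^sup>2" by (intro mult_left_mono power_mono k2 a L1_nonneg cuw K(1))
  also have "... = ((K * (M + 2)\<^sup>2) * s) * s" by (simp add: power2_eq_square)
  also have "... <= 1 / 2 * s" using s by (intro mult_right_mono) auto
  finally have 1: "norm (g a - dv w 1 (%t. u a t - w t)) <= s / 2" by simp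
  have "dv w 1 (%t. SUM b:Basis. (a \<bullet> b) *R h b t) = a" using cw ch by (simp add: dv_sum h(2) euclidean_representation)
  hence "dv w 1 (%t. u a t - w t) - a = dv w 1 (%t. u a t - w t - (SUM b:Basis. (a \<bullet> b) *R h b t))"
   by (subst (2) dv_diff) (auto intro!: cw cuw ctrl_sum ch)
  moreover have "norm ... <= B * L1 1 (%t. u a t - w t - (SUM b:Basis. (a \<bullet> b) *R h b t))"
   by (intro B(2) ctrl_diff cuw ctrl_sum finite_Basis ch)
  moreover have "... <= B * (2 * \<d> m)" by (intro mult_left_mono k1 a B(1))
  ultimately have 2: "norm (dv w 1 (%t. u a t - w t) - a) <= s / 2" using \<d>s(2) by simp
  show "norm (g a - a) <= s" using norm_triangle_ineq[of "g a - dv w 1 (%t. u a t - w t)" "dv w 1 (%t. u a t - w t) - a"] 1 2 by simp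
 qed
 \<comment> \<open>\<open>a - g a\<close> maps the ball of radius \<open>s\<close> into itself. A
   fixed point is a zero of \<open>g\<close>, that is, a parameter for which the endpoint of
   \<open>w\<close> is attained.\<close>
 have "continuous_on (cball 0 s) (%a. a - g a)"
 proof (intro continuous_intros)
  show "continuous_on (cball 0 s) g" unfolding continuous_on_def
  proof
   fix a :: 'e assume "a : cball 0 s"
   hence "flow (u a) 1 \<otimes> inv (flow w 1) : U R" by (intro gU) simp
   moreover have "continuous_on UNIV (%a. flow (%t. u a t) 1)" unfolding u_def by (intro flow_affine_family_continuous cm)
   hence "((%a. flow (u a) 1) ---> flow (u a) 1) (at a within cball 0 s)" by (auto simp: continuous_on_def intro: tendsto_within_subset)
   hence "((%a. flow (u a) 1 \<otimes> inv (flow w 1)) ---> flow (u a) 1 \<otimes> inv (flow w 1)) (at a within cball 0 s)"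
    by (intro tendsto_mult_G tendsto_const)
   ultimately show "(g ---> g a) (at a within cball 0 s)" unfolding g_def by (intro tendsto_\<k>')
  qed
 qed
 then obtain a where a: "norm a <= s" "a - g a = a" by (rule brouwer_ball[OF s(1)]) (use gest in "auto simp: norm_minus_commute")
 have fu: "flow (u a) 1 = flow w 1" using \<k>_eq_0[OF gU[OF a(1)]] a(2) by (simp add: g_def inv_mult_eq_one_iff) (metis gsimps mult_right_cancel)
 \<comment> \<open>Averaging is linear, so the corrected step control is itself the average of a
   perturbation of \<open>w\<close>; its distance to \<open>X\<close> can therefore be read off
   before averaging.\<close>
 define W where "W = avg m (%t. w t + (SUM b:Basis. (a \<bullet> b) *R h b t))"
 have uW: "u a = (%t. st W (real m * t))" unfolding W_def avg_sum[OF cw ch finite_Basis] st_sum u_def wm_def hm_def by simp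
 have hW: "W : tuples m (gs 1)" unfolding W_def by (intro avg_tuple horiz_add horiz_sum w h finite_Basis)
 show thesis
 proof (rule that[OF m(1) hW])
  show "flow (%t. st W (real m * t)) 1 = flow w 1" using fu uW by simp
  fix i assume i: "i : {1..m}"
  have "AE t in lebesgue. ALL b:Basis. t : {0..1} --> norm (h b t) <= c b" using c(2) by (intro AE_finite_allI) auto
  hence "ae {0..1} (%t. norm (w t + (SUM b:Basis. (a \<bullet> b) *R h b t) - X) <= 2 * \<eta>)" using wX
  proof eventually_elim
   case (elim t)
   show ?case
   proof
    assume t: "t : {0..1}"
    have "norm (SUM b:Basis. (a \<bullet> b) *R h b t) <= (SUM b:(Basis::'e set). s * c b)" unfolding norm_scaleR using elim(1) t a(1) s(1)
     by (intro order_trans[OF norm_sum] sum_mono) (auto intro!: mult_mono order_trans[OF Basis_le_norm])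
    hence "norm (SUM b:Basis. (a \<bullet> b) *R h b t) <= \<eta>" using s(6) by (simp add: M2_def sum_distrib_left mult.commute)
    thus "norm (w t + (SUM b:Basis. (a \<bullet> b) *R h b t) - X) <= 2 * \<eta>"
     using elim(2) t norm_triangle_ineq[of "w t - X" "SUM b:Basis. (a \<bullet> b) *R h b t"] by (simp add: algebra_simps)
   qed
  qed
  thus "norm (W i - X) <= 2 * \<eta>" unfolding W_def by (rule avg_near[rotated]) (use i \<eta> in "auto intro!: ctrl_add cw ctrl_sum ch")
 next
  show "reg_tuple m W"
  proof (rule reg_tupleI[OF hW m0 avg_tuple[OF h(1)]])
   fix b :: 'e assume b: "b : Basis"
   have kd: "L1 1 (%t. u a t - w t) <= d" using k2[OF a(1)] s(3) by simp
   have "L1 1 (%t. hm m b t - h b t + h b t) <= L1 1 (%t. hm m b t - h b t) + L1 1 (h b)" by (intro L1_add ctrl_diff cm ch)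
   hence hb: "L1 1 (hm m b) <= M + 1" using \<d>1(2)[OF b] M(2)[OF b] \<d>s s by simp
   have "norm (dv (u a) 1 (hm m b) - dv w 1 (hm m b)) <= C * L1 1 (%t. u a t - w t) * L1 1 (hm m b)" by (rule C(3)[OF cu cm(2) kd])
   also have "... <= C * ((M + 2) * s) * (M + 1)" using M(1) s(1) C(1) by (intro mult_mono mult_left_mono k2 a hb L1_nonneg cm) auto
   finally have 1: "norm (dv (u a) 1 (hm m b) - dv w 1 (hm m b)) <= C * ((M + 2) * s) * (M + 1)" .
   have "norm (dv w 1 (%t. hm m b t - h b t)) <= B * L1 1 (%t. hm m b t - h b t)" by (intro B(2) ctrl_diff cm ch)
   also have "... <= B * s" using \<d>1(2)[OF b] \<d>s s B(1) by (intro mult_left_mono) auto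
   finally have 2: "norm (dv w 1 (hm m b) - b) <= B * s" using cw cm ch by (simp add: dv_diff h(2))
   have "norm (dv (u a) 1 (hm m b) - b) <= C * ((M + 2) * s) * (M + 1) + B * s"
    using norm_triangle_ineq[of "dv (u a) 1 (hm m b) - dv w 1 (hm m b)" "dv w 1 (hm m b) - b"] 1 2 by simp
   also have "... = (C * (M + 2) * (M + 1) + B) * s" by (simp add: algebra_simps)
   finally show "norm (dv (%t. st W (real m * t)) 1 (%t. st (avg m (h b)) (real m * t)) - b) <= 1 / (2 * real DIM('e))"
    using s(5) by (simp add: uW hm_def)
  qed
 qed
qed

end

section \<open>The six conditions in terms of flows\<close>

declare One_nat_def [simp del]

text \<open>Elements of \<open>Linf\<close> are constrained on the unit interval only; extension by
  zero makes them controls on the half-line.\<close>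

definition \<theta> :: "(real => 'e::zero) => real => 'e" where
 "\<theta> Y t = (if t : {0..1} then Y t else 0)"

lemma AE_not_in_unit: "~ (AE t in lebesgue. t : {0..1::real} --> False)"
proof
 assume "ae {0..1::real} (%t. False)"
 moreover have "{t::real. ~ (t : {0..1} --> False)} = cbox 0 1" by auto
 ultimately have "negligible (cbox 0 (1::real))" by (simp only: AE_lebesgue_iff)
 thus False unfolding negligible_interval by simp
qed

lemma tuple_norm_le_iff: "1 <= p ==> tuple_norm N p W <= C <-> (ALL i:{1..p}. N (W i) <= C)" unfolding tuple_norm_def by (subst Max_le_iff) auto

lemma tuple_norm_ge: "i : {1..p} ==> N (W i) <= tuple_norm N p W" unfolding tuple_norm_def by (rule Max_ge) auto

lemma tuple_norm_attained: "1 <= p ==> EX i:{1..p}. tuple_norm N p W = N (W i)"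
 unfolding tuple_norm_def using Max_in[of "(%i. N (W i)) ` {1..p}"] by (auto simp: image_iff)

lemma continuous_on_norm_on:
 fixes V :: "'e::euclidean_space set"
 assumes V: "subspace V" and N: "norm_on V N" and c: "0 < c" "!!v. v : V ==> N v <= c * norm v"
 shows "continuous_on V N" unfolding continuous_on_iff
proof (intro ballI allI impI)
 fix x and e :: real assume x: "x : V" and e: "0 < e"
 have "dist (N y) (N x) < e" if y: "y : V" "dist y x < e / c" for y
 proof -
  have d: "y - x : V" "x - y : V" using subspace_diff[OF V] x y by auto
  have tri: "N (v + w) <= N v + N w" if "v : V" "w : V" for v w using N that unfolding norm_on_def by auto
  have "norm (y - x) * c < e" using y(2) c(1) by (simp add: dist_norm pos_less_divide_eq)
  hence "N (y - x) < e" "N (x - y) < e" using c(2)[OF d(1)] c(2)[OF d(2)] by (simp_all add: mult.commute norm_minus_commute)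
  thus ?thesis using tri[OF d(1) x] tri[OF d(2) y(1)] by (simp add: dist_real_def)
 qed
 thus "EX d>0. ALL y:V. dist y x < d --> dist (N y) (N x) < e" using e c(1) by (intro exI[of _ "e / c"]) auto
qed

context stratified_lie
begin

text \<open>\<open>N\<close> means nothing outside the first layer. The upper bound therefore
  expands a vector in the projected basis \<open>comp b 1\<close>; the lower one minimises
  \<open>N\<close> over the unit vectors of the layer.\<close>

lemma norm_on_equiv:
 assumes N: "norm_on (gs 1) N"
 obtains c1 c2 where "0 < c1" "0 < c2" "!!v. v : gs 1 ==> norm v <= c1 * N v" "!!v. v : gs 1 ==> N v <= c2 * norm v"
proof -
 have N0: "0 <= N v" "N v = 0 <-> v = 0" "N (c *R v) = abs c * N v" if "v : gs 1" for v c using N that unfolding norm_on_def by auto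
 have Ntri: "N (v + w) <= N v + N w" if "v : gs 1" "w : gs 1" for v w using N that unfolding norm_on_def by auto
 note V0 = subspace_0[OF V_subspace] and Vs = subspace_scale[OF V_subspace]
 define c2 where "c2 = (SUM b:(Basis::'e set). N (comp b 1)) + 1"
 have c2: "0 < c2" unfolding c2_def by (intro add_nonneg_pos sum_nonneg N0 comp_1_V) auto
 have upper: "N v <= c2 * norm v" if v: "v : gs 1" for v
 proof -
  have Nsum: "N (SUM b:B. x b) <= (SUM b:B. N (x b))" if "finite B" "!!b. b : B ==> x b : gs 1" for B and x :: "'e => 'e" using that
  proof (induction B rule: finite_induct)
   case empty thus ?case using N0(2)[OF V0] by simp
  next
   case (insert b B)
   thus ?case using Ntri[of "x b" "sum x B"] subspace_sum[OF V_subspace, of B x] by simp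
  qed
  have "v = comp (SUM b:Basis. (v \<bullet> b) *R b) 1" using comp_1_id[OF v] by (simp only: euclidean_representation)
  also have "... = (SUM b:Basis. (v \<bullet> b) *R comp b 1)" by (simp only: linear_sum[OF comp_1_linear] linear_scale[OF comp_1_linear])
  also have "N ... <= (SUM b:Basis. N ((v \<bullet> b) *R comp b 1))" by (intro Nsum finite_Basis Vs comp_1_V)
  also have "... <= (SUM b:Basis. norm v * N (comp b 1))" unfolding N0(3)[OF comp_1_V] by (intro sum_mono mult_right_mono N0 comp_1_V Basis_le_norm)
  also have "... <= c2 * norm v" by (simp add: c2_def sum_distrib_left[symmetric] algebra_simps)
  finally show ?thesis .
 qed
 note cont = continuous_on_norm_on[OF V_subspace N c2 upper]
 define S where "S = sphere 0 1 Int gs 1"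
 show thesis
 \<comment> \<open>Without unit vectors in the layer there is nothing to minimise over; this case is
   settled directly.\<close>
 proof (cases "S = {}")
  case True
  have "v = 0" if "v : gs 1" for v
  proof (rule ccontr)
   assume "v ~= 0"
   hence "(1 / norm v) *R v : S" using Vs[OF that] by (simp add: S_def)
   thus False using True by simp
  qed
  thus thesis using N0 V0 by (intro that[of 1 c2] c2 upper) auto
 next
  case False
  have "compact S" unfolding S_def using closed_subspace[OF V_subspace] by (intro compact_Int_closed) auto
  then obtain v0 where v0: "v0 : S" "!!v. v : S ==> N v0 <= N v"
   using continuous_attains_inf[OF _ False continuous_on_subset[OF cont]] by (auto simp: S_def)
  have p: "0 < N v0" using v0(1) N0(1)[of v0] N0(2)[of v0] by (auto simp: S_def less_le)
  have "norm v <= 1 / N v0 * N v" if v: "v : gs 1" for v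
  proof (cases "v = 0")
   case False
   hence "N v0 <= 1 / norm v * N v" using v0(2)[of "(1 / norm v) *R v"] Vs[OF v] N0(3)[OF v, of "1 / norm v"] by (simp add: S_def)
   thus ?thesis using False p by (simp add: field_simps)
  qed (use N0(2)[OF V0] in simp)
  thus thesis using p by (intro that[of "1 / N v0" c2] c2 upper) auto
 qed
qed

end

section \<open>The space of controls with its seminorm\<close>

locale normed_stratified_lie = stratified_lie G \<k> \<pi> F br R r L gs s
 for G :: "'g::t2_space monoid" (structure)
  and \<k> :: "'g => 'e::euclidean_space" and \<pi> :: "'e => 'g"
  and F :: "'e => 'e => 'e" and br :: "'e => 'e => 'e" and R r L :: real
  and gs :: "nat => 'e set" and s :: nat +
 fixes N :: "'e => real" and X :: 'e and c1 c2 :: real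
 assumes N: "norm_on (gs 1) N" and X: "X : gs 1" and c_pos: "0 < c1" "0 < c2"
  and norm_le_N: "!!v. v : gs 1 ==> norm v <= c1 * N v" and N_le_norm: "!!v. v : gs 1 ==> N v <= c2 * norm v"
begin

abbreviation "LV \<equiv> Linf (gs 1) N"
abbreviation "\<nu> \<equiv> Linf_norm N"
abbreviation "TV p \<equiv> tuples p (gs 1)"

lemmas V_0 = subspace_0[OF V_subspace] and V_add = subspace_add[OF V_subspace]
 and V_diff = subspace_diff[OF V_subspace] and V_scale = subspace_scale[OF V_subspace]

lemma N_props:
 "v : gs 1 ==> 0 <= N v" "v : gs 1 ==> N (c *R v) = abs c * N v"
 "v : gs 1 ==> w : gs 1 ==> N (v + w) <= N v + N w" using N unfolding norm_on_def by auto

text \<open>\<open>N\<close> is continuous on the first layer only; composing it with the projection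
  \<open>comp _ 1\<close> gives a Borel function that agrees with it on the values of
  \<open>Y\<close>.\<close>

lemma N_measurable:
 assumes Y: "Y : borel_measurable (lebesgue_on {0..1::real})" "!!t. t : {0..1} ==> Y t : gs 1"
 shows "(%t. ereal (N (Y t))) : borel_measurable (lebesgue_on {0..1})"
proof -
 have "continuous_on (gs 1) N" by (rule continuous_on_norm_on[OF V_subspace N c_pos(2) N_le_norm])
 hence "continuous_on UNIV (%x. N (comp x 1))"
  by (rule continuous_on_compose2[OF _ linear_continuous_on[OF linear_conv_bounded_linear[THEN iffD1, OF comp_1_linear]]]) (use comp_1_V in auto)
 hence "(%x. N (comp x 1)) : borel_measurable borel" by (rule borel_measurable_continuous_onI)
 from borel_measurable_ereal[OF measurable_compose[OF Y(1) this]]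
 have "(%t. ereal (N (comp (Y t) 1))) : borel_measurable (lebesgue_on {0..1})" .
 thus ?thesis by (rule measurable_cong[THEN iffD1, rotated]) (use Y(2) comp_1_id in auto)
qed

lemma AE_unit: "(AE t in lebesgue_on {0..1::real}. P t) <-> (AE t in lebesgue. t : {0..1} --> P t)" by (rule AE_lebesgue_on_iff) simp

lemma Linf_iff: "Y : LV <-> Y : borel_measurable (lebesgue_on {0..1}) & (ALL t:{0..1}. Y t : gs 1) &
  (EX C. AE t in lebesgue. t : {0..1} --> N (Y t) <= C)" (is "_ <-> ?r")
 and Linf_norm_nonneg: "Y : LV ==> 0 <= \<nu> Y"
 and Linf_norm_AE: "Y : LV ==> ae {0..1} (%t. N (Y t) <= \<nu> Y)"
 and Linf_norm_le: "Y : LV ==> AE t in lebesgue. t : {0..1} --> N (Y t) <= C ==> \<nu> Y <= C"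
proof -
 define e where "e = esssup (lebesgue_on {0..1}) (%t. ereal (N (Y t)))"
 \<comment> \<open>Otherwise \<open>N (Y t)\<close> would be negative almost everywhere on the unit
   interval. With the upper bound this makes \<open>e\<close> finite, so that
   \<open>real_of_ereal\<close> loses nothing.\<close>
 have pos: "0 <= e" if "Y : borel_measurable (lebesgue_on {0..1})" "ALL t:{0..1}. Y t : gs 1"
 proof (rule ccontr)
  assume "~ 0 <= e"
  hence "x < 0" if "ereal x <= e" for x using that by (cases e) auto
  hence "ae {0..1} (%t. N (Y t) < 0)" using esssup_AE[of "%t. ereal (N (Y t))" "lebesgue_on {0..1}"] unfolding AE_unit e_def[symmetric]
   by (auto elim!: eventually_mono)
  hence "ae {0..1::real} (%t. False)" by eventually_elim (use that(2) N_props(1) in "auto simp: not_less[symmetric]")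
  thus False using AE_not_in_unit by blast
 qed
 have AE: "ae {0..1} (%t. ereal (N (Y t)) <= e)" using esssup_AE[of "%t. ereal (N (Y t))" "lebesgue_on {0..1}"] unfolding AE_unit e_def .
 have le: "e <= ereal C" if "Y : borel_measurable (lebesgue_on {0..1})" "ALL t:{0..1}. Y t : gs 1"
  "ae {0..1} (%t. N (Y t) <= C)" for C unfolding e_def by (rule esssup_I[OF N_measurable]) (use that in "auto simp: AE_unit")
 have fin: "e = ereal (\<nu> Y)" "0 <= \<nu> Y" if "Y : LV"
 proof -
  have "e < \<infinity>" "0 <= e" using that pos unfolding Linf_def e_def by auto
  thus "e = ereal (\<nu> Y)" "0 <= \<nu> Y" unfolding Linf_norm_def e_def[symmetric] by (cases e; simp)+
 qed
 show "Y : LV ==> 0 <= \<nu> Y" by (rule fin)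
 show a: "Y : LV ==> ae {0..1} (%t. N (Y t) <= \<nu> Y)" using AE fin by simp
 show "Y : LV ==> AE t in lebesgue. t : {0..1} --> N (Y t) <= C ==> \<nu> Y <= C" using le[of C] fin unfolding Linf_def by auto
 show "Y : LV <-> ?r"
 proof
  show "Y : LV ==> ?r" using a unfolding Linf_def by blast
  show "?r ==> Y : LV" using le unfolding Linf_def e_def by (auto intro: le_less_trans)
 qed
qed

lemma Linf_add:
 assumes Y: "Y : LV" and Z: "Z : LV"
 shows "(%t. Y t + Z t) : LV & \<nu> (%t. Y t + Z t) <= \<nu> Y + \<nu> Z"
proof -
 have "ae {0..1} (%t. N (Y t + Z t) <= \<nu> Y + \<nu> Z)" using Linf_norm_AE[OF Y] Linf_norm_AE[OF Z]
 proof eventually_elim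
  case (elim t)
  show ?case
  proof
   assume "t : {0..1}"
   thus "N (Y t + Z t) <= \<nu> Y + \<nu> Z" using elim Y Z N_props(3)[of "Y t" "Z t"] unfolding Linf_iff by fastforce
  qed
 qed
 moreover from this have "(%t. Y t + Z t) : LV" using Y Z V_add unfolding Linf_iff by (auto intro!: borel_measurable_add)
 ultimately show ?thesis using Linf_norm_le by blast
qed

lemma Linf_scale_le:
 assumes Y: "Y : LV"
 shows "(%t. c *R Y t) : LV & \<nu> (%t. c *R Y t) <= abs c * \<nu> Y"
proof -
 have "ae {0..1} (%t. N (c *R Y t) <= abs c * \<nu> Y)"
  using Linf_norm_AE[OF Y] by eventually_elim (use Y in "auto simp: Linf_iff N_props(2) mult_left_mono")
 moreover from this have "(%t. c *R Y t) : LV" using Y V_scale unfolding Linf_iff by auto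
 ultimately show ?thesis using Linf_norm_le by blast
qed

lemma Linf_scale:
 assumes Y: "Y : LV"
 shows "\<nu> (%t. c *R Y t) = abs c * \<nu> Y"
proof (cases "c = 0")
 case False
 have "\<nu> Y <= abs (1 / c) * \<nu> (%t. c *R Y t)" using Linf_scale_le[of "%t. c *R Y t" "1 / c"] Linf_scale_le[OF Y, of c] False by simp
 thus ?thesis using Linf_scale_le[OF Y, of c] False by (simp add: field_simps)
qed (use Linf_scale_le[OF Y, of 0] Linf_norm_nonneg[of "%t. 0 *R Y t"] in auto)

lemma Linf_diff: "Y : LV ==> Z : LV ==> (%t. Y t - Z t) : LV" using Linf_add[of Y "%t. -1 *R Z t"] Linf_scale_le[of Z "-1"] by simp

lemma horiz_Linf:
 assumes u: "horiz u"
 shows "u : LV"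
proof -
 obtain C where "ae {0..1} (%t. norm (u t) <= C)" using ctrlE[OF horiz_ctrl[OF u], of 1] by blast
 hence "ae {0..1} (%t. N (u t) <= c2 * C)"
 proof eventually_elim
  case (elim t)
  have "N (u t) <= c2 * norm (u t)" using u N_le_norm by (simp add: horiz_def)
  thus ?case using elim c_pos by (auto intro: order_trans mult_left_mono)
 qed
 thus ?thesis using u unfolding Linf_iff by (auto simp: horiz_def ctrl_def intro: measurable_restrict_space1)
qed

lemma Linf_norm_bound:
 assumes "Y : LV"
 shows "ae {0..1} (%t. norm (Y t) <= c1 * \<nu> Y)" using Linf_norm_AE[OF assms]
proof eventually_elim
 case (elim t)
 show ?case
 proof
  assume t: "t : {0..1}"
  hence "norm (Y t) <= c1 * N (Y t)" using assms norm_le_N by (simp add: Linf_iff)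
  also have "... <= c1 * \<nu> Y" using elim t c_pos by (intro mult_left_mono) auto
  finally show "norm (Y t) <= c1 * \<nu> Y" .
 qed
qed

lemma \<theta>_horiz:
 assumes Y: "Y : LV"
 shows "horiz (\<theta> Y)"
proof -
 have "ctrl (\<theta> Y)"
 proof (rule ctrlI)
  show "\<theta> Y : borel_measurable lebesgue" using Y borel_measurable_if_I[of Y "{0..1}"] unfolding Linf_iff \<theta>_def[abs_def] by auto
  show "EX C. ae {0..T} (%t. norm (\<theta> Y t) <= C)" for T using Linf_norm_bound[OF Y] c_pos Linf_norm_nonneg[OF Y]
   by (intro exI[of _ "c1 * \<nu> Y"]) (auto simp: \<theta>_def elim!: eventually_mono)
 qed
 thus ?thesis using Y V_0 unfolding horiz_def Linf_iff by (auto simp: \<theta>_def)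
qed

lemma L1_bound:
 assumes "ctrl u" "0 <= T" "ae {0..T} (%t. norm (u t) <= C)" "0 <= C"
 shows "L1 T u <= C * T" using integral_norm_bound_AE[of 0 T "%t. norm (u t)" C] assms ctrl_norm_integrable[of u 0 T] L1_nonneg[of u T] by simp

lemma Linf_family:
 assumes u0: "ctrl u0" and f: "!!z. z : LV ==> f z = flow (%t. u0 t + \<theta> z t) 1"
 shows "control_family G \<k> \<pi> F br R r L LV \<nu> \<theta> u0 1 c1 f"
proof unfold_locales
 show "L1 1 (\<theta> h) <= c1 * \<nu> h" if "h : LV" for h
  using L1_bound[of "\<theta> h" 1 "c1 * \<nu> h"] Linf_norm_bound[OF that] \<theta>_horiz[OF that] c_pos Linf_norm_nonneg[OF that]
  by (auto simp: horiz_def \<theta>_def elim!: eventually_mono)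
qed (use Linf_add Linf_scale_le Linf_scale Linf_norm_nonneg horiz_Linf[OF horiz_0] \<theta>_horiz f u0 c_pos in
  \<open>auto simp: \<theta>_def horiz_ctrl\<close>)

lemma Linf_Dv:
 assumes u0: "ctrl u0" and f: "!!z. z : LV ==> f z = flow (%t. u0 t + \<theta> z t) 1" and y: "y : LV"
 shows "sub_at LV \<nu> f y <-> reg (%t. u0 t + \<theta> y t) 1"
  "reg (%t. u0 t + \<theta> y t) 1 ==> open_at LV \<nu> f y"
proof -
 interpret c: control_family G \<k> \<pi> F br R r L LV \<nu> \<theta> u0 1 c1 f by (rule Linf_family[OF u0 f])
 let ?u = "%t. u0 t + \<theta> y t"
 have "c.Dv y ` LV = dv ?u 1 ` {h. horiz h}"
 proof (intro equalityI subsetI)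
  fix x assume "x : c.Dv y ` LV"
  thus "x : dv ?u 1 ` {h. horiz h}" using \<theta>_horiz by (auto simp: c.Dv_def dv_def)
 next
  fix x assume "x : dv ?u 1 ` {h. horiz h}"
  then obtain h where h: "horiz h" "x = dv ?u 1 h" by auto
  have "c.Dv y h = dv ?u 1 h" unfolding c.Dv_def dv_def by (rule integral_cong) (simp add: \<theta>_def)
  thus "x : c.Dv y ` LV" using h(2) imageI[OF horiz_Linf[OF h(1)], of "c.Dv y"] by simp
 qed
 thus "sub_at LV \<nu> f y <-> reg ?u 1" "reg ?u 1 ==> open_at LV \<nu> f y"
  using c.sub_at_iff[OF y] c.open_at_if_surj[OF y] by (simp_all add: reg_def)
qed

lemma tuple_family:
 assumes p: "1 <= p"
 shows "control_family G \<k> \<pi> F br R r L (TV p) (tuple_norm N p) st (%_. 0) (real p) (c1 * real p) (%W. flow (st W) (real p))"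
proof unfold_locales
 fix h k c assume h: "h : TV p"
 have hV: "h i : gs 1" if "i : {1..p}" for i using h that by (simp add: tuples_def)
 show nn: "0 <= tuple_norm N p h" using tuple_norm_ge[of 1 p N h] hV[of 1] N_props(1) p by force
 show "tuple_norm N p (%i. c *R h i) = abs c * tuple_norm N p h"
 proof (rule antisym)
  show "tuple_norm N p (%i. c *R h i) <= abs c * tuple_norm N p h"
   unfolding tuple_norm_le_iff[OF p] using hV tuple_norm_ge[of _ p N h] by (simp add: N_props(2) mult_left_mono)
  obtain i where "i : {1..p}" "tuple_norm N p h = N (h i)" using tuple_norm_attained[OF p] by blast
  thus "abs c * tuple_norm N p h <= tuple_norm N p (%i. c *R h i)" using tuple_norm_ge[of i p N "%i. c *R h i"] hV[of i] by (simp add: N_props(2))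
 qed
 show "tuple_norm N p (%i. h i + k i) <= tuple_norm N p h + tuple_norm N p k" if k: "k : TV p" unfolding tuple_norm_le_iff[OF p]
 proof
  fix i assume i: "i : {1..p}"
  hence "N (h i + k i) <= N (h i) + N (k i)" using hV k by (intro N_props) (auto simp: tuples_def)
  thus "N (h i + k i) <= tuple_norm N p h + tuple_norm N p k" using tuple_norm_ge[OF i, of N h] tuple_norm_ge[OF i, of N k] by linarith
 qed
 have "norm (st h t) <= c1 * tuple_norm N p h" for t
 proof (cases "nat \<lfloor>t\<rfloor> + 1 : {1..p}")
  case True
  hence "norm (st h t) <= c1 * N (h (nat \<lfloor>t\<rfloor> + 1))" unfolding st_def by (intro norm_le_N hV)
  also have "... <= c1 * tuple_norm N p h" using c_pos by (intro mult_left_mono tuple_norm_ge True) auto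
  finally show ?thesis .
 next
  case False
  hence "st h t = 0" using h by (simp add: st_def tuples_def)
  thus ?thesis using nn c_pos by simp
 qed
 thus "L1 (real p) (st h) <= c1 * real p * tuple_norm N p h"
  using L1_bound[of "st h" "real p" "c1 * tuple_norm N p h"] st_ctrl[OF h] nn c_pos by (simp add: mult_ac)
qed (use tuples_0[OF V_subspace] tuples_add[OF V_subspace] tuples_scale[OF V_subspace] c_pos st_ctrl in "auto simp: st_def[abs_def]")

lemma tuple_Dv:
 assumes p: "1 <= p" and W: "W : TV p"
 shows "sub_at (TV p) (tuple_norm N p) (%W. flow (st W) (real p)) W <-> reg_tuple p W"
  "reg_tuple p W ==> open_at (TV p) (tuple_norm N p) (%W. flow (st W) (real p)) W"
proof -
 interpret c: control_family G \<k> \<pi> F br R r L "TV p" "tuple_norm N p" st "%_. 0" "real p" "c1 * real p" "%W. flow (st W) (real p)"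
  by (rule tuple_family[OF p])
 have "c.Dv W ` TV p = (%H. dv (st W) (real p) (st H)) ` TV p" by (simp add: c.Dv_def[abs_def] dv_def)
 thus "sub_at (TV p) (tuple_norm N p) (%W. flow (st W) (real p)) W <-> reg_tuple p W"
  "reg_tuple p W ==> open_at (TV p) (tuple_norm N p) (%W. flow (st W) (real p)) W"
  using c.sub_at_iff[OF W] c.open_at_if_surj[OF W] by (simp_all add: reg_tuple_def)
qed

section \<open>The conditions in terms of horizontal flows\<close>

definition E :: "(real => 'e) => 'g" where "E Y = flow (\<theta> Y) 1"

abbreviation "\<Gamma> p W \<equiv> flow (st W) (real p)"
abbreviation "cX \<equiv> (%_::real. X)"

lemma cX: "horiz cX" "cX : LV" using X horiz_Linf[of cX] by (auto simp: horiz_def)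

lemma E_eq: "ctrl u ==> AE t in lebesgue. t : {0..1} --> u t = Y t ==> E Y = flow u 1"
 unfolding E_def by (rule flow_cong_AE) (auto simp: \<theta>_def elim!: eventually_mono)

lemma E_horiz: "horiz u ==> E u = flow u 1" by (rule E_eq) (auto simp: horiz_def)

lemma E_shift: "Y : LV ==> E (%t. X + Y t) = flow (%t. X + \<theta> Y t) 1"
 using ctrl_add[OF ctrl_const[of X] horiz_ctrl[OF \<theta>_horiz]] by (intro E_eq) (auto simp: \<theta>_def)

lemma reg_cong:
 assumes "ctrl u" "ae {0..1} (%t. u t = v t)" "reg u 1"
 shows "reg v 1" using dv_cong_AE[OF assms(1,2), of h h for h] assms(3) unfolding reg_def by auto

lemma flow_X: "0 < c ==> flow cX c = D c (flow cX 1)" using flow_stretch[OF cX(1), of c 1] by simp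

lemma const_tuple_TV: "const_tuple p X : TV p" using X by (auto simp: const_tuple_def tuples_def)

lemma \<Gamma>_const: "1 <= p ==> \<Gamma> p (const_tuple p X) = D (real p) (flow cX 1)"
 using flow_cong[of cX "real p" "st (const_tuple p X)"] flow_X[of "real p"] by (auto simp: st_const)

text \<open>A \<open>p\<close>-fold multiexponential is the endpoint of a control on the unit
  interval, dilated by \<open>p\<close>. As \<open>D (real p)\<close> is injective, equality of
  endpoints can be tested on either side.\<close>

lemma \<Gamma>_step: "W : TV p ==> 1 <= p ==> \<Gamma> p W = D (real p) (flow (%t. st W (real p * t)) 1)"
 using flow_stretch[OF st_horiz, of W p "real p" 1] by simp

lemma D_inj: "c ~= 0 ==> D c x = D c y ==> x = y" using D_inverse(2) by metis

lemma step_near: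
 assumes W: "ALL i:{1..p}. P (W i)" and p: "1 <= p"
 shows "ae {0..1} (%t. P (st W (real p * t)))" using AE_neq[of 1]
proof eventually_elim
 case (elim t)
 show ?case
 proof
  assume "t : {0..1}"
  hence "0 < p" "t : {0..<1}" using elim p by auto
  thus "P (st W (real p * t))" using st_index[of p t thesis] W by (metis st_index)
 qed
qed

text \<open>The common form to which (SP) and (FH) are reduced: controls on the unit interval and
  the Euclidean norm in place of \<open>N\<close>, the two being exchanged by \<open>c1\<close> and
  \<open>c2\<close>.\<close>

definition SP where "SP <-> (ALL \<eta>>0. EX w. horiz w & (AE t in lebesgue. t : {0..1} --> norm (w t - X) <= \<eta>) &
 flow w 1 = flow cX 1 & reg w 1)"

lemma SP_iff: "(ALL \<eta>>0. EX Y:LV. \<nu> Y < \<eta> & E (%t. X + Y t) = E (%t. X + 0) &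
  sub_at LV \<nu> (%Y. E (%t. X + Y t)) Y) <-> SP" (is "?l <-> _")
proof -
 have sub: "sub_at LV \<nu> (%Y. E (%t. X + Y t)) Y <-> reg (%t. X + \<theta> Y t) 1" if "Y : LV" for Y
  by (rule Linf_Dv(1)[OF ctrl_const E_shift that])
 have E0: "E (%t. X + 0) = flow cX 1" using E_horiz[OF cX(1)] by simp
 show ?thesis
 proof
  assume l: ?l
  show SP unfolding SP_def
  proof (intro allI impI)
   fix \<eta> :: real assume "0 < \<eta>"
   hence "0 < \<eta> / c1" using c_pos by simp
   with l obtain Y where Y: "Y : LV" "\<nu> Y < \<eta> / c1" "E (%t. X + Y t) = E (%t. X + 0)" "sub_at LV \<nu> (%Y. E (%t. X + Y t)) Y" by blast
   have "c1 * \<nu> Y <= \<eta>" using Y(2) c_pos by (simp add: pos_less_divide_eq mult.commute)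
   hence "ae {0..1} (%t. norm (X + \<theta> Y t - X) <= \<eta>)" using Linf_norm_bound[OF Y(1)] by (auto simp: \<theta>_def elim!: eventually_mono)
   thus "EX w. horiz w & (AE t in lebesgue. t : {0..1} --> norm (w t - X) <= \<eta>) & flow w 1 = flow cX 1 & reg w 1"
    using Y sub[OF Y(1)] E_shift[OF Y(1)] E0 horiz_add[OF cX(1) \<theta>_horiz[OF Y(1)]] by (intro exI[of _ "%t. X + \<theta> Y t"]) auto
  qed
 next
  assume SP
  show ?l
  proof (intro allI impI)
   fix \<eta> :: real assume \<eta>: "0 < \<eta>"
   \<comment> \<open>\<open>c2\<close> converts the norm, and the half turns the weak inequality of
     \<open>SP\<close> into the strict one of the condition.\<close>
   hence "0 < \<eta> / 2 / c2" using c_pos by simp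
   with \<open>SP\<close> obtain w where w: "horiz w" "ae {0..1} (%t. norm (w t - X) <= \<eta> / 2 / c2)"
    "flow w 1 = flow cX 1" "reg w 1" unfolding SP_def by blast
   define Y where "Y t = w t - X" for t
   have Y: "Y : LV" unfolding Y_def by (rule Linf_diff[OF horiz_Linf[OF w(1)] cX(2)])
   have YV: "Y t : gs 1" for t using w(1) X V_diff by (simp add: Y_def horiz_def)
   have "ae {0..1} (%t. N (Y t) <= \<eta> / 2)" using w(2)
   proof eventually_elim
    case (elim t)
    have "N (Y t) <= c2 * norm (Y t)" by (rule N_le_norm[OF YV])
    thus ?case using elim c_pos by (auto simp: Y_def pos_le_divide_eq mult.commute)
   qed
   hence "\<nu> Y <= \<eta> / 2" by (rule Linf_norm_le[OF Y])
   moreover have "E (%t. X + Y t) = E (%t. X + 0)" unfolding E0 using E_horiz[OF w(1)] w(3) by (simp add: Y_def)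
   moreover have "reg (%t. X + \<theta> Y t) 1" by (rule reg_cong[OF horiz_ctrl[OF w(1)] _ w(4)]) (simp add: \<theta>_def Y_def)
   ultimately show "EX Y:LV. \<nu> Y < \<eta> & E (%t. X + Y t) = E (%t. X + 0) & sub_at LV \<nu> (%Y. E (%t. X + Y t)) Y"
    using Y \<eta> sub by (intro bexI[of _ Y]) auto
  qed
 qed
qed

lemma reg_tuple_imp_reg: "W : TV p ==> 1 <= p ==> reg_tuple p W ==> reg (%t. st W (real p * t)) 1"
proof -
 assume W: "W : TV p" "1 <= p" and "reg_tuple p W"
 moreover have "(%H. dv (st W) (real p) (st H)) ` TV p \<subseteq> dv (st W) (real p) ` {h. horiz h}" using st_horiz by auto
 ultimately have "reg (st W) (real p)" unfolding reg_tuple_def reg_def by auto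
 thus ?thesis using reg_stretch[OF st_horiz[OF W(1)], of "real p"] W(2) by simp
qed

lemma FH_iff: "(ALL \<eta>>0. EX p>=2. EX W:TV p. (ALL i:{1..p}. N (W i - X) < \<eta>) & \<Gamma> p W = \<Gamma> p (const_tuple p X) &
  sub_at (TV p) (tuple_norm N p) (\<Gamma> p) W) <-> SP" (is "?l <-> _")
proof
 assume l: ?l
 show SP unfolding SP_def
 proof (intro allI impI)
  fix \<eta> :: real assume "0 < \<eta>"
  hence "0 < \<eta> / c1" using c_pos by simp
  with l obtain p W where W: "2 <= p" "W : TV p" "ALL i:{1..p}. N (W i - X) < \<eta> / c1" "\<Gamma> p W = \<Gamma> p (const_tuple p X)"
   "sub_at (TV p) (tuple_norm N p) (\<Gamma> p) W" by blast
  hence p: "1 <= p" by simp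
  have "ALL i:{1..p}. norm (W i - X) <= \<eta>"
  proof
   fix i assume i: "i : {1..p}"
   hence "norm (W i - X) <= c1 * N (W i - X)" using W(2) X V_diff by (intro norm_le_N) (auto simp: tuples_def)
   moreover have "c1 * N (W i - X) < \<eta>" using W(3) i c_pos by (simp add: pos_less_divide_eq mult.commute)
   ultimately show "norm (W i - X) <= \<eta>" by simp
  qed
  hence near: "ae {0..1} (%t. norm (st W (real p * t) - X) <= \<eta>)" by (rule step_near[OF _ p])
  have "reg (%t. st W (real p * t)) 1" using W p tuple_Dv(1)[OF p] reg_tuple_imp_reg by blast
  moreover have "flow (%t. st W (real p * t)) 1 = flow cX 1"
   by (rule D_inj[of "real p"]) (use W(4) p in "simp_all add: \<Gamma>_const[OF p] \<Gamma>_step[OF W(2) p]")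
  ultimately show "EX w. horiz w & (AE t in lebesgue. t : {0..1} --> norm (w t - X) <= \<eta>) & flow w 1 = flow cX 1 & reg w 1"
   using near horiz_stretch[OF st_horiz[OF W(2)], of "real p"] p by (intro exI[of _ "%t. st W (real p * t)"] conjI) simp_all
 qed
next
 assume SP
 show ?l
 proof (intro allI impI)
  fix \<eta> :: real assume \<eta>: "0 < \<eta>"
  \<comment> \<open>\<open>regular_step_approx\<close> doubles the distance and \<open>c2\<close>
    converts the norm; one more factor 2 makes the inequality strict.\<close>
  define \<epsilon> where "\<epsilon> = \<eta> / 4 / c2"
  have \<epsilon>: "0 < \<epsilon>" using \<eta> c_pos by (simp add: \<epsilon>_def)
  with \<open>SP\<close> obtain w where w: "horiz w" "ae {0..1} (%t. norm (w t - X) <= \<epsilon>)"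
   "flow w 1 = flow cX 1" "reg w 1" unfolding SP_def by blast
  obtain m W where W: "2 <= m" "W : tuples m (gs 1)" "!!i. i : {1..m} ==> norm (W i - X) <= 2 * \<epsilon>"
   "flow (%t. st W (real m * t)) 1 = flow w 1" "reg_tuple m W" using regular_step_approx[OF w(1,4) X w(2) \<epsilon>] by metis
  hence m: "1 <= m" by simp
  have "N (W i - X) < \<eta>" if i: "i : {1..m}" for i
  proof -
   have "N (W i - X) <= c2 * norm (W i - X)" using W(2) X V_diff i by (intro N_le_norm) (auto simp: tuples_def)
   also have "... <= c2 * (2 * \<epsilon>)" using W(3)[OF i] c_pos by (intro mult_left_mono) auto
   also have "... < \<eta>" using \<eta> c_pos by (simp add: \<epsilon>_def)
   finally show ?thesis .
  qed
  moreover have "\<Gamma> m W = \<Gamma> m (const_tuple m X)" unfolding \<Gamma>_const[OF m] \<Gamma>_step[OF W(2) m] using W(4) w(3) by simp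
  ultimately show "EX p>=2. EX W:TV p. (ALL i:{1..p}. N (W i - X) < \<eta>) & \<Gamma> p W = \<Gamma> p (const_tuple p X) &
    sub_at (TV p) (tuple_norm N p) (\<Gamma> p) W" using W tuple_Dv(1)[OF m W(2)] by blast
 qed
qed

lemma Reg_iff: "sub_at LV \<nu> E cX <-> reg cX 1"
proof -
 have "sub_at LV \<nu> E cX <-> reg (%t. 0 + \<theta> cX t) 1" by (rule Linf_Dv(1)[OF ctrl_const _ cX(2)]) (simp add: E_def)
 also have "... <-> reg cX 1"
 proof -
  have "ae {0..1} (%t. \<theta> cX t = X)" "ae {0..1} (%t. X = \<theta> cX t)" by (simp_all add: \<theta>_def)
  thus ?thesis using reg_cong[of "\<theta> cX" cX] reg_cong[of cX "\<theta> cX"] horiz_ctrl[OF \<theta>_horiz[OF cX(2)]] by auto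
 qed
 finally show ?thesis .
qed

lemma SbH_iff: "(EX p>=1. sub_at (TV p) (tuple_norm N p) (\<Gamma> p) (const_tuple p X)) <-> reg cX 1"
proof
 assume "EX p>=1. sub_at (TV p) (tuple_norm N p) (\<Gamma> p) (const_tuple p X)"
 then obtain p where p: "1 <= p" "reg_tuple p (const_tuple p X)" using tuple_Dv(1)[OF _ const_tuple_TV] by blast
 have "ae {0..1} (%t. st (const_tuple p X) (real p * t) = X)" by (rule step_near[OF _ p(1)]) (auto simp: const_tuple_def)
 thus "reg cX 1" using reg_cong[OF horiz_ctrl[OF horiz_stretch[OF st_horiz[OF const_tuple_TV]]] _ reg_tuple_imp_reg[OF const_tuple_TV p]] p(1) by simp
next
 assume "reg cX 1"
 thus "EX p>=1. sub_at (TV p) (tuple_norm N p) (\<Gamma> p) (const_tuple p X)" using reg_const_tuple[OF X] tuple_Dv(1)[OF _ const_tuple_TV] by blast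
qed

section \<open>Implications between the conditions\<close>

lemma SbH_imp_H: "reg cX 1 ==> EX p>=1. open_at (TV p) (tuple_norm N p) (\<Gamma> p) (const_tuple p X)"
 using reg_const_tuple[OF X] tuple_Dv(2)[OF _ const_tuple_TV] by blast

text \<open>A neighbourhood reached by tuples near \<open>X\<close> is pulled back by the continuous
  map \<open>D (real p)\<close>. The tuples, run in unit time, are controls whose distance to
  \<open>X\<close> is at most the tuple norm.\<close>

lemma H_imp_P:
 assumes p: "1 <= p" and op: "open_at (TV p) (tuple_norm N p) (\<Gamma> p) (const_tuple p X)"
 shows "open_at LV \<nu> E cX" unfolding open_at_def
proof (intro allI impI)
 fix S assume "S \<subseteq> LV" "EX \<r>>0. ALL z:LV. \<nu> (%t. z t - X) < \<r> --> z : S"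
 then obtain \<r> where \<r>: "0 < \<r>" "!!z. z : LV ==> \<nu> (%t. z t - X) < \<r> ==> z : S" by blast
 define S' where "S' = {W : TV p. tuple_norm N p (%i. W i - const_tuple p X i) < \<r>}"
 have "\<Gamma> p (const_tuple p X) : interior (\<Gamma> p ` S')" using op \<r>(1) unfolding open_at_def S'_def by (elim allE impE) auto
 then obtain T where T: "open T" "\<Gamma> p (const_tuple p X) : T" "T \<subseteq> \<Gamma> p ` S'" unfolding interior_def by auto
 have p0: "real p ~= 0" using p by simp
 show "E cX : interior (E ` S)"
 proof (rule interiorI)
  show "open (D (real p) -` T)" by (rule open_vimage[OF T(1) D_continuous])
  show "E cX : D (real p) -` T" using T(2) \<Gamma>_const[OF p] E_horiz[OF cX(1)] by simp
  show "D (real p) -` T \<subseteq> E ` S"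
  proof
   fix x assume "x : D (real p) -` T"
   then obtain W where W: "W : S'" "D (real p) x = \<Gamma> p W" using T(3) by auto
   hence WT: "W : TV p" by (simp add: S'_def)
   let ?z = "%t. st W (real p * t)"
   have hz: "horiz ?z" using horiz_stretch[OF st_horiz[OF WT]] p by simp
   have "x = E ?z" using W(2) unfolding \<Gamma>_step[OF WT p] E_horiz[OF hz] by (rule D_inj[OF p0])
   moreover have "?z : S"
   proof (rule \<r>(2)[OF horiz_Linf[OF hz]])
    let ?n = "tuple_norm N p (%i. W i - const_tuple p X i)"
    have "ALL i:{1..p}. N (W i - X) <= ?n" using tuple_norm_ge[of _ p N "%i. W i - const_tuple p X i"] by (auto simp: const_tuple_def)
    from step_near[of p "%v. N (v - X) <= ?n", OF this p] have "\<nu> (%t. ?z t - X) <= ?n"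
     by (rule Linf_norm_le[OF Linf_diff[OF horiz_Linf[OF hz] cX(2)]])
    thus "\<nu> (%t. ?z t - X) < \<r>" using W(1) by (simp add: S'_def)
   qed
   ultimately show "x : E ` S" by blast
  qed
 qed
qed

text \<open>\<open>SP\<close> supplies a control near \<open>X\<close> with the same endpoint and
  surjective differential. The endpoint map is open there, and a small ball around that control lies
  in the given ball around \<open>X\<close>.\<close>

lemma SP_imp_P:
 assumes SP
 shows "open_at LV \<nu> E cX" unfolding open_at_def
proof (intro allI impI)
 fix S assume "S \<subseteq> LV" "EX \<r>>0. ALL z:LV. \<nu> (%t. z t - X) < \<r> --> z : S"
 then obtain \<r> where \<r>: "0 < \<r>" "!!z. z : LV ==> \<nu> (%t. z t - X) < \<r> ==> z : S" by blast
 obtain Y where Y: "Y : LV" "\<nu> Y < \<r> / 2" "E (%t. X + Y t) = E (%t. X + 0)" "sub_at LV \<nu> (%Y. E (%t. X + Y t)) Y"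
  using assms \<r>(1) unfolding SP_iff[symmetric] by (meson half_gt_zero)
 have y: "(%t. X + Y t) : LV" using Linf_add[OF cX(2) Y(1)] by simp
 have "reg (%t. X + \<theta> Y t) 1" using Y(4) Linf_Dv(1)[OF ctrl_const E_shift Y(1)] by simp
 from reg_cong[OF ctrl_add[OF ctrl_const horiz_ctrl[OF \<theta>_horiz[OF Y(1)]]] _ this, of "%t. 0 + \<theta> (%t. X + Y t) t"]
 have "reg (%t. 0 + \<theta> (%t. X + Y t) t) 1" by (auto simp: \<theta>_def)
 hence op: "open_at LV \<nu> E (%t. X + Y t)" by (intro Linf_Dv(2)[OF ctrl_const[of 0] _ y]) (simp_all add: E_def)
 define S' where "S' = {z : LV. \<nu> (%t. z t - (X + Y t)) < \<r> / 2}"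
 have "E (%t. X + Y t) : interior (E ` S')" using op \<r>(1) unfolding open_at_def S'_def by (elim allE impE) (auto intro!: exI[of _ "\<r> / 2"])
 moreover have "S' \<subseteq> S"
 proof
  fix z assume z: "z : S'"
  hence zL: "z : LV" "(%t. z t - (X + Y t)) : LV" using Linf_diff[OF _ y] by (auto simp: S'_def)
  have "\<nu> (%t. z t - X) <= \<nu> (%t. z t - (X + Y t)) + \<nu> Y" using Linf_add[OF zL(2) Y(1)] by simp
  thus "z : S" using z Y(2) by (intro \<r>(2) zL) (simp add: S'_def)
 qed
 hence "interior (E ` S') \<subseteq> interior (E ` S)" by (intro interior_mono image_mono)
 ultimately show "E cX : interior (E ` S)" using Y(3) by auto
qed

text \<open>The new control runs a regular \<open>w\<close> in time \<open>e\<close> and then some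
  \<open>Y\<close> in time \<open>e'\<close>. Its endpoint
  \<open>D e ?g \<otimes> D e' (E Y)\<close> equals \<open>?x = D e ?x \<otimes> D e' ?x\<close> as
  soon as \<open>E Y = D (1 / real n) (inv ?g \<otimes> ?x) \<otimes> ?x\<close>; this point tends
  to \<open>?x\<close>, so openness at \<open>X\<close> provides such a \<open>Y\<close> near
  \<open>X\<close>. The first piece makes the whole regular.\<close>

lemma P_imp_SP:
 assumes P: "open_at LV \<nu> E cX"
 shows SP unfolding SP_def
proof (intro allI impI)
 fix \<eta> :: real assume \<eta>: "0 < \<eta>"
 let ?x = "flow cX 1"
 define S where "S = {z : LV. \<nu> (%t. z t - X) < \<eta> / c1}"
 have int: "?x : interior (E ` S)"
 proof -
  have "S \<subseteq> LV" "EX \<r>>0. ALL z:LV. \<nu> (%t. z t - X) < \<r> --> z : S"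
   using \<eta> c_pos by (auto simp: S_def intro!: exI[of _ "\<eta> / c1"])
  thus ?thesis using P E_horiz[OF cX(1)] unfolding open_at_def by simp
 qed
 obtain w where w: "horiz w" "!!t. norm (w t - X) < \<eta>" "reg w 1" by (rule exists_regular[OF X \<eta>]) blast
 let ?g = "flow w 1"
 have "(%n. D (1 / real n) (inv ?g \<otimes> ?x) \<otimes> ?x) \<longlonglongrightarrow> \<one> \<otimes> ?x"
  by (intro tendsto_mult_G tendsto_D_0 tendsto_const)
 hence "\<forall>\<^sub>F n in sequentially. D (1 / real n) (inv ?g \<otimes> ?x) \<otimes> ?x : interior (E ` S)"
  by (rule topological_tendstoD) (use int in "simp_all add: gsimps")
 hence "\<forall>\<^sub>F n in sequentially. 0 < n & D (1 / real n) (inv ?g \<otimes> ?x) \<otimes> ?x : interior (E ` S)"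
  using eventually_gt_at_top[of 0] by eventually_elim simp
 then obtain n where n: "0 < n" "D (1 / real n) (inv ?g \<otimes> ?x) \<otimes> ?x : interior (E ` S)"
  using eventually_happens'[OF sequentially_bot] by blast
 hence "D (1 / real n) (inv ?g \<otimes> ?x) \<otimes> ?x : E ` S" using subsetD[OF interior_subset] by blast
 then obtain Y where Y: "Y : S" "E Y = D (1 / real n) (inv ?g \<otimes> ?x) \<otimes> ?x" by force
 have YL: "Y : LV" using Y by (simp add: S_def)
 \<comment> \<open>The times are \<open>e = 1 / (n + 1)\<close> and \<open>e' = n / (n + 1)\<close>:
   their sum is 1 and \<open>e' * (1 / n) = e\<close>, which makes \<open>D e'\<close> turn the
   correcting factor into a dilation by \<open>e\<close>.\<close>
 define c where "c = real n + 1"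
 define e where "e = 1 / c"
 define e' where "e' = real n / c"
 have e: "0 < c" "0 < e" "0 < e'" "e + e' = 1" "e * c = 1" "e' * (c / real n) = 1" "c / real n * e = 1 / real n"
  using n(1) by (auto simp: e_def e'_def c_def add_divide_distrib[symmetric])
 let ?w = "%t. w (c * t)" and ?y = "%t. \<theta> Y (c / real n * t)"
 let ?z = "%t. if t < e then ?w t else ?y (t - e)"
 have hw: "horiz ?w" and hy: "horiz ?y" using horiz_stretch[OF w(1) e(1)] horiz_stretch[OF \<theta>_horiz[OF YL], of "c / real n"] e(1) n(1) by simp_all
 have hz: "horiz ?z" by (rule horiz_concat[OF hw hy])
 have we: "(%t. ?w (e * t)) = w" and ye: "(%t. ?y (e' * t)) = \<theta> Y"
 proof -
  have "c * (e * t) = t" "c / real n * (e' * t) = t" for t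
   using e(5,6) mult.assoc[of c e t] mult.assoc[of "c / real n" e' t] by (metis mult.commute mult_1)+
  thus "(%t. ?w (e * t)) = w" "(%t. ?y (e' * t)) = \<theta> Y" by presburger+
 qed
 have fw: "flow ?w e = D e ?g" using flow_stretch[OF hw e(2), of 1] unfolding we by simp
 have fy: "flow ?y e' = D e' (E Y)" using flow_stretch[OF hy e(3), of 1] unfolding ye E_def by simp
 have "flow ?z 1 = D e ?g \<otimes> D e' (E Y)" using flow_concat[OF horiz_ctrl[OF hw] horiz_ctrl[OF hy], of e e'] e fw fy by simp
 also have "D e' (E Y) = D e (inv ?g \<otimes> ?x) \<otimes> D e' ?x"
 proof -
  have "e' * (1 / real n) = e" using n(1) by (simp add: e_def e'_def)
  thus ?thesis unfolding Y(2) D_mult D_D by simp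
 qed
 also have "D e ?g \<otimes> (D e (inv ?g \<otimes> ?x) \<otimes> D e' ?x) = D e ?x \<otimes> D e' ?x" unfolding D_mult D_inv by (simp only: gsimps)
 also have "... = flow cX e \<otimes> flow cX e'" by (simp only: flow_X[OF e(2)] flow_X[OF e(3)])
 also have "... = ?x" using flow_add[of cX e e'] e by simp
 finally have fz: "flow ?z 1 = ?x" .
 have rz: "reg ?z 1" using reg_concat[OF hw _ hy, of e e'] reg_stretch[OF hw e(2)] w(3) e unfolding we by simp
 have "ae {0..1} (%t. norm (Y t - X) <= \<eta>)"
 proof -
  have "c1 * \<nu> (%t. Y t - X) <= \<eta>" using Y(1) c_pos by (simp add: S_def pos_less_divide_eq mult.commute)
  thus ?thesis using Linf_norm_bound[OF Linf_diff[OF YL cX(2)]] by (auto elim!: eventually_mono)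
 qed
 from AE_lebesgue_affine[OF this, of "c / real n" "- 1 / real n"]
 have "ae {0..1} (%t. norm (?z t - X) <= \<eta>)"
 proof -
  assume "c / real n ~= 0 ==> AE t in lebesgue. - 1 / real n + c / real n * t : {0..1} -->
   norm (Y (- 1 / real n + c / real n * t) - X) <= \<eta>"
  hence "AE t in lebesgue. - 1 / real n + c / real n * t : {0..1} -->
   norm (Y (- 1 / real n + c / real n * t) - X) <= \<eta>" using e n(1) by simp
  thus ?thesis
  proof eventually_elim
   case (elim t)
   have s: "c / real n * (t - e) = - 1 / real n + c / real n * t" using e(7) by (simp add: right_diff_distrib)
   have "c / real n * (t - e) : {0..1}" if "t : {0..1}" "~ t < e"
   proof -
    have "c / real n * (t - e) <= c / real n * e'" using that e n(1) by (intro mult_left_mono) auto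
    thus ?thesis using that e n(1) by (simp add: mult.commute)
   qed
   thus ?case using elim w(2)[of "c * t"] unfolding s by (auto simp: \<theta>_def less_imp_le)
  qed
 qed
 thus "EX w. horiz w & (AE t in lebesgue. t : {0..1} --> norm (w t - X) <= \<eta>) & flow w 1 = ?x & reg w 1" using hz fz rz by blast
qed

end

section \<open>The local structure of a Lie group\<close>

declare One_nat_def [simp]

lemma strict_deriv_cong:
 assumes "strict_deriv f x D" "open S" "x : S" "!!y. y : S ==> f y = g y"
 shows "strict_deriv g x D"
proof -
 obtain d0 where d0: "d0 > 0" "ball x d0 \<subseteq> S" using assms openE by blast
 have "EX d>0. ALL y:ball x d. ALL z:ball x d. norm (g y - g z - D (y - z)) <= e * norm (y - z)" if e: "e > 0" for e
 proof -
  obtain d where d: "d > 0" "!!y z. y : ball x d ==> z : ball x d ==> norm (f y - f z - D (y - z)) <= e * norm (y - z)"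
   using strict_derivE[OF assms(1) e] by blast
  show ?thesis
  proof (intro exI[of _ "min d d0"] conjI ballI)
   fix y z assume yz: "y : ball x (min d d0)" "z : ball x (min d d0)"
   hence "f y = g y" "f z = g z" using d0 assms(4) by auto
   thus "norm (g y - g z - D (y - z)) <= e * norm (y - z)" using d(2)[of y z] yz by auto
  qed (use d d0 in auto)
 qed
 thus ?thesis using assms(1) by (simp add: strict_deriv_def)
qed

lemma has_derivative_cong_nhds:
 assumes "(f has_derivative D) (at x)" "\<forall>\<^sub>F y in nhds x. f y = g y"
 shows "(g has_derivative D) (at x)" by (rule has_derivative_transform_eventually[OF assms(1)])
  (use assms(2) eventually_nhds_x_imp_x[OF assms(2)] in "auto simp: eventually_at_filter elim: eventually_mono")

lemma has_derivative_shift: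
 assumes "(f has_derivative D) (at a)"
 shows "((%b. f (b + a)) has_derivative D) (at 0)"
proof -
 have "((%b. b + a) has_derivative (%v. v)) (at 0)" by (auto intro!: derivative_eq_intros)
 from has_derivative_compose[OF this, of f D] assms show ?thesis by simp
qed

lemma has_derivative_partial:
 assumes "(f has_derivative D) (at (p, q))"
 shows "((%p. f (p, q)) has_derivative (%v. D (v, 0))) (at p)"
  "((%q. f (p, q)) has_derivative (%v. D (0, v))) (at q)"
proof -
 have "((%p. (p, q)) has_derivative (%v. (v, 0))) (at p)" "((%q. (p, q)) has_derivative (%v. (0, v))) (at q)"
  by (intro has_derivative_Pair has_derivative_ident has_derivative_const)+
 from this[THEN has_derivative_compose, OF assms]
 show "((%p. f (p, q)) has_derivative (%v. D (v, 0))) (at p)"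
  "((%q. f (p, q)) has_derivative (%v. D (0, v))) (at q)" .
qed

text \<open>A bootstrap. For \<open>K * norm a \<le> 1 / 2\<close> the error can be absorbed, so
  \<open>B a - w\<close> is of order \<open>norm a\<close>; inserted again, this makes the error
  quadratic. The first bound uses no prior continuity of \<open>B\<close>.\<close>

lemma has_derivative_implicit:
 fixes B H :: "'a::real_normed_vector => 'b::real_normed_vector"
 assumes H: "(H has_derivative H') (at 0)" "H 0 = 0" and K: "0 <= K" "0 < d"
  and B: "B 0 = w" "!!a. norm a < d ==> norm (B a - w - H a) <= K * norm a * norm (B a - w)"
 shows "(B has_derivative H') (at 0)"
proof -
 have bl: "bounded_linear H'" using H(1) by (rule has_derivative_bounded_linear)
 obtain C where C: "C > 0" "!!v. norm (H' v) <= norm v * C" using bounded_linear.pos_bounded[OF bl] by blast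
 obtain d1 where d1: "d1 > 0" "!!a. norm a < d1 ==> norm (H a - H' a) <= 1 * norm a"
  using H unfolding has_derivative_at_alt by (metis diff_zero zero_less_one)
 have "EX \<d>>0. ALL a. norm a < \<d> --> norm (B a - w - H' a) <= e * norm a" if e: "e > 0" for e
 proof -
  obtain d2 where d2: "d2 > 0" "!!a. norm a < d2 ==> norm (H a - H' a) <= e / 2 * norm a"
   using H e unfolding has_derivative_at_alt by (metis diff_zero half_gt_zero)
  define q where "q = 4 * K * (C + 1)"
  have q: "0 <= q" using K C by (simp add: q_def)
  define \<d> where "\<d> = Min {d, d1, d2, 1 / (2 * K + 1), e / (q + 1)}"
  have \<d>: "0 < \<d>" using K d1 d2 e q by (simp add: \<d>_def add_nonneg_pos)
  have "norm (B a - w - H' a) <= e * norm a" if "norm a < \<d>" for a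
  proof -
   have a: "norm a < d" "norm a < d1" "norm a < d2" "norm a < 1 / (2 * K + 1)" "norm a < e / (q + 1)" using that by (simp_all add: \<d>_def)
   define z where "z = norm (B a - w)"
   have "norm a * (2 * K + 1) < 1" "norm a * (q + 1) < e" using a(4,5) K q by (simp_all add: pos_less_divide_eq add_nonneg_pos)
   moreover have "norm a * (2 * K + 1) = 2 * (K * norm a) + norm a" "norm a * (q + 1) = q * norm a + norm a" by (simp_all add: algebra_simps)
   ultimately have Ka: "K * norm a <= 1 / 2" and qa: "q * norm a <= e" using norm_ge_zero[of a] by linarith+
   have Ba: "norm (B a - w - H a) <= K * norm a * z" using B(2)[OF a(1)] by (simp add: z_def)
   have "K * norm a * z <= 1 / 2 * z" using Ka by (intro mult_right_mono) (simp_all add: z_def)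
   moreover have "z <= norm (B a - w - H a) + norm (H a)" using norm_triangle_ineq[of "B a - w - H a" "H a"] by (simp add: z_def)
   moreover have "norm (H a) <= (C + 1) * norm a"
    using d1(2)[OF a(2)] C(2)[of a] norm_triangle_ineq[of "H a - H' a" "H' a"] by (simp add: algebra_simps)
   ultimately have z: "z <= 2 * ((C + 1) * norm a)" using Ba by linarith
   have "norm (B a - w - H' a) <= K * norm a * z + e / 2 * norm a" using Ba d2(2)[OF a(3)] norm_triangle_ineq[of "B a - w - H a" "H a - H' a"] by simp
   also have "K * norm a * z <= K * norm a * (2 * ((C + 1) * norm a))" using z K by (intro mult_left_mono) auto
   also have "... = (q * norm a) / 2 * norm a" by (simp add: q_def)
   also have "... <= e / 2 * norm a" using qa by (intro mult_right_mono) auto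
   finally show ?thesis by simp
  qed
  with \<d> show ?thesis by blast
 qed
 thus ?thesis using bl by (simp add: has_derivative_at_alt B(1))
qed

section \<open>Multiplication in charts\<close>

locale lie_chart =
 fixes G :: "'g::{t2_space,second_countable_topology} monoid" (structure)
  and A :: "('g, 'e::euclidean_space) chart set" and c :: "('g, 'e) chart"
 assumes lie: "lie_group G A" and cA: "c : A" and one_c: "\<one> : fst c"
begin

definition base ("\<o>") where "\<o> = snd c \<one>"
definition "\<k> x = snd c x - \<o>"
definition "\<pi> a = param c (a + \<o>)"
definition "FF a v = left_field G c v (a + \<o>)"

lemma chart:
 assumes "d : A"
 shows "open (fst d)" "open (snd d ` fst d)" "x : fst d ==> param d (snd d x) = x"
  "p : snd d ` fst d ==> snd d (param d p) = p" "p : snd d ` fst d ==> param d p : fst d"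
  "continuous_on (fst d) (snd d)" "continuous_on (snd d ` fst d) (param d)"
proof -
 have "is_chart d" using lie assms by (simp add: lie_group_def smooth_atlas_def)
 hence h: "open (fst d)" "open (snd d ` fst d)" "homeomorphism (fst d) (snd d ` fst d) (snd d) (param d)" by (auto simp: is_chart_def)
 show "open (fst d)" "open (snd d ` fst d)" by (rule h)+
 show "x : fst d ==> param d (snd d x) = x" "p : snd d ` fst d ==> snd d (param d p) = p"
  "p : snd d ` fst d ==> param d p : fst d"
  "continuous_on (fst d) (snd d)" "continuous_on (snd d ` fst d) (param d)" using h(3) unfolding homeomorphism_def by auto
qed

lemma chart_at: obtains d where "d : A" "x : fst d" using lie unfolding lie_group_def smooth_atlas_def by blast

lemma group_facts: "group G" "carrier G = UNIV" "continuous_on UNIV (%(x, y). x \<otimes> y)" "continuous_on UNIV (%x. inv x)"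
 using lie by (auto simp: lie_group_def smooth_map_def)

lemma continuous_mult: "continuous_on S f ==> continuous_on S g ==> continuous_on S (%t. f t \<otimes> g t)"
 using continuous_on_compose2[OF group_facts(3) continuous_on_Pair, of S f g] by simp

lemma continuous_inv: "continuous_on S f ==> continuous_on S (%t. inv (f t))" using continuous_on_compose2[OF group_facts(4)] by blast

lemma group_simps: "(x \<otimes> y) \<otimes> z = x \<otimes> (y \<otimes> z)" "\<one> \<otimes> x = x" "x \<otimes> \<one> = x" "inv x \<otimes> x = \<one>" "x \<otimes> inv x = \<one>" "inv \<one> = \<one>"
 using group_facts by (simp_all add: group.is_monoid monoid.m_assoc monoid.l_one monoid.r_one group.l_inv group.r_inv monoid.inv_one)

definition mult_dom where
 "mult_dom d1 d2 d3 = {(p, q). p : snd d1 ` fst d1 & q : snd d2 ` fst d2 & param d1 p \<otimes> param d2 q : fst d3}"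

text \<open>Smoothness is given for the product atlas, whose \<open>param\<close> is an
  \<open>inv_into\<close> of pairs; it has to be identified with the pair of the two
  parametrisations on the domain.\<close>

lemma mult_chart:
 assumes d: "d1 : A" "d2 : A" "d3 : A"
 obtains m where "open (mult_dom d1 d2 d3)" "smooth_on (mult_dom d1 d2 d3) m"
  "!!p q. (p, q) : mult_dom d1 d2 d3 ==> m (p, q) = snd d3 (param d1 p \<otimes> param d2 q)"
proof -
 let ?c = "(fst d1 \<times> fst d2, map_prod (snd d1) (snd d2))" and ?F = "%(x, y). x \<otimes> y"
 let ?m = "snd d3 \<circ> ?F \<circ> param ?c"
 have inj: "inj_on (snd ?c) (fst ?c)" by (rule inj_on_inverseI[of _ "%(p, q). (param d1 p, param d2 q)"])
   (auto simp: chart(3)[OF d(1)] chart(3)[OF d(2)])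
 have par: "param ?c (p, q) = (param d1 p, param d2 q)" if "p : snd d1 ` fst d1" "q : snd d2 ` fst d2" for p q
  unfolding param_def[of ?c] by (rule inv_into_f_eq[OF inj]) (use that chart(4,5)[OF d(1)] chart(4,5)[OF d(2)] in auto)
 have dom: "snd ?c ` (fst ?c Int ?F -` fst d3) = mult_dom d1 d2 d3" using chart(3)[OF d(1)] chart(3)[OF d(2)] by (force simp: mult_dom_def image_iff)
 have sm: "smooth_on (mult_dom d1 d2 d3) ?m" using lie d unfolding lie_group_def smooth_map_def prod_atlas_def dom[symmetric] by blast
 have op: "open (mult_dom d1 d2 d3)"
 proof -
  have "continuous_on (snd d1 ` fst d1 \<times> snd d2 ` fst d2) (%z. param d1 (fst z) \<otimes> param d2 (snd z))"
   by (intro continuous_mult continuous_on_compose2[OF chart(7)[OF d(1)]] continuous_on_compose2[OF chart(7)[OF d(2)]]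
     continuous_intros) auto
  from continuous_open_preimage[OF this _ chart(1)[OF d(3)]]
  have "open ((snd d1 ` fst d1 \<times> snd d2 ` fst d2) Int (%z. param d1 (fst z) \<otimes> param d2 (snd z)) -` fst d3)"
   using chart(2)[OF d(1)] chart(2)[OF d(2)] by (auto intro: open_Times)
  also have "... = mult_dom d1 d2 d3" by (auto simp: mult_dom_def)
  finally show ?thesis .
 qed
 have "?m (p, q) = snd d3 (param d1 p \<otimes> param d2 q)" if "(p, q) : mult_dom d1 d2 d3" for p q using that par by (auto simp: mult_dom_def)
 with op sm show thesis by (rule that)
qed

lemma mult_strict_deriv:
 assumes d: "d1 : A" "d2 : A" "d3 : A" and x: "x : fst d1" "y : fst d2" "x \<otimes> y : fst d3"
 obtains D where "strict_deriv (%(p, q). snd d3 (param d1 p \<otimes> param d2 q)) (snd d1 x, snd d2 y) D"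
proof -
 obtain m where m: "open (mult_dom d1 d2 d3)" "smooth_on (mult_dom d1 d2 d3) m"
  "!!p q. (p, q) : mult_dom d1 d2 d3 ==> m (p, q) = snd d3 (param d1 p \<otimes> param d2 q)" by (rule mult_chart[OF d]) blast
 have x: "(snd d1 x, snd d2 y) : mult_dom d1 d2 d3" using x chart(3)[OF d(1)] chart(3)[OF d(2)] by (simp add: mult_dom_def)
 show thesis by (rule that[OF strict_deriv_cong[OF smooth_on_strict_deriv[OF m(1) x m(2)] m(1) x]]) (use m(3) in auto)
qed

lemma translate_differentiable:
 assumes d: "d : A" "d' : A" "y : fst d"
 shows "x \<otimes> y : fst d' ==> (%q. snd d' (x \<otimes> param d q)) differentiable at (snd d y)"
  "y \<otimes> x : fst d' ==> (%q. snd d' (param d q \<otimes> x)) differentiable at (snd d y)"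
proof -
 obtain e where e: "e : A" "x : fst e" by (rule chart_at)
 { assume "x \<otimes> y : fst d'"
  then obtain D where "strict_deriv (%(p, q). snd d' (param e p \<otimes> param d q)) (snd e x, snd d y) D"
   using mult_strict_deriv[OF e(1) d(1,2) e(2) d(3)] by blast
  from has_derivative_partial(2)[OF strict_deriv_has_derivative[OF this]]
  show "(%q. snd d' (x \<otimes> param d q)) differentiable at (snd d y)" using chart(3)[OF e] by (auto simp: differentiable_def) }
 { assume "y \<otimes> x : fst d'"
  then obtain D where "strict_deriv (%(p, q). snd d' (param d p \<otimes> param e q)) (snd d y, snd e x) D"
   using mult_strict_deriv[OF d(1) e(1) d(2) d(3) e(2)] by blast
  from has_derivative_partial(1)[OF strict_deriv_has_derivative[OF this]]
  show "(%q. snd d' (param d q \<otimes> x)) differentiable at (snd d y)" using chart(3)[OF e] by (auto simp: differentiable_def) }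
qed

lemma eventually_param:
 assumes d: "d : A" "y : fst d" and T: "open T" "y : T"
 shows "\<forall>\<^sub>F q in nhds (snd d y). q : snd d ` fst d & param d q : T"
proof -
 have "open (snd d ` fst d Int param d -` T)" by (rule continuous_open_preimage[OF chart(7,2)[OF d(1)] T(1)])
 hence "\<forall>\<^sub>F q in nhds (snd d y). q : snd d ` fst d Int param d -` T" by (rule eventually_nhds_in_open) (use d T chart(3)[OF d] in auto)
 thus ?thesis by eventually_elim auto
qed

text \<open>\<open>x \<otimes> \<pi> b\<close> lies near \<open>x\<close>, possibly outside the
  chart \<open>c\<close>; a chart \<open>d\<close> around \<open>x\<close> is interposed, and the
  conjugation splits into two translations.\<close>

lemma conj_differentiable: "(%b. \<k> (x \<otimes> \<pi> b \<otimes> inv x)) differentiable at 0"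
proof -
 obtain d where d: "d : A" "x : fst d" by (rule chart_at)
 let ?f = "%q. snd d (x \<otimes> param c q)" and ?g = "%p. snd c (param d p \<otimes> inv x)"
 have f: "?f differentiable at \<o>" unfolding base_def by (rule translate_differentiable(1)[OF cA d(1) one_c]) (simp add: d group_simps)
 have "?g differentiable at (snd d x)" by (rule translate_differentiable(2)[OF d(1) cA d(2)]) (simp add: group_simps one_c)
 hence "(?g \<circ> ?f) differentiable at \<o>" using f one_c chart(3)[OF cA] by (intro differentiable_chain_at) (simp_all add: base_def group_simps)
 then obtain D where D: "((?g \<circ> ?f) has_derivative D) (at \<o>)" by (auto simp: differentiable_def)
 have "open ((%y. x \<otimes> y) -` fst d)" by (intro open_vimage chart(1) d continuous_mult continuous_intros)
 hence "\<forall>\<^sub>F q in nhds \<o>. q : snd c ` fst c & param c q : (%y. x \<otimes> y) -` fst d"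
  unfolding base_def by (intro eventually_param cA one_c) (simp_all add: group_simps d)
 hence "\<forall>\<^sub>F q in nhds \<o>. (?g \<circ> ?f) q = snd c (x \<otimes> param c q \<otimes> inv x)"
  by eventually_elim (simp add: chart(3)[OF d(1)])
 from has_derivative_cong_nhds[OF D this]
 have "((%q. snd c (x \<otimes> param c q \<otimes> inv x)) has_derivative D) (at \<o>)" .
 from has_derivative_diff[OF has_derivative_shift[OF this] has_derivative_const[of \<o>]]
 show ?thesis unfolding \<k>_def \<pi>_def differentiable_def by blast
qed

text \<open>All data come from the multiplication \<open>m\<close> read in the chart at the
  identity. Its derivative at the base point is addition, and strict differentiability there makes
  multiplication nearly additive on a small ball; second derivatives give the frame and the
  bracket.\<close>

lemma local_lie_structure: "EX R r L. local_lie G \<k> \<pi> FF (lie_bracket G c) R r L"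
proof -
 let ?\<Omega> = "mult_dom c c c"
 obtain m where m: "open ?\<Omega>" "smooth_on ?\<Omega> m" "!!p q. (p, q) : ?\<Omega> ==> m (p, q) = snd c (param c p \<otimes> param c q)"
  by (rule mult_chart[OF cA cA cA]) blast
 define f' where "f' y = frechet_derivative m (at y)" for y
 have df: "(m has_derivative f' y) (at y)" if "y : ?\<Omega>" for y
  using strict_deriv_has_derivative[OF smooth_on_strict_deriv[OF m(1) that m(2)]] by (simp add: f'_def)
 have bl: "bounded_linear (f' y)" if "y : ?\<Omega>" for y using df[OF that] by (rule has_derivative_bounded_linear)
 define E where "E v = frechet_derivative (%y. f' y v) (at (\<o>, \<o>))" for v
 have c_o: "\<o> : snd c ` fst c" "param c \<o> = \<one>" using one_c chart(3)[OF cA] by (auto simp: base_def)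
 have oo: "(\<o>, \<o>) : ?\<Omega>" using c_o one_c by (simp add: mult_dom_def group_simps)
 have E: "strict_deriv (%y. f' y v) (\<o>, \<o>) (E v)" for v
  unfolding E_def f'_def by (rule smooth_on_strict_deriv[OF m(1) oo smooth_on_frechet_derivative[OF m(2)]])
 obtain R0 where R0: "0 < R0" "ball (\<o>, \<o>) R0 \<subseteq> ?\<Omega>" using m(1) oo openE by blast
 have dom: "(a + \<o>, b + \<o>) : ball (\<o>, \<o>) d" if "norm a + norm b < d" for a b :: 'e and d
 proof -
  have "dist (\<o>, \<o>) (a + \<o>, b + \<o>) = norm (a, b)" by (simp add: dist_Pair_Pair dist_norm norm_Pair)
  thus ?thesis using that norm_Pair_le[of a b] by simp
 qed
 have m_one: "m (p, \<o>) = p" "m (\<o>, p) = p" and one_dom: "(p, \<o>) : ?\<Omega>" "(\<o>, p) : ?\<Omega>" if "p : snd c ` fst c" for p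
 proof -
  show 1: "(p, \<o>) : ?\<Omega>" "(\<o>, p) : ?\<Omega>" using that c_o chart(5)[OF cA] by (auto simp: mult_dom_def group_simps)
  show "m (p, \<o>) = p" "m (\<o>, p) = p" using 1[THEN m(3)] that c_o chart(4)[OF cA] by (simp_all add: group_simps)
 qed
 have near: "\<forall>\<^sub>F p in nhds \<o>. p : snd c ` fst c" using eventually_nhds_in_open[OF chart(2)[OF cA] c_o(1)] .
 have part1: "((%p. m (p, q)) has_derivative (%v. f' (p, q) (v, 0))) (at p)"
  and part2: "((%q. m (p, q)) has_derivative (%v. f' (p, q) (0, v))) (at q)" if "(p, q) : ?\<Omega>" for p q
  by (rule has_derivative_partial[OF df[OF that]])+
 have f'_oo: "f' (\<o>, \<o>) (v, 0) = v" "f' (\<o>, \<o>) (0, v) = v" "f' (\<o>, \<o>) (v, w) = v + w" for v w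
 proof -
  have ev: "\<forall>\<^sub>F p in nhds \<o>. m (p, \<o>) = p" "\<forall>\<^sub>F p in nhds \<o>. m (\<o>, p) = p"
   using near by (eventually_elim, simp add: m_one)+
  from has_derivative_unique[OF has_derivative_cong_nhds[OF part1[OF oo] ev(1)] has_derivative_ident]
   has_derivative_unique[OF has_derivative_cong_nhds[OF part2[OF oo] ev(2)] has_derivative_ident]
  show 1: "f' (\<o>, \<o>) (v, 0) = v" "f' (\<o>, \<o>) (0, v) = v" for v by (simp_all add: fun_eq_iff)
  show "f' (\<o>, \<o>) (v, w) = v + w" using linear_add[OF bounded_linear.linear[OF bl[OF oo]], of "(v, 0)" "(0, w)"] by (simp add: 1)
 qed
 have left_field_eq: "left_field G c v p = f' (p, \<o>) (0, v)" and left_field_der: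
  "((%q. snd c (param c p \<otimes> param c q)) has_derivative (%v. f' (p, \<o>) (0, v))) (at \<o>)"
  if p: "p : snd c ` fst c" for p v
 proof -
  have "\<forall>\<^sub>F q in nhds \<o>. (p, q) : ?\<Omega>"
   using eventually_nhds_in_open[OF open_vimage[OF m(1), of "%q. (p, q)"], of \<o>] one_dom[OF p] by (simp add: continuous_intros)
  hence "\<forall>\<^sub>F q in nhds \<o>. m (p, q) = snd c (param c p \<otimes> param c q)" by eventually_elim (rule m(3))
  from has_derivative_cong_nhds[OF part2[OF one_dom(1)[OF p]] this]
  show "((%q. snd c (param c p \<otimes> param c q)) has_derivative (%v. f' (p, \<o>) (0, v))) (at \<o>)" .
  from frechet_derivative_at[OF this] show "left_field G c v p = f' (p, \<o>) (0, v)" unfolding left_field_def by (simp add: base_def fun_eq_iff)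
 qed
 \<comment> \<open>Each \<open>f' _ i\<close> with \<open>i\<close> a basis vector of the product
   space is strictly differentiable, hence Lipschitz near the base point; summing over
   \<open>i\<close> gives a bound linear in \<open>v\<close>.\<close>
 obtain d1 K where d1: "0 < d1" and K: "0 <= K" "!!y z v. y : ball (\<o>, \<o>) d1 ==> z : ball (\<o>, \<o>) d1 ==>
   y : ?\<Omega> ==> z : ?\<Omega> ==> norm (f' y v - f' z v) <= K * norm (y - z) * norm v"
 proof -
  have "EX d>0. EX K>0. ALL y:ball (\<o>, \<o>) d. ALL z:ball (\<o>, \<o>) d. norm (f' y i - f' z i) <= K * norm (y - z)" for i
   by (rule strict_deriv_lipschitz[OF E[of i]]) blast
  then obtain d k where dk: "!!i. 0 < d i" "!!i. 0 < k i"
   "!!i y z. y : ball (\<o>, \<o>) (d i) ==> z : ball (\<o>, \<o>) (d i) ==> norm (f' y i - f' z i) <= k i * norm (y - z)" by metis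
  show thesis
  proof (rule that[of "Min (d ` Basis)" "SUM i:Basis. k i"])
   show "0 < Min (d ` Basis)" using dk(1) by (subst Min_gr_iff) auto
   show "0 <= (SUM i:Basis. k i)" using dk(2) by (intro sum_nonneg) (simp add: less_imp_le)
   fix y z and v :: "'e \<times> 'e"
   assume yz: "y : ball (\<o>, \<o>) (Min (d ` Basis))" "z : ball (\<o>, \<o>) (Min (d ` Basis))" "y : ?\<Omega>" "z : ?\<Omega>"
   have exp: "f' y v = (SUM i:Basis. (v \<bullet> i) *R f' y i)" if "y : ?\<Omega>" for y using bounded_linear.linear[OF bl[OF that]]
    by (subst euclidean_representation[of v, symmetric]) (simp only: linear_sum linear_scale)
   have "f' y v - f' z v = (SUM i:Basis. (v \<bullet> i) *R (f' y i - f' z i))"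
    unfolding exp[OF yz(3)] exp[OF yz(4)] by (simp add: sum_subtractf scaleR_diff_right)
   also have "norm ... <= (SUM i:Basis. norm v * (k i * norm (y - z)))"
   proof (intro order_trans[OF norm_sum] sum_mono)
    fix i :: "'e \<times> 'e" assume i: "i : Basis"
    hence "norm (f' y i - f' z i) <= k i * norm (y - z)" using yz by (intro dk(3)) auto
    thus "norm ((v \<bullet> i) *R (f' y i - f' z i)) <= norm v * (k i * norm (y - z))"
     unfolding norm_scaleR using i by (intro mult_mono Basis_le_norm) auto
   qed
   also have "... = (SUM i:Basis. k i) * norm (y - z) * norm v" by (simp add: sum_distrib_left sum_distrib_right mult_ac)
   finally show "norm (f' y v - f' z v) <= (SUM i:Basis. k i) * norm (y - z) * norm v" .
  qed
 qed
 have strict_m: "strict_deriv m (\<o>, \<o>) (f' (\<o>, \<o>))" unfolding f'_def by (rule smooth_on_strict_deriv[OF m(1) oo m(2)])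
 have strict: "EX d>0. ALL a b a' b'. norm a < d --> norm b < d --> norm a' < d --> norm b' < d -->
   norm (\<k> (\<pi> a \<otimes> \<pi> b) - \<k> (\<pi> a' \<otimes> \<pi> b') - (a - a') - (b - b')) <= e * (norm (a - a') + norm (b - b'))" if e: "0 < e" for e
 proof -
  obtain d where d: "0 < d" "!!y z. y : ball (\<o>, \<o>) d ==> z : ball (\<o>, \<o>) d ==>
   norm (m y - m z - f' (\<o>, \<o>) (y - z)) <= e * norm (y - z)" by (rule strict_derivE[OF strict_m e]) blast
  show ?thesis
  proof (intro exI[of _ "min R0 d / 2"] conjI allI impI)
   fix a b a' b' :: 'e
   assume n: "norm a < min R0 d / 2" "norm b < min R0 d / 2" "norm a' < min R0 d / 2" "norm b' < min R0 d / 2"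
   let ?y = "(a + \<o>, b + \<o>)" and ?z = "(a' + \<o>, b' + \<o>)"
   have y: "?y : ball (\<o>, \<o>) d" "?z : ball (\<o>, \<o>) d" "?y : ?\<Omega>" "?z : ?\<Omega>"
   proof -
    have s: "norm a + norm b < d" "norm a' + norm b' < d" "norm a + norm b < R0" "norm a' + norm b' < R0" using n by auto
    show "?y : ball (\<o>, \<o>) d" "?z : ball (\<o>, \<o>) d" by (rule dom, rule s)+
    show "?y : ?\<Omega>" "?z : ?\<Omega>" by (rule subsetD[OF R0(2)], rule dom, rule s)+
   qed
   have "norm (m ?y - m ?z - f' (\<o>, \<o>) (?y - ?z)) <= e * norm (?y - ?z)" by (rule d(2)[OF y(1,2)])
   also have "... <= e * (norm (a - a') + norm (b - b'))" using e norm_Pair_le[of "a - a'" "b - b'"] by (intro mult_left_mono) auto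
   finally show "norm (\<k> (\<pi> a \<otimes> \<pi> b) - \<k> (\<pi> a' \<otimes> \<pi> b') - (a - a') - (b - b')) <= e * (norm (a - a') + norm (b - b'))"
    using m(3)[OF y(3)] m(3)[OF y(4)] by (simp add: \<k>_def \<pi>_def f'_oo algebra_simps)
  qed (use d R0 in auto)
 qed
 obtain d2 where d2: "0 < d2" "ball \<o> d2 \<subseteq> snd c ` fst c" using chart(2)[OF cA] c_o(1) openE by blast
 obtain d3 where d3: "0 < d3" "!!a b a' b'. norm a < d3 ==> norm b < d3 ==> norm a' < d3 ==> norm b' < d3 ==>
   norm (\<k> (\<pi> a \<otimes> \<pi> b) - \<k> (\<pi> a' \<otimes> \<pi> b') - (a - a') - (b - b')) <= 1 / 4 * (norm (a - a') + norm (b - b'))"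
  using strict[of "1 / 4"] by auto
 \<comment> \<open>Within \<open>R0\<close> products stay in the chart, within \<open>d1\<close> the
   derivative \<open>f'\<close> is Lipschitz, within \<open>d2\<close> coordinates are in the image
   of the chart, and \<open>d3\<close> gives the error of one quarter.\<close>
 define R where "R = Min {R0, d1, d2, d3}"
 have R: "0 < R" "R <= R0" "R <= d1" "R <= d2" "R <= d3" using R0 d1 d2 d3 by (auto simp: R_def)
 have inR: "a + \<o> : snd c ` fst c" if "norm a < R" for a using that R(4) d2(2) by (intro subsetD[OF d2(2)]) (simp add: dist_norm)
 have \<pi>0: "\<pi> 0 = \<one>" by (simp add: \<pi>_def c_o)
 have \<k>\<pi>: "\<k> (\<pi> a) = a" if "norm a < R" for a using chart(4)[OF cA inR[OF that]] by (simp add: \<k>_def \<pi>_def)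
 have \<pi>_cont: "continuous_on (ball 0 R) \<pi>"
  unfolding \<pi>_def by (rule continuous_on_compose2[OF chart(7)[OF cA]]) (auto intro!: continuous_intros inR)
 have \<pi>_open: "open (\<pi> ` ball 0 \<r>)" if "\<r> <= R" for \<r>
 proof -
  have "\<pi> ` ball 0 \<r> = fst c Int snd c -` ball \<o> \<r>"
  proof (intro equalityI subsetI)
   fix x assume "x : \<pi> ` ball 0 \<r>"
   then obtain a where a: "norm a < \<r>" "x = \<pi> a" by auto
   hence "a + \<o> : snd c ` fst c" using that by (intro inR) simp
   thus "x : fst c Int snd c -` ball \<o> \<r>" using a chart(4,5)[OF cA] by (simp add: \<pi>_def dist_norm)
  next
   fix x assume "x : fst c Int snd c -` ball \<o> \<r>"
   thus "x : \<pi> ` ball 0 \<r>"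
    using chart(3)[OF cA] by (intro image_eqI[of _ _ "snd c x - \<o>"]) (auto simp: \<pi>_def dist_norm norm_minus_commute)
  qed
  thus ?thesis using continuous_open_preimage[OF chart(6,1)[OF cA] open_ball] by simp
 qed
 \<comment> \<open>Stated for a general operation \<open>h\<close>, in order to serve for products
   and for left quotients.\<close>
 have cont_near: "EX d>0. ALL a b. norm a < d --> norm b < d --> h (\<pi> a) (\<pi> b) : \<pi> ` ball 0 R"
  if h: "!!f g. continuous_on (ball 0 R \<times> ball 0 R) f ==> continuous_on (ball 0 R \<times> ball 0 R) g ==>
   continuous_on (ball 0 R \<times> ball 0 R) (%z::'e \<times> 'e. h (f z) (g z))" "h \<one> \<one> = \<one>" for h :: "'g => 'g => 'g"
 proof -
  have "continuous_on (ball 0 R \<times> ball 0 R) (%z. h (\<pi> (fst z)) (\<pi> (snd z)))"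
   by (intro h(1) continuous_on_compose2[OF \<pi>_cont] continuous_intros) auto
  from continuous_open_preimage[OF this open_Times[OF open_ball open_ball] \<pi>_open[OF order_refl]]
  have "open ((ball 0 R \<times> ball 0 R) Int (%z. h (\<pi> (fst z)) (\<pi> (snd z))) -` (\<pi> ` ball 0 R))" (is "open ?S") .
  moreover have "0 : ?S" using R(1) h(2) by (auto simp: \<pi>0 zero_prod_def intro!: image_eqI[of _ \<pi> 0])
  ultimately obtain d where d: "0 < d" "ball 0 d \<subseteq> ?S" by (rule openE)
  have "h (\<pi> a) (\<pi> b) : \<pi> ` ball 0 R" if "norm a < d / 2" "norm b < d / 2" for a b
  proof -
   have "(a, b) : ball 0 d" using that norm_Pair_le[of a b] by simp
   thus ?thesis using d(2) by auto
  qed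
  thus ?thesis using d(1) by (intro exI[of _ "d / 2"]) auto
 qed
 obtain r1 where r1: "0 < r1" "!!a b. norm a < r1 ==> norm b < r1 ==> \<pi> a \<otimes> \<pi> b : \<pi> ` ball 0 R"
  using cont_near[of "%x y. x \<otimes> y", OF continuous_mult] unfolding group_simps by blast
 obtain r2 where r2: "0 < r2" "!!a b. norm a < r2 ==> norm b < r2 ==> inv (\<pi> a) \<otimes> \<pi> b : \<pi> ` ball 0 R"
  using cont_near[of "%x y. inv x \<otimes> y", OF continuous_mult[OF continuous_inv]] unfolding group_simps by blast
 have F_eq: "FF a v = f' (a + \<o>, \<o>) (0, v)" if "norm a < R" for a v using left_field_eq[OF inR[OF that]] by (simp add: FF_def)
 have pdom: "(a + \<o>, \<o>) : ball (\<o>, \<o>) d1" "(a + \<o>, \<o>) : ?\<Omega>" "(\<o>, a + \<o>) : ball (\<o>, \<o>) d1" "(\<o>, a + \<o>) : ?\<Omega>"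
  if "norm a < R" for a using dom[of a 0] dom[of 0 a] that R one_dom[OF inR[OF that]] by auto
 have F_lip: "norm (FF a v - FF a' v) <= K * norm (a - a') * norm v" if a: "norm a < R" "norm a' < R" for a a' v
  using K(2)[OF pdom(1)[OF a(1)] pdom(1)[OF a(2)] pdom(2)[OF a(1)] pdom(2)[OF a(2)], of "(0, v)"] by (simp add: F_eq a norm_Pair)
 have F_der: "((%b. \<k> (\<pi> a \<otimes> \<pi> b)) has_derivative FF a) (at 0)" if a: "norm a < R" for a
 proof -
  from has_derivative_diff[OF has_derivative_shift[OF left_field_der[OF inR[OF a]]] has_derivative_const[of \<o>]]
  have "((%b. \<k> (\<pi> a \<otimes> \<pi> b)) has_derivative (%v. f' (a + \<o>, \<o>) (0, v))) (at 0)" by (simp add: \<k>_def \<pi>_def)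
  moreover have "FF a = (%v. f' (a + \<o>, \<o>) (0, v))" using F_eq[OF a] by auto
  ultimately show ?thesis by simp
 qed
 have Ad_der: "((%a. frechet_derivative (%b. \<k> (\<pi> a \<otimes> \<pi> b \<otimes> inv (\<pi> a))) (at 0) w) has_derivative (%v. lie_bracket G c v w)) (at 0)" for w
 proof -
  define B where "B a = frechet_derivative (%b. \<k> (\<pi> a \<otimes> \<pi> b \<otimes> inv (\<pi> a))) (at 0)" for a
  have B: "((%b. \<k> (\<pi> a \<otimes> \<pi> b \<otimes> inv (\<pi> a))) has_derivative B a) (at 0)" for a
   using conj_differentiable[of "\<pi> a"] unfolding B_def frechet_derivative_works .
\<comment> \<open>differentiate \<open>x y = (x y x\<^sup>-\<^sup>1) x\<close> in \<open>y\<close> at the identity\<close>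
  have rel: "FF a v = f' (\<o>, a + \<o>) (B a v, 0)" if a: "norm a < R" for a v
  proof -
   let ?g = "%b. \<k> (\<pi> a \<otimes> \<pi> b \<otimes> inv (\<pi> a)) + \<o>"
   have g0: "?g 0 = \<o>" by (simp add: \<pi>0 group_simps \<k>_def base_def)
   have g: "(?g has_derivative B a) (at 0)" using has_derivative_add[OF B[of a] has_derivative_const[of \<o>]] by simp
   have m1: "((%b. m (?g b, a + \<o>)) has_derivative (%v. f' (\<o>, a + \<o>) (B a v, 0))) (at 0)"
    by (rule has_derivative_compose[OF g]) (use part1[OF pdom(4)[OF a]] in "simp add: g0")
   have ev: "\<forall>\<^sub>F b in nhds 0. \<pi> a \<otimes> \<pi> b \<otimes> inv (\<pi> a) : fst c & (?g b, a + \<o>) : ?\<Omega>"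
   proof -
    define T where "T = fst c Int snd c -` ((%p. (p, a + \<o>)) -` ?\<Omega>)"
    have "open T" unfolding T_def by (intro continuous_open_preimage chart cA open_vimage m(1) continuous_intros)
    moreover have "\<one> : T" using one_c pdom(4)[OF a] by (simp add: T_def base_def)
    ultimately have "open ((%y. \<pi> a \<otimes> y \<otimes> inv (\<pi> a)) -` T)" "\<one> : (%y. \<pi> a \<otimes> y \<otimes> inv (\<pi> a)) -` T"
     by (auto simp: group_simps intro!: open_vimage continuous_mult continuous_intros)
    from eventually_param[OF cA one_c this]
    have "\<forall>\<^sub>F q in nhds \<o>. \<pi> a \<otimes> param c q \<otimes> inv (\<pi> a) : T" unfolding base_def by eventually_elim auto
    hence "\<forall>\<^sub>F b in nhds 0. \<pi> a \<otimes> param c (b + \<o>) \<otimes> inv (\<pi> a) : T"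
     by (rule eventually_compose_filterlim) (use tendsto_add[OF filterlim_ident tendsto_const[of \<o> "nhds 0"]] in simp)
    thus ?thesis by eventually_elim (auto simp: T_def \<k>_def \<pi>_def)
   qed
   have "\<forall>\<^sub>F b in nhds 0. m (?g b, a + \<o>) - \<o> = \<k> (\<pi> a \<otimes> \<pi> b)" using ev
   proof eventually_elim
    case (elim b)
    thus ?case using m(3)[of "?g b" "a + \<o>"] chart(3)[OF cA, of "\<pi> a \<otimes> \<pi> b \<otimes> inv (\<pi> a)"]
     by (simp add: \<k>_def \<pi>_def[symmetric] group_simps)
   qed
   from has_derivative_cong_nhds[OF has_derivative_diff[OF m1 has_derivative_const[of \<o>]] this]
   have "((%b. \<k> (\<pi> a \<otimes> \<pi> b)) has_derivative (%v. f' (\<o>, a + \<o>) (B a v, 0))) (at 0)" by simp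
   from has_derivative_unique[OF F_der[OF a] this] show ?thesis by (simp add: fun_eq_iff)
  qed
  have B0: "B 0 w = w" using rel[of 0 w] R(1) by (simp add: F_eq f'_oo)
  \<comment> \<open>By \<open>rel\<close>, \<open>H a = f' (\<o>, a + \<o>) (B a w - w, 0)\<close>.
    Since \<open>f' (\<o>, \<o>)\<close> is addition, \<open>B a w - w\<close> agrees with
    \<open>H a\<close> up to an error as in \<open>has_derivative_implicit\<close>, and
    \<open>H\<close> can be differentiated explicitly.\<close>
  define H where "H a = f' (a + \<o>, \<o>) (0, w) - f' (\<o>, a + \<o>) (w, 0)" for a
  have "((%a. f' (a + \<o>, \<o>) (0, w)) has_derivative (%v. E (0, w) (v, 0))) (at 0)"
   by (rule has_derivative_shift[where f="%p. f' (p, \<o>) (0, w)"])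
    (simp add: has_derivative_partial(1)[where f="%y. f' y (0, w)"] strict_deriv_has_derivative[OF E])
  moreover have "((%a. f' (\<o>, a + \<o>) (w, 0)) has_derivative (%v. E (w, 0) (0, v))) (at 0)"
   by (rule has_derivative_shift[where f="%p. f' (\<o>, p) (w, 0)"])
    (simp add: has_derivative_partial(2)[where f="%y. f' y (w, 0)"] strict_deriv_has_derivative[OF E])
  ultimately have H: "(H has_derivative (%v. E (0, w) (v, 0) - E (w, 0) (0, v))) (at 0)" unfolding H_def[abs_def] by (rule has_derivative_diff)
  have lf: "frechet_derivative (left_field G c v) (at \<o>) u = E (0, v) (u, 0)" for u v
  proof -
   have "((%p. f' (p, \<o>) (0, v)) has_derivative (%u. E (0, v) (u, 0))) (at \<o>)"
    by (rule has_derivative_partial[OF strict_deriv_has_derivative[OF E]])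
   hence "(left_field G c v has_derivative (%u. E (0, v) (u, 0))) (at \<o>)"
    by (rule has_derivative_cong_nhds) (use near in eventually_elim, simp add: left_field_eq)
   from frechet_derivative_at[OF this] show ?thesis by (simp add: fun_eq_iff)
  qed
  \<comment> \<open>\<open>lie_bracket\<close> differentiates both fields in the left factor,
    whereas the second term of \<open>H\<close> moves the right one; symmetry of the second
    derivative of \<open>m\<close> reconciles them.\<close>
  have "E (w, 0) (0, v) = E (0, v) (w, 0)" for v by (rule second_derivative_symmetric[OF m(1) oo _ E E]) (use df in blast)
  hence HH: "(%v. E (0, w) (v, 0) - E (w, 0) (0, v)) = (%v. lie_bracket G c v w)" unfolding lie_bracket_def base_def[symmetric] lf by simp
  have "((%a. B a w) has_derivative (%v. E (0, w) (v, 0) - E (w, 0) (0, v))) (at 0)"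
  proof (rule has_derivative_implicit[where B="%a. B a w", OF H _ K(1) R(1) B0])
   show "H 0 = 0" by (simp add: H_def f'_oo)
   fix a :: 'e assume a: "norm a < R"
   note lin = bounded_linear.linear[OF bl[OF pdom(4)[OF a]]]
   have "B a w - w - H a = (B a w - w) - f' (\<o>, a + \<o>) (B a w - w, 0)"
    using rel[OF a, of w] linear_diff[OF lin, of "(B a w, 0)" "(w, 0)"] by (simp add: H_def F_eq[OF a])
   also have "... = f' (\<o>, \<o>) (B a w - w, 0) - f' (\<o>, a + \<o>) (B a w - w, 0)" by (simp add: f'_oo)
   also have "norm ... <= K * norm ((\<o>, \<o>) - (\<o>, a + \<o>)) * norm (B a w - w, 0::'e)" by (rule K(2)) (use d1 oo pdom[OF a] in auto)
   finally show "norm (B a w - w - H a) <= K * norm a * norm (B a w - w)" by (simp add: norm_Pair)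
  qed
  thus ?thesis unfolding HH B_def .
 qed
 have "local_lie G \<k> \<pi> FF (lie_bracket G c) R (Min {R, r1, r2}) K"
 proof (rule local_lie.intro)
  show "norm (\<k> (\<pi> a \<otimes> \<pi> b) - \<k> (\<pi> a' \<otimes> \<pi> b') - (a - a') - (b - b')) <= (norm (a - a') + norm (b - b')) / 4"
   if "norm a < R" "norm b < R" "norm a' < R" "norm b' < R" for a b a' b' using d3(2)[of a b a' b'] that R(5) by simp
  show "EX d>0. ALL a b. norm a < d --> norm b < d --> norm (\<k> (\<pi> a \<otimes> \<pi> b) - a - b) <= e * (norm a + norm b)" if e: "0 < e" for e
  proof -
   obtain d where d: "0 < d" "!!a b a' b'. norm a < d ==> norm b < d ==> norm a' < d ==> norm b' < d ==>
    norm (\<k> (\<pi> a \<otimes> \<pi> b) - \<k> (\<pi> a' \<otimes> \<pi> b') - (a - a') - (b - b')) <= e * (norm (a - a') + norm (b - b'))"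
    using strict[OF e] by blast
   have "\<k> \<one> = 0" by (simp add: \<k>_def base_def)
   thus ?thesis using d(2)[of _ _ 0 0] d(1) by (intro exI[of _ d]) (auto simp: \<pi>0 group_simps)
  qed
 qed (use group_facts R r1 r2 K(1) \<k>\<pi> \<pi>0 \<pi>_cont \<pi>_open F_der F_lip conj_differentiable Ad_der in auto)
 thus ?thesis by blast
qed

end

section \<open>Endpoint and multiexponential maps\<close>

lemma divide_mult_cancel: "0 < b ==> x / b * b = (x::real)" by simp

lemma has_derivative_in_near:
 assumes D: "has_derivative_in V \<nu> f D y" and \<nu>: "!!h. h : V ==> 0 <= \<nu> h"
 shows "EX K>0. EX \<r>>0. ALL h:V. \<nu> h < \<r> --> norm (f (%i. y i + h i) - f y) <= K * \<nu> h"
proof -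
 obtain K where K: "!!h. h : V ==> norm (D h) <= K * \<nu> h" using D unfolding has_derivative_in_def by blast
 obtain \<r> where \<r>: "0 < \<r>" "!!h. h : V ==> \<nu> h < \<r> ==> norm (f (%i. y i + h i) - f y - D h) <= 1 * \<nu> h"
  using D unfolding has_derivative_in_def by (meson zero_less_one)
 show ?thesis
 proof (rule exI[of _ "abs K + 1"], intro conjI, simp, rule exI[of _ \<r>], intro conjI ballI impI)
  fix h assume h: "h : V" "\<nu> h < \<r>"
  have "K * \<nu> h <= abs K * \<nu> h" using \<nu>[OF h(1)] by (intro mult_right_mono) auto
  thus "norm (f (%i. y i + h i) - f y) <= (abs K + 1) * \<nu> h"
   using \<r>(2)[OF h] K[OF h(1)] norm_triangle_ineq[of "f (%i. y i + h i) - f y - D h" "D h"] by (simp add: distrib_right)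
 qed (use \<r> in auto)
qed

lemma has_derivative_in_open:
 assumes D: "has_derivative_in V \<nu> f D y" and \<nu>: "!!h. h : V ==> 0 <= \<nu> h" and T: "open T" "f y : T"
 shows "EX \<r>>0. ALL h:V. \<nu> h < \<r> --> f (%i. y i + h i) : T"
proof -
 obtain K \<r> where K: "0 < K" "0 < \<r>" "!!h. h : V ==> \<nu> h < \<r> ==> norm (f (%i. y i + h i) - f y) <= K * \<nu> h"
  using has_derivative_in_near[OF D \<nu>] by blast
 obtain e where e: "0 < e" "ball (f y) e \<subseteq> T" using T openE by blast
 show ?thesis
 proof (intro exI[of _ "min \<r> (e / K)"] conjI ballI impI)
  fix h assume h: "h : V" "\<nu> h < min \<r> (e / K)"
  hence "\<nu> h * K < e" using K(1) by (simp add: pos_less_divide_eq)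
  hence "norm (f (%i. y i + h i) - f y) < e" using K(3)[of h] h by (simp add: mult.commute)
  thus "f (%i. y i + h i) : T" using e(2) by (auto simp: dist_norm norm_minus_commute)
 qed (use K e in auto)
qed

text \<open>\<open>k\<close> needs to agree with \<open>g\<close> after \<open>f\<close> only near
  \<open>y\<close>, since a chart says nothing outside its domain.\<close>

lemma has_derivative_in_chain:
 assumes D: "has_derivative_in V \<nu> f D y" and g: "(g has_derivative T) (at (f y))" and \<nu>: "!!h. h : V ==> 0 <= \<nu> h"
  and k: "0 < \<r>" "!!h. h : V ==> \<nu> h < \<r> ==> k (%i. y i + h i) = g (f (%i. y i + h i))" "k y = g (f y)"
 shows "has_derivative_in V \<nu> k (%h. T (D h)) y"
proof -
 have T: "bounded_linear T" using g by (rule has_derivative_bounded_linear)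
 obtain B where B: "B > 0" "!!v. norm (T v) <= norm v * B" using bounded_linear.pos_bounded[OF T] by blast
 from D obtain K where K: "!!h. h : V ==> norm (D h) <= K * \<nu> h"
  and D_eps: "!!e. e > 0 ==> EX \<d>>0. ALL h:V. \<nu> h < \<d> --> norm (f (%i. y i + h i) - f y - D h) <= e * \<nu> h"
  unfolding has_derivative_in_def by blast
 obtain K' \<r>' where K': "0 < K'" "0 < \<r>'" "!!h. h : V ==> \<nu> h < \<r>' ==> norm (f (%i. y i + h i) - f y) <= K' * \<nu> h"
  using has_derivative_in_near[OF D \<nu>] by blast
 have "norm (T (D h)) <= B * K * \<nu> h" if "h : V" for h
 proof -
  have "norm (T (D h)) <= B * norm (D h)" using B(2) by (simp add: mult.commute)
  also have "... <= B * (K * \<nu> h)" using K[OF that] B(1) by (intro mult_left_mono) auto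
  finally show ?thesis by (simp add: mult.assoc)
 qed
 moreover have "EX \<d>>0. ALL h:V. \<nu> h < \<d> --> norm (k (%i. y i + h i) - k y - T (D h)) <= e * \<nu> h" if e: "e > 0" for e
 proof -
  obtain d1 where d1: "0 < d1" "!!w. norm (w - f y) < d1 ==> norm (g w - g (f y) - T (w - f y)) <= e / 2 / K' * norm (w - f y)"
  proof -
   have "0 < e / 2 / K'" using e K'(1) by simp
   thus thesis using g that unfolding has_derivative_at_alt by blast
  qed
  obtain d2 where d2: "0 < d2" "!!h. h : V ==> \<nu> h < d2 ==> norm (f (%i. y i + h i) - f y - D h) <= e / 2 / B * \<nu> h"
   using D_eps[of "e / 2 / B"] e B(1) by auto
  show ?thesis
  proof (intro exI[of _ "Min {\<r>, \<r>', d1 / K', d2}"] conjI ballI impI)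
   show "0 < Min {\<r>, \<r>', d1 / K', d2}" using k(1) K' d1 d2 by simp
   fix h assume h: "h : V" "\<nu> h < Min {\<r>, \<r>', d1 / K', d2}"
   let ?w = "f (%i. y i + h i) - f y"
   have w: "norm ?w <= K' * \<nu> h" using K'(3) h by simp
   have "\<nu> h * K' < d1" using h K'(1) by (simp add: pos_less_divide_eq)
   hence "norm ?w < d1" using w by (simp add: mult.commute)
   hence "norm (g (f (%i. y i + h i)) - g (f y) - T ?w) <= e / 2 / K' * norm ?w" by (rule d1(2))
   also have "... <= e / 2 / K' * (K' * \<nu> h)" using w e K'(1) by (intro mult_left_mono) auto
   finally have 1: "norm (g (f (%i. y i + h i)) - g (f y) - T ?w) <= e / 2 * \<nu> h" using K'(1) by simp
   have "norm (T (?w - D h)) <= e / 2 / B * \<nu> h * B" using B(2)[of "?w - D h"] mult_right_mono[OF d2(2)[of h], of B] h B(1) by simp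
   hence 2: "norm (T ?w - T (D h)) <= e / 2 * \<nu> h" using B(1) by (simp add: linear_diff[OF bounded_linear.linear[OF T]])
   have "k (%i. y i + h i) - k y = g (f (%i. y i + h i)) - g (f y)" using k(2)[OF h(1)] h(2) k(3) by simp
   thus "norm (k (%i. y i + h i) - k y - T (D h)) <= e * \<nu> h"
    using 1 2 norm_triangle_ineq[of "g (f (%i. y i + h i)) - g (f y) - T ?w" "T ?w - T (D h)"] by simp
  qed
 qed
 ultimately show ?thesis using D unfolding has_derivative_in_def
  by (auto simp: linear_add[OF bounded_linear.linear[OF T]] linear_scale[OF bounded_linear.linear[OF T]])
qed

lemma nearby:
 assumes "continuous_on S f" "t : S" "open T" "f t : T"
 shows "\<forall>\<^sub>F s in nhds t. s : S --> f s : T" using assms unfolding continuous_on_topological eventually_nhds by meson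

section \<open>Charts compared with the coordinate ball\<close>

locale lie_chart_local = lie_chart G A c +
 local_lie G "lie_chart.\<k> G c" "lie_chart.\<pi> G c" "lie_chart.FF G c" "lie_bracket G c" R r L
 for G :: "'g::{t2_space,second_countable_topology} monoid" (structure)
  and A :: "('g, 'e::euclidean_space) chart set" and c R r L
begin

lemma U_param: "x : U R ==> param c (snd c x) = x" using U_D[of x R] by (simp add: \<k>_def \<pi>_def)

text \<open>The two changes of coordinates are mutually inverse near the points in question, so by
  the chain rule their differentials are inverse linear maps.\<close>

lemma transition_inverse:
 assumes d: "d : A" "x : fst d"
 obtains T S where "((%p. \<k> (param d p \<otimes> inv x)) has_derivative T) (at (snd d x))"
  "((%b. snd d (\<pi> b \<otimes> x)) has_derivative S) (at 0)" "surj T" "surj S"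
proof -
 let ?g = "%p. \<k> (param d p \<otimes> inv x)" and ?s = "%b. snd d (\<pi> b \<otimes> x)"
 obtain T where "((%p. snd c (param d p \<otimes> inv x)) has_derivative T) (at (snd d x))"
  using translate_differentiable(2)[OF d(1) cA d(2), of "inv x"] one_c by (auto simp: differentiable_def gsimps)
 from has_derivative_diff[OF this has_derivative_const[of \<o>]]
 have T: "(?g has_derivative T) (at (snd d x))" by (simp add: \<k>_def)
 obtain S where "((%q. snd d (param c q \<otimes> x)) has_derivative S) (at \<o>)"
  using translate_differentiable(2)[OF cA d(1) one_c, of x] d by (auto simp: differentiable_def gsimps base_def)
 from has_derivative_shift[OF this] have S: "(?s has_derivative S) (at 0)" by (simp add: \<pi>_def)
 have g0: "?g (snd d x) = 0" and s0: "?s 0 = snd d x" using chart(3)[OF d] by (simp_all add: gsimps \<pi>_0)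
 have "\<forall>\<^sub>F b in nhds 0. b : ball 0 R & \<pi> b \<otimes> x : fst d"
 proof -
  have "continuous_on (ball 0 R) (%b. \<pi> b \<otimes> x)" by (intro continuous_intros \<pi>_cont)
  from nearby[OF this, of 0 "fst d"] have "\<forall>\<^sub>F b in nhds 0. b : ball 0 R --> \<pi> b \<otimes> x : fst d"
   using R_pos chart(1)[OF d(1)] d by (simp add: \<pi>_0 gsimps)
  moreover have "\<forall>\<^sub>F b in nhds 0. b : ball (0::'e) R" by (rule eventually_nhds_in_open) (use R_pos in auto)
  ultimately show ?thesis by eventually_elim auto
 qed
 hence ev: "\<forall>\<^sub>F b in nhds 0. ?g (?s b) = b" by eventually_elim (simp add: chart(3)[OF d(1)] gsimps \<k>_\<pi>)
 have "(?g has_derivative T) (at (?s 0))" using T s0 by simp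
 from has_derivative_cong_nhds[OF has_derivative_compose[OF S this] ev]
 have TS: "(%v. T (S v)) = (%v. v)" by (rule has_derivative_unique) (rule has_derivative_ident)
 have "\<forall>\<^sub>F p in nhds (snd d x). p : snd d ` fst d & param d p : (%z. z \<otimes> inv x) -` U R"
  by (intro eventually_param d open_vimage open_U R_pos order_refl continuous_intros) (use R_pos in "simp add: gsimps")
 hence ev: "\<forall>\<^sub>F p in nhds (snd d x). ?s (?g p) = p" by eventually_elim (use U_D[of _ R] chart(4)[OF d(1)] in "simp add: gsimps")
 have "(?s has_derivative S) (at (?g (snd d x)))" using S g0 by simp
 from has_derivative_cong_nhds[OF has_derivative_compose[OF T this] ev]
 have ST: "(%v. S (T v)) = (%v. v)" by (rule has_derivative_unique) (rule has_derivative_ident)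
 show thesis by (rule that[OF T S]; rule surjI) (rule fun_cong[OF TS] fun_cong[OF ST])+
qed

text \<open>A change of coordinates composes the differential with one of the surjections of
  \<open>transition_inverse\<close>. Differentiability implies continuity in \<open>\<nu>\<close>,
  which keeps small perturbations in the domain of the other coordinate.\<close>

lemma submersion_at_iff:
 assumes \<nu>: "!!h. h : V ==> 0 <= \<nu> h"
 shows "submersion_at A V \<nu> f y <-> sub_at V \<nu> f y"
proof
 assume "submersion_at A V \<nu> f y"
 then obtain d D \<r> where d: "d : A" "f y : fst d" and \<r>: "0 < \<r>" "!!h. h : V ==> \<nu> h < \<r> ==> f (%i. y i + h i) : fst d"
  and D: "has_derivative_in V \<nu> (snd d \<circ> f) D y" "D ` V = UNIV" unfolding submersion_at_def by blast
 obtain T S where T: "((%p. \<k> (param d p \<otimes> inv (f y))) has_derivative T) (at (snd d (f y)))" "surj T"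
  by (rule transition_inverse[OF d]) blast
 have "has_derivative_in V \<nu> (%z. \<k> (f z \<otimes> inv (f y))) (%h. T (D h)) y"
  by (rule has_derivative_in_chain[OF D(1) _ \<nu> \<r>(1), of "%p. \<k> (param d p \<otimes> inv (f y))"]) (use T(1) chart(3)[OF d(1)] \<r>(2) d in auto)
 moreover have "(%h. T (D h)) ` V = UNIV" using D(2) T(2) by (simp add: image_image[symmetric])
 moreover have "EX \<r>>0. ALL h:V. \<nu> h < \<r> --> f (%i. y i + h i) \<otimes> inv (f y) : U R"
 proof -
  have op: "open (snd d ` fst d Int param d -` ((%z. z \<otimes> inv (f y)) -` U R))"
   by (intro continuous_open_preimage chart d open_vimage open_U R_pos order_refl continuous_intros)
  obtain \<r>' where "\<r>' > 0" "!!h. h : V ==> \<nu> h < \<r>' ==> (snd d \<circ> f) (%i. y i + h i) : snd d ` fst d Int param d -` ((%z. z \<otimes> inv (f y)) -` U R)"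
   using has_derivative_in_open[OF D(1) \<nu> op] d chart(3)[OF d] R_pos by (auto simp: gsimps)
  thus ?thesis using \<r> chart(3)[OF d(1) \<r>(2)] by (intro exI[of _ "min \<r> \<r>'"]) force
 qed
 ultimately show "sub_at V \<nu> f y" unfolding sub_at_def by blast
next
 assume "sub_at V \<nu> f y"
 then obtain \<r> D where \<r>: "0 < \<r>" "!!h. h : V ==> \<nu> h < \<r> ==> f (%i. y i + h i) \<otimes> inv (f y) : U R"
  and D: "has_derivative_in V \<nu> (%z. \<k> (f z \<otimes> inv (f y))) D y" "D ` V = UNIV" unfolding sub_at_def by blast
 obtain d where d: "d : A" "f y : fst d" by (rule chart_at)
 obtain T S where S: "((%b. snd d (\<pi> b \<otimes> f y)) has_derivative S) (at 0)" "surj S" by (rule transition_inverse[OF d]) blast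
 have U: "\<pi> (\<k> (f (%i. y i + h i) \<otimes> inv (f y))) \<otimes> f y = f (%i. y i + h i)" if "h : V" "\<nu> h < \<r>" for h
  using U_D[OF \<r>(2)[OF that] order_refl] by (simp add: gsimps)
 have "has_derivative_in V \<nu> (snd d \<circ> f) (%h. S (D h)) y"
  by (rule has_derivative_in_chain[OF D(1) _ \<nu> \<r>(1), of "%b. snd d (\<pi> b \<otimes> f y)"]) (use S(1) U in "auto simp: gsimps \<pi>_0")
 moreover have "(%h. S (D h)) ` V = UNIV" using D(2) S(2) by (simp add: image_image[symmetric])
 moreover have "EX \<r>>0. ALL h:V. \<nu> h < \<r> --> f (%i. y i + h i) : fst d"
 proof -
  have op: "open (ball 0 R Int (%b. \<pi> b \<otimes> f y) -` fst d)"
   by (intro continuous_open_preimage chart d open_ball continuous_intros \<pi>_cont)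
  obtain \<r>' where "\<r>' > 0" "!!h. h : V ==> \<nu> h < \<r>' ==> \<k> (f (%i. y i + h i) \<otimes> inv (f y)) : ball 0 R Int (%b. \<pi> b \<otimes> f y) -` fst d"
   using has_derivative_in_open[OF D(1) \<nu> op] d R_pos by (auto simp: gsimps \<pi>_0)
  thus ?thesis using \<r>(1) U by (intro exI[of _ "min \<r> \<r>'"]) force
 qed
 ultimately show "submersion_at A V \<nu> f y" unfolding submersion_at_def using d by blast
qed

text \<open>Near \<open>t0\<close> the chart value of \<open>\<c> t\<close> is a function of that of
  \<open>\<c> s\<close> and of the coordinate of \<open>inv (\<c> s) \<otimes> \<c> t\<close>,
  strictly differentiable at \<open>(\<c> t0, \<one>)\<close> in coordinates. Local Lipschitz bounds
  on a compact interval give a global one.\<close>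

lemma left_lip_chart_lipschitz:
 assumes lip: "left_lip {a..b} \<c>" and d: "d : A" "\<c> ` {a..b} \<subseteq> fst d"
 obtains K where "!!s t. s : {a..b} ==> t : {a..b} ==> norm (snd d (\<c> t) - snd d (\<c> s)) <= K * abs (t - s)"
proof -
 obtain K \<d> where K: "0 <= K" "0 < \<d>" "!!s t. s : {a..b} ==> t : {a..b} ==> abs (s - t) < \<d> ==>
   inv (\<c> s) \<otimes> \<c> t : U R & norm (\<k> (inv (\<c> s) \<otimes> \<c> t)) <= K * abs (s - t)" using lip unfolding left_lip_def by blast
 have cont: "continuous_on {a..b} (%t. snd d (\<c> t))" using continuous_on_compose2[OF chart(6)[OF d(1)] left_lip_continuous_on[OF lip] d(2)] .
 \<comment> \<open>The first argument is a dummy parameter; only the space variable counts.\<close>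
 have "local_lipschitz {0::real} {a..b} (%_ t. snd d (\<c> t))"
 proof (rule local_lipschitzI)
  fix x0 t0 :: real assume t0: "t0 : {a..b}"
  hence t0d: "\<c> t0 : fst d" using d by auto
  obtain D where "strict_deriv (%(p, q). snd d (param d p \<otimes> param c q)) (snd d (\<c> t0), \<o>) D"
   unfolding base_def by (rule mult_strict_deriv[OF d(1) cA d(1) t0d one_c]) (simp_all add: gsimps t0d)
  then obtain e K' where e: "0 < e" "0 < K'" "!!y z. y : ball (snd d (\<c> t0), \<o>) e ==> z : ball (snd d (\<c> t0), \<o>) e ==>
   norm ((%(p, q). snd d (param d p \<otimes> param c q)) y - (%(p, q). snd d (param d p \<otimes> param c q)) z) <= K' * norm (y - z)"
   by (rule strict_deriv_lipschitz) blast
  have "\<forall>\<^sub>F s in nhds t0. s : {a..b} --> snd d (\<c> s) : ball (snd d (\<c> t0)) (e / 2)" by (rule nearby[OF cont t0]) (use e in auto)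
  then obtain e1 where e1: "0 < e1" "!!s. dist s t0 < e1 ==> s : {a..b} ==> snd d (\<c> s) : ball (snd d (\<c> t0)) (e / 2)"
   unfolding eventually_nhds_metric by blast
  \<comment> \<open>With \<open>u = m / 4\<close>, two points of the \<open>u\<close>-ball are less
    than \<open>\<d>\<close> apart and their left quotient has coordinate norm below
    \<open>e / 2\<close>.\<close>
  define m where "m = min (min e1 \<d>) (e / 2 / (K + 1))"
  define u where "u = m / 4"
  have u: "0 < u" "u < e1" "2 * u < \<d>" "2 * u * (K + 1) < e / 2"
  proof -
   have m: "0 < m" "m <= e1" "m <= \<d>" "m <= e / 2 / (K + 1)"
    unfolding m_def using e e1 K by (auto simp only: min_less_iff_conj min.cobounded1 min.cobounded2 min.coboundedI1 intro!: divide_pos_pos)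
   thus "0 < u" "u < e1" "2 * u < \<d>" by (auto simp: u_def)
   have "2 * u < e / 2 / (K + 1)" using m unfolding u_def by linarith
   hence "2 * u * (K + 1) < e / 2 / (K + 1) * (K + 1)" using K(1) by (intro mult_strict_right_mono) auto
   thus "2 * u * (K + 1) < e / 2" using divide_mult_cancel[of "K + 1" "e / 2"] K(1) by linarith
  qed
  have "norm (snd d (\<c> t) - snd d (\<c> s)) <= K' * K * abs (t - s)" if s: "s : cball t0 u Int {a..b}" "t : cball t0 u Int {a..b}" for s t
  proof -
   have st: "abs (s - t) <= 2 * u" using s by (auto simp: dist_real_def)
   hence k: "inv (\<c> s) \<otimes> \<c> t : U R" "norm (\<k> (inv (\<c> s) \<otimes> \<c> t)) <= K * abs (s - t)" using K(3)[of s t] s u(3) by auto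
   let ?p = "snd d (\<c> s)" and ?q = "snd c (inv (\<c> s) \<otimes> \<c> t)"
   have p: "dist (snd d (\<c> t0)) ?p < e / 2" using e1(2)[of s] s u(2) by (auto simp: dist_commute)
   have "K * abs (s - t) <= (K + 1) * (2 * u)" using st K(1) u(1) by (intro mult_mono) auto
   moreover have "(K + 1) * (2 * u) = 2 * u * (K + 1)" by simp
   moreover have "norm (\<k> (inv (\<c> s) \<otimes> \<c> t)) = dist \<o> ?q" by (simp add: \<k>_def dist_norm norm_minus_commute)
   ultimately have q: "dist \<o> ?q < e / 2" using k(2) u(4) by linarith
   have "dist (snd d (\<c> t0), \<o>) (?p, ?q) <= dist (snd d (\<c> t0)) ?p + dist \<o> ?q"
    unfolding dist_Pair_Pair using sqrt_sum_squares_le_sum by force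
   hence B: "(?p, ?q) : ball (snd d (\<c> t0), \<o>) e" "(?p, \<o>) : ball (snd d (\<c> t0), \<o>) e"
   proof -
    have "dist (snd d (\<c> t0)) ?p < e" using p zero_le_dist[of "snd d (\<c> t0)" ?p] by linarith
    thus "(?p, \<o>) : ball (snd d (\<c> t0), \<o>) e" by (simp add: dist_Pair_Pair)
   qed (use p q in simp)
   have \<c>s: "param d ?p = \<c> s" using s d by (intro chart(3)) auto
   have "norm (snd d (\<c> t) - snd d (\<c> s)) <= K' * norm ((?p, ?q) - (?p, \<o>))"
    using e(3)[OF B] U_param[OF k(1)] \<c>s chart(3)[OF cA one_c] by (simp add: gsimps base_def)
   also have "... <= K' * (K * abs (s - t))" using k(2) e(2) by (intro mult_left_mono) (auto simp: norm_Pair \<k>_def)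
   finally show ?thesis by (simp add: abs_minus_commute mult.assoc)
  qed
  hence "(K' * K)-lipschitz_on (cball t0 u Int {a..b}) (%t. snd d (\<c> t))"
   using e(2) K(1) by (intro lipschitz_onI) (auto simp: dist_norm dist_real_def abs_minus_commute norm_minus_commute)
  thus "EX u>0. EX L. ALL t:cball x0 u Int {0}. L-lipschitz_on (cball t0 u Int {a..b}) (%t. snd d (\<c> t))" using u(1) by blast
 qed
 then obtain K where "K-lipschitz_on {a..b} (%t. snd d (\<c> t))"
  using local_lipschitz_compact_implies_lipschitz[of "{0::real}" "{a..b}" "%_ t. snd d (\<c> t)"] by auto
 thus thesis by (intro that[of K]) (auto dest: lipschitz_onD simp: dist_norm dist_real_def)
qed

lemma logder_const: "t : S ==> logder (%_. x) S t 0" using R_pos by (simp add: logder_def germ_def gsimps)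

lemma left_lip_const: "left_lip S (%_. x)" by (rule left_lipI[of 0 1]) (use R_pos in "simp_all add: gsimps")

context
 fixes u Y :: "real => 'e"
 assumes u: "ctrl u" and uY: "!!t. t : {0..1} ==> u t = Y t"
begin

lemma flow_lip: "left_lip {0..1} (flow u)" and flow_logder: "ae {0..1} (%t. logder (flow u) {0..1} t (u t))"
 using flow_sol[OF u zero_le_one] by (auto simp: sol_def)

lemma flow_solves: "solves G A c Y (flow u)"
proof -
 have "abs_cont_on a b (snd d \<circ> flow u)" if d: "d : A" "0 <= a" "b <= 1" "flow u ` {a..b} \<subseteq> fst d" for d a b
 proof -
  have "left_lip {a..b} (flow u)" using flow_lip d by (rule_tac left_lip_subset) auto
  then obtain K where K: "!!s t. s : {a..b} ==> t : {a..b} ==> norm (snd d (flow u t) - snd d (flow u s)) <= K * abs (t - s)"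
   using d by (rule_tac left_lip_chart_lipschitz) auto
  have "norm (snd d (flow u t) - snd d (flow u s)) <= K * (t - s)" if "a <= s" "s < t" "t <= b" for s t using K[of s t] that by simp
  thus ?thesis by (intro lipschitz_abs_cont_on[where K=K]) simp
 qed
 hence "abs_cont_curve A (flow u)" unfolding abs_cont_curve_def using continuous_on_subset[OF continuous_on_flow[OF u]] by auto
 moreover have "AE t in lebesgue. t : {0..1} -->
   ((%s. snd c (inv (flow u t) \<otimes> flow u s)) has_vector_derivative Y t) (at t within {0..1})" using flow_logder
 proof eventually_elim
  case (elim t)
  show ?case
  proof
   assume t: "t : {0..1}"
   hence "((%s. \<k> (inv (flow u t) \<otimes> flow u s)) has_vector_derivative u t) (at t within {0..1})"
    using elim by (simp add: logder_def germ_def)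
   from has_vector_derivative_add[OF this has_vector_derivative_const[of \<o>]]
   show "((%s. snd c (inv (flow u t) \<otimes> flow u s)) has_vector_derivative Y t) (at t within {0..1})" using uY[OF t] by (simp add: \<k>_def)
  qed
 qed
 ultimately show ?thesis unfolding solves_def by (simp add: AE_lebesgue_on_iff)
qed

text \<open>\<open>\<c>\<close> is only absolutely continuous, and that chart by chart, so
  \<open>sol_unique\<close> does not apply. The quotient \<open>\<zeta>\<close> of
  \<open>\<c>\<close> by the flow has logarithmic derivative zero almost everywhere; it remains to
  see that its local coordinate is absolutely continuous, whence \<open>\<zeta>\<close> is locally
  constant.\<close>

lemma solves_unique:
 assumes sol: "solves G A c Y \<c>"
 shows "\<c> 1 = flow u 1"
proof -
 let ?I = "{0..1::real}" and ?\<phi> = "flow u"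
 have ac: "!!d a b. d : A ==> 0 <= a ==> a <= b ==> b <= 1 ==> \<c> ` {a..b} \<subseteq> fst d ==> abs_cont_on a b (snd d \<circ> \<c>)"
  and cont: "continuous_on ?I \<c>" and \<c>0: "\<c> 0 = \<one>"
  and der: "AE t in lebesgue. t : ?I --> ((%s. snd c (inv (\<c> t) \<otimes> \<c> s)) has_vector_derivative Y t) (at t within ?I)"
  using sol unfolding solves_def abs_cont_curve_def by (auto simp: AE_lebesgue_on_iff)
 have c\<phi>: "continuous_on ?I ?\<phi>" using continuous_on_subset[OF continuous_on_flow[OF u]] by auto
 define \<zeta> where "\<zeta> t = \<c> t \<otimes> inv (?\<phi> t)" for t
 have ld: "AE t in lebesgue. t : ?I --> logder \<zeta> ?I t 0" using der flow_logder
 proof eventually_elim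
  case (elim t)
  show ?case
  proof
   assume t: "t : ?I"
   from has_vector_derivative_diff[OF _ has_vector_derivative_const[of \<o>], of "%s. snd c (inv (\<c> t) \<otimes> \<c> s)" "Y t"] elim t
   have "((%s. \<k> (inv (\<c> t) \<otimes> \<c> s)) has_vector_derivative Y t) (at t within ?I)" by (simp add: \<k>_def)
   moreover have "((%s. inv (\<c> t) \<otimes> \<c> s) ---> inv (\<c> t) \<otimes> \<c> t) (at t within ?I)"
    using cont t by (intro tendsto_mult_G tendsto_const) (simp add: continuous_on_def)
   hence "\<forall>\<^sub>F s in at t within ?I. inv (\<c> t) \<otimes> \<c> s : U R"
    by (rule topological_tendstoD[OF _ open_U]) (use R_pos in "simp_all add: gsimps")
   ultimately have "logder \<c> ?I t (u t)" using uY[OF t] by (simp add: logder_def germ_def gsimps)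
   from logder_mult[OF this logder_inv[of ?\<phi> ?I t "u t"]] elim t
   show "logder \<zeta> ?I t 0" by (simp add: \<zeta>_def[abs_def] gsimps)
  qed
 qed
 have "\<zeta> constant_on ?I"
 proof (rule locally_constant_imp_constant)
  fix t0 assume t0: "t0 : ?I"
  obtain d where d: "d : A" "\<c> t0 : fst d" by (rule chart_at)
  obtain e where e: "e : A" "inv (\<c> t0) : fst e" by (rule chart_at)
  obtain D where "strict_deriv (%(p, q). snd c (param e p \<otimes> param d q)) (snd e (inv (\<c> t0)), snd d (\<c> t0)) D"
   by (rule mult_strict_deriv[OF e(1) d(1) cA e(2) d(2)]) (simp_all add: gsimps one_c)
  then obtain \<d> K where K: "0 < \<d>" "0 < K" "!!y z. y : ball (snd e (inv (\<c> t0)), snd d (\<c> t0)) \<d> ==> z : ball (snd e (inv (\<c> t0)), snd d (\<c> t0)) \<d> ==>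
   norm ((%(p, q). snd c (param e p \<otimes> param d q)) y - (%(p, q). snd c (param e p \<otimes> param d q)) z) <= K * norm (y - z)"
   by (rule strict_deriv_lipschitz) blast
  \<comment> \<open>\<open>x s \<otimes> \<eta> s\<close> is \<open>\<zeta> s\<close> translated on
    both sides so that it passes through \<open>\<one>\<close> at \<open>t0\<close>; the factor
    \<open>x\<close> carries the merely absolutely continuous part, \<open>\<eta>\<close> is
    Lipschitz.\<close>
  define x where "x s = inv (\<c> t0) \<otimes> \<c> s" for s
  define \<eta> where "\<eta> s = inv (?\<phi> s) \<otimes> ?\<phi> t0" for s
  define W where "W = fst d Int snd d -` ball (snd d (\<c> t0)) \<d>"
  have W: "open W" "\<c> t0 : W" unfolding W_def using d K(1) by (auto intro!: continuous_open_preimage chart)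
  have cx: "continuous_on ?I x" "continuous_on ?I \<eta>" "continuous_on ?I (%s. x s \<otimes> \<eta> s)"
   unfolding x_def \<eta>_def by (intro continuous_intros cont c\<phi>)+
  have Ur: "open (U r)" "\<one> : U r" using radii by (auto intro: open_U)
  have "\<forall>\<^sub>F s in nhds t0. s : ?I --> \<c> s : W & x s : U r & \<eta> s : U r Int fst c & x s \<otimes> \<eta> s : U r"
  proof -
   have "\<forall>\<^sub>F s in nhds t0. s : ?I --> \<eta> s : U r Int fst c"
    by (rule nearby[OF cx(2) t0]) (use Ur one_c chart(1)[OF cA] in "auto simp: \<eta>_def gsimps")
   moreover have "\<forall>\<^sub>F s in nhds t0. s : ?I --> x s : U r" "\<forall>\<^sub>F s in nhds t0. s : ?I --> x s \<otimes> \<eta> s : U r"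
    using nearby[OF cx(1) t0 Ur(1)] nearby[OF cx(3) t0 Ur(1)] Ur(2) by (simp_all add: x_def \<eta>_def gsimps)
   ultimately show ?thesis using nearby[OF cont t0 W] by eventually_elim auto
  qed
  then obtain \<epsilon> where \<epsilon>: "0 < \<epsilon>" and near: "!!s. abs (s - t0) < \<epsilon> ==> s : ?I ==> \<c> s : W & x s : U r & \<eta> s : U r & \<eta> s : fst c & x s \<otimes> \<eta> s : U r"
   unfolding eventually_nhds_metric dist_real_def by auto
  define k where "k s = \<k> (x s \<otimes> \<eta> s)" for s
  have flat: "k b = k a" if ab: "0 <= a" "a <= b" "b <= 1" "{a..b} \<subseteq> ball t0 \<epsilon>" for a b
  proof (rule abs_cont_zero_derivative[OF _ ab(2)])
   have in_near: "\<c> s : W" "x s : U r" "\<eta> s : U r" "\<eta> s : fst c" "x s \<otimes> \<eta> s : U r" "s : ?I" if "s : {a..b}" for s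
    using near[of s] ab that by (auto simp: dist_real_def subset_iff abs_minus_commute)
   have "left_lip {a..b} \<eta>" unfolding \<eta>_def
    using ab by (intro left_lip_subset[OF left_lip_mult[OF left_lip_inv[OF flow_lip] left_lip_const]]) auto
   then obtain K' where K': "!!s t. s : {a..b} ==> t : {a..b} ==> norm (snd c (\<eta> t) - snd c (\<eta> s)) <= K' * abs (t - s)"
    by (rule left_lip_chart_lipschitz[OF _ cA]) (use in_near in auto)
   have ac1: "abs_cont_on a b (%s. \<k> (\<eta> s))"
   proof (rule lipschitz_abs_cont_on)
    show "norm (\<k> (\<eta> t) - \<k> (\<eta> s)) <= K' * (t - s)" if "a <= s" "s < t" "t <= b" for s t using K'[of s t] that by (simp add: \<k>_def)
   qed
   have ac2: "abs_cont_on a b (snd d \<circ> \<c>)" using ab in_near(1) by (intro ac d) (auto simp: W_def)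
   show "abs_cont_on a b k"
   proof (rule abs_cont_on_dominated[OF ac2 ac1, of "2 * (K + 1)"])
    fix s t assume s: "s : {a..b}" "t : {a..b}"
    have xk: "norm (\<k> (x t) - \<k> (x s)) <= K * norm (snd d (\<c> t) - snd d (\<c> s))"
     using K(3)[of "(snd e (inv (\<c> t0)), snd d (\<c> t))" "(snd e (inv (\<c> t0)), snd d (\<c> s))"] in_near(1)[OF s(1)] in_near(1)[OF s(2)]
     by (simp add: W_def dist_Pair_Pair chart(3)[OF e] chart(3)[OF d(1)] \<k>_def x_def norm_Pair)
    have in_R: "norm (\<k> z) < R" "\<pi> (\<k> z) = z" if "z : U r" for z using U_D[OF that radii(2)] radii by auto
    let ?a = "\<k> (x t) - \<k> (x s)" and ?b = "\<k> (\<eta> t) - \<k> (\<eta> s)"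
    have "norm (k t - k s - ?a - ?b) <= (norm ?a + norm ?b) / 4"
     using strict[of "\<k> (x t)" "\<k> (\<eta> t)" "\<k> (x s)" "\<k> (\<eta> s)"] in_near[OF s(1)] in_near[OF s(2)] in_R by (simp add: k_def)
    hence "norm (k t - k s) <= 2 * (norm ?a + norm ?b)" by norm
    also have "... <= 2 * (K * norm (snd d (\<c> t) - snd d (\<c> s)) + norm ?b)" using xk by simp
    also have "... <= 2 * ((K + 1) * norm (snd d (\<c> t) - snd d (\<c> s)) + (K + 1) * norm ?b)"
     using K(2) by (intro mult_left_mono add_mono mult_right_mono) (auto simp: distrib_right)
    finally show "norm (k t - k s) <= 2 * (K + 1) * (norm ((snd d \<circ> \<c>) t - (snd d \<circ> \<c>) s) + norm ?b)" by (simp add: algebra_simps)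
   qed (use K(2) in simp)
   show "ae {a..b} (%t. (k has_vector_derivative 0) (at t within {a..b}))" using ld
   proof eventually_elim
    case (elim t)
    show ?case
    proof
     assume t: "t : {a..b}"
     have "logder (%s. (inv (\<c> t0) \<otimes> \<zeta> s) \<otimes> ?\<phi> t0) ?I t (Ad (inv (?\<phi> t0)) 0 + 0)"
      using elim in_near(6)[OF t] by (intro logder_mult logder_const) (simp_all add: logder_translate)
     hence "logder (%s. x s \<otimes> \<eta> s) {a..b} t 0"
      using logder_subset[of _ ?I t _ "{a..b}"] ab linear_0[OF linear_Ad] by (simp add: x_def \<eta>_def \<zeta>_def gsimps)
     from logder_chart[OF this, of \<one>] in_near(5)[OF t]
     show "(k has_vector_derivative 0) (at t within {a..b})"
      using linear_0[OF F_linear] U_D[OF in_near(5)[OF t] radii(2)] radii by (simp add: k_def[abs_def] gsimps)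
    qed
   qed
  qed
  have const: "\<zeta> s = \<zeta> t0" if s: "s : ?I Int ball t0 \<epsilon>" for s
  proof -
   have "k s = k t0"
   proof (cases "s <= t0")
    case True thus ?thesis using flat[of s t0] s t0 by (auto simp: dist_real_def subset_iff)
   next
    case False thus ?thesis using flat[of t0 s] s t0 by (auto simp: dist_real_def subset_iff)
   qed
   hence "\<k> (x s \<otimes> \<eta> s) = 0" by (simp add: k_def x_def \<eta>_def gsimps)
   moreover have "x s \<otimes> \<eta> s : U R" using near[of s] s U_mono[OF radii(2)] by (auto simp: dist_real_def abs_minus_commute)
   ultimately have "inv (\<c> t0) \<otimes> (\<zeta> s \<otimes> ?\<phi> t0) = \<one>" using \<k>_eq_0 by (simp add: x_def \<eta>_def \<zeta>_def gsimps)
   hence "\<zeta> s \<otimes> ?\<phi> t0 = \<zeta> t0 \<otimes> ?\<phi> t0" by (simp add: inv_mult_eq_one_iff \<zeta>_def gsimps)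
   thus ?thesis by (simp add: mult_right_cancel)
  qed
  show "EX T. openin (top_of_set ?I) T & t0 : T & (ALL s:T. \<zeta> s = \<zeta> t0)"
  proof (intro exI[of _ "?I Int ball t0 \<epsilon>"] conjI ballI)
   show "openin (top_of_set ?I) (?I Int ball t0 \<epsilon>)" by (rule openin_open_Int) simp
   show "t0 : ?I Int ball t0 \<epsilon>" using t0 \<epsilon> by simp
  qed (rule const)
 qed auto
 then obtain z where z: "!!t. t : ?I ==> \<zeta> t = z" unfolding constant_on_def by blast
 from z[of 0] z[of 1] have 1: "\<c> 1 \<otimes> inv (?\<phi> 1) = \<one>" by (simp add: \<zeta>_def gsimps \<c>0)
 have "\<c> 1 = (\<c> 1 \<otimes> inv (?\<phi> 1)) \<otimes> ?\<phi> 1" by (simp only: gsimps)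
 also have "... = ?\<phi> 1" by (simp only: 1 gsimps)
 finally show ?thesis .
qed

lemma endpoint_eq: "endpoint G A c Y = flow u 1" unfolding endpoint_def by (rule the_equality) (use flow_solves solves_unique in blast)+

end

section \<open>One-parameter subgroups and multiexponentials\<close>

lemma flow_const_add: "0 <= a ==> 0 <= b ==> flow (%_. v) (a + b) = flow (%_. v) a \<otimes> flow (%_. v) b" by (simp add: flow_add)

text \<open>\<open>flow\<close> is constant at nonpositive times, so negative times are supplied by
  inverses; one of the two factors is always \<open>\<one>\<close>.\<close>

lemma one_parameter_subgroup:
 fixes v :: 'e
 defines "\<c> \<equiv> %t. flow (%_. v) (max t 0) \<otimes> inv (flow (%_. v) (max (- t) 0))"
 shows "continuous_on UNIV \<c>" "\<c> (s + t) = \<c> s \<otimes> \<c> t" "((%t. snd c (\<c> t)) has_vector_derivative v) (at 0)"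
proof -
 let ?f = "flow (%_. v)"
 show "continuous_on UNIV \<c>" unfolding \<c>_def by (intro continuous_intros continuous_on_compose2[OF continuous_on_flow[OF ctrl_const]]) auto
 have \<c>: "\<c> (a - b) = ?f a \<otimes> inv (?f b)" if "0 <= a" "0 <= b" for a b
 proof (cases "b <= a")
  case True
  hence "?f a = ?f (a - b) \<otimes> ?f b" using flow_const_add[of "a - b" b v] that by simp
  thus ?thesis using True by (simp add: \<c>_def max_def gsimps)
 next
  case False
  hence "?f b = ?f (b - a) \<otimes> ?f a" using flow_const_add[of "b - a" a v] that by simp
  thus ?thesis using False by (simp add: \<c>_def max_def gsimps)
 qed
 have comm: "?f a \<otimes> ?f b = ?f b \<otimes> ?f a" if "0 <= a" "0 <= b" for a b
  using flow_const_add[OF that, of v] flow_const_add[OF that(2,1), of v] by (simp add: add.commute)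
 define a b where "a = max s 0" and "b = max (- s) 0"
 define a' b' where "a' = max t 0" and "b' = max (- t) 0"
 have ab: "0 <= a" "0 <= b" "s = a - b" "0 <= a'" "0 <= b'" "t = a' - b'" by (auto simp: a_def b_def a'_def b'_def)
 have "inv (?f b) \<otimes> (?f a' \<otimes> x) = ?f a' \<otimes> (inv (?f b) \<otimes> x)" for x
 proof -
  have "inv (?f b) \<otimes> (?f a' \<otimes> x) = inv (?f b) \<otimes> ((?f a' \<otimes> ?f b) \<otimes> (inv (?f b) \<otimes> x))" by (simp only: gsimps)
  also have "... = ?f a' \<otimes> (inv (?f b) \<otimes> x)" unfolding comm[OF ab(4,2)] by (simp only: gsimps)
  finally show ?thesis .
 qed
 moreover have "\<c> (s + t) = ?f (a + a') \<otimes> inv (?f (b' + b))"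
 proof -
  have e: "s + t = (a + a') - (b' + b)" using ab by simp
  show ?thesis unfolding e by (rule \<c>) (use ab in auto)
 qed
 ultimately show "\<c> (s + t) = \<c> s \<otimes> \<c> t" using ab by (simp add: \<c> flow_const_add gsimps)
 have neg: "inv (?f t) = flow (%_. - v) t" if "0 <= t" for t
  using flow_reverse[OF ctrl_const that, of v] flow_cong[OF ctrl_const, of t "- v" "%s. - (if s <= t then v else 0)"] by simp
 have g: "\<forall>\<^sub>F t in at_right 0. norm (\<k> (flow (%_. w) t) - t *R w) <= e * abs t" if "e > 0" for e w
  using germ_flow_const[of w] that unfolding germ_iff at_within_Ici_at_right by simp
 have "((%t. \<k> (\<c> t)) has_vector_derivative v) (at 0)" unfolding has_vector_derivative_iff_eventually
 proof (intro allI impI)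
  fix e :: real assume e: "e > 0"
  have "\<forall>\<^sub>F t in at_right 0. norm (\<k> (\<c> t) - t *R v) <= e * abs t"
   using g[OF e, of v] eventually_at_right_less[of 0] by eventually_elim (simp add: \<c>_def gsimps)
  moreover have "\<forall>\<^sub>F t in at_left 0. norm (\<k> (\<c> t) - t *R v) <= e * abs t"
   unfolding at_left_minus[of 0] eventually_filtermap minus_zero
   using g[OF e, of "- v"] eventually_at_right_less[of 0] by eventually_elim (simp add: \<c>_def gsimps neg)
  ultimately show "\<forall>\<^sub>F t in at 0. norm (\<k> (\<c> t) - \<k> (\<c> 0) - (t - 0) *R v) <= e * abs (t - 0)"
   unfolding eventually_at_split by (simp add: \<c>_def gsimps)
 qed
 from has_vector_derivative_add[OF this has_vector_derivative_const[of \<o>]]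
 show "((%t. snd c (\<c> t)) has_vector_derivative v) (at 0)" by (simp add: \<k>_def)
qed

text \<open>The homomorphism property carries the velocity at 0 to a logarithmic derivative at every
  time and gives a uniform left Lipschitz bound, so the curve is a solution for the constant
  control.\<close>

lemma one_parameter_subgroup_unique:
 assumes cont: "continuous_on UNIV \<c>" and hom: "!!s t. \<c> (s + t) = \<c> s \<otimes> \<c> t"
  and der: "((%t. snd c (\<c> t)) has_vector_derivative v) (at (0::real))"
 shows "\<c> 1 = flow (%_. v) 1"
proof -
 have "inv (\<c> 0) \<otimes> \<c> 0 = inv (\<c> 0) \<otimes> (\<c> 0 \<otimes> \<c> 0)" using hom[of 0 0] by simp
 hence \<c>0: "\<c> 0 = \<one>" by (simp add: gsimps)
 have diff: "inv (\<c> s) \<otimes> \<c> t = \<c> (t - s)" for s t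
 proof -
  have "inv (\<c> s) \<otimes> \<c> t = inv (\<c> s) \<otimes> (\<c> s \<otimes> \<c> (t - s))" using hom[of s "t - s"] by simp
  thus ?thesis by (simp add: gsimps)
 qed
 have near: "EX d>0. ALL h. abs h < d --> \<c> h : U R & norm (\<k> (\<c> h) - h *R v) <= e * abs h" if e: "e > 0" for e
 proof -
  obtain d1 where d1: "0 < d1" "!!h. abs h < d1 ==> norm (snd c (\<c> h) - snd c (\<c> 0) - h *R v) <= e * abs h"
   using der e unfolding has_vector_derivative_def has_derivative_at_alt by (metis diff_zero real_norm_def)
  have "\<forall>\<^sub>F h in nhds 0. h : UNIV --> \<c> h : U R" by (rule nearby[OF cont UNIV_I open_U]) (use R_pos \<c>0 in auto)
  then obtain d2 where d2: "0 < d2" "!!h. abs h < d2 ==> \<c> h : U R" unfolding eventually_nhds_metric dist_real_def by auto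
  show ?thesis using d1 d2 by (intro exI[of _ "min d1 d2"]) (auto simp: \<k>_def \<c>0 base_def)
 qed
 have "sol 1 (%_. v) \<c>" unfolding sol_def
 proof (intro conjI \<c>0 AE_I2 impI)
  obtain d where d: "0 < d" "!!h. abs h < d ==> \<c> h : U R & norm (\<k> (\<c> h) - h *R v) <= 1 * abs h" using near[of 1] by auto
  show "left_lip {0..1} \<c>"
  proof (rule left_lipI[of "norm v + 1" d])
   fix s t assume "abs (s - t) < d"
   moreover define h where "h = t - s"
   ultimately have h: "\<c> h : U R" "norm (\<k> (\<c> h) - h *R v) <= abs h" "abs (s - t) = abs h" using d(2)[of h] by (auto simp: abs_minus_commute)
   thus "inv (\<c> s) \<otimes> \<c> t : U R & norm (\<k> (inv (\<c> s) \<otimes> \<c> t)) <= (norm v + 1) * abs (s - t)"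
    unfolding diff h_def[symmetric] using norm_triangle_ineq[of "\<k> (\<c> h) - h *R v" "h *R v"] by (simp add: algebra_simps)
  qed (use d in auto)
  fix t :: real
  have ev: "\<forall>\<^sub>F s in at t within {0..1}. \<c> (s - t) : U R & norm (\<k> (\<c> (s - t)) - (s - t) *R v) <= e * abs (s - t)" if "e > 0" for e
   using near[OF that] unfolding eventually_at dist_real_def by blast
  show "logder \<c> {0..1} t v" unfolding logder_def germ_iff diff
  proof (intro conjI allI impI)
   show "\<forall>\<^sub>F s in at t within {0..1}. \<c> (s - t) : U R" using ev[of 1] by (auto elim: eventually_mono)
   show "\<forall>\<^sub>F s in at t within {0..1}. norm (\<k> (\<c> (s - t)) - (s - t) *R v) <= e * abs (s - t)" if "e > 0" for e
    using ev[OF that] by (auto elim: eventually_mono)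
  qed (simp add: \<c>0)
 qed
 from flow_eq[OF this, of 1] show ?thesis by simp
qed

lemma lie_exp_eq: "lie_exp G c v = flow (%_. v) 1" unfolding lie_exp_def
proof (rule the_equality)
 let ?\<c> = "%t. flow (%_. v) (max t 0) \<otimes> inv (flow (%_. v) (max (- t) 0))"
 show "EX \<c>. continuous_on UNIV \<c> & (ALL s t. \<c> (s + t) = \<c> s \<otimes> \<c> t) &
  ((%t. snd c (\<c> t)) has_vector_derivative v) (at 0) & flow (%_. v) 1 = \<c> 1"
  by (intro exI[of _ ?\<c>] conjI allI one_parameter_subgroup) (simp add: gsimps)
qed (use one_parameter_subgroup_unique in blast)

text \<open>The length \<open>q\<close> of the tuple is kept apart from the number \<open>p\<close>
  of factors, so that the induction on \<open>p\<close> leaves \<open>W\<close> unchanged.\<close>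

lemma multiexp_eq: "W : tuples q V ==> multiexp G c p W = flow (st W) (real p)"
proof (induction p)
 case (Suc p)
 have "flow (st W) (real p + 1) = flow (st W) (real p) \<otimes> flow (%t. st W (real p + t)) 1" by (rule flow_add[OF st_ctrl[OF Suc.prems]]) auto
 moreover have "flow (%t. st W (real p + t)) 1 = flow (%_. W (Suc p)) 1"
 proof (rule flow_cong[OF ctrl_const])
  fix t :: real assume "0 <= t" "t < 1"
  hence "nat \<lfloor>real p + t\<rfloor> = p" by linarith
  thus "W (Suc p) = st W (real p + t)" by (simp add: st_def)
 qed
 ultimately show ?case using Suc by (simp add: lie_exp_eq add.commute)
qed simp

lemma sub_at_cong:
 assumes "!!h. h : V ==> f (%i. y i + h i) = g (%i. y i + h i)" "f y = g y"
 shows "sub_at V \<nu> f y <-> sub_at V \<nu> g y" unfolding sub_at_def has_derivative_in_def Ball_def using assms by (simp cong: conj_cong imp_cong)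

end

lemma open_at_cong: "(!!z. z : V ==> f z = g z) ==> y : V ==> open_at V \<nu> f y <-> open_at V \<nu> g y"
 unfolding open_at_def by (intro all_cong1 imp_cong refl) (metis (no_types, lifting) image_cong subsetD)

theorem theorem1p1:
  fixes G :: "'g::{t2_space,second_countable_topology} monoid"
    and A :: "('g, 'e::euclidean_space) chart set"
    and c :: "('g, 'e) chart"
    and gs :: "nat \<Rightarrow> 'e set" and s :: nat
    and N :: "'e \<Rightarrow> real" and X :: 'e
  assumes "carnot_group G A c gs s"
    and "norm_on (gs 1) N"
    and "X \<in> gs 1"
  shows "(cond_P G A c (gs 1) N X \<longleftrightarrow> cond_SP G A c (gs 1) N X) \<and>
         (cond_SP G A c (gs 1) N X \<longleftrightarrow> cond_FH G A c (gs 1) N X) \<and>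
         (cond_Reg G A c (gs 1) N X \<longleftrightarrow> cond_SbH G A c (gs 1) N X) \<and>
         (cond_SbH G A c (gs 1) N X \<longrightarrow> cond_H G c (gs 1) N X) \<and>
         (cond_H G c (gs 1) N X \<longrightarrow> cond_P G A c (gs 1) N X)"
proof -
 interpret lie_chart G A c using assms(1) by unfold_locales (auto simp: carnot_group_def)
 obtain R r L where "local_lie G \<k> \<pi> FF (lie_bracket G c) R r L" using local_lie_structure by blast
 then interpret l: lie_chart_local G A c R r L by (intro lie_chart_local.intro lie_chart_axioms)
 interpret st: stratified_lie G \<k> \<pi> FF "lie_bracket G c" R r L gs s
  using assms(1) unfolding carnot_group_def stratification_def bracket_space_def by unfold_locales auto
 obtain c1 c2 where c12: "0 < c1" "0 < c2" "!!v. v : gs 1 ==> norm v <= c1 * N v" "!!v. v : gs 1 ==> N v <= c2 * norm v"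
  by (rule st.norm_on_equiv[OF assms(2)]) blast
 interpret n: normed_stratified_lie G \<k> \<pi> FF "lie_bracket G c" R r L gs s N X c1 c2 by unfold_locales (use assms(2,3) c12 in auto)
 let ?LV = "Linf (gs 1) N" and ?\<nu> = "Linf_norm N"
 have E: "endpoint G A c Y = n.E Y" if "Y : ?LV" for Y
  using l.endpoint_eq[OF st.horiz_ctrl[OF n.\<theta>_horiz[OF that]], of Y] by (simp add: \<theta>_def n.E_def)
 have EX: "endpoint_at G A c X Y = n.E (%t. X + Y t)" if "Y : ?LV" for Y unfolding endpoint_at_def using n.Linf_add[OF n.cX(2) that] by (intro E) simp
 have \<Gamma>: "multiexp G c p W = l.flow (st W) (real p)" if "W : tuples p (gs 1)" for p W using l.multiexp_eq[OF that] .
 have LV0: "(%t. 0) : ?LV" by (rule n.horiz_Linf[OF st.horiz_0])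
 have sub_L: "submersion_at A ?LV ?\<nu> f Y <-> l.sub_at ?LV ?\<nu> g Y"
  if "Y : ?LV" "!!Z. Z : ?LV ==> f Z = g Z" for f g Y
 proof -
  have "submersion_at A ?LV ?\<nu> f Y <-> l.sub_at ?LV ?\<nu> f Y" by (rule l.submersion_at_iff[OF n.Linf_norm_nonneg])
  also have "... <-> l.sub_at ?LV ?\<nu> g Y" by (rule l.sub_at_cong) (use that n.Linf_add in auto)
  finally show ?thesis .
 qed
 have sub_T: "submersion_at A (tuples p (gs 1)) (tuple_norm N p) (multiexp G c p) W <->
   l.sub_at (tuples p (gs 1)) (tuple_norm N p) (%W. l.flow (st W) (real p)) W"
  if W: "W : tuples p (gs 1)" and p: "1 <= p" for p W
 proof -
  interpret t: control_family G \<k> \<pi> FF "lie_bracket G c" R r L "tuples p (gs 1)" "tuple_norm N p" st "%_. 0" "real p"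
   "c1 * real p" "%W. l.flow (st W) (real p)" by (rule n.tuple_family[OF p])
  have "submersion_at A (tuples p (gs 1)) (tuple_norm N p) (multiexp G c p) W <->
    l.sub_at (tuples p (gs 1)) (tuple_norm N p) (multiexp G c p) W" by (rule l.submersion_at_iff[OF t.\<nu>_nonneg])
  also have "... <-> l.sub_at (tuples p (gs 1)) (tuple_norm N p) (%W. l.flow (st W) (real p)) W"
   by (rule l.sub_at_cong) (use W t.VV_add \<Gamma> in auto)
  finally show ?thesis .
 qed
 have P: "cond_P G A c (gs 1) N X <-> open_at ?LV ?\<nu> n.E (%_. X)" unfolding cond_P_def by (rule open_at_cong[OF E n.cX(2)])
 have SP: "cond_SP G A c (gs 1) N X <-> n.SP" unfolding cond_SP_def n.SP_iff[symmetric]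
  using sub_L[OF _ EX] EX EX[OF LV0] by (auto cong: conj_cong bex_cong)
 have FH: "cond_FH G A c (gs 1) N X <-> n.SP"
  unfolding cond_FH_def n.FH_iff[symmetric] using sub_T \<Gamma> n.const_tuple_TV by (auto cong: conj_cong bex_cong)
 have Reg: "cond_Reg G A c (gs 1) N X <-> st.reg (%_. X) 1" unfolding cond_Reg_def n.Reg_iff[symmetric] using sub_L[OF n.cX(2) E] by simp
 have SbH: "cond_SbH G A c (gs 1) N X <-> st.reg (%_. X) 1"
  unfolding cond_SbH_def n.SbH_iff[symmetric] using sub_T[OF n.const_tuple_TV] by (auto cong: conj_cong)
 have H: "cond_H G c (gs 1) N X <-> (EX p>=1. open_at (tuples p (gs 1)) (tuple_norm N p) (%W. l.flow (st W) (real p)) (const_tuple p X))"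
  unfolding cond_H_def using open_at_cong[OF \<Gamma> n.const_tuple_TV] by simp
 show ?thesis unfolding P SP FH Reg SbH H using n.SP_imp_P n.P_imp_SP n.SbH_imp_H n.H_imp_P by blast
qed

end
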